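(* Let $d\ge1$ and let $A$ be a compactly supported Laplacian modulated operator on $L_2(\mathbb R^d)$ with symbol $p_A$. Then $A\in\mathcal L_{1,\infty}(L_2(\mathbb R^d))$. Moreover: (i) for every normalised positive trace $\tau$ on $\mathcal L_{1,\infty}(L_2(\mathbb R^d))$, $$\tau(A)=\frac1{(2\pi)^d\log2}\,B\left(\left\{\int_{\mathbb R^d}\int_{2^{n/d}<|s|\le2^{(n+1)/d}}p_A(x,s)\,ds\,dx\right\}_{n\ge0}\right),$$ where $B=\tau\circ{\rm diag}\circ D$ is the Banach limit corresponding to $\tau$; (ii) the equality $\tau(A)=\frac1{d(2\pi)^d}{\rm Res}(A)$ holds for every positive normalised trace $\tau$ on $\mathcal L_{1,\infty}(L_2(\mathbb R^d))$ if and only if ${\rm Res}(A)$ is a scalar and the sequence $\left\{\int_{\mathbb R^d}\int_{2^{n/d}<|s|\le2^{(n+1)/d}}p_A(x,s)\,ds\,dx\right\}_{n\ge0}$ is almost convergent to the number $\frac1d\log2\cdot{\rm Res}(A)$.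
   Context: $\mu(n,A)$ are singular values; $\mathcal L_{1,\infty}=\{A\text{ compact}:\sup_n(n+1)\mu(n,A)<\infty\}$. A trace is a unitarily invariant linear functional on $\mathcal L_{1,\infty}$; positive: nonnegative on positive operators; normalised: value $1$ on $A\ge0$ with $\mu(n,A)=1/(n+1)$. A Banach limit is a linear functional $B$ on real $l_\infty$ with $B\ge0$, $B(1,1,\dots)=1$, $B(x_0,x_1,\dots)=B(0,x_0,x_1,\dots)$, applied to complex sequences by complex linearity; a bounded sequence is almost convergent to $a$ if every Banach limit takes value $a$ on it. $D:l_\infty\to l_{1,\infty}$ is $(Dx)_k=\log2\cdot x_n/2^n$ for $2^n-1\le k\le2^{n+1}-2$; ${\rm diag}(x)$ is the diagonal operator with diagonal $x$ in a fixed orthonormal basis of $L_2(\mathbb R^d)$; for $\tau$ positive normalised, $\tau\circ{\rm diag}\circ D$ is a Banach limit. With $\Delta$ the Laplacian on $\mathbb R^d$, a bounded operator $A$ on $L_2(\mathbb R^d)$ is Laplacian modulated if $\sup_{t>0}t^{1/2}\|A(1+t(1-\Delta)^{-d/2})^{-1}\|_{\mathcal L_2}<\infty$ ($\mathcal L_2$ = Hilbert–Schmidt norm); such $A$ is Hilbert–Schmidt and its symbol is the unique $p_A\in L_2(\mathbb R^d\times\mathbb R^d)$ such that $A$ has integral kernel $K_A(x,y)=(2\pi)^{-d}\int_{\mathbb R^d}e^{i\langle x-y,s\rangle}p_A(x,s)\,ds$. $A$ is compactly supported if $M_\phi AM_\psi=A$ for some $\phi,\psi\in C_c^\infty(\mathbb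 R^d)$, $M_\phi$ being multiplication by $\phi$. For such $A$, the sequence $\{\frac1{\log(2+n)}\int_{\mathbb R^d}\int_{|s|\le n^{1/d}}p_A(x,s)ds\,dx\}_n$ is bounded and ${\rm Res}(A)\in l_\infty/c_0$ is its class; ${\rm Res}(A)$ is a scalar $\alpha$ if this class is that of a sequence converging to $\alpha$. *)

theory Defs
  imports "HOL-Analysis.Analysis"
begin

text \<open>Elements of L_2(R^d) are represented by Borel square-integrable functions
  real^'d => complex, taken modulo almost-everywhere equality. Bounded operators
  are represented by maps on representatives that respect a.e. equality.\<close>

type_synonym 'd fn = "real^'d \<Rightarrow> complex"
type_synonym 'd op = "('d::finite) fn \<Rightarrow> 'd fn"

definition sqint :: "('d::finite) fn \<Rightarrow> bool" where
  "sqint f \<longleftrightarrow> f \<in> borel_measurable lborel \<and> integrable lborel (\<lambda>x. (cmod (f x))^2)"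

definition l1l2 :: "('d::finite) fn \<Rightarrow> bool" where
  "l1l2 f \<longleftrightarrow> sqint f \<and> integrable lborel f"

definition aeq :: "('d::finite) fn \<Rightarrow> 'd fn \<Rightarrow> bool" where
  "aeq f g \<longleftrightarrow> (AE x in lborel. f x = g x)"

definition l2norm :: "('d::finite) fn \<Rightarrow> real" where
  "l2norm f = sqrt (LINT x|lborel. (cmod (f x))^2)"

definition l2inner :: "('d::finite) fn \<Rightarrow> 'd fn \<Rightarrow> complex" where
  "l2inner f g = (LINT x|lborel. f x * cnj (g x))"

definition fourier :: "('d::finite) fn \<Rightarrow> 'd fn" where
  "fourier f \<xi> = (LINT x|lborel. exp (- \<i> * complex_of_real (inner x \<xi>)) * f x)"

definition is_bop :: "('d::finite) op \<Rightarrow> bool" where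
  "is_bop A \<longleftrightarrow>
     (\<forall>f. sqint f \<longrightarrow> sqint (A f)) \<and>
     (\<forall>f g. sqint f \<and> sqint g \<and> aeq f g \<longrightarrow> aeq (A f) (A g)) \<and>
     (\<forall>f g a b. sqint f \<and> sqint g \<longrightarrow>
        aeq (A (\<lambda>x. a * f x + b * g x)) (\<lambda>x. a * A f x + b * A g x)) \<and>
     (\<exists>C. \<forall>f. sqint f \<longrightarrow> l2norm (A f) \<le> C * l2norm f)"

definition op_eq :: "('d::finite) op \<Rightarrow> 'd op \<Rightarrow> bool" where
  "op_eq A B \<longleftrightarrow> (\<forall>f. sqint f \<longrightarrow> aeq (A f) (B f))"

definition op_lin :: "complex \<Rightarrow> ('d::finite) op \<Rightarrow> complex \<Rightarrow> 'd op \<Rightarrow> 'd op" where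
  "op_lin a A b B = (\<lambda>f x. a * A f x + b * B f x)"

definition opnorm :: "('d::finite) op \<Rightarrow> real" where
  "opnorm A = Sup {l2norm (A f) | f. sqint f \<and> l2norm f \<le> 1}"

definition rank_le :: "('d::finite) op \<Rightarrow> nat \<Rightarrow> bool" where
  "rank_le F n \<longleftrightarrow> (\<exists>g. (\<forall>i<n. sqint (g i)) \<and>
     (\<forall>f. sqint f \<longrightarrow> (\<exists>c. aeq (F f) (\<lambda>x. \<Sum>i<n. c i * g i x))))"

definition sing_val :: "nat \<Rightarrow> ('d::finite) op \<Rightarrow> real" where
  "sing_val n A = Inf {opnorm (op_lin 1 A (-1) F) | F. is_bop F \<and> rank_le F n}"

definition compact_op :: "('d::finite) op \<Rightarrow> bool" where
  "compact_op A \<longleftrightarrow> is_bop A \<and>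
     (\<forall>fs::nat \<Rightarrow> 'd fn. (\<forall>k. sqint (fs k)) \<and> bdd_above (range (\<lambda>k. l2norm (fs k))) \<longrightarrow>
        (\<exists>r::nat\<Rightarrow>nat. strict_mono r \<and> (\<forall>\<epsilon>>0. \<exists>N. \<forall>m\<ge>N. \<forall>n\<ge>N.
            l2norm (\<lambda>x. A (fs (r m)) x - A (fs (r n)) x) < \<epsilon>)))"

definition weak1 :: "('d::finite) op \<Rightarrow> bool" where
  "weak1 A \<longleftrightarrow> compact_op A \<and> bdd_above (range (\<lambda>n. (real n + 1) * sing_val n A))"

definition pos_op :: "('d::finite) op \<Rightarrow> bool" where
  "pos_op A \<longleftrightarrow> is_bop A \<and> (\<forall>f. sqint f \<longrightarrow> l2inner (A f) f \<in> \<real> \<and> 0 \<le> Re (l2inner (A f) f))"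

definition unitary_pair :: "('d::finite) op \<Rightarrow> 'd op \<Rightarrow> bool" where
  "unitary_pair U V \<longleftrightarrow> is_bop U \<and> is_bop V \<and>
     (\<forall>f. sqint f \<longrightarrow> l2norm (U f) = l2norm f \<and> aeq (V (U f)) f \<and> aeq (U (V f)) f)"

definition is_trace :: "(('d::finite) op \<Rightarrow> complex) \<Rightarrow> bool" where
  "is_trace \<tau> \<longleftrightarrow>
     (\<forall>A B. weak1 A \<and> op_eq A B \<longrightarrow> \<tau> A = \<tau> B) \<and>
     (\<forall>A B a b. weak1 A \<and> weak1 B \<longrightarrow> \<tau> (op_lin a A b B) = a * \<tau> A + b * \<tau> B) \<and>
     (\<forall>A U V. weak1 A \<and> unitary_pair U V \<longrightarrow> \<tau> (U \<circ> A \<circ> V) = \<tau> A)"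

definition pos_norm_trace :: "(('d::finite) op \<Rightarrow> complex) \<Rightarrow> bool" where
  "pos_norm_trace \<tau> \<longleftrightarrow> is_trace \<tau> \<and>
     (\<forall>A. weak1 A \<and> pos_op A \<longrightarrow> \<tau> A \<in> \<real> \<and> 0 \<le> Re (\<tau> A)) \<and>
     (\<forall>A. weak1 A \<and> pos_op A \<and> (\<forall>n. sing_val n A = 1 / (real n + 1)) \<longrightarrow> \<tau> A = 1)"

definition onb :: "(nat \<Rightarrow> ('d::finite) fn) \<Rightarrow> bool" where
  "onb e \<longleftrightarrow> (\<forall>k. sqint (e k)) \<and>
     (\<forall>j k. l2inner (e j) (e k) = (if j = k then 1 else 0)) \<and>
     (\<forall>f. sqint f \<and> (\<forall>k. l2inner f (e k) = 0) \<longrightarrow> aeq f (\<lambda>_. 0))"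

definition diag :: "(nat \<Rightarrow> ('d::finite) fn) \<Rightarrow> (nat \<Rightarrow> complex) \<Rightarrow> 'd op" where
  "diag e x = (SOME T. is_bop T \<and> (\<forall>k. aeq (T (e k)) (\<lambda>y. x k * e k y)))"

definition Dmap :: "(nat \<Rightarrow> complex) \<Rightarrow> nat \<Rightarrow> complex" where
  "Dmap x k = (let n = (THE n::nat. 2^n \<le> k + 1 \<and> k + 1 < 2^(n+1))
               in complex_of_real (ln 2) * x n / 2^n)"

definition banach_limit :: "((nat \<Rightarrow> real) \<Rightarrow> real) \<Rightarrow> bool" where
  "banach_limit B \<longleftrightarrow>
     (\<forall>x y a b. Bseq x \<and> Bseq y \<longrightarrow> B (\<lambda>n. a * x n + b * y n) = a * B x + b * B y) \<and>
     (\<forall>x. Bseq x \<and> (\<forall>n. 0 \<le> x n) \<longrightarrow> 0 \<le> B x) \<and>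
     B (\<lambda>_. 1) = 1 \<and>
     (\<forall>x. Bseq x \<longrightarrow> B x = B (\<lambda>n. if n = 0 then 0 else x (n - 1)))"

definition almost_conv :: "(nat \<Rightarrow> complex) \<Rightarrow> complex \<Rightarrow> bool" where
  "almost_conv x a \<longleftrightarrow> Bseq x \<and>
     (\<forall>B. banach_limit B \<longrightarrow>
        complex_of_real (B (\<lambda>n. Re (x n))) + \<i> * complex_of_real (B (\<lambda>n. Im (x n))) = a)"

definition hs_le :: "('d::finite) op \<Rightarrow> real \<Rightarrow> bool" where
  "hs_le A C \<longleftrightarrow> (\<forall>e. onb e \<longrightarrow>
      summable (\<lambda>k. (l2norm (A (e k)))^2) \<and> sqrt (\<Sum>k. (l2norm (A (e k)))^2) \<le> C)"

definition fourier_mult :: "(real^('d::finite) \<Rightarrow> real) \<Rightarrow> 'd op \<Rightarrow> bool" where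
  "fourier_mult g M \<longleftrightarrow> is_bop M \<and>
     (\<forall>f h. l1l2 f \<and> l1l2 h \<longrightarrow>
        l2inner (M f) h = (1 / (2 * pi) ^ CARD('d)) *
          (LINT \<xi>|lborel. complex_of_real (g \<xi>) * fourier f \<xi> * cnj (fourier h \<xi>)))"

text \<open>Laplacian modulated: sup_{t>0} t^{1/2} ||A (1 + t(1-\<Delta>)^{-d/2})^{-1}||_{L_2} < \<infinity>,
  where (1-\<Delta>)^{-d/2} is the Fourier multiplier with symbol (1+|\<xi>|^2)^{-d/2}.\<close>
definition laplacian_modulated :: "('d::finite) op \<Rightarrow> bool" where
  "laplacian_modulated A \<longleftrightarrow> is_bop A \<and>
     (\<exists>C. \<forall>t>0. \<forall>M T.
        fourier_mult (\<lambda>\<xi>. (1 + (norm \<xi>)^2) powr (- real CARD('d) / 2)) M \<and> is_bop T \<and>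
        (\<forall>f. sqint f \<longrightarrow> aeq (T (\<lambda>x. f x + complex_of_real t * M f x)) f \<and>
                          aeq (\<lambda>x. T f x + complex_of_real t * M (T f) x) f)
        \<longrightarrow> hs_le (A \<circ> T) (C / sqrt t))"

text \<open>p is the symbol of A: A has square-integrable kernel K with
  K(x,y) = (2\<pi>)^{-d} \<integral> e^{i<x-y,s>} p(x,s) ds, the s-integral understood in the L_2
  (Plancherel) sense, expressed weakly against L_1 \<inter> L_2 test functions.\<close>
definition is_symbol :: "('d::finite) op \<Rightarrow> ((real^'d) \<times> (real^'d) \<Rightarrow> complex) \<Rightarrow> bool" where
  "is_symbol A p \<longleftrightarrow>
     p \<in> borel_measurable lborel \<and> integrable lborel (\<lambda>z. (cmod (p z))^2) \<and>
     (\<exists>K :: (real^'d) \<times> (real^'d) \<Rightarrow> complex.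
        K \<in> borel_measurable lborel \<and> integrable lborel (\<lambda>z. (cmod (K z))^2) \<and>
        (\<forall>f. sqint f \<longrightarrow> (AE x in lborel. A f x = (LINT y|lborel. K (x, y) * f y))) \<and>
        (AE x in lborel. \<forall>h. l1l2 h \<longrightarrow>
           (LINT z|lborel. K (x, x - z) * cnj (h z)) =
           (1 / (2 * pi) ^ CARD('d)) * (LINT s|lborel. p (x, s) * cnj (fourier h s))))"

coinductive smooth_fn :: "('d::finite) fn \<Rightarrow> bool" where
  "(\<forall>x. f differentiable (at x)) \<Longrightarrow>
   (\<forall>i. smooth_fn (\<lambda>x. frechet_derivative f (at x) (axis i 1))) \<Longrightarrow> smooth_fn f"

definition cc_smooth :: "('d::finite) fn \<Rightarrow> bool" where
  "cc_smooth \<phi> \<longleftrightarrow> smooth_fn \<phi> \<and> bounded {x. \<phi> x \<noteq> 0}"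

definition compactly_supported :: "('d::finite) op \<Rightarrow> bool" where
  "compactly_supported A \<longleftrightarrow> (\<exists>\<phi> \<psi>. cc_smooth \<phi> \<and> cc_smooth \<psi> \<and>
      op_eq (\<lambda>f x. \<phi> x * A (\<lambda>y. \<psi> y * f y) x) A)"

definition annulus_seq :: "((real^('d::finite)) \<times> (real^'d) \<Rightarrow> complex) \<Rightarrow> nat \<Rightarrow> complex" where
  "annulus_seq p n = (LINT x|lborel. (LINT s:{s. 2 powr (real n / real CARD('d)) < norm s \<and>
        norm s \<le> 2 powr ((real n + 1) / real CARD('d))}|lborel. p (x, s)))"

definition res_seq :: "((real^('d::finite)) \<times> (real^'d) \<Rightarrow> complex) \<Rightarrow> nat \<Rightarrow> complex" where
  "res_seq p n = complex_of_real (1 / ln (2 + real n)) *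
     (LINT x|lborel. (LINT s:{s. norm s \<le> real n powr (1 / real CARD('d))}|lborel. p (x, s)))"

end

theory Submission
  imports Defs "HOL-Probability.Probability" "HOL-Real_Asymp.Real_Asymp"
begin

text \<open>
  By Schmidt's expansion an operator with $\mu(n) = O(1/n)$ has dyadic traces
  $s_n = \sum_{i<2^n} \mu(i) \langle g_i, f_i\rangle$, determined up to a bounded perturbation by any
  approximation with operators of rank $O(2^n)$ and error $O(2^{-n})$; every positive normalised trace
  is a Banach limit of $(s_{n+1} - s_n)/\log 2$, and every Banach limit defines a trace in this way.
  The operator $A$ is tested on the localised exponentials $\epsilon_s = 1_{|y|\le r} e^{i\langle y,s\rangle}$,
  for which $p_A(x,s) = e^{-i\langle x,s\rangle} (A\epsilon_s)(x)$. The modulation hypothesis bounds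
  $\int_{|s|^d>q} \|A\epsilon_s\|^2 ds$ by $O(1/q)$, while $\{|s|^d\le q\}$ has volume $O(q)$. Splitting
  $\langle Au,v\rangle = (2\pi)^{-d}\int \langle u,\epsilon_s\rangle\langle A\epsilon_s,v\rangle ds$ at $q\sim 2^n$
  gives both $\mu(n) = O(1/n)$ and $s_n = (2\pi)^{-d}\int_{|s|\le 2^{n/d}}\int p_A\,dx\,ds + O(1)$.
\<close>

text \<open>The obstacle is that an abstract trace comes with no formula, just with linearity,
  unitary invariance, positivity and normalisation. Unitaries that permute a basis supply a formula.
  A diagonal whose mean vanishes on every dyadic block can be rearranged inside the blocks so that
  its partial sums are as small as its entries; it is then a sequence minus a permutation of it, and
  its trace is zero. So a trace depends on block means alone, and moving each block into the two
  halves of the next shows that it is shift invariant in them. Bounded perturbations of s_n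
  disappear because the increments of a bounded sequence are a sequence minus its shift. On the
  analytic side the singular vectors of A are unknown, so the O(1/n) bound comes from counting: a
  region whose volume is a small multiple of m holds at most half of the total mass of m orthonormal
  vectors, and the other half is paid for by the modulation tail. The same tail estimate compares
  the trace of a Schmidt truncation with the integral of <A eps_s, eps_s>, which Fubini identifies
  with the integral of the symbol.\<close>

abbreviation cor :: "real \<Rightarrow> complex" where "cor \<equiv> complex_of_real"

lemmas LINT_cong = Bochner_Integration.integral_cong
lemmas LINT_dominated = Bochner_Integration.integrable_bound

text \<open>The metric structure is inherited from the real inner product space;
  \<open>cinner\<close>, linear in its first argument, is attached to it by
  \<open>cinner_norm\<close>. An abstract class keeps almost-everywhere equality out of the operator
  theory until the type \<open>L2\<close> is shown to be an instance.\<close>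

class chilbert = real_inner + complete_space +
 fixes scaleC :: "complex \<Rightarrow> 'a \<Rightarrow> 'a" (infixr \<open>*C\<close> 75)
  and cinner :: "'a \<Rightarrow> 'a \<Rightarrow> complex"
 assumes scaleC_add_right: "a *C (x + y) = a *C x + a *C y"
  and scaleC_add_left: "(a + b) *C x = a *C x + b *C x"
  and scaleC_scaleC: "a *C b *C x = (a * b) *C x"
  and scaleR_scaleC: "r *\<^sub>R x = cor r *C x"
  and cinner_add_left: "cinner (x + y) z = cinner x z + cinner y z"
  and cinner_scaleC_left: "cinner (a *C x) y = a * cinner x y"
  and cinner_commute: "cinner x y = cnj (cinner y x)"
  and cinner_norm: "cinner x x = cor ((norm x)^2)"

lemma mult_cnj_self: "z * cnj z = (cor (cmod z))^2"
 using complex_norm_square[of z] by simp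

lemma cnj_mult_self: "cnj z * z = (cor (cmod z))^2"
 using complex_norm_square[of z] by (simp add: mult.commute)

lemma scaleC_one [simp]: "1 *C x = x"
 using scaleR_scaleC[of 1 x] by simp

lemma scaleC_zero_left [simp]: "0 *C x = 0"
 using scaleR_scaleC[of 0 x] by simp

lemma scaleC_zero_right [simp]: "a *C 0 = 0"
 using scaleC_add_right[of a 0 0] by simp

lemma scaleC_minus_left [simp]: "(- a) *C x = - (a *C x)"
 using scaleC_add_left[of a "-a" x] by (simp add: eq_neg_iff_add_eq_0 add.commute)

lemma scaleC_minus_right [simp]: "a *C (- x) = - (a *C x)"
 using scaleC_add_right[of a x "-x"] by (simp add: eq_neg_iff_add_eq_0 add.commute)

lemma scaleC_diff_right: "a *C (x - y) = a *C x - a *C y"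
 using scaleC_add_right[of a x "-y"] by simp

lemma scaleC_diff_left: "(a - b) *C x = a *C x - b *C x"
 using scaleC_add_left[of a "-b" x] by simp

lemma scaleC_sum_right: "a *C (\<Sum>i\<in>I. f i) = (\<Sum>i\<in>I. a *C f i)"
 by (induction I rule: infinite_finite_induct) (auto simp: scaleC_add_right)

lemma cinner_zero_left [simp]: "cinner 0 x = 0"
 using cinner_scaleC_left[of 0 0 x] by simp

lemma cinner_zero_right [simp]: "cinner x 0 = 0"
 using cinner_commute[of x 0] by simp

lemma cinner_add_right: "cinner z (x + y) = cinner z x + cinner z y"
 using cinner_add_left[of x y z] cinner_commute[of z] by simp

lemma cinner_scaleC_right: "cinner x (a *C y) = cnj a * cinner x y"
 using cinner_scaleC_left[of a y x] cinner_commute[of x] by simp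

lemma cinner_minus_left [simp]: "cinner (- x) y = - cinner x y"
 using cinner_scaleC_left[of "-1" x y] by simp

lemma cinner_minus_right [simp]: "cinner x (- y) = - cinner x y"
 using cinner_scaleC_right[of x "-1" y] by simp

lemma cinner_diff_left: "cinner (x - y) z = cinner x z - cinner y z"
 using cinner_add_left[of x "-y" z] by simp

lemma cinner_diff_right: "cinner z (x - y) = cinner z x - cinner z y"
 using cinner_add_right[of z x "-y"] by simp

lemma cinner_sum_left: "cinner (\<Sum>i\<in>I. f i) x = (\<Sum>i\<in>I. cinner (f i) x)"
 by (induction I rule: infinite_finite_induct) (auto simp: cinner_add_left)

lemma cinner_sum_right: "cinner x (\<Sum>i\<in>I. f i) = (\<Sum>i\<in>I. cinner x (f i))"
 by (induction I rule: infinite_finite_induct) (auto simp: cinner_add_right)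

lemma Re_cinner_self: "Re (cinner x x) = (norm x)^2"
 by (simp add: cinner_norm)

lemma cinner_mult_cnj: "cinner x y * cinner y x = cor ((cmod (cinner x y))^2)"
 using cinner_commute[of y x] by (simp add: complex_mult_cnj cmod_power2)

lemma cmod_cinner_commute: "cmod (cinner x y) = cmod (cinner y x)"
 using cinner_commute[of x y] by simp

lemma norm_scaleC: "norm (a *C x) = cmod a * norm x"
proof -
 have "cor ((norm (a *C x))^2) = a * cnj a * cor ((norm x)^2)"
  by (simp only: cinner_norm[symmetric] cinner_scaleC_left cinner_scaleC_right mult_ac)
 also have "\<dots> = cor ((cmod a * norm x)^2)"
  by (simp add: mult_cnj_self power_mult_distrib)
 finally have "(norm (a *C x))^2 = (cmod a * norm x)^2"
  using of_real_eq_iff by blast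
 then show ?thesis by (simp add: power2_eq_iff_nonneg)
qed

lemma norm_add_sq: "(norm (x + y))^2 = (norm x)^2 + 2 * Re (cinner x y) + (norm y)^2"
proof -
 have "Re (cinner y x) = Re (cinner x y)" using cinner_commute[of y x] by simp
 then show ?thesis
  by (simp add: Re_cinner_self[symmetric] cinner_add_left cinner_add_right)
qed

lemma norm_diff_sq: "(norm (x - y))^2 = (norm x)^2 - 2 * Re (cinner x y) + (norm y)^2"
 using norm_add_sq[of x "-y"] by simp

lemma cinner_CS: "cmod (cinner x y) \<le> norm x * norm y"
proof (cases "y = 0")
 case False
 define a where "a = cinner x y / cor ((norm y)^2)"
 have ny: "norm y \<noteq> 0" using False by simp
 have 1: "cinner x (a *C y) = cor ((cmod (cinner x y))^2 / (norm y)^2)"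
  using ny by (simp add: cinner_scaleC_right a_def cnj_mult_self)
 have 2: "(norm (a *C y))^2 = (cmod (cinner x y))^2 / (norm y)^2"
  using ny by (simp add: norm_scaleC a_def norm_divide norm_power norm_mult field_simps power2_eq_square)
 have "0 \<le> (norm (x - a *C y))^2" by simp
 also have "\<dots> = (norm x)^2 - (cmod (cinner x y))\<^sup>2 / (norm y)^2"
  unfolding norm_diff_sq 1 2 by simp
 finally have "(cmod (cinner x y))^2 \<le> (norm x * norm y)^2"
  using ny by (simp add: field_simps power_mult_distrib)
 then show ?thesis by (rule power2_le_imp_le) simp
qed simp

lemma bounded_linear_cinner_left: "bounded_linear (\<lambda>x::'a::chilbert. cinner x y)"
 by (rule bounded_linear_intro[of _ "norm y"])
  (auto simp: cinner_add_left scaleR_scaleC cinner_scaleC_left scaleR_conv_of_real cinner_CS)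

lemma bounded_linear_cinner_right: "bounded_linear (\<lambda>x::'a::chilbert. cinner y x)"
proof (rule bounded_linear_intro[of _ "norm y"])
 fix x :: 'a show "cmod (cinner y x) \<le> norm x * norm y" using cinner_CS[of y x] by (simp add: mult.commute)
qed (auto simp: cinner_add_right scaleR_scaleC cinner_scaleC_right scaleR_conv_of_real)

lemma bounded_linear_scaleC: "bounded_linear (\<lambda>x::'a::chilbert. a *C x)"
 by (rule bounded_linear_intro[of _ "cmod a"])
  (auto simp: scaleC_add_right scaleR_scaleC scaleC_scaleC norm_scaleC mult.commute)

lemma bounded_linear_scaleC_left: "bounded_linear (\<lambda>a. a *C (x::'a::chilbert))"
 by (rule bounded_linear_intro[of _ "norm x"])
  (auto simp: scaleC_add_left scaleR_scaleC scaleC_scaleC norm_scaleC scaleR_conv_of_real)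

lemmas tendsto_cinner_left = bounded_linear.tendsto[OF bounded_linear_cinner_left]
lemmas tendsto_cinner_right = bounded_linear.tendsto[OF bounded_linear_cinner_right]
lemmas tendsto_scaleC = bounded_linear.tendsto[OF bounded_linear_scaleC]
lemmas sums_cinner_left = bounded_linear.sums[OF bounded_linear_cinner_left]
lemmas sums_cinner_right = bounded_linear.sums[OF bounded_linear_cinner_right]
lemmas sums_scaleC = bounded_linear.sums[OF bounded_linear_scaleC]

lemma norm_le_by_cinner:
 fixes x :: "'a::chilbert"
 assumes "\<And>y. cmod (cinner x y) \<le> K * norm y" "0 \<le> K"
 shows "norm x \<le> K"
proof (cases "x = 0")
 case False
 have "(norm x)^2 \<le> K * norm x"
  using assms(1)[of x] by (simp add: cinner_norm norm_power)
 then show ?thesis using False by (simp add: power2_eq_square)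
qed (use assms in simp)

lemma cinner_eqI: fixes x :: "'a::chilbert" assumes "\<And>z. cinner x z = cinner y z" shows "x = y"
proof -
 have "cinner (x - y) (x - y) = 0" using assms by (simp add: cinner_diff_left)
 then show ?thesis by (simp add: cinner_norm)
qed

section \<open>Bounded operators\<close>

definition clinop :: "('a::chilbert \<Rightarrow> 'a) \<Rightarrow> bool" where
 "clinop T \<longleftrightarrow> (\<forall>x y. T (x + y) = T x + T y) \<and> (\<forall>a x. T (a *C x) = a *C T x) \<and>
   (\<exists>K. \<forall>x. norm (T x) \<le> K * norm x)"

lemma clinopI:
 assumes "\<And>x y. T (x + y) = T x + T y" "\<And>a x. T (a *C x) = a *C T x" "\<And>x. norm (T x) \<le> K * norm x"
 shows "clinop T"
 using assms unfolding clinop_def by blast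

lemma clinop_add: "clinop T \<Longrightarrow> T (x + y) = T x + T y"
 and clinop_scaleC: "clinop T \<Longrightarrow> T (a *C x) = a *C T x"
 unfolding clinop_def by blast+

lemma clinop_bound: assumes "clinop T" obtains K where "K > 0" "\<And>x. norm (T x) \<le> K * norm x"
proof -
 obtain K where K: "\<And>x. norm (T x) \<le> K * norm x" using assms unfolding clinop_def by blast
 have "norm (T x) \<le> (max K 1) * norm x" for x
  using K[of x] by (meson max.cobounded1 mult_right_mono norm_ge_zero order_trans)
 then show ?thesis using that[of "max K 1"] by simp
qed

lemma clinop_bounded_linear: assumes "clinop T" shows "bounded_linear T"
proof -
 obtain K where "\<And>x. norm (T x) \<le> K * norm x" using clinop_bound[OF assms] by blast
 then show ?thesis
  using assms by (intro bounded_linear_intro[of _ K])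
   (auto simp: clinop_add[OF assms] scaleR_scaleC clinop_scaleC[OF assms] mult.commute)
qed

lemmas clinop_linear = bounded_linear.linear[OF clinop_bounded_linear]
lemmas clinop_diff = linear_diff[OF clinop_linear]
lemmas clinop_sum = linear_sum[OF clinop_linear]
lemmas clinop_0 = linear_0[OF clinop_linear]
lemmas clinop_sums = bounded_linear.sums[OF clinop_bounded_linear]
lemmas clinop_tendsto = bounded_linear.tendsto[OF clinop_bounded_linear]

lemma clinop_zero: "clinop (\<lambda>x. 0)" by (rule clinopI[of _ 0]) auto

lemma clinop_id: "clinop (\<lambda>x. x)" by (rule clinopI[of _ 1]) auto

lemma clinop_comp: assumes "clinop S" "clinop T" shows "clinop (\<lambda>x. S (T x))"
proof -
 obtain K L where K: "K > 0" "\<And>x. norm (S x) \<le> K * norm x" and L: "\<And>x. norm (T x) \<le> L * norm x"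
  using clinop_bound assms by metis
 have "norm (S (T x)) \<le> (K * L) * norm x" for x
  using order_trans[OF K(2)[of "T x"] mult_left_mono[OF L[of x], of K]] K(1) by (simp add: mult.assoc)
 then show ?thesis by (intro clinopI[of _ "K * L"])
  (auto simp: clinop_add[OF assms(1)] clinop_scaleC[OF assms(1)] clinop_add[OF assms(2)] clinop_scaleC[OF assms(2)])
qed

lemma clinop_lin: assumes "clinop S" "clinop T" shows "clinop (\<lambda>x. a *C S x + b *C T x)"
proof -
 obtain K L where K: "\<And>x. norm (S x) \<le> K * norm x" and L: "\<And>x. norm (T x) \<le> L * norm x"
  using clinop_bound assms by metis
 have "norm (a *C S x + b *C T x) \<le> (cmod a * K + cmod b * L) * norm x" for x
  using norm_triangle_ineq[of "a *C S x" "b *C T x"] mult_left_mono[OF K[of x], of "cmod a"]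
   mult_left_mono[OF L[of x], of "cmod b"] by (simp add: norm_scaleC algebra_simps)
 then show ?thesis
  by (intro clinopI[of _ "cmod a * K + cmod b * L"])
   (auto simp: clinop_add[OF assms(1)] clinop_scaleC[OF assms(1)] clinop_add[OF assms(2)] clinop_scaleC[OF assms(2)]
    scaleC_add_right scaleC_scaleC mult.commute)
qed

lemma clinop_plus: "clinop S \<Longrightarrow> clinop T \<Longrightarrow> clinop (\<lambda>x. S x + T x)"
 using clinop_lin[of S T 1 1] by simp

lemma clinop_scale: "clinop S \<Longrightarrow> clinop (\<lambda>x. a *C S x)"
 using clinop_lin[of S S a 0] by simp

lemma clinop_rank1: "clinop (\<lambda>x. cinner x u *C v)"
proof (rule clinopI[of _ "norm u * norm v"])
 fix x :: 'a
 show "norm (cinner x u *C v) \<le> norm u * norm v * norm x"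
  using mult_right_mono[OF cinner_CS[of x u], of "norm v"] by (simp add: norm_scaleC mult_ac)
qed (auto simp: cinner_add_left scaleC_add_left cinner_scaleC_left scaleC_scaleC)

lemma clinop_finsum: "(\<And>i. i \<in> I \<Longrightarrow> clinop (F i)) \<Longrightarrow> clinop (\<lambda>x. \<Sum>i\<in>I. F i x)"
 by (induction I rule: infinite_finite_induct) (auto intro: clinop_plus clinop_zero)

section \<open>Orthogonal systems\<close>

text \<open>Norm at most one, rather than equal to one, because the left singular vectors that
  belong to zero singular values are taken to be zero. Bessel's inequality survives this.\<close>

definition osys :: "(nat \<Rightarrow> 'a::chilbert) \<Rightarrow> bool" where
 "osys f \<longleftrightarrow> (\<forall>i j. i \<noteq> j \<longrightarrow> cinner (f i) (f j) = 0) \<and> (\<forall>i. norm (f i) \<le> 1)"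

definition ons :: "(nat \<Rightarrow> 'a::chilbert) \<Rightarrow> bool" where
 "ons f \<longleftrightarrow> (\<forall>i j. cinner (f i) (f j) = (if i = j then 1 else 0))"

definition is_onb :: "(nat \<Rightarrow> 'a::chilbert) \<Rightarrow> bool" where
 "is_onb e \<longleftrightarrow> ons e \<and> (\<forall>x. (\<forall>k. cinner x (e k) = 0) \<longrightarrow> x = 0)"

lemma ons_norm: "ons f \<Longrightarrow> norm (f i) = 1"
proof -
 assume "ons f"
 then have "cor ((norm (f i))^2) = 1" unfolding ons_def cinner_norm[symmetric] by simp
 then have "(norm (f i))^2 = 1\<^sup>2" by (simp only: of_real_eq_1_iff) simp
 then show ?thesis by (rule power2_eq_imp_eq) auto
qed

lemma ons_osys: "ons f \<Longrightarrow> osys f"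
 using ons_norm[of f] by (simp add: osys_def ons_def)

lemma ons_cinner: "ons f \<Longrightarrow> cinner (f i) (f j) = (if i = j then 1 else 0)"
 by (simp add: ons_def)

lemma is_onb_ons: "is_onb e \<Longrightarrow> ons e" by (simp add: is_onb_def)

lemma osys_norm_sum:
 assumes "osys f" "finite I"
 shows "(norm (\<Sum>i\<in>I. c i *C f i))^2 = (\<Sum>i\<in>I. (cmod (c i))\<^sup>2 * (norm (f i))^2)"
 using assms(2)
proof (induction I rule: finite_induct)
 case (insert i I)
 have "cinner (c i *C f i) (\<Sum>i\<in>I. c i *C f i) = 0"
  unfolding cinner_sum_right
 proof (intro sum.neutral ballI)
  fix j assume "j \<in> I"
  then have "i \<noteq> j" using insert(2) by auto
  then have "cinner (f i) (f j) = 0" using assms(1) by (simp add: osys_def)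
  then show "cinner (c i *C f i) (c j *C f j) = 0" by (simp add: cinner_scaleC_left cinner_scaleC_right)
 qed
 then show ?case using insert by (simp add: norm_add_sq norm_scaleC power_mult_distrib)
qed simp

lemma osys_norm_sum_le:
 assumes "osys f" "finite I"
 shows "(norm (\<Sum>i\<in>I. c i *C f i))^2 \<le> (\<Sum>i\<in>I. (cmod (c i))\<^sup>2)"
 unfolding osys_norm_sum[OF assms]
proof (rule sum_mono)
 fix i
 have "(norm (f i))^2 \<le> 1" using assms(1) by (simp add: osys_def power_le_one)
 then show "(cmod (c i))^2 * (norm (f i))^2 \<le> (cmod (c i))^2"
  by (simp add: mult_left_le)
qed

lemma osys_bessel:
 assumes "osys f" "finite I"
 shows "(\<Sum>i\<in>I. (cmod (cinner x (f i)))\<^sup>2) \<le> (norm x)^2"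
proof -
 let ?S = "\<Sum>i\<in>I. (cmod (cinner x (f i)))\<^sup>2"
 let ?y = "\<Sum>i\<in>I. cinner x (f i) *C f i"
 have "cinner x ?y = (\<Sum>i\<in>I. cor ((cmod (cinner x (f i)))^2))"
  unfolding cinner_sum_right
  by (intro sum.cong refl) (simp add: cinner_scaleC_right cnj_mult_self)
 also have "\<dots> = cor ?S" by simp
 finally have 1: "cinner x ?y = cor ?S" .
 have 2: "(norm ?y)^2 \<le> ?S" by (rule osys_norm_sum_le[OF assms])
 have "0 \<le> (norm (x - ?y))^2" by simp
 then show ?thesis unfolding norm_diff_sq 1 using 2 by simp
qed

lemma osys_summable_bessel:
 assumes "osys f" shows "summable (\<lambda>i. (cmod (cinner x (f i)))\<^sup>2)"
  and "(\<Sum>i. (cmod (cinner x (f i)))\<^sup>2) \<le> (norm x)^2"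
proof -
 show *: "summable (\<lambda>i. (cmod (cinner x (f i)))\<^sup>2)"
  by (rule summableI_nonneg_bounded) (auto intro: osys_bessel[OF assms])
 show "(\<Sum>i. (cmod (cinner x (f i)))\<^sup>2) \<le> (norm x)^2"
  by (rule suminf_le_const[OF *]) (auto intro: osys_bessel[OF assms])
qed

lemma osys_summable:
 fixes f :: "nat \<Rightarrow> 'a::chilbert"
 assumes "osys f" "summable (\<lambda>i. (cmod (c i))\<^sup>2)"
 shows "summable (\<lambda>i. c i *C f i)"
 unfolding summable_iff_convergent Cauchy_convergent_iff[symmetric]
proof (rule CauchyI')
 fix e :: real assume e: "e > 0"
 then obtain N where N: "\<And>m n. m \<ge> N \<Longrightarrow> norm (\<Sum>i=m..<n. (cmod (c i))\<^sup>2) < e\<^sup>2"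
  using assms(2) unfolding summable_Cauchy using zero_less_power[OF e, of 2] by blast
 have "dist (\<Sum>i<m. c i *C f i) (\<Sum>i<n. c i *C f i) < e" if "m \<ge> N" "n > m" for m n
 proof -
  have "(norm (\<Sum>i=m..<n. c i *C f i))^2 < e\<^sup>2"
   using osys_norm_sum_le[OF assms(1), of "{m..<n}" c] N[OF that(1), of n] by simp
  then have "norm (\<Sum>i=m..<n. c i *C f i) < e" using e by (simp add: power2_less_imp_less)
  moreover have "(\<Sum>i<n. c i *C f i) - (\<Sum>i<m. c i *C f i) = (\<Sum>i=m..<n. c i *C f i)"
   using sum_diff_nat_ivl[of 0 m n "\<lambda>i. c i *C f i"] that(2) by (simp add: lessThan_atLeast0)
  ultimately show ?thesis by (metis dist_norm dist_commute)
 qed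
 then show "\<exists>M. \<forall>m\<ge>M. \<forall>n>m. dist (\<Sum>i<m. c i *C f i) (\<Sum>i<n. c i *C f i) < e" by blast
qed

lemma osys_suminf_norm:
 assumes "osys f" "summable (\<lambda>i. (cmod (c i))\<^sup>2)"
 shows "(norm (\<Sum>i. c i *C f i))^2 \<le> (\<Sum>i. (cmod (c i))\<^sup>2)"
proof (rule LIMSEQ_le)
 show "(\<lambda>n. (norm (\<Sum>i<n. c i *C f i))\<^sup>2) \<longlonglongrightarrow> (norm (\<Sum>i. c i *C f i))\<^sup>2"
  by (intro tendsto_intros summable_LIMSEQ osys_summable assms)
 show "(\<lambda>n. \<Sum>i<n. (cmod (c i))\<^sup>2) \<longlonglongrightarrow> (\<Sum>i. (cmod (c i))\<^sup>2)"
  by (rule summable_LIMSEQ[OF assms(2)])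
 show "\<exists>N. \<forall>n\<ge>N. (norm (\<Sum>i<n. c i *C f i))\<^sup>2 \<le> (\<Sum>i<n. (cmod (c i))\<^sup>2)"
  using osys_norm_sum_le[OF assms(1)] by blast
qed

lemma onb_expand:
 assumes "is_onb e"
 shows "(\<lambda>k. cinner x (e k) *C e k) sums x"
proof -
 have o: "ons e" using assms by (simp add: is_onb_def)
 let ?y = "\<Sum>k. cinner x (e k) *C e k"
 have s: "(\<lambda>k. cinner x (e k) *C e k) sums ?y"
  by (intro summable_sums osys_summable osys_summable_bessel ons_osys o)
 have "cinner (x - ?y) (e j) = 0" for j
 proof -
  have "(\<lambda>k. cinner (cinner x (e k) *C e k) (e j)) sums cinner ?y (e j)"
   by (rule sums_cinner_left[OF s])
  moreover have "(\<lambda>k. cinner (cinner x (e k) *C e k) (e j)) = (\<lambda>k. if k = j then cinner x (e j) else 0)"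
   using o by (auto simp: cinner_scaleC_left ons_cinner)
  ultimately have "cinner ?y (e j) = cinner x (e j)"
   using sums_single[of j "\<lambda>_. cinner x (e j)"] by (simp add: sums_iff)
  then show ?thesis by (simp add: cinner_diff_left)
 qed
 then have "x - ?y = 0" using assms unfolding is_onb_def by blast
 then show ?thesis using s by simp
qed

lemma onb_cinner_sums:
 assumes "is_onb e"
 shows "(\<lambda>k. cinner x (e k) * cinner (e k) y) sums cinner x y"
 using sums_cinner_left[OF onb_expand[OF assms], of x y] by (simp add: cinner_scaleC_left)

lemma onb_norm_sums:
 assumes "is_onb e"
 shows "(\<lambda>k. (cmod (cinner x (e k)))\<^sup>2) sums (norm x)\<^sup>2"
 using sums_Re[OF onb_cinner_sums[OF assms, of x x]] unfolding cinner_mult_cnj Re_cinner_self by simp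

section \<open>Diagonal operators\<close>

text \<open>One series for several uses: a Schmidt expansion, a diagonal operator when
  \<open>f\<close> and \<open>g\<close> coincide, and, with all coefficients 1, a projection or a
  unitary between two bases.\<close>

definition dgo :: "(nat \<Rightarrow> complex) \<Rightarrow> (nat \<Rightarrow> 'a) \<Rightarrow> (nat \<Rightarrow> 'a) \<Rightarrow> 'a \<Rightarrow> 'a::chilbert" where
 "dgo c f g x = (\<Sum>i. (c i * cinner x (f i)) *C g i)"

lemma dgo_coeff_summable:
 assumes "osys f" "\<And>i. cmod (c i) \<le> K"
 shows "summable (\<lambda>i. (cmod (c i * cinner x (f i)))\<^sup>2)"
  and "(\<Sum>i. (cmod (c i * cinner x (f i)))\<^sup>2) \<le> (K * norm x)^2"
proof -
 have K: "0 \<le> K" using assms(2)[of 0] norm_ge_zero order_trans by blast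
 have le: "(cmod (c i * cinner x (f i)))^2 \<le> K\<^sup>2 * (cmod (cinner x (f i)))^2" for i
  using power_mono[OF assms(2)[of i], of 2] by (simp add: norm_mult power_mult_distrib mult_right_mono)
 have s: "summable (\<lambda>i. K\<^sup>2 * (cmod (cinner x (f i)))^2)"
  by (intro summable_mult osys_summable_bessel assms)
 show *: "summable (\<lambda>i. (cmod (c i * cinner x (f i)))\<^sup>2)"
  by (rule summable_comparison_test'[OF s, of 0]) (use le in auto)
 have "(\<Sum>i. (cmod (c i * cinner x (f i)))\<^sup>2) \<le> (\<Sum>i. K\<^sup>2 * (cmod (cinner x (f i)))^2)"
  by (rule suminf_le[OF _ * s]) (use le in auto)
 also have "\<dots> = K\<^sup>2 * (\<Sum>i. (cmod (cinner x (f i)))\<^sup>2)"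
  by (rule suminf_mult) (rule osys_summable_bessel[OF assms(1)])
 also have "\<dots> \<le> K\<^sup>2 * (norm x)^2"
  by (intro mult_left_mono osys_summable_bessel assms) simp
 finally show "(\<Sum>i. (cmod (c i * cinner x (f i)))\<^sup>2) \<le> (K * norm x)^2" by (simp add: power_mult_distrib)
qed

lemma dgo_sums:
 assumes "osys f" "osys g" "Bseq c"
 shows "(\<lambda>i. (c i * cinner x (f i)) *C g i) sums dgo c f g x"
proof -
 obtain K where "\<And>i. cmod (c i) \<le> K" using assms(3) by (meson BseqE)
 then show ?thesis unfolding dgo_def
  using summable_sums[OF osys_summable[OF assms(2) dgo_coeff_summable(1)[where x = x, OF assms(1)]]] by blast
qed

lemma dgo_norm:
 assumes "osys f" "osys g" "\<And>i. cmod (c i) \<le> K"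
 shows "norm (dgo c f g x) \<le> K * norm x"
proof -
 have K: "0 \<le> K" using assms(3)[of 0] norm_ge_zero order_trans by blast
 have "(norm (dgo c f g x))^2 \<le> (K * norm x)^2"
  unfolding dgo_def
  by (rule order_trans[OF osys_suminf_norm[OF assms(2) dgo_coeff_summable(1)[where x = x, OF assms(1,3)]]
    dgo_coeff_summable(2)[where x = x, OF assms(1,3)]])
 then show ?thesis by (rule power2_le_imp_le) (use K in simp)
qed

lemma dgo_clinop:
 assumes "osys f" "osys g" "Bseq c" shows "clinop (dgo c f g)"
proof -
 obtain K where K: "\<And>i. cmod (c i) \<le> K" using assms(3) by (meson BseqE)
 note s = dgo_sums[OF assms]
 show ?thesis
 proof (rule clinopI[of _ K])
  show "dgo c f g (x + y) = dgo c f g x + dgo c f g y" for x y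
   by (rule sums_unique2[OF s[of "x+y"]])
    (use sums_add[OF s[of x] s[of y]] in \<open>simp add: cinner_add_left distrib_left scaleC_add_left\<close>)
  show "dgo c f g (a *C x) = a *C dgo c f g x" for a x
   by (rule sums_unique2[OF s[of "a *C x"]])
    (use sums_scaleC[OF s[of x], of a] in \<open>simp add: cinner_scaleC_left scaleC_scaleC mult_ac\<close>)
  show "norm (dgo c f g x) \<le> K * norm x" for x by (rule dgo_norm[OF assms(1,2) K])
 qed
qed

lemma dgo_lin:
 assumes "osys f" "osys g" "Bseq c" "Bseq d"
 shows "dgo (\<lambda>i. a * c i + b * d i) f g x = a *C dgo c f g x + b *C dgo d f g x"
proof -
 have "(\<lambda>i. a *C (c i * cinner x (f i)) *C g i + b *C (d i * cinner x (f i)) *C g i)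
   sums (a *C dgo c f g x + b *C dgo d f g x)"
  by (intro sums_add sums_scaleC dgo_sums assms)
 moreover have "(\<lambda>i. a *C (c i * cinner x (f i)) *C g i + b *C (d i * cinner x (f i)) *C g i)
   = (\<lambda>i. ((a * c i + b * d i) * cinner x (f i)) *C g i)"
  by (simp add: scaleC_scaleC distrib_right scaleC_add_left mult.assoc)
 ultimately show ?thesis unfolding dgo_def[of "\<lambda>i. a * c i + b * d i"] by (simp add: sums_iff)
qed

lemma dgo_finite:
 assumes "\<And>i. i \<ge> n \<Longrightarrow> c i = 0"
 shows "dgo c f g x = (\<Sum>i<n. (c i * cinner x (f i)) *C g i)"
 unfolding dgo_def by (rule suminf_finite) (use assms in \<open>auto simp: not_less\<close>)

lemma dgo_tail:
 assumes "osys f" "osys g" "Bseq c"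
 shows "dgo c f g x - (\<Sum>i<n. (c i * cinner x (f i)) *C g i) = dgo (\<lambda>i. if i < n then 0 else c i) f g x"
proof -
 obtain K where K: "K > 0" "\<And>i. cmod (c i) \<le> K" using assms(3) by (meson BseqE)
 define c0 where "c0 = (\<lambda>i. if i < n then c i else 0)"
 have B0: "Bseq c0" by (rule BseqI'[of _ K]) (use K in \<open>auto simp: c0_def\<close>)
 have "dgo (\<lambda>i. 1 * c i + (-1) * c0 i) f g x = 1 *C dgo c f g x + (-1) *C dgo c0 f g x"
  by (rule dgo_lin[OF assms B0])
 moreover have "(\<lambda>i. 1 * c i + (-1) * c0 i) = (\<lambda>i. if i < n then 0 else c i)" by (auto simp: c0_def)
 moreover have "dgo c0 f g x = (\<Sum>i<n. (c i * cinner x (f i)) *C g i)"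
  by (subst dgo_finite[of n]) (auto simp: c0_def)
 ultimately show ?thesis by simp
qed

text \<open>Cutting the series at \<open>n\<close> terms costs no more than a bound for the
  discarded coefficients; this is the upper half of the description of singular values.\<close>

lemma dgo_tail_norm:
 assumes "osys f" "osys g" "\<And>i. i \<ge> n \<Longrightarrow> cmod (c i) \<le> K" "0 \<le> K" "Bseq c"
 shows "norm (dgo c f g x - (\<Sum>i<n. (c i * cinner x (f i)) *C g i)) \<le> K * norm x"
 unfolding dgo_tail[OF assms(1,2,5)] by (rule dgo_norm) (use assms in auto)

lemma dgo_cinner_sums:
 assumes "osys f" "osys g" "Bseq c"
 shows "(\<lambda>i. c i * cinner x (f i) * cinner (g i) y) sums cinner (dgo c f g x) y"
 using sums_cinner_left[OF dgo_sums[OF assms, of x], of y] by (simp add: cinner_scaleC_left)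

lemma dgo_ons: assumes "ons f" "osys g" "Bseq c" shows "dgo c f g (f j) = c j *C g j"
proof -
 have "(\<lambda>i. (c i * cinner (f j) (f i)) *C g i) = (\<lambda>i. if i = j then c j *C g j else 0)"
  using assms(1) by (auto simp: ons_cinner)
 then have "(\<lambda>i. (c i * cinner (f j) (f i)) *C g i) sums (c j *C g j)"
  using sums_single[of j "\<lambda>_. c j *C g j"] by simp
 with dgo_sums[OF ons_osys[OF assms(1)] assms(2,3), of "f j"] show ?thesis by (rule sums_unique2)
qed

lemma clinop_eq_onb:
 assumes "is_onb e" "clinop S" "clinop T" "\<And>k. S (e k) = T (e k)" shows "S x = T x"
 by (rule sums_unique2[OF clinop_sums[OF assms(2) onb_expand[OF assms(1), of x]]])
  (use clinop_sums[OF assms(3) onb_expand[OF assms(1), of x]] in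
   \<open>simp add: clinop_scaleC[OF assms(2)] clinop_scaleC[OF assms(3)] assms(4)\<close>)

text \<open>The adjoint is written down as the series of <y, A e_k> e_k. Its coefficients are square
  summable by duality: pairing \<open>y\<close> with the image of the partial sum x returns the
  partial sum S of squares itself, so S \<le> K |y| |x| with |x|^2 \<le> S.\<close>

lemma adjoint_exists:
 fixes e :: "nat \<Rightarrow> 'a::chilbert" and A :: "'a \<Rightarrow> 'a"
 assumes "is_onb e" "clinop A"
 obtains B where "clinop B" "\<forall>x y. cinner (A x) y = cinner x (B y)"
proof -
 have oe: "osys e" using assms(1) by (simp add: is_onb_ons ons_osys)
 obtain K where K: "K > 0" "\<And>x. norm (A x) \<le> K * norm x" using clinop_bound[OF assms(2)] by blast
 have fin: "(\<Sum>k<n. (cmod (cinner y (A (e k))))\<^sup>2) \<le> (K * norm y)^2" for y n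
 proof -
  let ?S = "\<Sum>k<n. (cmod (cinner y (A (e k))))\<^sup>2"
  let ?x = "\<Sum>k<n. cinner y (A (e k)) *C e k"
  have "cinner y (A ?x) = (\<Sum>k<n. cor ((cmod (cinner y (A (e k))))^2))"
   by (simp add: clinop_sum[OF assms(2)] clinop_scaleC[OF assms(2)] cinner_sum_right cinner_scaleC_right
     cnj_mult_self)
  then have "cinner y (A ?x) = cor ?S" by simp
  then have "?S = cmod (cinner y (A ?x))" by (simp only: norm_of_real) (simp add: sum_nonneg)
  also have "\<dots> \<le> norm y * norm (A ?x)" by (rule cinner_CS)
  also have "\<dots> \<le> norm y * (K * norm ?x)" by (intro mult_left_mono K) simp
  finally have 1: "?S \<le> K * norm y * norm ?x" by (simp add: mult_ac)
  have 2: "(norm ?x)^2 \<le> ?S" by (rule osys_norm_sum_le[OF oe]) simp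
  have "norm ?x \<le> K * norm y"
  proof (cases "norm ?x = 0")
   case False
   have "(norm ?x)^2 \<le> K * norm y * norm ?x" using 1 2 by linarith
   then show ?thesis using False by (simp add: power2_eq_square)
  qed (use K in simp)
  then have "K * norm y * norm ?x \<le> K * norm y * (K * norm y)" by (intro mult_left_mono) (use K in auto)
  then show ?thesis using 1 by (simp add: power2_eq_square)
 qed
 have sm: "summable (\<lambda>k. (cmod (cinner y (A (e k))))\<^sup>2)" for y
  by (rule summableI_nonneg_bounded[OF _ fin]) simp
 define B where "B y = (\<Sum>k. cinner y (A (e k)) *C e k)" for y
 have Bs: "(\<lambda>k. cinner y (A (e k)) *C e k) sums B y" for y
  unfolding B_def by (intro summable_sums osys_summable oe sm)
 have eq: "cinner (A x) y = cinner x (B y)" for x y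
 proof -
  have "(\<lambda>k. cinner x (cinner y (A (e k)) *C e k)) sums cinner x (B y)" by (rule sums_cinner_right[OF Bs])
  moreover have "(\<lambda>k. cinner (A (cinner x (e k) *C e k)) y) sums cinner (A x) y"
   by (rule sums_cinner_left[OF clinop_sums[OF assms(2) onb_expand[OF assms(1)]]])
  moreover have "cinner (A (cinner x (e k) *C e k)) y = cinner x (cinner y (A (e k)) *C e k)" for k
   unfolding clinop_scaleC[OF assms(2)] cinner_scaleC_left cinner_scaleC_right
   by (subst cinner_commute[of "A (e k)" y], rule mult.commute)
  ultimately show ?thesis by (simp add: sums_iff)
 qed
 have "clinop B"
 proof (rule clinopI[of _ K])
  show "B (x + y) = B x + B y" for x y
   by (rule sums_unique2[OF Bs[of "x+y"]])
    (use sums_add[OF Bs[of x] Bs[of y]] in \<open>simp add: cinner_add_left scaleC_add_left\<close>)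
  show "B (a *C x) = a *C B x" for a x
   by (rule sums_unique2[OF Bs[of "a *C x"]])
    (use sums_scaleC[OF Bs[of x], of a] in \<open>simp add: cinner_scaleC_left scaleC_scaleC\<close>)
  show "norm (B y) \<le> K * norm y" for y
  proof (rule norm_le_by_cinner)
   fix x
   have "cmod (cinner (B y) x) = cmod (cinner (A x) y)" by (simp add: eq cmod_cinner_commute)
   also have "\<dots> \<le> norm (A x) * norm y" by (rule cinner_CS)
   also have "\<dots> \<le> K * norm x * norm y" by (intro mult_right_mono K) simp
   finally show "cmod (cinner (B y) x) \<le> K * norm y * norm x" by (simp add: mult_ac)
  qed (use K in simp)
 qed
 moreover have "\<forall>x y. cinner (A x) y = cinner x (B y)" using eq by simp
 ultimately show ?thesis by (rule that)
qed

section \<open>Finite-rank operators\<close>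

text \<open>Gaussian elimination: an unknown \<open>i0\<close> with a nonzero coefficient in
  equation \<open>j\<close> is eliminated, which removes one equation and one unknown and so
  preserves \<open>card J < card I\<close>.\<close>

lemma kernel_system:
 fixes M :: "'i \<Rightarrow> 'j \<Rightarrow> complex"
 assumes "finite J" "finite I" "card J < card I"
 shows "\<exists>v. (\<exists>i\<in>I. v i \<noteq> 0) \<and> (\<forall>j\<in>J. (\<Sum>i\<in>I. v i * M i j) = 0)"
 using assms
proof (induction J arbitrary: I M rule: finite_induct)
 case empty
 then obtain i where "i \<in> I" by fastforce
 then show ?case by (intro exI[of _ "\<lambda>_. 1"]) auto
next
 case (insert j J)
 show ?case
 proof (cases "\<forall>i\<in>I. M i j = 0")
  case True
  obtain v where "\<exists>i\<in>I. v i \<noteq> 0" "\<forall>k\<in>J. (\<Sum>i\<in>I. v i * M i k) = 0"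
   using insert.IH[of I M] insert.prems insert.hyps by auto
  then show ?thesis using True by (intro exI[of _ v]) auto
 next
  case False
  then obtain i0 where i0: "i0 \<in> I" "M i0 j \<noteq> 0" by blast
  \<comment> \<open>The remaining system after substituting the unknown \<open>i0\<close> from
    equation \<open>j\<close>.\<close>
  define N where "N = (\<lambda>i k. M i k - M i j / M i0 j * M i0 k)"
  have "card J < card (I - {i0})" using insert.prems insert.hyps i0 by simp
  then obtain v where v: "\<exists>i\<in>I - {i0}. v i \<noteq> 0" "\<forall>k\<in>J. (\<Sum>i\<in>I - {i0}. v i * N i k) = 0"
   using insert.IH[of "I - {i0}" N] insert.prems by auto
  define s where "s = (\<Sum>i\<in>I - {i0}. v i * M i j)"
  \<comment> \<open>The value at \<open>i0\<close> is what makes equation \<open>j\<close> hold; in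
    the other equations it reproduces the correction built into \<open>N\<close>.\<close>
  define w where "w = v(i0 := - s / M i0 j)"
  have sum: "(\<Sum>i\<in>I. w i * M i k) = - s / M i0 j * M i0 k + (\<Sum>i\<in>I - {i0}. v i * M i k)" for k
   using insert.prems i0 by (subst sum.remove[of _ i0]) (auto simp: w_def intro!: sum.cong)
  have "(\<Sum>i\<in>I. w i * M i k) = 0" if "k \<in> insert j J" for k
  proof (cases "k = j")
   case True then show ?thesis using i0 unfolding sum by (simp add: s_def)
  next
   case False
   then have "(\<Sum>i\<in>I - {i0}. v i * N i k) = 0" using v(2) that by auto
   moreover have "(\<Sum>i\<in>I - {i0}. v i * N i k) = (\<Sum>i\<in>I - {i0}. v i * M i k) - s / M i0 j * M i0 k"
    by (simp add: N_def s_def right_diff_distrib sum_subtractf sum_distrib_right sum_divide_distrib mult.assoc)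
   ultimately show ?thesis unfolding sum by simp
  qed
  moreover have "\<exists>i\<in>I. w i \<noteq> 0" using v(1) by (auto simp: w_def)
  ultimately show ?thesis by blast
 qed
qed

definition onf :: "(nat \<Rightarrow> 'a::chilbert) \<Rightarrow> nat \<Rightarrow> bool" where
 "onf h m \<longleftrightarrow> (\<forall>i<m. \<forall>j<m. cinner (h i) (h j) = (if i = j then 1 else 0))"

definition proj :: "(nat \<Rightarrow> 'a::chilbert) \<Rightarrow> nat \<Rightarrow> 'a \<Rightarrow> 'a" where
 "proj h m x = (\<Sum>j<m. cinner x (h j) *C h j)"

lemma ons_onf: "ons h \<Longrightarrow> onf h m" by (simp add: ons_def onf_def)

lemma proj_add: "proj h m (x + y) = proj h m x + proj h m y"
 by (simp add: proj_def cinner_add_left scaleC_add_left sum.distrib)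

lemma proj_scaleC: "proj h m (a *C x) = a *C proj h m x"
 by (simp add: proj_def cinner_scaleC_left scaleC_sum_right scaleC_scaleC)

lemma proj_sum: "proj h m (\<Sum>i\<in>I. c i *C g i) = (\<Sum>i\<in>I. c i *C proj h m (g i))"
 by (induction I rule: infinite_finite_induct) (auto simp: proj_add proj_scaleC, auto simp: proj_def)

lemma cinner_proj_perp: "(\<And>j. j < m \<Longrightarrow> cinner y (h j) = 0) \<Longrightarrow> cinner (proj h m x) y = 0"
 unfolding proj_def cinner_sum_left
proof (intro sum.neutral ballI)
 fix j assume y: "\<And>j. j < m \<Longrightarrow> cinner y (h j) = 0" "j \<in> {..<m}"
 then show "cinner (cinner x (h j) *C h j) y = 0"
  using cinner_commute[of "h j" y] by (simp add: cinner_scaleC_left)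
qed

lemma cinner_proj_left:
 assumes "onf h m" "j < m" shows "cinner (proj h m x) (h j) = cinner x (h j)"
proof -
 have "cinner (proj h m x) (h j) = (\<Sum>i<m. if i = j then cinner x (h j) else 0)"
  unfolding proj_def cinner_sum_left
  by (intro sum.cong refl) (use assms in \<open>auto simp: onf_def cinner_scaleC_left\<close>)
 then show ?thesis using assms(2) by simp
qed

lemma cinner_residual: "onf h m \<Longrightarrow> j < m \<Longrightarrow> cinner (x - proj h m x) (h j) = 0"
 by (simp add: cinner_diff_left cinner_proj_left)

lemma norm_residual: assumes "onf h m" shows "norm (x - proj h m x) \<le> norm x"
proof -
 have "cinner (proj h m x) (x - proj h m x) = 0"
  by (rule cinner_proj_perp) (rule cinner_residual[OF assms])
 then have "(norm x)^2 = (norm (proj h m x))^2 + (norm (x - proj h m x))^2"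
  using norm_add_sq[of "proj h m x" "x - proj h m x"] by simp
 then have "(norm (x - proj h m x))^2 \<le> (norm x)^2" by simp
 then show ?thesis by (rule power2_le_imp_le) simp
qed

lemma gram_schmidt_step:
 assumes "onf h m" "norm w = 1" "\<And>j. j < m \<Longrightarrow> cinner w (h j) = 0"
 shows "onf (h(m := w)) (Suc m)"
proof -
 have ww: "cinner w w = 1" using assms(2) by (simp add: cinner_norm)
 have hw: "cinner (h j) w = 0" if "j < m" for j using assms(3)[OF that] cinner_commute[of "h j" w] by simp
 show ?thesis using assms ww hw unfolding onf_def by (auto simp: less_Suc_eq)
qed

lemma normalize_residual:
 fixes r :: "'a::chilbert" assumes "r \<noteq> 0"
 shows "norm (cor (1 / norm r) *C r) = 1"
 using assms by (simp add: norm_scaleC norm_divide)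

text \<open>Vectors that already lie in the span so far are skipped, hence only
  \<open>m \<le> n\<close>. That \<open>proj h m\<close> fixes a vector is the working form of
  membership in the span of \<open>h\<close>.\<close>

lemma gram_schmidt_finite:
 "\<exists>m\<le>n. \<exists>h. onf h m \<and> (\<forall>i<n. proj h m (g i) = g i)"
proof (induction n)
 case 0 then show ?case by (auto simp: onf_def)
next
 case (Suc n)
 then obtain m h where h: "m \<le> n" "onf h m" "\<And>i. i < n \<Longrightarrow> proj h m (g i) = g i" by blast
 define r where "r = g n - proj h m (g n)"
 show ?case
 proof (cases "r = 0")
  case True
  then show ?thesis using h by (intro exI[of _ m] conjI exI[of _ h]) (auto simp: less_Suc_eq r_def)
 next
  case False
  define w where "w = cor (1 / norm r) *C r"
  have rh: "cinner r (h j) = 0" if "j < m" for j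
   unfolding r_def by (rule cinner_residual[OF h(2) that])
  have o: "onf (h(m := w)) (Suc m)"
   by (rule gram_schmidt_step[OF h(2)]) (use False rh in \<open>auto simp: w_def normalize_residual cinner_scaleC_left simp del: of_real_divide\<close>)
  have pr: "proj (h(m := w)) (Suc m) x = proj h m x + cinner x w *C w" for x
   unfolding proj_def by simp
  have "proj (h(m := w)) (Suc m) (g i) = g i" if "i < Suc n" for i
  proof (cases "i = n")
   case True
   have "cinner (g n) r = cinner r r"
   proof -
    have "cinner (proj h m (g n)) r = 0" by (rule cinner_proj_perp) (rule rh)
    then show ?thesis by (simp add: r_def cinner_diff_left)
   qed
   then have "cinner (g n) w *C w = r"
    using False by (simp add: w_def cinner_scaleC_right scaleC_scaleC cinner_norm power2_eq_square)
   then show ?thesis unfolding pr True by (simp add: r_def)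
  next
   case False
   then have gi: "proj h m (g i) = g i" using that h by simp
   have "cinner (proj h m (g i)) r = 0" by (rule cinner_proj_perp) (rule rh)
   then show ?thesis unfolding pr gi by (simp add: w_def cinner_scaleC_right gi)
  qed
  moreover have "Suc m \<le> Suc n" using h(1) by simp
  ultimately show ?thesis using o by blast
 qed
qed

definition rank_op :: "('a::chilbert \<Rightarrow> 'a) \<Rightarrow> nat \<Rightarrow> bool" where
 "rank_op F n \<longleftrightarrow> (\<exists>g. \<forall>x. \<exists>c. F x = (\<Sum>i<n. c i *C g i))"

text \<open>Turns the unspecified coefficients of \<open>rank_op\<close> into inner products with at
  most \<open>n\<close> orthonormal vectors, which is what traces and kernels are computed
  from.\<close>

lemma rank_op_proj:
 assumes "rank_op F n"
 obtains m h where "m \<le> n" "onf h m" "\<And>x. proj h m (F x) = F x"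
proof -
 obtain g where g: "\<And>x. \<exists>c. F x = (\<Sum>i<n. c i *C g i)" using assms by (auto simp: rank_op_def)
 obtain m h where h: "m \<le> n" "onf h m" "\<And>i. i < n \<Longrightarrow> proj h m (g i) = g i"
  using gram_schmidt_finite[of n g] by blast
 have "proj h m (F x) = F x" for x
 proof -
  obtain c where c: "F x = (\<Sum>i<n. c i *C g i)" using g by blast
  show ?thesis unfolding c proj_sum using h(3) by (intro sum.cong) auto
 qed
 then show ?thesis using h that by blast
qed

lemma rank_op_mono: assumes "rank_op F n" "n \<le> m" shows "rank_op F m"
proof -
 obtain g where g: "\<And>x. \<exists>c. F x = (\<Sum>i<n. c i *C g i)" using assms by (auto simp: rank_op_def)
 have "\<exists>c. F x = (\<Sum>i<m. c i *C g i)" for x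
 proof -
  obtain c where c: "F x = (\<Sum>i<n. c i *C g i)" using g by blast
  have "(\<Sum>i<m. (if i < n then c i else 0) *C g i) = (\<Sum>i<n. c i *C g i)"
   by (rule sum.mono_neutral_cong_right) (use assms(2) in auto)
  then show ?thesis using c by (intro exI[of _ "\<lambda>i. if i < n then c i else 0"]) simp
 qed
 then show ?thesis by (auto simp: rank_op_def)
qed

lemma rank_op_lin:
 assumes "rank_op F n" "rank_op G m" shows "rank_op (\<lambda>x. a *C F x + b *C G x) (n + m)"
proof -
 obtain g where g: "\<And>x. \<exists>c. F x = (\<Sum>i<n. c i *C g i)" using assms by (auto simp: rank_op_def)
 obtain h where h: "\<And>x. \<exists>c. G x = (\<Sum>i<m. c i *C h i)" using assms by (auto simp: rank_op_def)
 have *: "\<exists>c. a *C F x + b *C G x = (\<Sum>i<n+m. c i *C (if i < n then g i else h (i - n)))" for x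
 proof -
  obtain c where c: "F x = (\<Sum>i<n. c i *C g i)" using g by blast
  obtain d where d: "G x = (\<Sum>i<m. d i *C h i)" using h by blast
  let ?e = "\<lambda>i. if i < n then a * c i else b * d (i - n)"
  have "(\<Sum>i<n+m. ?e i *C (if i < n then g i else h (i - n)))
    = (\<Sum>i<n. ?e i *C (if i < n then g i else h (i - n))) + (\<Sum>i=n..<n+m. ?e i *C (if i < n then g i else h (i - n)))"
   by (simp only: lessThan_atLeast0) (rule sum.atLeastLessThan_concat[symmetric], simp_all)
  also have "(\<Sum>i=n..<n+m. ?e i *C (if i < n then g i else h (i - n))) = (\<Sum>i<m. (b * d i) *C h i)"
   using sum.shift_bounds_nat_ivl[of "\<lambda>i. ?e i *C (if i < n then g i else h (i - n))" 0 n m]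
   by (simp add: add.commute lessThan_atLeast0)
  also have "(\<Sum>i<n. ?e i *C (if i < n then g i else h (i - n))) = (\<Sum>i<n. (a * c i) *C g i)"
   by (intro sum.cong) auto
  finally show ?thesis unfolding c d
   by (intro exI[of _ ?e]) (simp add: scaleC_sum_right scaleC_scaleC)
 qed
 show ?thesis unfolding rank_op_def by (intro exI[of _ "\<lambda>i. if i < n then g i else h (i - n)"] allI *)
qed

lemma rank_op_comp_left: assumes "rank_op F n" "clinop U" shows "rank_op (\<lambda>x. U (F (V x))) n"
proof -
 obtain g where g: "\<And>x. \<exists>c. F x = (\<Sum>i<n. c i *C g i)" using assms by (auto simp: rank_op_def)
 have *: "\<exists>c. U (F (V x)) = (\<Sum>i<n. c i *C U (g i))" for x
 proof -
  obtain c where c: "F (V x) = (\<Sum>i<n. c i *C g i)" using g by blast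
  show ?thesis unfolding c by (intro exI[of _ c]) (simp add: clinop_sum[OF assms(2)] clinop_scaleC[OF assms(2)])
 qed
 show ?thesis unfolding rank_op_def by (intro exI[of _ "\<lambda>i. U (g i)"] allI *)
qed

lemma rank_op_sum: "rank_op (\<lambda>x. \<Sum>i<n. c i x *C g i) n"
 unfolding rank_op_def by (rule exI[of _ g], intro allI, rule exI, rule refl)

text \<open>The conditions <F x, h_j> = 0 are at most \<open>n\<close> linear equations for
  \<open>n + 1\<close> coefficients. This feeds the min-max lower bound for singular values.\<close>

lemma rank_op_kernel:
 assumes "clinop F" "rank_op F n"
 obtains v where "\<exists>i\<le>n. v i \<noteq> 0" "F (\<Sum>i\<le>n. v i *C f i) = 0"
proof -
 obtain m h where h: "m \<le> n" "onf h m" "\<And>x. proj h m (F x) = F x"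
  using rank_op_proj[OF assms(2)] by blast
 obtain v where v: "\<exists>i\<in>{..n}. v i \<noteq> 0" "\<forall>j\<in>{..<m}. (\<Sum>i\<le>n. v i * cinner (F (f i)) (h j)) = 0"
  using kernel_system[of "{..<m}" "{..n}" "\<lambda>i j. cinner (F (f i)) (h j)"] h(1) by auto
 have "F (\<Sum>i\<le>n. v i *C f i) = proj h m (F (\<Sum>i\<le>n. v i *C f i))" by (simp add: h)
 also have "\<dots> = 0" unfolding proj_def
  by (rule sum.neutral)
   (use v(2) in \<open>auto simp: clinop_sum[OF assms(1)] clinop_scaleC[OF assms(1)] cinner_sum_left cinner_scaleC_left\<close>)
 finally show ?thesis using v(1) that by auto
qed

text \<open>Infinite dimension in usable form: finitely many constraints never exhaust an
  orthonormal sequence. The last conclusion reflects that the witness lies in the span of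
  \<open>b\<close>, so it inherits every orthogonality that all the \<open>b i\<close>
  share.\<close>

lemma ons_perp_exists:
 fixes b h :: "nat \<Rightarrow> 'a::chilbert"
 assumes "ons b"
 obtains x where "x \<noteq> 0" "\<forall>j<m. cinner x (h j) = 0" "\<forall>y. (\<forall>i. cinner (b i) y = 0) \<longrightarrow> cinner x y = 0"
proof -
 obtain v where v: "\<exists>i\<in>{..m}. v i \<noteq> 0" "\<forall>j\<in>{..<m}. (\<Sum>i\<le>m. v i * cinner (b i) (h j)) = 0"
  using kernel_system[of "{..<m}" "{..m}" "\<lambda>i j. cinner (b i) (h j)"] by auto
 let ?x = "\<Sum>i\<le>m. v i *C b i"
 have "(norm ?x)^2 = (\<Sum>i\<le>m. (cmod (v i))\<^sup>2)"
  using osys_norm_sum[OF ons_osys[OF assms], of "{..m}" v] ons_norm[OF assms] by simp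
 moreover have "(\<Sum>i\<le>m. (cmod (v i))\<^sup>2) > 0"
  using v(1) by (auto intro!: sum_pos2)
 ultimately have x0: "?x \<noteq> 0" by auto
 have xh: "\<forall>j<m. cinner ?x (h j) = 0"
  using v(2) by (simp add: cinner_sum_left cinner_scaleC_left)
 have "\<forall>y. (\<forall>i. cinner (b i) y = 0) \<longrightarrow> cinner ?x y = 0"
  by (simp add: cinner_sum_left cinner_scaleC_left)
 with x0 xh show ?thesis by (rule that)
qed

section \<open>The spectral theorem for positive compact operators\<close>

definition cpt :: "('a::chilbert \<Rightarrow> 'a) \<Rightarrow> bool" where
 "cpt T \<longleftrightarrow> clinop T \<and> (\<forall>X. bounded (range X) \<longrightarrow> (\<exists>r::nat\<Rightarrow>nat. strict_mono r \<and> convergent (\<lambda>k. T (X (r k)))))"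

definition posop :: "('a::chilbert \<Rightarrow> 'a) \<Rightarrow> bool" where
 "posop T \<longleftrightarrow> clinop T \<and> (\<forall>x. Im (cinner (T x) x) = 0 \<and> 0 \<le> Re (cinner (T x) x))"

text \<open>Polarisation: reality of the form at x + y settles the imaginary parts, reality at x +
  iy the real parts.\<close>

lemma posop_hermitian:
 assumes "posop T" shows "cinner (T x) y = cinner x (T y)"
proof -
 have T: "clinop T" and im: "\<And>x. Im (cinner (T x) x) = 0" using assms by (auto simp: posop_def)
 have "Im (cinner (T x) y) + Im (cinner (T y) x) = 0"
  using im[of "x + y"] im[of x] im[of y] by (simp add: clinop_add[OF T] cinner_add_left cinner_add_right)
 moreover have "Re (cinner (T x) y) = Re (cinner (T y) x)"
  using im[of "x + \<i> *C y"] im[of x] im[of y]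
  by (simp add: clinop_add[OF T] clinop_scaleC[OF T] cinner_add_left cinner_add_right cinner_scaleC_left cinner_scaleC_right)
 ultimately have "cinner (T x) y = cnj (cinner (T y) x)" by (simp add: complex_eq_iff)
 then show ?thesis using cinner_commute[of x "T y"] by simp
qed

text \<open>Positivity at x - s T x is a quadratic inequality in s, and s = 1/M is the best choice.
  The bound M is asked for at x and T x alone, so that the lemma applies inside an invariant
  subspace on which M bounds the form.\<close>

lemma posop_bound:
 assumes "posop T" "0 \<le> M" "Re (cinner (T x) x) \<le> M * (norm x)^2"
  "Re (cinner (T (T x)) (T x)) \<le> M * (norm (T x))^2"
 shows "(norm (T x))^2 \<le> M * Re (cinner (T x) x)"
proof -
 have T: "clinop T" and p: "\<And>x. Re (cinner (T x) x) \<ge> 0" using assms(1) by (auto simp: posop_def)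
 let ?b = "(norm (T x))^2" let ?a = "Re (cinner (T x) x)"
 have key: "2 * s * ?b \<le> ?a + s\<^sup>2 * (M * ?b)" if "s \<ge> 0" for s
 proof -
  have "T (x - cor s *C T x) = T x - cor s *C T (T x)"
   by (simp add: clinop_diff[OF T] clinop_scaleC[OF T])
  then have "0 \<le> Re (cinner (T x - cor s *C T (T x)) (x - cor s *C T x))"
   using p[of "x - cor s *C T x"] by simp
  also have "\<dots> = ?a - 2 * s * ?b + s\<^sup>2 * Re (cinner (T (T x)) (T x))"
   using posop_hermitian[OF assms(1), of "T x" x]
   by (simp add: cinner_diff_left cinner_diff_right cinner_scaleC_left cinner_scaleC_right Re_cinner_self algebra_simps power2_eq_square)
  also have "\<dots> \<le> ?a - 2 * s * ?b + s\<^sup>2 * (M * ?b)" using assms(4) by (intro add_left_mono mult_left_mono) auto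
  finally show ?thesis by simp
 qed
 show ?thesis
 proof (cases "M = 0")
  case True
  then have "?a = 0" using assms(3) p[of x] by simp
  then show ?thesis using key[of 1] True by simp
 next
  case False
  then have "M > 0" using assms(2) by simp
  then show ?thesis using key[of "1 / M"] by (simp add: field_simps power2_eq_square)
 qed
qed

text \<open>Variational construction of the next eigenvector: M is the supremum of the form on the
  unit sphere of the complement V of the eigenvectors found so far, which T leaves invariant. By
  \<open>posop_bound\<close> a maximising sequence is asymptotically a sequence of eigenvectors, and
  compactness extracts its limit.\<close>

lemma spectral_step:
 assumes T: "cpt T" and p: "posop T" and ev: "\<And>i. i < n \<Longrightarrow> \<exists>l::real. T (u i) = cor l *C u i"
  and x0: "x0 \<noteq> 0" "\<And>i. i < n \<Longrightarrow> cinner x0 (u i) = 0"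
 obtains w l where "norm w = 1" "\<And>i. i < n \<Longrightarrow> cinner w (u i) = 0" "(0::real) \<le> l"
  "T w = cor l *C w" "\<And>x. (\<And>i. i < n \<Longrightarrow> cinner x (u i) = 0) \<Longrightarrow> Re (cinner (T x) x) \<le> l * (norm x)^2"
proof -
 have cl: "clinop T" using T by (simp add: cpt_def)
 have pos: "\<And>x. Re (cinner (T x) x) \<ge> 0" using p by (simp add: posop_def)
 define V where "V = {x. \<forall>i<n. cinner x (u i) = 0}"
 have TV: "T x \<in> V" if "x \<in> V" for x
 proof -
  have "cinner (T x) (u i) = 0" if i: "i < n" for i
  proof -
   obtain l :: real where "T (u i) = cor l *C u i" using ev[OF i] by blast
   then show ?thesis using posop_hermitian[OF p, of x "u i"] i \<open>x \<in> V\<close>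
    by (simp add: V_def cinner_scaleC_right)
  qed
  then show ?thesis by (simp add: V_def)
 qed
 have Vs: "a *C x \<in> V" if "x \<in> V" for a x using that by (simp add: V_def cinner_scaleC_left)
 obtain K where K: "K > 0" "\<And>x. norm (T x) \<le> K * norm x" using clinop_bound[OF cl] by blast
 define S where "S = {Re (cinner (T x) x) | x. x \<in> V \<and> norm x = 1}"
 have bound: "Re (cinner (T x) x) \<le> K" if "norm x = 1" for x
  using complex_Re_le_cmod[of "cinner (T x) x"] cinner_CS[of "T x" x] K(2)[of x] that by simp
 have bdd: "bdd_above S" unfolding S_def by (rule bdd_aboveI[of _ K]) (use bound in auto)
 define w0 where "w0 = cor (1 / norm x0) *C x0"
 have w0: "norm w0 = 1" "w0 \<in> V"
  using x0 by (auto simp: w0_def V_def normalize_residual cinner_scaleC_left simp del: of_real_divide)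
 then have ne: "S \<noteq> {}" by (auto simp: S_def)
 define M where "M = Sup S"
 have M1: "Re (cinner (T x) x) \<le> M" if "norm x = 1" "x \<in> V" for x
  unfolding M_def by (rule cSup_upper[OF _ bdd]) (use that in \<open>auto simp: S_def\<close>)
 have M0: "M \<ge> 0" using M1[OF w0] pos[of w0] by simp
 have Mb: "Re (cinner (T x) x) \<le> M * (norm x)^2" if "x \<in> V" for x
 proof (cases "x = 0")
  case False
  define y where "y = cor (1 / norm x) *C x"
  have "norm y = 1" "y \<in> V" using False that by (auto simp: y_def normalize_residual Vs simp del: of_real_divide)
  from M1[OF this] have "Re (cinner (T y) y) \<le> M" .
  moreover have "cinner (T y) y = cor (1 / (norm x)^2) * cinner (T x) x"
   by (simp add: y_def clinop_scaleC[OF cl] cinner_scaleC_left cinner_scaleC_right power2_eq_square)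
  then have "Re (cinner (T y) y) = Re (cinner (T x) x) / (norm x)^2"
   by (simp del: of_real_divide add: Re_complex_of_real)
  ultimately show ?thesis using False by (simp add: field_simps)
 qed (simp add: clinop_0[OF cl])
 have TM: "(norm (T x))^2 \<le> M * Re (cinner (T x) x)" if "x \<in> V" for x
  by (rule posop_bound[OF p M0 Mb[OF that] Mb[OF TV[OF that]]])
 show ?thesis
 proof (cases "M = 0")
  \<comment> \<open>With M = 0 the operator vanishes on V, and any unit vector of V serves.\<close>
  case True
  then have "T w0 = 0" using TM[OF w0(2)] by simp
  show ?thesis
   by (rule that[of w0 0]) (use w0 Mb True \<open>T w0 = 0\<close> in \<open>auto simp: V_def\<close>)
 next
  case False
  then have Mpos: "M > 0" using M0 by simp
  have "\<exists>x. x \<in> V \<and> norm x = 1 \<and> Re (cinner (T x) x) > M - 1 / real (Suc k)" for k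
  proof -
   have "M - 1 / real (Suc k) < Sup S" unfolding M_def by simp
   then show ?thesis using less_cSup_iff[OF ne bdd] by (auto simp: S_def)
  qed
  then obtain X where X: "\<And>k. X k \<in> V" "\<And>k. norm (X k) = 1" "\<And>k. Re (cinner (T (X k)) (X k)) > M - 1 / real (Suc k)"
   by metis
  have "bounded (range X)" unfolding bounded_iff using X(2) by (intro exI[of _ 1]) auto
  then obtain r :: "nat \<Rightarrow> nat" where r: "strict_mono r" "convergent (\<lambda>k. T (X (r k)))"
   using T unfolding cpt_def by blast
  then obtain y where y: "(\<lambda>k. T (X (r k))) \<longlonglongrightarrow> y" by (auto simp: convergent_def)
  let ?M = "cor M"
  \<comment> \<open>The squared defect |T X - M X|^2 is at most M (M - <T X, X>), because |T X|^2
    \<le> M <T X, X> on V.\<close>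
  have sq: "(norm (T (X k) - ?M *C X k))^2 \<le> M * (1 / real (Suc k))" for k
  proof -
   have "(norm (T (X k) - ?M *C X k))^2 = (norm (T (X k)))^2 - 2 * M * Re (cinner (T (X k)) (X k)) + M\<^sup>2"
    by (simp add: norm_diff_sq cinner_scaleC_right norm_scaleC X(2) power_mult_distrib)
   also have "\<dots> \<le> M * (M - Re (cinner (T (X k)) (X k)))"
    using TM[OF X(1)[of k]] by (simp add: algebra_simps power2_eq_square)
   also have "\<dots> \<le> M * (1 / real (Suc k))" using X(3)[of k] Mpos by (intro mult_left_mono) auto
   finally show ?thesis .
  qed
  have "(\<lambda>k. M * (1 / real (Suc k))) \<longlonglongrightarrow> 0" by real_asymp
  then have "(\<lambda>k. (norm (T (X k) - ?M *C X k))\<^sup>2) \<longlonglongrightarrow> 0"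
   by (rule Lim_null_comparison[rotated]) (use sq in auto)
  then have "(\<lambda>k. sqrt ((norm (T (X k) - ?M *C X k))^2)) \<longlonglongrightarrow> sqrt 0" by (rule tendsto_real_sqrt)
  then have "(\<lambda>k. T (X k) - ?M *C X k) \<longlonglongrightarrow> 0" by (simp add: tendsto_norm_zero_iff)
  then have "(\<lambda>k. T (X (r k)) - ?M *C X (r k)) \<longlonglongrightarrow> 0"
   using LIMSEQ_subseq_LIMSEQ[OF _ r(1)] by (auto simp: o_def)
  from tendsto_diff[OF y this] have "(\<lambda>k. ?M *C X (r k)) \<longlonglongrightarrow> y" by simp
  from tendsto_scaleC[OF this, of "cor (1 / M)"]
  have lim: "(\<lambda>k. X (r k)) \<longlonglongrightarrow> cor (1 / M) *C y" using Mpos by (simp add: scaleC_scaleC)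
  define w where "w = cor (1 / M) *C y"
  have limw: "(\<lambda>k. X (r k)) \<longlonglongrightarrow> w" using lim by (simp add: w_def)
  have "(\<lambda>k. norm (X (r k))) \<longlonglongrightarrow> norm w" by (intro tendsto_norm limw)
  then have nw: "norm w = 1" by (simp add: X(2) LIMSEQ_const_iff)
  have wV: "cinner w (u i) = 0" if "i < n" for i
  proof -
   have "(\<lambda>k. cinner (X (r k)) (u i)) \<longlonglongrightarrow> cinner w (u i)" by (rule tendsto_cinner_left[OF limw])
   moreover have "cinner (X (r k)) (u i) = 0" for k using X(1)[of "r k"] that by (simp add: V_def)
   ultimately show ?thesis by (simp add: LIMSEQ_const_iff)
  qed
  have "(\<lambda>k. T (X (r k))) \<longlonglongrightarrow> T w" by (rule clinop_tendsto[OF cl limw])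
  then have "T w = y" using y LIMSEQ_unique by blast
  then have "T w = ?M *C w" using Mpos by (simp add: w_def scaleC_scaleC)
  then show ?thesis
   by (intro that[of w M]) (use nw wV M0 Mb in \<open>auto simp: V_def\<close>)
 qed
qed

text \<open>Iterates \<open>spectral_step\<close>; the orthonormal sequence \<open>b\<close>
  provides the infinite dimension that keeps the recursion going. Eigenvalues staying above L > 0
  would give images of orthogonal eigenvectors at mutual distance at least L, against compactness.
  The last clause, a maximum principle beyond the first \<open>n\<close> eigenvectors, is what the
  Schmidt expansion needs.\<close>

theorem spectral:
 fixes T :: "'a::chilbert \<Rightarrow> 'a"
 assumes T: "cpt T" and p: "posop T" and inf: "ons (b :: nat \<Rightarrow> 'a)"
 obtains u :: "nat \<Rightarrow> 'a" and l :: "nat \<Rightarrow> real" where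
  "ons u" "decseq l" "\<And>i. 0 \<le> l i" "\<And>i. T (u i) = cor (l i) *C u i" "l \<longlonglongrightarrow> 0"
  "T = dgo (\<lambda>i. cor (l i)) u u"
  "\<forall>x n. (\<forall>i<n. cinner x (u i) = 0) \<longrightarrow> Re (cinner (T x) x) \<le> l n * (norm x)^2"
proof -
 have cl: "clinop T" using T by (simp add: cpt_def)
 \<comment> \<open>The maximum principle is carried along with the eigenvalue equation. The
   predicate looks at \<open>f\<close> below \<open>n\<close> only, as the recursion scheme
   requires.\<close>
 define P where "P = (\<lambda>f (n::nat) w. norm w = 1 \<and> (\<forall>i<n. cinner w (f i) = 0) \<and>
   (\<exists>l\<ge>0. T w = cor l *C w \<and> (\<forall>x. (\<forall>i<n. cinner x (f i) = 0) \<longrightarrow> Re (cinner (T x) x) \<le> l * (norm x)^2)))"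
 have "\<exists>f. \<forall>n. P f n (f n)"
 proof (rule dependent_wellorder_choice)
  fix r f g and n :: nat assume "\<And>y. y < n \<Longrightarrow> f y = (g y :: 'a)"
  then show "P f n r = P g n r" by (simp add: P_def)
 next
  fix n f assume H: "\<And>y. y < n \<Longrightarrow> P f y (f y)"
  obtain x0 :: 'a where "x0 \<noteq> 0" "\<forall>j<n. cinner x0 (f j) = 0"
   by (rule ons_perp_exists[OF inf, where m = n and h = f])
  then have x0: "x0 \<noteq> 0" "\<And>j. j < n \<Longrightarrow> cinner x0 (f j) = 0" by auto
  have ev: "\<exists>l::real. T (f i) = cor l *C f i" if "i < n" for i using H[OF that] by (auto simp: P_def)
  show "\<exists>r. P f n r"
  proof (rule spectral_step[OF T p ev x0])
   fix w and l :: real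
   assume "norm w = 1" "\<And>i. i < n \<Longrightarrow> cinner w (f i) = 0" "0 \<le> l" "T w = cor l *C w"
    "\<And>x. (\<And>i. i < n \<Longrightarrow> cinner x (f i) = 0) \<Longrightarrow> Re (cinner (T x) x) \<le> l * (norm x)^2"
   then show "\<exists>r. P f n r" unfolding P_def by (intro exI[of _ w] conjI exI[of _ l]) auto
  qed
 qed
 then obtain u where u: "\<And>n. P u n (u n)" by blast
 have nu: "norm (u n) = 1" for n using u[of n] by (simp add: P_def)
 have ou: "cinner (u n) (u i) = 0" if "i < n" for i n using u[of n] that by (simp add: P_def)
 have ons: "ons u" unfolding ons_def
 proof (intro allI)
  fix i j show "cinner (u i) (u j) = (if i = j then 1 else 0)"
   using nu[of i] ou[of i j] ou[of j i] cinner_commute[of "u i" "u j"]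
   by (cases i j rule: linorder_cases) (auto simp: cinner_norm)
 qed
 obtain l where l: "\<And>n. l n \<ge> 0" "\<And>n. T (u n) = cor (l n) *C u n"
   and lmax: "\<And>x n. (\<And>i. i < n \<Longrightarrow> cinner x (u i) = 0) \<Longrightarrow> Re (cinner (T x) x) \<le> l n * (norm x)^2"
  using u unfolding P_def by metis
 have dec: "decseq l"
 proof (rule decseq_SucI)
  fix n
  have "Re (cinner (T (u (Suc n))) (u (Suc n))) \<le> l n * (norm (u (Suc n)))^2" by (rule lmax) (rule ou, simp)
  then show "l (Suc n) \<le> l n" by (simp add: l(2) cinner_scaleC_left cinner_norm nu)
 qed
 have lim: "l \<longlonglongrightarrow> 0"
 proof -
  obtain L where L: "l \<longlonglongrightarrow> L" "\<And>i. L \<le> l i" using decseq_convergent[OF dec, of 0] l(1) by blast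
  have "L \<ge> 0" using L(1) l(1) by (intro LIMSEQ_le_const) auto
  have "L = 0"
  proof (rule ccontr)
   assume "L \<noteq> 0"
   then have Lp: "L > 0" using \<open>L \<ge> 0\<close> by simp
   have "bounded (range u)" unfolding bounded_iff using nu by (intro exI[of _ 1]) auto
   then obtain r :: "nat \<Rightarrow> nat" where r: "strict_mono r" "convergent (\<lambda>k. T (u (r k)))"
    using T unfolding cpt_def by blast
   then have "Cauchy (\<lambda>k. T (u (r k)))" by (simp add: Cauchy_convergent_iff)
   then obtain N where N: "\<And>m n. m \<ge> N \<Longrightarrow> n \<ge> N \<Longrightarrow> dist (T (u (r m))) (T (u (r n))) < L"
    unfolding Cauchy_def using Lp by blast
   have ne: "r N < r (Suc N)" using r(1) by (simp add: strict_mono_Suc_iff)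
   let ?a = "r (Suc N)" let ?b = "r N"
   have z: "cinner (T (u ?a)) (T (u ?b)) = 0" by (simp add: l(2) cinner_scaleC_left cinner_scaleC_right ou[OF ne])
   have "(norm (T (u ?a) - T (u ?b)))^2 = (l ?a)^2 + (l ?b)^2"
    unfolding norm_diff_sq z by (simp add: l(2) norm_scaleC nu)
   moreover have "L\<^sup>2 \<le> (l ?a)^2" using L(2)[of ?a] Lp by (intro power_mono) auto
   moreover have "0 \<le> (l ?b)^2" by simp
   ultimately have "L\<^sup>2 \<le> (norm (T (u ?a) - T (u ?b)))^2" by linarith
   then have "L \<le> norm (T (u ?a) - T (u ?b))" by (rule power2_le_imp_le) simp
   then show False using N[of "Suc N" N] by (simp add: dist_norm)
  qed
  then show ?thesis using L(1) by simp
 qed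
 \<comment> \<open>On the complement of the first \<open>n\<close> eigenvectors the form is at most
   \<open>l n\<close>, so \<open>posop_bound\<close> makes the operator norm there at most
   \<open>l n\<close>; the expansion converges because \<open>l\<close> tends to 0.\<close>
 have bound: "norm (T (x - proj u n x)) \<le> l n * norm x" for x n
 proof -
  let ?y = "x - proj u n x"
  have y: "cinner ?y (u i) = 0" if "i < n" for i by (rule cinner_residual[OF ons_onf[OF ons] that])
  have Ty: "cinner (T ?y) (u i) = 0" if "i < n" for i
   using posop_hermitian[OF p, of ?y "u i"] y[OF that] by (simp add: l(2) cinner_scaleC_right)
  have "(norm (T ?y))^2 \<le> l n * Re (cinner (T ?y) ?y)"
   by (rule posop_bound[OF p l(1) lmax[OF y] lmax[OF Ty]])
  also have "\<dots> \<le> l n * (l n * (norm ?y)^2)" by (intro mult_left_mono lmax y l)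
  also have "\<dots> \<le> l n * (l n * (norm x)^2)"
   by (intro mult_left_mono l power_mono norm_residual ons_onf ons norm_ge_zero)
  finally have "(norm (T ?y))^2 \<le> (l n * norm x)^2" by (simp add: power2_eq_square mult_ac)
  then show ?thesis by (rule power2_le_imp_le) (use l in auto)
 qed
 have "T x = dgo (\<lambda>i. cor (l i)) u u x" for x
 proof -
  have "(\<lambda>n. l n * norm x) \<longlonglongrightarrow> 0" using tendsto_mult_right[OF lim, of "norm x"] by simp
  then have "(\<lambda>n. T (x - proj u n x)) \<longlonglongrightarrow> 0"
   by (rule Lim_null_comparison[OF always_eventually[OF allI[OF bound]]])
  then have "(\<lambda>n. T x - T (proj u n x)) \<longlonglongrightarrow> 0" by (simp add: clinop_diff[OF cl])
  from tendsto_diff[OF tendsto_const[of "T x"] this] have "(\<lambda>n. T (proj u n x)) \<longlonglongrightarrow> T x" by simp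
  moreover have "T (proj u n x) = (\<Sum>i<n. (cor (l i) * cinner x (u i)) *C u i)" for n
   unfolding proj_def by (simp add: clinop_sum[OF cl] clinop_scaleC[OF cl] l(2) scaleC_scaleC mult.commute)
  ultimately have "(\<lambda>i. (cor (l i) * cinner x (u i)) *C u i) sums T x" by (simp add: sums_def)
  then show ?thesis by (simp add: dgo_def sums_iff)
 qed
 then have Teq: "T = dgo (\<lambda>i. cor (l i)) u u" by (rule ext)
 show ?thesis by (rule that[OF ons dec l(1) l(2) lim Teq]) (use lmax in blast)
qed

section \<open>Schmidt decomposition\<close>

definition schmidt :: "(nat \<Rightarrow> real) \<Rightarrow> (nat \<Rightarrow> 'a) \<Rightarrow> (nat \<Rightarrow> 'a::chilbert) \<Rightarrow> bool" where
 "schmidt s f g \<longleftrightarrow> ons f \<and> osys g \<and> decseq s \<and> (\<forall>i. 0 \<le> s i) \<and> s \<longlonglongrightarrow> 0 \<and> (\<forall>i. s i \<noteq> 0 \<longrightarrow> norm (g i) = 1)"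

lemma cpt_comp: assumes "clinop B" "cpt A" shows "cpt (\<lambda>x. B (A x))"
 unfolding cpt_def
proof (intro conjI allI impI)
 show "clinop (\<lambda>x. B (A x))" using assms by (simp add: cpt_def clinop_comp[OF assms(1)])
 fix X :: "nat \<Rightarrow> 'a" assume "bounded (range X)"
 then obtain r :: "nat \<Rightarrow> nat" where r: "strict_mono r" "convergent (\<lambda>k. A (X (r k)))" using assms(2) by (auto simp: cpt_def)
 then obtain y where "(\<lambda>k. A (X (r k))) \<longlonglongrightarrow> y" by (auto simp: convergent_def)
 from clinop_tendsto[OF assms(1) this] show "\<exists>r. strict_mono r \<and> convergent (\<lambda>k. B (A (X (r k))))"
  using r(1) by (auto simp: convergent_def)
qed

text \<open>Diagonalise the positive compact operator B A, with B the adjoint, and put s_i =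
  sqrt(l_i) and g_i = A f_i / s_i. The intertwining relations for \<open>A\<close> and
  \<open>B\<close> are exported because the frame estimates use them vector by vector.\<close>

theorem schmidt_exists:
 fixes A :: "'a::chilbert \<Rightarrow> 'a"
 assumes "cpt A" "is_onb (e :: nat \<Rightarrow> 'a)" "clinop B" and adj0: "\<forall>x y. cinner (A x) y = cinner x (B y)"
 obtains s f g where "schmidt s f g" "A = dgo (\<lambda>i. cor (s i)) f g"
  "\<forall>i. B (g i) = cor (s i) *C f i" "\<forall>i. A (f i) = cor (s i) *C g i"
proof -
 note adj = adj0[rule_format]
 have cl: "clinop A" using assms(1) by (simp add: cpt_def)
 define T where "T = (\<lambda>x. B (A x))"
 have T: "cpt T" unfolding T_def by (rule cpt_comp[OF assms(3,1)])
 have TA: "cinner (T x) y = cinner (A x) (A y)" for x y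
 proof -
  have "cinner (T x) y = cnj (cinner y (B (A x)))" unfolding T_def by (rule cinner_commute)
  also have "\<dots> = cnj (cinner (A y) (A x))" by (simp only: adj)
  also have "\<dots> = cinner (A x) (A y)" by (rule cinner_commute[symmetric])
  finally show ?thesis .
 qed
 have p: "posop T" unfolding posop_def using T by (auto simp: TA cinner_norm cpt_def)
 obtain f l where f: "ons f" and l: "decseq l" "\<And>i. 0 \<le> l i" "\<And>i. T (f i) = cor (l i) *C f i" "l \<longlonglongrightarrow> 0"
  and lm: "\<forall>x n. (\<forall>i<n. cinner x (f i) = 0) \<longrightarrow> Re (cinner (T x) x) \<le> l n * (norm x)^2"
  by (rule spectral[OF T p is_onb_ons[OF assms(2)]]) (rule that)
 have lmax: "Re (cinner (T x) x) \<le> l n * (norm x)^2" if "\<And>i. i < n \<Longrightarrow> cinner x (f i) = 0" for x n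
  using lm that by blast
 define s where "s = (\<lambda>i. sqrt (l i))"
 have s2: "s i * s i = l i" for i using l(2) by (simp add: s_def)
 define g where "g = (\<lambda>i. if s i = 0 then 0 else cor (1 / s i) *C A (f i))"
 have AA: "cinner (A (f i)) (A (f j)) = (if i = j then cor (l i) else 0)" for i j
  unfolding TA[symmetric] by (simp add: l cinner_scaleC_left ons_cinner[OF f])
 have nA: "norm (A (f i)) = s i" for i
 proof -
  have "cor ((norm (A (f i)))^2) = cor (l i)" unfolding cinner_norm[symmetric] AA by simp
  then have "(norm (A (f i)))^2 = l i" using of_real_eq_iff by blast
  then show ?thesis unfolding s_def by (metis norm_ge_zero real_sqrt_abs abs_of_nonneg)
 qed
 have Af: "A (f i) = cor (s i) *C g i" for i
  using nA[of i] by (auto simp: g_def scaleC_scaleC)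
 have Bg: "B (g i) = cor (s i) *C f i" for i
 proof (cases "s i = 0")
  case False
  then have "B (g i) = cor (1 / s i) *C T (f i)" by (simp add: g_def T_def clinop_scaleC[OF assms(3)])
  then show ?thesis using False s2[of i] by (simp add: l(3) scaleC_scaleC flip: of_real_mult of_real_divide)
    (metis nonzero_mult_div_cancel_left)
 qed (simp add: g_def clinop_0[OF assms(3)])
 have ng: "norm (g i) = (if s i = 0 then 0 else 1)" for i
  using nA[of i] l(2)[of i] by (auto simp: g_def norm_scaleC norm_divide s_def)
 have osg: "osys g" unfolding osys_def
 proof (intro conjI allI impI)
  fix i j :: nat assume "i \<noteq> j"
  then show "cinner (g i) (g j) = 0" by (simp add: g_def cinner_scaleC_left cinner_scaleC_right AA)
 next
  fix i show "norm (g i) \<le> 1" by (simp add: ng)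
 qed
 have lim: "s \<longlonglongrightarrow> 0" unfolding s_def using tendsto_real_sqrt[OF l(4)] by simp
 have sch: "schmidt s f g" unfolding schmidt_def
  using f osg lim ng l(1,2) by (auto simp: s_def decseq_def)
 have bound: "norm (A (x - proj f n x)) \<le> s n * norm x" for x n
 proof -
  let ?y = "x - proj f n x"
  have "(norm (A ?y))^2 = Re (cinner (T ?y) ?y)" by (simp add: TA cinner_norm)
  also have "\<dots> \<le> l n * (norm ?y)^2" by (intro lmax cinner_residual ons_onf f)
  also have "\<dots> \<le> l n * (norm x)^2" by (intro mult_left_mono l power_mono norm_residual ons_onf f norm_ge_zero)
  finally have "(norm (A ?y))^2 \<le> (s n * norm x)^2" using s2[of n] by (simp add: power2_eq_square mult_ac)
  then show ?thesis by (rule power2_le_imp_le) (use l in \<open>auto simp: s_def\<close>)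
 qed
 have "A x = dgo (\<lambda>i. cor (s i)) f g x" for x
 proof -
  have "(\<lambda>n. s n * norm x) \<longlonglongrightarrow> 0" using tendsto_mult_right[OF lim, of "norm x"] by simp
  then have "(\<lambda>n. A (x - proj f n x)) \<longlonglongrightarrow> 0"
   by (rule Lim_null_comparison[OF always_eventually[OF allI[OF bound]]])
  then have "(\<lambda>n. A x - A (proj f n x)) \<longlonglongrightarrow> 0" by (simp add: clinop_diff[OF cl])
  from tendsto_diff[OF tendsto_const[of "A x"] this] have "(\<lambda>n. A (proj f n x)) \<longlonglongrightarrow> A x" by simp
  moreover have "A (proj f n x) = (\<Sum>i<n. (cor (s i) * cinner x (f i)) *C g i)" for n
   unfolding proj_def by (simp add: clinop_sum[OF cl] clinop_scaleC[OF cl] Af scaleC_scaleC mult.commute)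
  ultimately have "(\<lambda>i. (cor (s i) * cinner x (f i)) *C g i) sums A x" by (simp add: sums_def)
  then show ?thesis by (simp add: dgo_def sums_iff)
 qed
 then have Aeq: "A = dgo (\<lambda>i. cor (s i)) f g" by (rule ext)
 show ?thesis by (rule that[OF sch Aeq]) (use Bg Af in auto)
qed

lemma schmidt_Bseq: "schmidt s f g \<Longrightarrow> Bseq (\<lambda>i. cor (s i))"
 unfolding schmidt_def by (intro convergent_imp_Bseq convergentI[of _ "cor 0"] tendsto_of_real) blast

text \<open>Some nonzero combination of f_0, ..., f_n lies in the kernel of \<open>F\<close>, and
  the Schmidt series stretches it by at least s_n.\<close>

lemma schmidt_lower:
 assumes "schmidt s f g" "clinop F" "rank_op F n"
  "\<And>x. norm (dgo (\<lambda>i. cor (s i)) f g x - F x) \<le> K * norm x"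
 shows "s n \<le> K"
proof -
 let ?A = "dgo (\<lambda>i. cor (s i)) f g"
 have f: "ons f" and g: "osys g" and dec: "decseq s" and s0: "\<And>i. 0 \<le> s i" and ng: "\<And>i. s i \<noteq> 0 \<Longrightarrow> norm (g i) = 1"
  using assms(1) by (auto simp: schmidt_def)
 note B = schmidt_Bseq[OF assms(1)]
 have cl: "clinop ?A" by (rule dgo_clinop[OF ons_osys[OF f] g B])
 obtain v where v: "\<exists>i\<le>n. v i \<noteq> 0" "F (\<Sum>i\<le>n. v i *C f i) = 0" using rank_op_kernel[OF assms(2,3)] by blast
 let ?x = "\<Sum>i\<le>n. v i *C f i"
 have nx: "(norm ?x)^2 = (\<Sum>i\<le>n. (cmod (v i))\<^sup>2)"
  using osys_norm_sum[OF ons_osys[OF f], of "{..n}" v] ons_norm[OF f] by simp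
 have "(\<Sum>i\<le>n. (cmod (v i))\<^sup>2) > 0" using v(1) by (auto intro!: sum_pos2)
 then have "(norm ?x)^2 > 0" by (simp only: nx)
 then have px: "norm ?x > 0" by (simp only: zero_less_power2 norm_eq_zero zero_less_norm_iff not_False_eq_True)
 have "?A ?x = (\<Sum>i\<le>n. (v i * cor (s i)) *C g i)"
  by (simp add: clinop_sum[OF cl] clinop_scaleC[OF cl] dgo_ons[OF f g B] scaleC_scaleC)
 then have nA: "(norm (?A ?x))^2 = (\<Sum>i\<le>n. (cmod (v i) * s i)\<^sup>2 * (norm (g i))^2)"
  using osys_norm_sum[OF g, of "{..n}"] s0 by (simp add: norm_mult)
 have "(s n * norm ?x)^2 = (\<Sum>i\<le>n. (s n)\<^sup>2 * (cmod (v i))^2)"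
  unfolding power_mult_distrib nx by (rule sum_distrib_left)
 also have "\<dots> \<le> (\<Sum>i\<le>n. (cmod (v i) * s i)\<^sup>2 * (norm (g i))^2)"
 proof (rule sum_mono)
  fix i assume "i \<in> {..n}"
  then have le: "s n \<le> s i" using dec by (simp add: decseq_def)
  show "(s n)^2 * (cmod (v i))^2 \<le> (cmod (v i) * s i)^2 * (norm (g i))^2"
  proof (cases "s i = 0")
   case True then show ?thesis using le s0[of n] by simp
  next
   case False
   have "(s n)^2 \<le> (s i)^2" using le s0 by (intro power_mono)
   then show ?thesis using mult_right_mono[of "(s n)^2" "(s i)^2" "(cmod (v i))^2"] ng[OF False]
    by (simp add: power_mult_distrib mult.commute)
  qed
 qed
 also have "\<dots> = (norm (?A ?x))^2" by (simp add: nA)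
 finally have "s n * norm ?x \<le> norm (?A ?x)" by (rule power2_le_imp_le) simp
 also have "\<dots> \<le> K * norm ?x" using assms(4)[of ?x] v(2) by simp
 finally show ?thesis using px by simp
qed

section \<open>Approximation by finite-rank operators and compactness\<close>

lemma compact_box_span:
 fixes m :: nat shows "compact {\<Sum>i<m. c i *C (h i :: 'a::chilbert) | c. \<forall>i<m. cmod (c i) \<le> B}"
proof (induction m)
 case 0 then show ?case by auto
next
 case (Suc m)
 let ?S = "{\<Sum>i<m. c i *C h i | c. \<forall>i<m. cmod (c i) \<le> B}"
 let ?T = "(\<lambda>a. a *C h m) ` cball 0 B"
 have "compact ?T"
  by (intro compact_continuous_image compact_cball linear_continuous_on bounded_linear_scaleC_left)
 then have "compact {x + y | x y. x \<in> ?S \<and> y \<in> ?T}" using Suc by (rule compact_sums[rotated])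
 moreover have "{x + y | x y. x \<in> ?S \<and> y \<in> ?T} = {\<Sum>i<Suc m. c i *C h i | c. \<forall>i<Suc m. cmod (c i) \<le> B}"
 proof (intro set_eqI iffI)
  fix z assume "z \<in> {x + y | x y. x \<in> ?S \<and> y \<in> ?T}"
  then obtain c a where "z = (\<Sum>i<m. c i *C h i) + a *C h m" "\<forall>i<m. cmod (c i) \<le> B" "cmod a \<le> B" by auto
  then show "z \<in> {\<Sum>i<Suc m. c i *C h i | c. \<forall>i<Suc m. cmod (c i) \<le> B}"
   by (intro CollectI exI[of _ "c(m := a)"]) (auto simp: less_Suc_eq)
 next
  fix z assume "z \<in> {\<Sum>i<Suc m. c i *C h i | c. \<forall>i<Suc m. cmod (c i) \<le> B}"
  then obtain c where "z = (\<Sum>i<m. c i *C h i) + c m *C h m" "\<forall>i<Suc m. cmod (c i) \<le> B" by auto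
  then show "z \<in> {x + y | x y. x \<in> ?S \<and> y \<in> ?T}" by fastforce
 qed
 ultimately show ?case by simp
qed

text \<open>The image of a ball under T is totally bounded: a finite-rank approximant sends the ball
  into a compact box of coefficients, and a net of the box is a net of the image.\<close>

lemma cpt_approx:
 fixes T :: "'a::chilbert \<Rightarrow> 'a"
 assumes cl: "clinop T" and ap: "\<And>\<epsilon>. \<epsilon> > 0 \<Longrightarrow> \<exists>F n. clinop F \<and> rank_op F n \<and> (\<forall>x. norm (T x - F x) \<le> \<epsilon> * norm x)"
 shows "cpt T"
 unfolding cpt_def
proof (intro conjI cl allI impI)
 fix X :: "nat \<Rightarrow> 'a" assume "bounded (range X)"
 then obtain R where R: "R > 0" "\<And>k. norm (X k) \<le> R" unfolding bounded_pos by blast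
 define S where "S = T ` cball 0 R"
 have tb: "\<exists>k. finite k \<and> closure S \<subseteq> (\<Union>x\<in>k. ball x e)" if e: "e > 0" for e
 proof -
  \<comment> \<open>The error e/(4 R) on a ball of radius R contributes e/4; the net and the passage
    to the closure contribute e/4 each, which stays below e.\<close>
  obtain F n where F: "clinop F" "rank_op F n" "\<And>x. norm (T x - F x) \<le> (e / (4 * R)) * norm x"
   using ap[of "e / (4 * R)"] e R(1) by auto
  obtain m h where h: "m \<le> n" "onf h m" "\<And>x. proj h m (F x) = F x" using rank_op_proj[OF F(2)] by blast
  obtain K where K: "K > 0" "\<And>x. norm (F x) \<le> K * norm x" using clinop_bound[OF F(1)] by blast
  let ?C = "{\<Sum>i<m. c i *C h i | c. \<forall>i<m. cmod (c i) \<le> K * R}"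
  have "\<exists>k. finite k \<and> ?C \<subseteq> (\<Union>x\<in>k. ball x (e/4))"
   using compact_box_span[where m = m and h = h and B = "K * R"] e unfolding compact_eq_totally_bounded by (meson divide_pos_pos zero_less_numeral)
  then obtain k where k: "finite k" "?C \<subseteq> (\<Union>x\<in>k. ball x (e/4))" by blast
  have "closure S \<subseteq> (\<Union>x\<in>k. ball x e)"
  proof
   fix y assume "y \<in> closure S"
   then obtain z where z: "norm z \<le> R" "dist (T z) y < e / 4"
    unfolding closure_approachable S_def using e by (metis divide_pos_pos imageE mem_cball_0 zero_less_numeral)
   have "F z \<in> ?C"
   proof (intro CollectI exI[of _ "\<lambda>i. cinner (F z) (h i)"] conjI allI impI)
    show "F z = (\<Sum>i<m. cinner (F z) (h i) *C h i)" using h(3)[of z] by (simp add: proj_def)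
    fix i assume i: "i < m"
    have "cor ((norm (h i))^2) = 1" using h(2) i unfolding onf_def cinner_norm[symmetric] by simp
    then have "(norm (h i))^2 = 1\<^sup>2" by (simp only: of_real_eq_1_iff) simp
    then have nh: "norm (h i) = 1" by (rule power2_eq_imp_eq) auto
    have "cmod (cinner (F z) (h i)) \<le> norm (F z)" using cinner_CS[of "F z" "h i"] nh by simp
    also have "\<dots> \<le> K * R" using K(2)[of z] mult_left_mono[OF z(1), of K] K(1) by linarith
    finally show "cmod (cinner (F z) (h i)) \<le> K * R" .
   qed
   then obtain x where x: "x \<in> k" "dist x (F z) < e/4" using k(2) by auto
   have "norm (T z - F z) \<le> (e / (4 * R)) * R"
    by (rule order_trans[OF F(3)]) (use z(1) e R(1) in \<open>intro mult_left_mono, auto\<close>)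
   then have "dist (F z) (T z) \<le> e / 4" using R(1) by (simp add: dist_norm norm_minus_commute)
   then have "dist x y < e" using x(2) z(2) dist_triangle[of x y "F z"] dist_triangle[of "F z" y "T z"] e by linarith
   then show "y \<in> (\<Union>x\<in>k. ball x e)" using x(1) by auto
  qed
  then show ?thesis using k(1) by blast
 qed
 have "compact (closure S)"
  unfolding compact_eq_totally_bounded using tb by (simp add: complete_eq_closed)
 moreover have "T (X k) \<in> closure S" for k
  using R(2)[of k] by (intro closure_subset[THEN subsetD]) (auto simp: S_def)
 ultimately obtain y r where "strict_mono r" "((\<lambda>k. T (X k)) \<circ> r) \<longlonglongrightarrow> y"
  using compact_imp_seq_compact[of "closure S"] unfolding seq_compact_def by meson
 then show "\<exists>r. strict_mono r \<and> convergent (\<lambda>k. T (X (r k)))" by (auto simp: convergent_def o_def)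
qed

text \<open>The weak trace class through approximation by finite rank: the distance to rank
  \<open>n\<close> is O(1/n). Asking for approximants keeps infima out of the arguments;
  \<open>weak1_wk\<close> identifies this with \<open>weak1\<close>.\<close>

definition wk :: "('a::chilbert \<Rightarrow> 'a) \<Rightarrow> bool" where
 "wk T \<longleftrightarrow> clinop T \<and> (\<exists>C. \<forall>n. \<exists>F. clinop F \<and> rank_op F n \<and> (\<forall>x. norm (T x - F x) \<le> C / (real n + 1) * norm x))"

lemma wk_cpt: assumes "wk T" shows "cpt T"
proof (rule cpt_approx)
 show "clinop T" using assms by (simp add: wk_def)
 fix e :: real assume e: "e > 0"
 obtain C where C: "\<And>n. \<exists>F. clinop F \<and> rank_op F n \<and> (\<forall>x. norm (T x - F x) \<le> C / (real n + 1) * norm x)"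
  using assms unfolding wk_def by blast
 obtain n :: nat where n: "C / e < real n" using reals_Archimedean2 by blast
 then have "C / (real n + 1) \<le> e" using e by (simp add: field_simps)
 moreover obtain F where F: "clinop F" "rank_op F n" "\<And>x. norm (T x - F x) \<le> C / (real n + 1) * norm x" using C by blast
 ultimately have "norm (T x - F x) \<le> e * norm x" for x by (meson mult_right_mono norm_ge_zero order_trans)
 then show "\<exists>F n. clinop F \<and> rank_op F n \<and> (\<forall>x. norm (T x - F x) \<le> e * norm x)" using F by blast
qed

lemma wk_schmidt_bound:
 assumes "wk (dgo (\<lambda>i. cor (s i)) f g)" "schmidt s f g"
 obtains C where "\<And>i. s i \<le> C / (real i + 1)"
proof -
 obtain C where C: "\<And>n. \<exists>F. clinop F \<and> rank_op F n \<and> (\<forall>x. norm (dgo (\<lambda>i. cor (s i)) f g x - F x) \<le> C / (real n + 1) * norm x)"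
  using assms(1) unfolding wk_def by blast
 have "s i \<le> C / (real i + 1)" for i using C[of i] schmidt_lower[OF assms(2)] by blast
 then show ?thesis using that by blast
qed

lemma inverse_bound_Bseq: assumes "\<And>i. cmod (c i) \<le> C / (real i + 1)" shows "Bseq c"
proof (rule BseqI'[of _ C])
 fix n
 have "0 \<le> C / (real n + 1)" using assms[of n] norm_ge_zero order_trans by blast
 then have "0 \<le> C" by (simp add: zero_le_divide_iff)
 then have "C / (real n + 1) \<le> C" by (simp add: field_simps mult_nonneg_nonneg)
 then show "cmod (c n) \<le> C" using assms[of n] by linarith
qed

lemma dgo_partial_bound:
 assumes "osys f" "osys g" "\<And>i. cmod (c i) \<le> C / (real i + 1)"
 shows "norm (dgo c f g x - (\<Sum>i<n. (c i * cinner x (f i)) *C g i)) \<le> C / (real n + 1) * norm x"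
proof (rule dgo_tail_norm[OF assms(1,2)])
 have "0 \<le> C / (real 0 + 1)" by (rule order_trans[OF norm_ge_zero assms(3)])
 then have C: "0 \<le> C" by simp
 show "cmod (c i) \<le> C / (real n + 1)" if "n \<le> i" for i
  by (rule order_trans[OF assms(3)]) (use that C in \<open>simp add: frac_le\<close>)
 show "0 \<le> C / (real n + 1)" using C by simp
 show "Bseq c" by (rule inverse_bound_Bseq[OF assms(3)])
qed

lemma clinop_partial: "clinop (\<lambda>x. \<Sum>i<(n::nat). (c i * cinner x (f i)) *C g i)"
 by (intro clinop_finsum) (simp add: scaleC_scaleC[symmetric] clinop_scale clinop_rank1)

lemma dgo_wk:
 assumes "osys f" "osys g" "\<And>i. cmod (c i) \<le> C / (real i + 1)"
 shows "wk (dgo c f g)"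
 unfolding wk_def
proof (intro conjI exI[of _ C] allI)
 show "clinop (dgo c f g)" by (rule dgo_clinop[OF assms(1,2) inverse_bound_Bseq[OF assms(3)]])
 fix n
 show "\<exists>F. clinop F \<and> rank_op F n \<and> (\<forall>x. norm (dgo c f g x - F x) \<le> C / (real n + 1) * norm x)"
  by (intro exI[of _ "\<lambda>x. \<Sum>i<n. (c i * cinner x (f i)) *C g i"] conjI clinop_partial rank_op_sum allI
    dgo_partial_bound[OF assms])
qed

section \<open>Orthonormal bases and unitaries\<close>

definition csub :: "'a::chilbert set \<Rightarrow> bool" where
 "csub S \<longleftrightarrow> 0 \<in> S \<and> (\<forall>x\<in>S. \<forall>y\<in>S. x + y \<in> S) \<and> (\<forall>a. \<forall>x\<in>S. a *C x \<in> S)"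

lemma csub_sum: "csub S \<Longrightarrow> (\<And>i. i \<in> I \<Longrightarrow> f i \<in> S) \<Longrightarrow> (\<Sum>i\<in>I. f i) \<in> S"
 by (induction I rule: infinite_finite_induct) (auto simp: csub_def)

lemma csub_scaleC: "csub S \<Longrightarrow> x \<in> S \<Longrightarrow> a *C x \<in> S"
 by (simp add: csub_def)

lemma csub_diff: "csub S \<Longrightarrow> x \<in> S \<Longrightarrow> y \<in> S \<Longrightarrow> x - y \<in> S"
 using csub_scaleC[of S y "-1"] by (simp add: csub_def) (metis add_uminus_conv_diff)

lemma csub_perp: "csub {x. \<forall>i. cinner x (a i) = 0}"
 by (simp add: csub_def cinner_add_left cinner_scaleC_left)

text \<open>Step \<open>n\<close> takes the first b_k outside the span built so far;
  \<open>ne\<close> says that no finite span contains them all, so such a k exists. The clause about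
  every \<open>csub\<close> expresses that the new vectors are finite combinations of the old
  ones.\<close>

lemma gram_schmidt_sequence:
 fixes b :: "nat \<Rightarrow> 'a::chilbert"
 assumes ne: "\<And>h m. onf h m \<Longrightarrow> \<exists>k. b k \<noteq> proj h m (b k)"
 obtains u where "ons u" "\<forall>k. \<exists>m. proj u m (b k) = b k" "\<forall>S i. csub S \<longrightarrow> range b \<subseteq> S \<longrightarrow> u i \<in> S"
proof -
 define res where "res = (\<lambda>f n. b (LEAST k. b k \<noteq> proj f n (b k)) - proj f n (b (LEAST k. b k \<noteq> proj f n (b k))))"
 define P where "P = (\<lambda>f n w. w = cor (1 / norm (res f n)) *C res f n)"
 have "\<exists>f. \<forall>n. P f n (f n)"
 proof (rule dependent_wellorder_choice)
  fix r f g and n :: nat assume "\<And>y. y < n \<Longrightarrow> f y = (g y :: 'a)"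
  then have "proj f n = proj g n" unfolding proj_def by (intro ext sum.cong) auto
  then show "P f n r = P g n r" by (simp add: P_def res_def)
 next
  fix n f show "\<exists>r. P f n r" by (simp add: P_def)
 qed
 then obtain u where u: "\<And>n. u n = cor (1 / norm (res u n)) *C res u n" unfolding P_def by auto
 have res: "b k \<noteq> proj u n (b k)" if "onf u n" "k = (LEAST k. b k \<noteq> proj u n (b k))" for n k
  using LeastI_ex[OF ne[OF that(1)]] that(2) by simp
 have onf: "onf u n" for n
 proof (induction n)
  case 0 then show ?case by (simp add: onf_def)
 next
  case (Suc n)
  have r: "res u n \<noteq> 0" using res[OF Suc refl] by (simp add: res_def)
  have "onf (u(n := u n)) (Suc n)"
  proof (rule gram_schmidt_step[OF Suc])
   show "norm (u n) = 1" unfolding u[of n] by (rule normalize_residual[OF r])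
   fix j assume "j < n"
   then have "cinner (res u n) (u j) = 0" unfolding res_def by (rule cinner_residual[OF Suc])
   then show "cinner (u n) (u j) = 0" by (subst u[of n]) (simp add: cinner_scaleC_left)
  qed
  then show ?case by simp
 qed
 have ons: "ons u" unfolding ons_def
 proof (intro allI)
  fix i j show "cinner (u i) (u j) = (if i = j then 1 else 0)"
   using onf[of "Suc (max i j)"] by (simp add: onf_def)
 qed
 \<comment> \<open>Since the least missing index is always taken, \<open>n\<close> steps absorb at
   least the first \<open>n\<close> vectors of \<open>b\<close>.\<close>
 have fixed: "\<forall>k<n. proj u n (b k) = b k" for n
 proof (induction n)
  case (Suc n)
  have ext: "proj u (Suc n) x = proj u n x + cinner x (u n) *C u n" for x by (simp add: proj_def)
  have keep: "proj u (Suc n) (b k) = b k" if "proj u n (b k) = b k" for k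
  proof -
   have "cinner (proj u n (b k)) (u n) = 0" by (rule cinner_proj_perp) (simp add: ons_cinner[OF ons])
   then show ?thesis using that by (simp add: ext)
  qed
  have "proj u (Suc n) (b n) = b n"
  proof (cases "proj u n (b n) = b n")
   case False
   have "(LEAST k. b k \<noteq> proj u n (b k)) = n"
   proof (rule Least_equality)
    show "b n \<noteq> proj u n (b n)" using False by simp
    show "n \<le> y" if "b y \<noteq> proj u n (b y)" for y using that Suc by (metis not_le)
   qed
   then have re: "res u n = b n - proj u n (b n)" by (simp add: res_def)
   let ?r = "res u n"
   have r0: "?r \<noteq> 0" using False re by simp
   have "cinner (proj u n (b n)) ?r = 0"
    unfolding re by (rule cinner_proj_perp) (rule cinner_residual[OF onf])
   moreover have "b n = ?r + proj u n (b n)" using re by simp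
   ultimately have "cinner (b n) ?r = cinner ?r ?r" by (metis cinner_add_left add.right_neutral)
   then have "cinner (b n) (u n) *C u n = ?r"
    unfolding u[of n] using r0 by (simp add: cinner_scaleC_right scaleC_scaleC cinner_norm power2_eq_square)
   then show ?thesis by (simp add: ext re)
  qed (rule keep)
  then show ?case using Suc keep by (auto simp: less_Suc_eq)
 qed simp
 have sub: "u i \<in> S" if S: "csub S" "range b \<subseteq> S" for S i
 proof (induction i rule: less_induct)
  case (less i)
  have "proj u i x \<in> S" for x unfolding proj_def by (intro csub_sum csub_scaleC S) (use less in auto)
  then have "res u i \<in> S" unfolding res_def using S by (intro csub_diff) auto
  then show ?case by (subst u) (rule csub_scaleC[OF S(1)])
 qed
 have "\<forall>k. \<exists>m. proj u m (b k) = b k" using fixed lessI by blast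
 moreover have "\<forall>S i. csub S \<longrightarrow> range b \<subseteq> S \<longrightarrow> u i \<in> S" using sub by blast
 ultimately show ?thesis by (rule that[OF ons])
qed

text \<open>A total sequence is not contained in a finite span here, because the orthonormal
  sequence \<open>c\<close> provides a nonzero vector orthogonal to any such span.\<close>

lemma onb_of_total:
 fixes b c :: "nat \<Rightarrow> 'a::chilbert"
 assumes "\<And>x. (\<And>k. cinner x (b k) = 0) \<Longrightarrow> x = 0" "ons c"
 obtains e where "is_onb e" "\<forall>S i. csub S \<longrightarrow> range b \<subseteq> S \<longrightarrow> e i \<in> S"
proof -
 have "\<exists>k. b k \<noteq> proj h m (b k)" if "onf h m" for h m
 proof (rule ccontr)
  assume "\<not> ?thesis"
  then have b: "b k = proj h m (b k)" for k by blast
  obtain x where x: "x \<noteq> 0" "\<forall>j<m. cinner x (h j) = 0"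
   by (rule ons_perp_exists[OF assms(2), where m = m and h = h])
  have "cinner x (b k) = 0" for k
  proof -
   have "cinner (proj h m (b k)) x = 0"
    by (rule cinner_proj_perp) (use x(2) in auto)
   then show ?thesis using b[of k] cinner_commute[of x "b k"] by simp
  qed
  then show False using assms(1) x(1) by blast
 qed
 then obtain u where u: "ons u" "\<forall>k. \<exists>m. proj u m (b k) = b k" "\<forall>S i. csub S \<longrightarrow> range b \<subseteq> S \<longrightarrow> u i \<in> S"
  by (rule gram_schmidt_sequence)
 have "is_onb u" unfolding is_onb_def
 proof (intro conjI u(1) allI impI)
  fix x assume x: "\<forall>k. cinner x (u k) = 0"
  have "cinner x (b k) = 0" for k
  proof -
   obtain m where m: "proj u m (b k) = b k" using u(2) by blast
   have "cinner (proj u m (b k)) x = 0"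
    by (rule cinner_proj_perp) (use x in auto)
   then show ?thesis using m cinner_commute[of x "b k"] by simp
  qed
  then show "x = 0" by (rule assms(1))
 qed
 then show ?thesis using u(3) by (rule that)
qed

lemma closed_csub_total:
 fixes b :: "nat \<Rightarrow> 'a::chilbert"
 assumes "is_onb e" "\<forall>S i. csub S \<longrightarrow> range b \<subseteq> S \<longrightarrow> e i \<in> S" "csub S" "closed S" "range b \<subseteq> S"
 shows "x \<in> S"
proof -
 have "(\<lambda>n. \<Sum>k<n. cinner x (e k) *C e k) \<longlonglongrightarrow> x" using onb_expand[OF assms(1)] by (simp add: sums_def)
 moreover have eS: "e k \<in> S" for k using assms(2,3,5) by blast
 have "\<forall>n. (\<Sum>k<n. cinner x (e k) *C e k) \<in> S"
  by (intro allI csub_sum csub_scaleC assms(3) eS)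
 ultimately show ?thesis using closed_sequentially[OF assms(4), of "\<lambda>n. \<Sum>k<n. cinner x (e k) *C e k" x] by blast
qed

text \<open>An orthonormal sequence indexed by all naturals leaves no index free for completing it
  to a basis. Dropping its odd half frees indices and also makes the complement infinite
  dimensional, so that a basis of the complement fills the odd places.\<close>

lemma onb_extend_even:
 fixes v e :: "nat \<Rightarrow> 'a::chilbert"
 assumes "is_onb e" "ons v"
 obtains c where "is_onb c" "\<forall>i. c (2 * i) = v (2 * i)"
proof -
 define a where "a = (\<lambda>i. v (2 * i))"
 have a: "ons a" using assms(2) by (simp add: ons_def a_def)
 have oa: "osys a" by (rule ons_osys[OF a])
 have B1: "Bseq (\<lambda>_. 1 :: complex)" by (rule BseqI'[of _ 1]) simp
 \<comment> \<open>Orthogonal projection onto the closed span of the even half.\<close>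
 define P where "P = dgo (\<lambda>_. 1) a a"
 have P0: "cinner (P x) y = 0" if "\<And>i. cinner (a i) y = 0" for x y
  using dgo_cinner_sums[OF oa oa B1, of x y] that by (simp add: P_def sums_iff)
 have Pa: "cinner (P x) (a j) = cinner x (a j)" for x j
 proof -
  have "(\<lambda>i. 1 * cinner x (a i) * cinner (a i) (a j)) = (\<lambda>i. if i = j then cinner x (a j) else 0)"
   by (auto simp: ons_cinner[OF a])
  then have "(\<lambda>i. 1 * cinner x (a i) * cinner (a i) (a j)) sums cinner x (a j)"
   using sums_single[of j "\<lambda>_. cinner x (a j)"] by simp
  with dgo_cinner_sums[OF oa oa B1, of x "a j"] show ?thesis unfolding P_def by (rule sums_unique2)
 qed
 \<comment> \<open>A total family of the complement, ready for Gram-Schmidt. That no finite span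
   contains it is seen from the odd half of \<open>v\<close>, which is orthogonal to the even
   half.\<close>
 define b where "b = (\<lambda>k. e k - P (e k))"
 have "\<exists>k. b k \<noteq> proj h m (b k)" if "onf h m" for h m
 proof (rule ccontr)
  assume "\<not> ?thesis"
  then have b: "b k = proj h m (b k)" for k by blast
  have o: "ons (\<lambda>i. v (2 * i + 1))" using assms(2) by (simp add: ons_def)
  obtain x where x: "x \<noteq> 0" "\<forall>j<m. cinner x (h j) = 0" "\<forall>y. (\<forall>i. cinner (v (2 * i + 1)) y = 0) \<longrightarrow> cinner x y = 0"
   by (rule ons_perp_exists[OF o, where m = m and h = h])
  have xa: "cinner x (a j) = 0" for j
  proof -
   have "cinner (v (2 * i + 1)) (a j) = 0" for i
    unfolding a_def ons_cinner[OF assms(2)] by simp presburger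
   then show ?thesis using x(3) by blast
  qed
  have "cinner x (e k) = 0" for k
  proof -
   have 1: "cinner (proj h m (b k)) x = 0"
    by (rule cinner_proj_perp) (use x(2) in auto)
   have 2: "cinner (P (e k)) x = 0"
   proof (rule P0)
    fix i show "cinner (a i) x = 0" using xa[of i] cinner_commute[of "a i" x] by simp
   qed
   have "cinner (e k) x = cinner (b k) x + cinner (P (e k)) x" by (simp add: b_def cinner_diff_left)
   also have "cinner (b k) x = 0" using 1 b[of k] by simp
   finally have "cinner (e k) x = 0" using 2 by simp
   then show ?thesis using cinner_commute[of x "e k"] by simp
  qed
  then have "x = 0" using assms(1) unfolding is_onb_def by blast
  with x(1) show False by blast
 qed
 then obtain u where u: "ons u" "\<forall>k. \<exists>m. proj u m (b k) = b k" "\<forall>S i. csub S \<longrightarrow> range b \<subseteq> S \<longrightarrow> u i \<in> S"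
  by (rule gram_schmidt_sequence)
 have "range b \<subseteq> {x. \<forall>i. cinner x (a i) = 0}"
  by (auto simp: b_def cinner_diff_left Pa)
 then have ua: "cinner (u i) (a j) = 0" for i j using u(3) csub_perp[of a] by blast
 define c where "c = (\<lambda>i. if even i then v i else u (i div 2))"
 have au: "cinner (a j) (u i) = 0" for i j using ua[of i j] cinner_commute[of "a j" "u i"] by simp
 have "ons c" unfolding ons_def
 proof (intro allI)
  fix i j :: nat
  have ev: "v k = a (k div 2)" if "even k" for k using that by (simp add: a_def)
  have odd_eq: "i div 2 = j div 2 \<longleftrightarrow> i = j" if "odd i" "odd j" using that by presburger
  consider "even i" "even j" | "even i" "odd j" | "odd i" "even j" | "odd i" "odd j" by blast
  then show "cinner (c i) (c j) = (if i = j then 1 else 0)"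
  proof cases
   case 1 then show ?thesis by (simp add: c_def ons_cinner[OF assms(2)])
  next
   case 2 then show ?thesis by (auto simp: c_def ev[of i] au)
  next
   case 3 then show ?thesis by (auto simp: c_def ev[of j] ua)
  next
   case 4 then show ?thesis by (simp add: c_def ons_cinner[OF u(1)] odd_eq)
  qed
 qed
 moreover have "x = 0" if x: "\<forall>k. cinner x (c k) = 0" for x
 proof -
  have xa: "cinner x (a i) = 0" for i using spec[OF x, of "2 * i"] by (simp add: c_def a_def)
  have xu: "cinner x (u i) = 0" for i using spec[OF x, of "2 * i + 1"] by (simp add: c_def)
  have "cinner x (e k) = 0" for k
  proof -
   obtain m where m: "proj u m (b k) = b k" using u(2) by blast
   have 1: "cinner (proj u m (b k)) x = 0" by (rule cinner_proj_perp) (rule xu)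
   have 2: "cinner (P (e k)) x = 0"
   proof (rule P0)
    fix i show "cinner (a i) x = 0" using xa[of i] cinner_commute[of "a i" x] by simp
   qed
   have "cinner (e k) x = cinner (b k) x + cinner (P (e k)) x" by (simp add: b_def cinner_diff_left)
   then have "cinner (e k) x = 0" using 1 2 m by simp
   then show ?thesis using cinner_commute[of x "e k"] by simp
  qed
  then show ?thesis using assms(1) unfolding is_onb_def by blast
 qed
 ultimately have "is_onb c" unfolding is_onb_def by blast
 then show ?thesis by (rule that) (simp add: c_def)
qed

definition unit_pair :: "('a::chilbert \<Rightarrow> 'a) \<Rightarrow> ('a \<Rightarrow> 'a) \<Rightarrow> bool" where
 "unit_pair U V \<longleftrightarrow> clinop U \<and> clinop V \<and> (\<forall>x. norm (U x) = norm x \<and> V (U x) = x \<and> U (V x) = x)"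

lemma unit_cinner: assumes "unit_pair U V" shows "cinner (U x) (U y) = cinner x y"
proof -
 have U: "clinop U" and n: "\<And>x. norm (U x) = norm x" using assms by (auto simp: unit_pair_def)
 have re: "Re (cinner (U x) (U y)) = Re (cinner x y)" for x y
  using norm_add_sq[of "U x" "U y"] norm_add_sq[of x y] n[of "x + y"] by (simp add: n clinop_add[OF U])
 have "Im (cinner (U x) (U y)) = Im (cinner x y)"
  using re[of x "\<i> *C y"] by (simp add: clinop_scaleC[OF U] cinner_scaleC_right)
 then show ?thesis using re by (simp add: complex_eq_iff)
qed

lemma unit_adjoint: assumes "unit_pair U V" shows "cinner x (U y) = cinner (V x) y"
 using unit_cinner[OF assms, of "V x" y] assms by (simp add: unit_pair_def)

lemma onb_unitary:
 fixes c d :: "nat \<Rightarrow> 'a::chilbert"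
 assumes "is_onb c" "is_onb d"
 obtains U V where "unit_pair U V" "\<forall>k. U (c k) = d k"
proof -
 have c: "ons c" "osys c" and d: "ons d" "osys d" using assms by (auto simp: is_onb_ons ons_osys)
 have B1: "Bseq (\<lambda>_. 1 :: complex)" by (rule BseqI'[of _ 1]) simp
 define U where "U = dgo (\<lambda>_. 1) c d"
 define V where "V = dgo (\<lambda>_. 1) d c"
 have U: "clinop U" "\<And>k. U (c k) = d k" "\<And>x. norm (U x) \<le> norm x"
  unfolding U_def using dgo_clinop[OF c(2) d(2) B1] dgo_ons[OF c(1) d(2) B1] dgo_norm[OF c(2) d(2), of "\<lambda>_. 1" 1] by auto
 have V: "clinop V" "\<And>k. V (d k) = c k" "\<And>x. norm (V x) \<le> norm x"
  unfolding V_def using dgo_clinop[OF d(2) c(2) B1] dgo_ons[OF d(1) c(2) B1] dgo_norm[OF d(2) c(2), of "\<lambda>_. 1" 1] by auto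
 have VU: "V (U x) = x" for x
  by (rule clinop_eq_onb[OF assms(1) clinop_comp[OF V(1) U(1)] clinop_id]) (simp add: U V)
 have UV: "U (V x) = x" for x
  by (rule clinop_eq_onb[OF assms(2) clinop_comp[OF U(1) V(1)] clinop_id]) (simp add: U V)
 have "norm (U x) = norm x" for x
  using U(3)[of x] V(3)[of "U x"] by (simp add: VU)
 then have "unit_pair U V" using U V UV VU by (simp add: unit_pair_def)
 moreover have "\<forall>k. U (c k) = d k" using U(2) by simp
 ultimately show ?thesis by (rule that)
qed

lemma dgo_unitary:
 assumes "unit_pair U V" "osys f" "osys g" "Bseq c"
 shows "U (dgo c f g (V x)) = dgo c (\<lambda>i. U (f i)) (\<lambda>i. U (g i)) x"
proof -
 have U: "clinop U" using assms(1) by (simp add: unit_pair_def)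
 have "(\<lambda>i. U ((c i * cinner (V x) (f i)) *C g i)) sums U (dgo c f g (V x))"
  by (rule clinop_sums[OF U dgo_sums[OF assms(2-4)]])
 then show ?thesis unfolding dgo_def[of c "\<lambda>i. U (f i)"]
  by (simp add: clinop_scaleC[OF U] unit_adjoint[OF assms(1)] sums_iff)
qed

section \<open>The trace of finite-rank operators\<close>

definition ftr :: "(nat \<Rightarrow> 'a::chilbert) \<Rightarrow> ('a \<Rightarrow> 'a) \<Rightarrow> complex" where
 "ftr e F = (\<Sum>k. cinner (F (e k)) (e k))"

text \<open>Expanding F e_k along \<open>h\<close> and exchanging the sums collapses the series to a
  finite sum that no longer mentions \<open>e\<close>: convergence, basis independence and the rank
  bound all follow.\<close>

lemma ftr_proj:
 assumes "is_onb e" "clinop F" "\<And>x. proj h m (F x) = F x"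
 shows "(\<lambda>k. cinner (F (e k)) (e k)) sums (\<Sum>i<m. cinner (F (h i)) (h i))"
proof -
 have "(\<lambda>k. cinner (F (cinner (h i) (e k) *C e k)) (h i)) sums cinner (F (h i)) (h i)" for i
  by (rule sums_cinner_left[OF clinop_sums[OF assms(2) onb_expand[OF assms(1)]]])
 then have "(\<lambda>k. \<Sum>i<m. cinner (F (cinner (h i) (e k) *C e k)) (h i)) sums (\<Sum>i<m. cinner (F (h i)) (h i))"
  by (intro sums_sum)
 moreover have "(\<Sum>i<m. cinner (F (cinner (h i) (e k) *C e k)) (h i)) = cinner (F (e k)) (e k)" for k
 proof -
  have "cinner (F (e k)) (e k) = cinner (proj h m (F (e k))) (e k)" by (simp add: assms(3))
  also have "\<dots> = (\<Sum>i<m. cinner (F (cinner (h i) (e k) *C e k)) (h i))"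
   unfolding proj_def cinner_sum_left
   by (intro sum.cong refl) (simp add: clinop_scaleC[OF assms(2)] cinner_scaleC_left mult.commute)
  finally show ?thesis by simp
 qed
 ultimately show ?thesis by simp
qed

lemma ftr_summable:
 assumes "is_onb e" "clinop F" "rank_op F n"
 shows "summable (\<lambda>k. cinner (F (e k)) (e k))"
proof -
 obtain m h where "onf h m" "\<And>x. proj h m (F x) = F x" using rank_op_proj[OF assms(3)] by blast
 then show ?thesis using ftr_proj[OF assms(1,2)] sums_summable by blast
qed

lemma ftr_bound:
 assumes "is_onb e" "clinop F" "rank_op F n" "\<And>x. norm (F x) \<le> K * norm x" "0 \<le> K"
 shows "cmod (ftr e F) \<le> real n * K"
proof -
 obtain m h where h: "m \<le> n" "onf h m" "\<And>x. proj h m (F x) = F x" using rank_op_proj[OF assms(3)] by blast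
 have "cmod (cinner (F (h i)) (h i)) \<le> K" if i: "i < m" for i
 proof -
  have "cor ((norm (h i))^2) = 1" using h(2) i unfolding onf_def cinner_norm[symmetric] by simp
  then have "(norm (h i))^2 = 1\<^sup>2" by (simp only: of_real_eq_1_iff) simp
  then have nh: "norm (h i) = 1" by (rule power2_eq_imp_eq) auto
  show ?thesis using cinner_CS[of "F (h i)" "h i"] assms(4)[of "h i"] by (simp add: nh)
 qed
 then have "cmod (\<Sum>i<m. cinner (F (h i)) (h i)) \<le> real m * K"
  using sum_norm_bound[of "{..<m}" "\<lambda>i. cinner (F (h i)) (h i)" K] by simp
 also have "\<dots> \<le> real n * K" using h(1) assms(5) by (intro mult_right_mono) auto
 finally show ?thesis using ftr_proj[OF assms(1,2) h(3)] by (simp add: ftr_def sums_iff)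
qed

lemma ftr_lin:
 assumes "is_onb e" "clinop F" "rank_op F n" "clinop G" "rank_op G m"
 shows "ftr e (\<lambda>x. a *C F x + b *C G x) = a * ftr e F + b * ftr e G"
proof -
 have "(\<lambda>k. a * cinner (F (e k)) (e k) + b * cinner (G (e k)) (e k)) sums (a * ftr e F + b * ftr e G)"
  unfolding ftr_def by (intro sums_add sums_mult summable_sums ftr_summable[OF assms(1-3)] ftr_summable[OF assms(1,4,5)])
 then show ?thesis unfolding ftr_def[of e "\<lambda>x. a *C F x + b *C G x"]
  by (simp add: cinner_add_left cinner_scaleC_left sums_iff)
qed

lemma ftr_unitary:
 assumes "is_onb e" "clinop F" "rank_op F n" "unit_pair U V"
 shows "ftr e (\<lambda>x. U (F (V x))) = ftr e F"
proof -
 obtain m h where h: "\<And>x. proj h m (F x) = F x" using rank_op_proj[OF assms(3)] by blast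
 have U: "clinop U" "clinop V" "\<And>x. V (U x) = x" using assms(4) by (auto simp: unit_pair_def)
 have "proj (\<lambda>i. U (h i)) m (U (F (V x))) = U (proj h m (F (V x)))" for x
  unfolding proj_def by (simp add: unit_cinner[OF assms(4)] clinop_sum[OF U(1)] clinop_scaleC[OF U(1)])
 then have "proj (\<lambda>i. U (h i)) m (U (F (V x))) = U (F (V x))" for x by (simp add: h)
 from ftr_proj[where F = "\<lambda>x. U (F (V x))", OF assms(1) clinop_comp[OF U(1) clinop_comp[OF assms(2) U(2)]] this]
 have "(\<lambda>k. cinner (U (F (V (e k)))) (e k)) sums (\<Sum>i<m. cinner (F (h i)) (h i))"
  by (simp add: U(3) unit_cinner[OF assms(4)])
 then show ?thesis using ftr_proj[OF assms(1,2) h] by (simp add: ftr_def sums_iff)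
qed

lemma ftr_partial:
 assumes "is_onb e"
 shows "ftr e (\<lambda>x. \<Sum>i<n. (c i * cinner x (f i)) *C g i) = (\<Sum>i<n. c i * cinner (g i) (f i))"
proof -
 have "(\<lambda>k. \<Sum>i<n. c i * (cinner (g i) (e k) * cinner (e k) (f i))) sums (\<Sum>i<n. c i * cinner (g i) (f i))"
  by (intro sums_sum sums_mult onb_cinner_sums[OF assms])
 then show ?thesis unfolding ftr_def
  by (simp add: cinner_sum_left cinner_scaleC_left sums_iff mult_ac)
qed

section \<open>Dyadic trace sequences\<close>

text \<open>Scale \<open>n\<close> allows rank C 2^n, error C / 2^n and an error C in the trace. A
  single natural constant serves all three, since it also multiplies a rank.\<close>

definition dapp :: "(nat \<Rightarrow> 'a::chilbert) \<Rightarrow> ('a \<Rightarrow> 'a) \<Rightarrow> (nat \<Rightarrow> complex) \<Rightarrow> nat \<Rightarrow> (nat \<Rightarrow> 'a \<Rightarrow> 'a) \<Rightarrow> bool" where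
 "dapp e A s C F \<longleftrightarrow> (\<forall>n. clinop (F n) \<and> rank_op (F n) (C * 2 ^ n) \<and>
   (\<forall>x. norm (A x - F n x) \<le> real C / 2 ^ n * norm x) \<and> cmod (s n - ftr e (F n)) \<le> real C)"

lemma dappD:
 assumes "dapp e A s C F"
 shows "clinop (F n)" "rank_op (F n) (C * 2 ^ n)" "norm (A x - F n x) \<le> real C / 2 ^ n * norm x"
  "cmod (s n - ftr e (F n)) \<le> real C"
 using assms by (auto simp: dapp_def)

definition dts :: "(nat \<Rightarrow> 'a::chilbert) \<Rightarrow> ('a \<Rightarrow> 'a) \<Rightarrow> (nat \<Rightarrow> complex) \<Rightarrow> bool" where
 "dts e A s \<longleftrightarrow> (\<exists>C F. dapp e A s C F)"

lemma dtsI: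
 assumes "\<And>n. clinop (F n)" "\<And>n. rank_op (F n) (K * 2 ^ n)" "\<And>n x. norm (A x - F n x) \<le> L / 2 ^ n * norm x"
  "\<And>n. cmod (s n - ftr e (F n)) \<le> M"
 shows "dts e A s"
proof -
 obtain C :: nat where C: "max (real K) (max L M) \<le> real C" using real_arch_simple by blast
 have "norm (A x - F n x) \<le> real C / 2 ^ n * norm x" for n x
  by (rule order_trans[OF assms(3)]) (intro mult_right_mono divide_right_mono, use C in auto)
 moreover have "rank_op (F n) (C * 2 ^ n)" for n
  by (rule rank_op_mono[OF assms(2)]) (use C in auto)
 moreover have "cmod (s n - ftr e (F n)) \<le> real C" for n using assms(4)[of n] C by linarith
 ultimately have "dapp e A s C F" using assms(1) unfolding dapp_def by blast
 then show ?thesis unfolding dts_def by blast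
qed

lemma ftr_diff_bound:
 assumes e: "is_onb e" and F: "clinop F" "rank_op F n" and G: "clinop G" "rank_op G m"
  and "\<And>x. norm (A x - F x) \<le> K * norm x" "\<And>x. norm (A x - G x) \<le> L * norm x" "0 \<le> K" "0 \<le> L"
 shows "cmod (ftr e F - ftr e G) \<le> real (n + m) * (K + L)"
proof -
 have "ftr e F - ftr e G = ftr e (\<lambda>x. 1 *C F x + (-1) *C G x)" using ftr_lin[OF e F G, of 1 "-1"] by simp
 also have "cmod \<dots> \<le> real (n + m) * (K + L)"
 proof (rule ftr_bound[OF e clinop_lin[OF F(1) G(1)] rank_op_lin[OF F(2) G(2)]])
  fix x
  have "1 *C F x + (-1) *C G x = (A x - G x) - (A x - F x)" by simp
  then have "norm (1 *C F x + (-1) *C G x) \<le> norm (A x - G x) + norm (A x - F x)" by (metis norm_triangle_ineq4)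
  then show "norm (1 *C F x + (-1) *C G x) \<le> (K + L) * norm x"
   using assms(6)[of x] assms(7)[of x] by (simp add: distrib_right)
 qed (use assms in simp)
 finally show ?thesis .
qed

lemma cmod_diff_via: "cmod (s - t) \<le> cmod (s - a) + cmod (t - b) + cmod (a - b)"
proof -
 have "s - t = (s - a) - (t - b) + (a - b)" by simp
 then show ?thesis using norm_triangle_ineq[of "(s - a) - (t - b)" "a - b"] norm_triangle_ineq4[of "s - a" "t - b"] by simp
qed

text \<open>The difference of two approximants at scale \<open>n\<close> has rank at most (C + D)
  2^n and norm at most (C + D) / 2^n, so its trace is at most (C + D)^2 whatever \<open>n\<close>
  is.\<close>

lemma dts_unique:
 assumes e: "is_onb e" and "dts e A s" "dts e A t"
 shows "Bseq (\<lambda>n. s n - t n)"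
proof -
 obtain C F where C: "dapp e A s C F" using assms(2) by (auto simp: dts_def)
 note F = dappD[OF C]
 obtain D G where D: "dapp e A t D G" using assms(3) by (auto simp: dts_def)
 note G = dappD[OF D]
 have "cmod (s n - t n) \<le> (real C + real D) + (real C + real D) * (real C + real D)" for n
 proof -
  have "cmod (ftr e (F n) - ftr e (G n)) \<le> real (C * 2 ^ n + D * 2 ^ n) * (real C / 2 ^ n + real D / 2 ^ n)"
   by (rule ftr_diff_bound[OF e F(1,2) G(1,2) F(3) G(3)]) auto
  also have "\<dots> = (real C + real D) * (real C + real D)" by (simp add: field_simps)
  finally have "cmod (ftr e (F n) - ftr e (G n)) \<le> (real C + real D) * (real C + real D)" .
  then show ?thesis using F(4)[of n] G(4)[of n] cmod_diff_via[of "s n" "t n" "ftr e (F n)" "ftr e (G n)"] by linarith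
 qed
 then show ?thesis by (rule BseqI')
qed

lemma dts_increment_Bseq:
 assumes e: "is_onb e" and "dts e A s"
 shows "Bseq (\<lambda>n. s (Suc n) - s n)"
proof -
 obtain C F where C: "dapp e A s C F" using assms(2) by (auto simp: dts_def)
 note F = dappD[OF C]
 have "cmod (s (Suc n) - s n) \<le> 2 * real C + 9 * (real C * real C)" for n
 proof -
  have "cmod (ftr e (F (Suc n)) - ftr e (F n)) \<le> real (C * 2 ^ Suc n + C * 2 ^ n) * (real C / 2 ^ Suc n + real C / 2 ^ n)"
   by (rule ftr_diff_bound[OF e F(1,2) F(1,2) F(3) F(3)]) auto
  \<comment> \<open>Adjacent scales: rank 3 C 2^n times norm (3/2) C / 2^n.\<close>
  also have "\<dots> = 9 / 2 * (real C * real C)" by (simp add: field_simps)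
  also have "\<dots> \<le> 9 * (real C * real C)" by simp
  finally have "cmod (ftr e (F (Suc n)) - ftr e (F n)) \<le> 9 * (real C * real C)" .
  then show ?thesis using F(4)[of n] F(4)[of "Suc n"] cmod_diff_via[of "s (Suc n)" "s n" "ftr e (F (Suc n))" "ftr e (F n)"] by linarith
 qed
 then show ?thesis by (rule BseqI')
qed

lemma dts_lin:
 assumes e: "is_onb e" and "dts e A s" "dts e B t"
 shows "dts e (\<lambda>x. a *C A x + b *C B x) (\<lambda>n. a * s n + b * t n)"
proof -
 obtain C F where C: "dapp e A s C F" using assms(2) by (auto simp: dts_def)
 note F = dappD[OF C]
 obtain D G where D: "dapp e B t D G" using assms(3) by (auto simp: dts_def)
 note G = dappD[OF D]
 show ?thesis
 proof (rule dtsI[where F = "\<lambda>n x. a *C F n x + b *C G n x" and K = "C + D"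
    and L = "cmod a * real C + cmod b * real D" and M = "cmod a * real C + cmod b * real D"])
  fix n
  show "clinop (\<lambda>x. a *C F n x + b *C G n x)" by (rule clinop_lin[OF F(1) G(1)])
  show "rank_op (\<lambda>x. a *C F n x + b *C G n x) ((C + D) * 2 ^ n)"
   using rank_op_lin[OF F(2)[of n] G(2)[of n]] by (simp add: distrib_right)
  have "a * s n + b * t n - ftr e (\<lambda>x. a *C F n x + b *C G n x) = a * (s n - ftr e (F n)) + b * (t n - ftr e (G n))"
   using ftr_lin[OF e F(1,2) G(1,2), of a n b n] by (simp add: algebra_simps)
  then show "cmod (a * s n + b * t n - ftr e (\<lambda>x. a *C F n x + b *C G n x)) \<le> cmod a * real C + cmod b * real D"
   using norm_triangle_ineq[of "a * (s n - ftr e (F n))" "b * (t n - ftr e (G n))"]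
    mult_left_mono[OF F(4)[of n], of "cmod a"] mult_left_mono[OF G(4)[of n], of "cmod b"] by (simp add: norm_mult)
  fix x
  have "a *C A x + b *C B x - (a *C F n x + b *C G n x) = a *C (A x - F n x) + b *C (B x - G n x)"
   by (simp add: scaleC_diff_right)
  then have "norm (a *C A x + b *C B x - (a *C F n x + b *C G n x)) \<le> cmod a * norm (A x - F n x) + cmod b * norm (B x - G n x)"
   using norm_triangle_ineq[of "a *C (A x - F n x)" "b *C (B x - G n x)"] by (simp add: norm_scaleC)
  also have "\<dots> \<le> cmod a * (real C / 2 ^ n * norm x) + cmod b * (real D / 2 ^ n * norm x)"
   by (intro add_mono mult_left_mono F G) auto
  also have "\<dots> = (cmod a * real C + cmod b * real D) / 2 ^ n * norm x" by (simp add: field_simps)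
  finally show "norm (a *C A x + b *C B x - (a *C F n x + b *C G n x)) \<le> (cmod a * real C + cmod b * real D) / 2 ^ n * norm x" .
 qed
qed

lemma dts_perturb:
 assumes "dts e A s" "Bseq (\<lambda>n. t n - s n)" shows "dts e A t"
proof -
 obtain C F where C: "dapp e A s C F" using assms(1) by (auto simp: dts_def)
 note F = dappD[OF C]
 obtain K where K: "\<And>n. cmod (t n - s n) \<le> K" using assms(2) by (meson BseqE)
 have "cmod (t n - ftr e (F n)) \<le> K + real C" for n
  using norm_triangle_ineq[of "t n - s n" "s n - ftr e (F n)"] K[of n] F(4)[of n] by simp
 then show ?thesis by (intro dtsI[of F C _ "real C"]) (use F in auto)
qed

lemma dts_unitary:
 assumes e: "is_onb e" and "dts e A s" "unit_pair U V"
 shows "dts e (\<lambda>x. U (A (V x))) s"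
proof -
 obtain C F where C: "dapp e A s C F" using assms(2) by (auto simp: dts_def)
 note F = dappD[OF C]
 have U: "clinop U" "clinop V" "\<And>x. norm (U x) = norm x" "\<And>x. U (V x) = x" using assms(3) by (auto simp: unit_pair_def)
 have nV: "norm (V x) = norm x" for x using U(3)[of "V x"] U(4) by simp
 show ?thesis
 proof (rule dtsI[where F = "\<lambda>n x. U (F n (V x))" and K = C and L = "real C" and M = "real C"])
  fix n
  show "clinop (\<lambda>x. U (F n (V x)))" by (rule clinop_comp[OF U(1) clinop_comp[OF F(1) U(2)]])
  show "rank_op (\<lambda>x. U (F n (V x))) (C * 2 ^ n)" by (rule rank_op_comp_left[OF F(2) U(1)])
  show "cmod (s n - ftr e (\<lambda>x. U (F n (V x)))) \<le> real C" unfolding ftr_unitary[OF e F(1,2) assms(3)] by (rule F(4))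
  fix x
  have "norm (U (A (V x)) - U (F n (V x))) = norm (A (V x) - F n (V x))"
   by (simp add: clinop_diff[OF U(1), symmetric] U(3))
  also have "\<dots> \<le> real C / 2 ^ n * norm x" using F(3)[of "V x" n] by (simp add: nV)
  finally show "norm (U (A (V x)) - U (F n (V x))) \<le> real C / 2 ^ n * norm x" .
 qed
qed

lemma dts_exists:
 assumes "wk A" shows "\<exists>s. dts e A s"
proof -
 obtain C where C: "\<And>n. \<exists>F. clinop F \<and> rank_op F n \<and> (\<forall>x. norm (A x - F x) \<le> C / (real n + 1) * norm x)"
  using assms unfolding wk_def by blast
 have "\<forall>n. \<exists>F. clinop F \<and> rank_op F (2 ^ n) \<and> (\<forall>x. norm (A x - F x) \<le> C / (real (2 ^ n) + 1) * norm x)" using C by blast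
 then obtain F where F: "\<And>n. clinop (F n)" "\<And>n. rank_op (F n) (2 ^ n)" "\<And>n x. norm (A x - F n x) \<le> C / (real (2 ^ n) + 1) * norm x"
  by metis
 have "dts e A (\<lambda>n. ftr e (F n))"
 proof (rule dtsI[where F = F and K = 1 and L = "\<bar>C\<bar>" and M = 0])
  fix n x
  have "C / (real (2 ^ n) + 1) \<le> \<bar>C\<bar> / 2 ^ n" by (intro frac_le) auto
  then show "norm (A x - F n x) \<le> \<bar>C\<bar> / 2 ^ n * norm x"
   using F(3)[of x n] by (meson mult_right_mono norm_ge_zero order_trans)
 qed (use F in auto)
 then show ?thesis by blast
qed

text \<open>The cut at 2^n - 1 falls exactly where dyadic block \<open>n\<close> begins, and from
  there on the coefficients are at most C / 2^n.\<close>

lemma dts_dgo: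
 assumes e: "is_onb e" and f: "osys f" "osys g" and c: "\<And>i. cmod (c i) \<le> C / (real i + 1)"
 shows "dts e (dgo c f g) (\<lambda>n. \<Sum>i<2 ^ n - 1. c i * cinner (g i) (f i))"
proof (rule dtsI[where F = "\<lambda>n x. \<Sum>i<2 ^ n - 1. (c i * cinner x (f i)) *C g i" and K = 1 and L = C and M = 0])
 fix n
 show "rank_op (\<lambda>x. \<Sum>i<2 ^ n - 1. (c i * cinner x (f i)) *C g i) (1 * 2 ^ n)"
  by (rule rank_op_mono[OF rank_op_sum]) simp
 show "norm (dgo c f g x - (\<Sum>i<2 ^ n - 1. (c i * cinner x (f i)) *C g i)) \<le> C / 2 ^ n * norm x" for x
  using dgo_partial_bound[OF f c, of x "2 ^ n - 1"] by (simp add: of_nat_diff)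
qed (auto simp: clinop_partial ftr_partial[OF e])

section \<open>Operators with singular values of order 1/n\<close>

lemma wk_clinop: "wk A \<Longrightarrow> clinop A" by (simp add: wk_def)

lemma wk_lin: assumes "wk A" "wk B" shows "wk (\<lambda>x. a *C A x + b *C B x)"
proof -
 obtain C where C: "\<And>n. \<exists>F. clinop F \<and> rank_op F n \<and> (\<forall>x. norm (A x - F x) \<le> C / (real n + 1) * norm x)"
  using assms(1) unfolding wk_def by blast
 obtain D where D: "\<And>n. \<exists>F. clinop F \<and> rank_op F n \<and> (\<forall>x. norm (B x - F x) \<le> D / (real n + 1) * norm x)"
  using assms(2) unfolding wk_def by blast
 define K where "K = 2 * (cmod a * \<bar>C\<bar> + cmod b * \<bar>D\<bar>)"
 have "\<exists>F. clinop F \<and> rank_op F n \<and> (\<forall>x. norm (a *C A x + b *C B x - F x) \<le> K / (real n + 1) * norm x)" for n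
 proof -
  \<comment> \<open>Half of the allowed rank goes to each summand; 2 (\<open>?m\<close> + 1) \<ge> n
    + 1 makes this cost a factor 2.\<close>
  let ?m = "n div 2"
  obtain F where F: "clinop F" "rank_op F ?m" "\<And>x. norm (A x - F x) \<le> C / (real ?m + 1) * norm x" using C by blast
  obtain G where G: "clinop G" "rank_op G ?m" "\<And>x. norm (B x - G x) \<le> D / (real ?m + 1) * norm x" using D by blast
  have "n + 1 \<le> 2 * (?m + 1)" by presburger
  then have "real (n + 1) \<le> real (2 * (?m + 1))" by (rule of_nat_mono)
  then have m: "2 * (real ?m + 1) \<ge> real n + 1" by simp
  have le: "E / (real ?m + 1) \<le> 2 * \<bar>E\<bar> / (real n + 1)" for E
  proof -
   have "E / (real ?m + 1) \<le> \<bar>E\<bar> / (real ?m + 1)" by (intro divide_right_mono) auto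
   also have "\<dots> = 2 * \<bar>E\<bar> / (2 * (real ?m + 1))" by (simp add: field_simps)
   also have "\<dots> \<le> 2 * \<bar>E\<bar> / (real n + 1)" using m by (intro divide_left_mono) auto
   finally show ?thesis .
  qed
  have "norm (a *C A x + b *C B x - (a *C F x + b *C G x)) \<le> K / (real n + 1) * norm x" for x
  proof -
   have "a *C A x + b *C B x - (a *C F x + b *C G x) = a *C (A x - F x) + b *C (B x - G x)"
    by (simp add: scaleC_diff_right)
   then have "norm (a *C A x + b *C B x - (a *C F x + b *C G x)) \<le> cmod a * norm (A x - F x) + cmod b * norm (B x - G x)"
    using norm_triangle_ineq[of "a *C (A x - F x)" "b *C (B x - G x)"] by (simp add: norm_scaleC)
   also have "\<dots> \<le> cmod a * (2 * \<bar>C\<bar> / (real n + 1) * norm x) + cmod b * (2 * \<bar>D\<bar> / (real n + 1) * norm x)"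
    by (intro add_mono mult_left_mono order_trans[OF F(3)] order_trans[OF G(3)] mult_right_mono le) auto
   also have "\<dots> = K / (real n + 1) * norm x" by (simp add: K_def add_divide_distrib distrib_right distrib_left mult_ac)
   finally show ?thesis .
  qed
  moreover have "rank_op (\<lambda>x. a *C F x + b *C G x) n"
   by (rule rank_op_mono[OF rank_op_lin[OF F(2) G(2)]]) simp
  ultimately show ?thesis using clinop_lin[OF F(1) G(1), of a b] by blast
 qed
 then show ?thesis unfolding wk_def using clinop_lin[OF assms(1)[THEN wk_clinop] assms(2)[THEN wk_clinop], of a b] by blast
qed

lemma wk_unitary: assumes "wk A" "unit_pair U V" shows "wk (\<lambda>x. U (A (V x)))"
proof -
 obtain C where C: "\<And>n. \<exists>F. clinop F \<and> rank_op F n \<and> (\<forall>x. norm (A x - F x) \<le> C / (real n + 1) * norm x)"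
  using assms(1) unfolding wk_def by blast
 have U: "clinop U" "clinop V" "\<And>x. norm (U x) = norm x" "\<And>x. U (V x) = x" using assms(2) by (auto simp: unit_pair_def)
 have nV: "norm (V x) = norm x" for x using U(3)[of "V x"] U(4) by simp
 have "\<exists>F. clinop F \<and> rank_op F n \<and> (\<forall>x. norm (U (A (V x)) - F x) \<le> C / (real n + 1) * norm x)" for n
 proof -
  obtain F where F: "clinop F" "rank_op F n" "\<And>x. norm (A x - F x) \<le> C / (real n + 1) * norm x" using C by blast
  have "norm (U (A (V x)) - U (F (V x))) \<le> C / (real n + 1) * norm x" for x
   using F(3)[of "V x"] by (simp add: clinop_diff[OF U(1), symmetric] U(3) nV)
  moreover have "clinop (\<lambda>x. U (F (V x)))" by (rule clinop_comp[OF U(1) clinop_comp[OF F(1) U(2)]])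
  ultimately show ?thesis using rank_op_comp_left[OF F(2) U(1), of V] by blast
 qed
 then show ?thesis unfolding wk_def using clinop_comp[OF U(1) clinop_comp[OF wk_clinop[OF assms(1)] U(2)]] by blast
qed

lemma wk_pos_spectral:
 fixes A :: "'a::chilbert \<Rightarrow> 'a" and e :: "nat \<Rightarrow> 'a"
 assumes "wk A" "posop A" "is_onb e"
 obtains l u C where "schmidt l u u" "A = dgo (\<lambda>i. cor (l i)) u u" "\<forall>i. l i \<le> C / (real i + 1)"
proof -
 obtain u l where u: "ons u" "decseq l" "\<forall>i. 0 \<le> l i" "l \<longlonglongrightarrow> 0" "A = dgo (\<lambda>i. cor (l i)) u u"
 proof (rule spectral[OF wk_cpt[OF assms(1)] assms(2) is_onb_ons[OF assms(3)]])
  fix u l assume "ons u" "decseq l" "\<And>i. 0 \<le> l i" "l \<longlonglongrightarrow> 0" "A = dgo (\<lambda>i. cor (l i)) u u"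
  then show thesis using that by blast
 qed
 have s: "schmidt l u u" using u ons_norm[OF u(1)] ons_osys[OF u(1)] unfolding schmidt_def by blast
 obtain C where "\<And>i. l i \<le> C / (real i + 1)" by (rule wk_schmidt_bound[OF _ s]) (use assms(1) u(5) in auto)
 then show ?thesis using that[of l u C] s u(5) by blast
qed

lemma cmod_schmidt: "schmidt s f g \<Longrightarrow> \<forall>i. s i \<le> C / (real i + 1) \<Longrightarrow> cmod (cor (s i)) \<le> C / (real i + 1)"
 by (simp add: schmidt_def)

lemma dgo_posop: assumes "ons u" "Bseq c" "\<And>i. Im (c i) = 0" "\<And>i. 0 \<le> Re (c i)" shows "posop (dgo c u u)"
proof -
 have o: "osys u" by (rule ons_osys[OF assms(1)])
 have "Im (cinner (dgo c u u x) x) = 0 \<and> 0 \<le> Re (cinner (dgo c u u x) x)" for x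
 proof -
  have eq: "(\<lambda>i. c i * cinner x (u i) * cinner (u i) x) = (\<lambda>i. cor (Re (c i) * (cmod (cinner x (u i)))^2))"
  proof
   fix i
   have "c i = cor (Re (c i))" using assms(3) by (simp add: complex_eq_iff)
   then show "c i * cinner x (u i) * cinner (u i) x = cor (Re (c i) * (cmod (cinner x (u i)))^2)"
    using cinner_mult_cnj[of x "u i"] by (simp add: mult.assoc)
  qed
  note s = dgo_cinner_sums[OF o o assms(2), of x x, unfolded eq]
  have "Im (cinner (dgo c u u x) x) = 0" using sums_Im[OF s] by (simp add: sums_iff)
  moreover have "0 \<le> Re (cinner (dgo c u u x) x)"
   using sums_le[OF _ sums_zero sums_Re[OF s]] assms(4) by simp
  ultimately show ?thesis by blast
 qed
 then show ?thesis unfolding posop_def using dgo_clinop[OF o o assms(2)] by blast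
qed

section \<open>Dyadic levels\<close>

text \<open>Dyadic coordinates: every index is k = 2^n - 1 + i with i < 2^n, where n =
  \<open>lev k\<close> and i = \<open>off k\<close>. These are the blocks on which
  \<open>Dmap\<close> is constant.\<close>

definition lev :: "nat \<Rightarrow> nat" where "lev k = (LEAST n. k + 1 < 2 ^ (n + 1))"
definition off :: "nat \<Rightarrow> nat" where "off k = k + 1 - 2 ^ lev k"
definition mk :: "nat \<Rightarrow> nat \<Rightarrow> nat" where "mk n i = 2 ^ n - 1 + i"

lemma lev_bounds: "2 ^ lev k \<le> k + 1" "k + 1 < 2 ^ (lev k + 1)"
proof -
 have "k + 1 < 2 ^ (k + 1)" by (rule less_exp)
 then show 2: "k + 1 < 2 ^ (lev k + 1)" unfolding lev_def by (rule LeastI)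
 show "2 ^ lev k \<le> k + 1"
 proof (cases "lev k")
  case (Suc m)
  then have "\<not> k + 1 < 2 ^ (m + 1)" unfolding lev_def using not_less_Least[of m "\<lambda>n. k + 1 < 2 ^ (n + 1)"] by simp
  then show ?thesis using Suc by simp
 qed simp
qed

lemma lev_eqI: assumes "2 ^ n \<le> k + 1" "k + 1 < 2 ^ (n + 1)" shows "lev k = n"
proof (rule antisym)
 show "lev k \<le> n" unfolding lev_def by (rule Least_le) (rule assms(2))
 have "(2::nat) ^ n < 2 ^ (lev k + 1)" using assms(1) lev_bounds(2)[of k] by linarith
 then have "n < lev k + 1" by (rule power_less_imp_less_exp[rotated]) simp
 then show "n \<le> lev k" by simp
qed

lemma lev_mk [simp]: "i < 2 ^ n \<Longrightarrow> lev (mk n i) = n"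
proof (rule lev_eqI)
 have p: "(2::nat) ^ n \<ge> 1" by simp
 show "2 ^ n \<le> mk n i + 1" using p unfolding mk_def by linarith
 assume "i < 2 ^ n" then show "mk n i + 1 < 2 ^ (n + 1)" using p unfolding mk_def power_add power_one_right by linarith
qed

lemma off_mk [simp]: "i < 2 ^ n \<Longrightarrow> off (mk n i) = i"
 using lev_mk[of i n] by (simp add: off_def mk_def)

lemma mk_lev_off [simp]: "mk (lev k) (off k) = k"
 using lev_bounds(1)[of k] by (simp add: mk_def off_def)

lemma off_less [simp]: "off k < 2 ^ lev k"
 using lev_bounds[of k] unfolding off_def power_add power_one_right by linarith

lemma mk_cases: obtains n i where "i < 2 ^ n" "k = mk n i"
 using that[of "off k" "lev k"] by simp

lemma lev_real: "real k + 1 \<le> 2 * 2 ^ lev k" "2 ^ lev k \<le> real k + 1"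
proof -
 have "real (k + 1) \<le> real (2 ^ (lev k + 1))" using lev_bounds(2)[of k] by (intro of_nat_mono) simp
 then show "real k + 1 \<le> 2 * 2 ^ lev k" by simp
 have "real (2 ^ lev k) \<le> real (k + 1)" using lev_bounds(1)[of k] by (intro of_nat_mono)
 then show "2 ^ lev k \<le> real k + 1" by simp
qed

definition lvperm :: "(nat \<Rightarrow> nat \<Rightarrow> nat) \<Rightarrow> nat \<Rightarrow> nat" where
 "lvperm q k = mk (lev k) (q (lev k) (off k))"

lemma lvperm_mk: "i < 2 ^ n \<Longrightarrow> lvperm q (mk n i) = mk n (q n i)"
 by (simp add: lvperm_def)

lemma bij_lvperm:
 assumes q: "\<And>n. bij_betw (q n) {..<2 ^ n} {..<2 ^ n}"
 shows "bij (lvperm q)"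
proof -
 have q1: "q n i < 2 ^ n" if "i < 2 ^ n" for n i using bij_betwE[OF q[of n]] that by auto
 define r where "r = (\<lambda>n. inv_into {..<2 ^ n} (q n))"
 have r1: "r n i < 2 ^ n" if "i < 2 ^ n" for n i
  using bij_betwE[OF bij_betw_inv_into[OF q[of n]]] that by (auto simp: r_def)
 have rq: "r n (q n i) = i" if "i < 2 ^ n" for n i
  using bij_betw_inv_into_left[OF q[of n], of i] that by (simp add: r_def)
 have qr: "q n (r n i) = i" if "i < 2 ^ n" for n i
  using bij_betw_inv_into_right[OF q[of n], of i] that by (simp add: r_def)
 show ?thesis
 proof (rule o_bij[of "lvperm r"])
  show "lvperm r \<circ> lvperm q = id"
  proof
   fix k show "(lvperm r \<circ> lvperm q) k = id k"
    by (rule mk_cases[of k]) (simp add: lvperm_mk q1 rq)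
  qed
  show "lvperm q \<circ> lvperm r = id"
  proof
   fix k show "(lvperm q \<circ> lvperm r) k = id k"
    by (rule mk_cases[of k]) (simp add: lvperm_mk r1 qr)
  qed
 qed
qed

lemma lev_lvperm:
 assumes q: "\<And>n. bij_betw (q n) {..<2 ^ n} {..<2 ^ n}"
 shows "lev (lvperm q k) = lev k"
 using bij_betwE[OF q[of "lev k"]] by (simp add: lvperm_def)

text \<open>Greedy choice: while the running sum is positive take a nonpositive term, otherwise a
  nonnegative one. Such a term exists because what is left sums to \<open>- s\<close>, and opposite
  signs keep the new sum within \<open>M\<close>. This is the one-dimensional Steinitz
  lemma.\<close>

lemma bounded_rearrangement:
 fixes x :: "nat \<Rightarrow> real"
 assumes "finite I" "\<And>i. i \<in> I \<Longrightarrow> \<bar>x i\<bar> \<le> M" "\<bar>s\<bar> \<le> M" "s + sum x I = 0"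
 shows "\<exists>p. bij_betw p {..<card I} I \<and> (\<forall>l\<le>card I. \<bar>s + (\<Sum>j<l. x (p j))\<bar> \<le> M)"
 using assms
proof (induction "card I" arbitrary: I s)
 case 0
 then show ?case by (auto simp: bij_betw_def)
next
 case (Suc c)
 have "I \<noteq> {}" using Suc.hyps(2) by auto
 have "\<exists>i\<in>I. \<bar>s + x i\<bar> \<le> M"
 proof (cases "s > 0")
  case True
  have "\<exists>i\<in>I. x i \<le> 0"
  proof (rule ccontr)
   assume "\<not> ?thesis" then have "sum x I \<ge> 0" by (intro sum_nonneg) auto
   then show False using True Suc.prems(4) by simp
  qed
  then obtain i where "i \<in> I" "x i \<le> 0" by blast
  then show ?thesis using True Suc.prems(2)[of i] Suc.prems(3) by (intro bexI[of _ i]) auto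
 next
  case False
  have "\<exists>i\<in>I. x i \<ge> 0"
  proof (rule ccontr)
   assume neg: "\<not> ?thesis"
   have "sum x I < (\<Sum>i\<in>I. 0)"
    by (rule sum_strict_mono) (use neg \<open>I \<noteq> {}\<close> Suc.prems(1) in \<open>auto simp: not_le\<close>)
   then show False using False Suc.prems(4) by simp
  qed
  then obtain i where "i \<in> I" "x i \<ge> 0" by blast
  then show ?thesis using False Suc.prems(2)[of i] Suc.prems(3) by (intro bexI[of _ i]) auto
 qed
 then obtain i where i: "i \<in> I" "\<bar>s + x i\<bar> \<le> M" by blast
 have c: "c = card (I - {i})" using Suc.hyps(2) i(1) Suc.prems(1) by simp
 have s0: "s + x i + sum x (I - {i}) = 0" using Suc.prems(1,4) i(1) by (simp add: sum.remove)
 obtain p where p: "bij_betw p {..<c} (I - {i})" "\<forall>l\<le>c. \<bar>s + x i + (\<Sum>j<l. x (p j))\<bar> \<le> M"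
  using Suc.hyps(1)[OF c _ _ i(2) s0] Suc.prems(1,2) c by auto
 \<comment> \<open>The chosen index \<open>i\<close> comes first, then the enumeration given by the
   induction.\<close>
 define p' where "p' = (\<lambda>j. if j = 0 then i else p (j - 1))"
 have sh: "(\<Sum>j<Suc l. x (p' j)) = x i + (\<Sum>j<l. x (p j))" for l
  by (simp add: sum.lessThan_Suc_shift p'_def del: sum.lessThan_Suc)
 have "bij_betw p' (insert 0 (Suc ` {..<c})) (insert i (I - {i}))"
 proof (rule bij_betw_combine[of p' "{0}" "{i}", simplified])
  show "bij_betw p' (Suc ` {..<c}) (I - {i})"
  proof -
   have "bij_betw (\<lambda>j. j - 1) (Suc ` {..<c}) {..<c}" by (rule bij_betw_byWitness[where f' = Suc]) auto
   then have "bij_betw (p \<circ> (\<lambda>j. j - 1)) (Suc ` {..<c}) (I - {i})" using p(1) by (rule bij_betw_trans)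
   then show ?thesis by (rule bij_betw_cong[THEN iffD1, rotated]) (auto simp: p'_def)
  qed
 qed (auto simp: bij_betw_def p'_def)
 moreover have "insert 0 (Suc ` {..<c}) = {..<Suc c}" by (auto simp: image_iff less_Suc_eq_0_disj)
 ultimately have "bij_betw p' {..<Suc c} I" using i(1) by (simp add: insert_absorb)
 moreover have "\<bar>s + (\<Sum>j<l. x (p' j))\<bar> \<le> M" if "l \<le> Suc c" for l
 proof (cases l)
  case 0 then show ?thesis using Suc.prems(3) by simp
 next
  case (Suc m) then show ?thesis using p(2) that sh[of m] by (simp add: add.assoc)
 qed
 ultimately show ?case using Suc.hyps(2) by (metis)
qed

section \<open>Positive normalised traces on diagonal operators\<close>

text \<open>A positive normalised trace transported to operators on the Hilbert space itself.
  Normalisation is asked of the harmonic diagonal along each orthonormal sequence; by the spectral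
  theorem these are the positive operators with singular values 1/(n+1).\<close>

definition ptrace :: "(('a::chilbert \<Rightarrow> 'a) \<Rightarrow> complex) \<Rightarrow> bool" where
 "ptrace t \<longleftrightarrow> (\<forall>A B a b. wk A \<and> wk B \<longrightarrow> t (\<lambda>x. a *C A x + b *C B x) = a * t A + b * t B) \<and>
   (\<forall>A U V. wk A \<and> unit_pair U V \<longrightarrow> t (\<lambda>x. U (A (V x))) = t A) \<and>
   (\<forall>A. wk A \<and> posop A \<longrightarrow> Im (t A) = 0 \<and> 0 \<le> Re (t A)) \<and>
   (\<forall>u. ons u \<longrightarrow> t (dgo (\<lambda>i. cor (1 / (real i + 1))) u u) = 1)"

text \<open>The order O(1/(k+1)) in a block-constant form, visibly invariant under permutations
  inside the dyadic blocks.\<close>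

definition lvb :: "(nat \<Rightarrow> complex) \<Rightarrow> bool" where
 "lvb x \<longleftrightarrow> (\<exists>C. \<forall>k. cmod (x k) \<le> C / 2 ^ lev k)"

text \<open>The map D of the statement without its factor log 2.\<close>

definition dm :: "(nat \<Rightarrow> complex) \<Rightarrow> nat \<Rightarrow> complex" where
 "dm x k = x (lev k) / 2 ^ lev k"

lemma lvb_bound: assumes "lvb x" obtains C where "\<forall>k. cmod (x k) \<le> C / (real k + 1)"
proof -
 obtain C where C: "\<And>k. cmod (x k) \<le> C / 2 ^ lev k" using assms by (auto simp: lvb_def)
 have "0 \<le> C / 2 ^ lev 0" using C[of 0] norm_ge_zero order_trans by blast
 then have "0 \<le> C / 2 ^ lev 0 * 2 ^ lev 0" by (intro mult_nonneg_nonneg) auto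
 then have C0: "0 \<le> C" by simp
 have "cmod (x k) \<le> 2 * C / (real k + 1)" for k
 proof -
  have "C / 2 ^ lev k \<le> 2 * C / (real k + 1)"
   using mult_left_mono[OF lev_real(1)[of k] C0] by (simp add: field_simps)
  then show ?thesis using C[of k] by linarith
 qed
 then show ?thesis using that by blast
qed

lemma lvbI: assumes "\<And>k. cmod (x k) \<le> C / (real k + 1)" shows "lvb x"
proof -
 have "0 \<le> C / (real 0 + 1)" using assms[of 0] norm_ge_zero order_trans by blast
 then have C0: "0 \<le> C" by simp
 have "cmod (x k) \<le> C / 2 ^ lev k" for k
  by (rule order_trans[OF assms]) (use C0 lev_real(2)[of k] in \<open>intro divide_left_mono, auto\<close>)
 then show ?thesis unfolding lvb_def by blast
qed

lemma lvb_lin: assumes "lvb x" "lvb y" shows "lvb (\<lambda>k. a * x k + b * y k)"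
proof -
 obtain C where C: "\<And>k. cmod (x k) \<le> C / 2 ^ lev k" using assms by (auto simp: lvb_def)
 obtain D where D: "\<And>k. cmod (y k) \<le> D / 2 ^ lev k" using assms by (auto simp: lvb_def)
 have "cmod (a * x k + b * y k) \<le> (cmod a * C + cmod b * D) / 2 ^ lev k" for k
  using norm_triangle_ineq[of "a * x k" "b * y k"] mult_left_mono[OF C[of k], of "cmod a"] mult_left_mono[OF D[of k], of "cmod b"]
  by (simp add: norm_mult add_divide_distrib)
 then show ?thesis unfolding lvb_def by blast
qed

lemma lvb_mono: assumes "lvb y" "\<And>k. cmod (x k) \<le> cmod (y k)" shows "lvb x"
 using assms unfolding lvb_def by (meson order_trans)

lemma lvb_lvperm:
 assumes "lvb x" "\<And>n. bij_betw (q n) {..<2 ^ n} {..<2 ^ n}" shows "lvb (\<lambda>k. x (lvperm q k))"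
proof -
 obtain C where C: "\<And>k. cmod (x k) \<le> C / 2 ^ lev k" using assms by (auto simp: lvb_def)
 have "cmod (x (lvperm q k)) \<le> C / 2 ^ lev k" for k using C[of "lvperm q k"] lev_lvperm[OF assms(2)] by simp
 then show ?thesis unfolding lvb_def by blast
qed

lemma lvb_dm: assumes "Bseq x" shows "lvb (dm x)"
proof -
 obtain K where "\<And>n. cmod (x n) \<le> K" using assms by (meson BseqE)
 then show ?thesis unfolding lvb_def dm_def by (intro exI[of _ K] allI) (simp add: norm_divide norm_power divide_right_mono)
qed

lemma dm_lin: "dm (\<lambda>n. a * x n + b * y n) = (\<lambda>k. a * dm x k + b * dm y k)"
 by (simp add: dm_def add_divide_distrib fun_eq_iff)

lemma lvb_Bseq: "lvb x \<Longrightarrow> Bseq x"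
 using lvb_bound inverse_bound_Bseq by metis

lemma lvb_wk: assumes "osys f" "osys g" "lvb x" shows "wk (dgo x f g)"
proof -
 obtain C where "\<forall>k. cmod (x k) \<le> C / (real k + 1)" using lvb_bound[OF assms(3)] by blast
 then show ?thesis using dgo_wk[OF assms(1,2)] by blast
qed

definition rshift :: "(nat \<Rightarrow> 'b::zero) \<Rightarrow> nat \<Rightarrow> 'b" where
 "rshift z n = (if n = 0 then 0 else z (n - 1))"

locale trace_onb =
 fixes t :: "('a::chilbert \<Rightarrow> 'a) \<Rightarrow> complex" and e :: "nat \<Rightarrow> 'a"
 assumes t: "ptrace t" and e: "is_onb e"
begin

lemma oe: "osys e" "ons e" using e by (auto simp: is_onb_ons ons_osys)

lemma t_lin: "wk A \<Longrightarrow> wk B \<Longrightarrow> t (\<lambda>x. a *C A x + b *C B x) = a * t A + b * t B"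
 and t_unit: "wk A \<Longrightarrow> unit_pair U V \<Longrightarrow> t (\<lambda>x. U (A (V x))) = t A"
 using t unfolding ptrace_def by blast+

definition phi :: "(nat \<Rightarrow> complex) \<Rightarrow> complex" where "phi x = t (dgo x e e)"

lemma phi_lin: assumes "lvb x" "lvb y" shows "phi (\<lambda>k. a * x k + b * y k) = a * phi x + b * phi y"
proof -
 have "dgo (\<lambda>k. a * x k + b * y k) e e = (\<lambda>v. a *C dgo x e e v + b *C dgo y e e v)"
  by (rule ext) (rule dgo_lin[OF oe(1) oe(1) lvb_Bseq[OF assms(1)] lvb_Bseq[OF assms(2)]])
 then show ?thesis unfolding phi_def using t_lin[OF lvb_wk[OF oe(1) oe(1) assms(1)] lvb_wk[OF oe(1) oe(1) assms(2)]] by simp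
qed

lemma phi_add: "lvb x \<Longrightarrow> lvb y \<Longrightarrow> phi (\<lambda>k. x k + y k) = phi x + phi y"
 using phi_lin[of x y 1 1] by simp

lemma phi_diff: "lvb x \<Longrightarrow> lvb y \<Longrightarrow> phi (\<lambda>k. x k - y k) = phi x - phi y"
 using phi_lin[of x y 1 "-1"] by simp

text \<open>Permuting the coefficients is conjugation with the unitary that permutes the
  basis.\<close>

lemma phi_perm:
 assumes "lvb x" "bij \<pi>" "lvb (\<lambda>k. x (\<pi> k))" shows "phi (\<lambda>k. x (\<pi> k)) = phi x"
proof -
 define f where "f = (\<lambda>j. e (inv \<pi> j))"
 have inj: "inv \<pi> (\<pi> k) = k" "\<pi> (inv \<pi> k) = k" for k using assms(2) by (auto simp: bij_def surj_f_inv_f)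
 have f: "ons f" using oe(2) inj unfolding f_def ons_def by (metis)
 have "is_onb f" unfolding is_onb_def
 proof (intro conjI f allI impI)
  fix x assume x: "\<forall>k. cinner x (f k) = 0"
  have "cinner x (e k) = 0" for k using x[rule_format, of "\<pi> k"] by (simp add: f_def inj)
  then show "x = 0" using e unfolding is_onb_def by blast
 qed
 then obtain U V where U: "unit_pair U V" "\<forall>k. U (e k) = f k" using onb_unitary[OF e] by blast
 have "dgo (\<lambda>k. x (\<pi> k)) e e = (\<lambda>v. U (dgo x e e (V v)))"
 proof
  fix v
  have "U (dgo x e e (V v)) = dgo x f f v"
   using dgo_unitary[OF U(1) oe(1) oe(1) lvb_Bseq[OF assms(1)]] U(2) by simp
  also have "\<dots> = dgo (\<lambda>k. x (\<pi> k)) e e v"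
  proof (rule clinop_eq_onb[OF e dgo_clinop[OF ons_osys[OF f] ons_osys[OF f] lvb_Bseq[OF assms(1)]] dgo_clinop[OF oe(1) oe(1) lvb_Bseq[OF assms(3)]]])
   fix k
   have "dgo x f f (f (\<pi> k)) = x (\<pi> k) *C f (\<pi> k)" by (rule dgo_ons[OF f ons_osys[OF f] lvb_Bseq[OF assms(1)]])
   then show "dgo x f f (e k) = dgo (\<lambda>k. x (\<pi> k)) e e (e k)"
    using dgo_ons[OF oe(2) oe(1) lvb_Bseq[OF assms(3)], of k] by (simp add: f_def inj)
  qed
  finally show "dgo (\<lambda>k. x (\<pi> k)) e e v = U (dgo x e e (V v))" by simp
 qed
 then show ?thesis unfolding phi_def using t_unit[OF lvb_wk[OF oe(1) oe(1) assms(1)] U(1)] by simp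
qed

text \<open>After the rearrangement \<open>p\<close> the block partial sums \<open>S\<close> are as
  small as the entries, hence still \<open>lvb\<close>, and the rearranged sequence is a cyclic
  shift of \<open>S\<close> within each block minus \<open>S\<close>. Both have the same trace by
  \<open>phi_perm\<close>.\<close>

lemma phi_mean_zero:
 fixes x :: "nat \<Rightarrow> real"
 assumes x: "\<And>k. \<bar>x k\<bar> \<le> C / 2 ^ lev k" and z: "\<And>n. (\<Sum>i<2 ^ n. x (mk n i)) = 0"
 shows "phi (\<lambda>k. cor (x k)) = 0"
proof -
 have "0 \<le> C / 2 ^ lev 0" using x[of 0] abs_ge_zero order_trans by blast
 then have "0 \<le> C / 2 ^ lev 0 * 2 ^ lev 0" by (intro mult_nonneg_nonneg) auto
 then have C0: "0 \<le> C" by simp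
 have "\<exists>p. bij_betw p {..<(2::nat) ^ n} {..<(2::nat) ^ n} \<and> (\<forall>l\<le>(2::nat) ^ n. \<bar>\<Sum>j<l. x (mk n (p j))\<bar> \<le> C / 2 ^ n)" for n :: nat
 proof -
  have "\<exists>p. bij_betw p {..<card {..<(2::nat) ^ n}} {..<(2::nat) ^ n} \<and>
    (\<forall>l\<le>card {..<(2::nat) ^ n}. \<bar>0 + (\<Sum>j<l. x (mk n (p j)))\<bar> \<le> C / 2 ^ n)"
  proof (rule bounded_rearrangement)
   show "\<bar>x (mk n i)\<bar> \<le> C / 2 ^ n" if "i \<in> {..<2 ^ n}" for i using x[of "mk n i"] that by simp
  qed (use z C0 in auto)
  then show ?thesis by simp
 qed
 then have "\<forall>n. \<exists>p. bij_betw p {..<(2::nat) ^ n} {..<(2::nat) ^ n} \<and> (\<forall>l\<le>(2::nat) ^ n. \<bar>\<Sum>j<l. x (mk n (p j))\<bar> \<le> C / 2 ^ n)"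
  by blast
 from choice[OF this] obtain p where
  pp: "\<forall>n. bij_betw (p n) {..<(2::nat) ^ n} {..<(2::nat) ^ n} \<and> (\<forall>l\<le>(2::nat) ^ n. \<bar>\<Sum>j<l. x (mk n (p n j))\<bar> \<le> C / 2 ^ n)"
  by blast
 have p: "bij_betw (p n) {..<2 ^ n} {..<2 ^ n}" "l \<le> 2 ^ n \<Longrightarrow> \<bar>\<Sum>j<l. x (mk n (p n j))\<bar> \<le> C / 2 ^ n" for n l
  using pp by blast+
 define y where "y = (\<lambda>k. x (lvperm p k))"
 define S where "S = (\<lambda>k. \<Sum>j<off k. y (mk (lev k) j))"
 \<comment> \<open>Cyclic successor in a block. The last position returns to 0, where
   \<open>S\<close> vanishes; the zero block sum is what makes the difference formula correct
   there.\<close>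
 define q where "q = (\<lambda>n i. if Suc i < 2 ^ n then Suc i else 0 :: nat)"
 have q: "bij_betw (q n) {..<2 ^ n} {..<2 ^ n}" for n
 proof -
  have "inj_on (q n) {..<2 ^ n}" by (auto simp: inj_on_def q_def split: if_splits)
  moreover have "q n ` {..<2 ^ n} \<subseteq> {..<2 ^ n}" by (auto simp: q_def)
  ultimately show ?thesis by (metis bij_betw_def endo_inj_surj finite_lessThan)
 qed
 have S_mk: "S (mk n i) = (\<Sum>j<i. x (mk n (p n j)))" if "i < 2 ^ n" for n i
  unfolding S_def y_def using that by (auto intro!: sum.cong simp: lvperm_mk)
 have Sb: "\<bar>S k\<bar> \<le> C / 2 ^ lev k" for k
  using S_mk[of "off k" "lev k"] p(2)[of "off k" "lev k"] off_less[of k] by simp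
 have yS: "y k = S (lvperm q k) - S k" for k
 proof (rule mk_cases[of k])
  fix n i assume i: "i < 2 ^ n" and k: "k = mk n i"
  have tot: "(\<Sum>j<2 ^ n. x (mk n (p n j))) = 0"
   using sum.reindex_bij_betw[OF p(1)[of n], of "\<lambda>i. x (mk n i)"] z[of n] by simp
  have yk: "y k = x (mk n (p n i))" by (simp add: y_def k lvperm_mk i)
  show ?thesis
  proof (cases "Suc i < 2 ^ n")
   case True
   then have "S (lvperm q k) = S (mk n (Suc i))" by (simp add: k lvperm_mk i q_def)
   then show ?thesis using True i by (simp add: S_mk k yk[unfolded k])
  next
   case False
   then have e: "2 ^ n = Suc i" using i by simp
   have "S (lvperm q k) = 0" using False by (simp add: k lvperm_mk i q_def S_mk)
   moreover have "S k + y k = 0" using tot unfolding e by (simp add: k S_mk i yk[unfolded k])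
   ultimately show ?thesis by simp
  qed
 qed
 have lx: "lvb (\<lambda>k. cor (x k))" unfolding lvb_def using x by (intro exI[of _ C]) simp
 have lS: "lvb (\<lambda>k. cor (S k))" unfolding lvb_def using Sb by (intro exI[of _ C]) simp
 have "phi (\<lambda>k. cor (x k)) = phi (\<lambda>k. cor (x (lvperm p k)))"
  by (rule phi_perm[OF lx bij_lvperm[OF p(1)] lvb_lvperm[OF lx p(1)], symmetric])
 also have "(\<lambda>k. cor (x (lvperm p k))) = (\<lambda>k. cor (S (lvperm q k)) - cor (S k))"
  using yS by (auto simp: y_def fun_eq_iff simp flip: of_real_diff)
 also have "phi \<dots> = phi (\<lambda>k. cor (S (lvperm q k))) - phi (\<lambda>k. cor (S k))"
  by (rule phi_diff[OF lvb_lvperm[OF lS q] lS])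
 also have "\<dots> = 0" using phi_perm[OF lS bij_lvperm[OF q] lvb_lvperm[OF lS q]] by simp
 finally show ?thesis .
qed

text \<open>Block \<open>n\<close> and either half of block \<open>n + 1\<close> have the same size
  2^n, so the values of \<open>dm z\<close> on block \<open>n\<close>, divided by two, can be
  carried there by a permutation. Restricting \<open>n\<close> to one parity keeps the exchanged
  pairs disjoint, which makes the map an involution.\<close>

lemma phi_shift_half:
 fixes z :: "nat \<Rightarrow> complex"
 assumes z: "Bseq z" and r: "r < 2" "\<And>n. n mod 2 \<noteq> r \<Longrightarrow> z n = 0" and b: "b \<le> (1::nat)"
 defines "w \<equiv> \<lambda>k. if lev k \<noteq> 0 \<and> b * 2 ^ (lev k - 1) \<le> off k \<and> off k < (b + 1) * 2 ^ (lev k - 1)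
   then z (lev k - 1) / 2 ^ lev k else 0"
 shows "phi w = phi (dm z) / 2" "lvb w"
proof -
 obtain K where K: "\<And>n. cmod (z n) \<le> K" using z by (meson BseqE)
 have "0 \<le> K" using K[of 0] norm_ge_zero order_trans by blast
 then have "cmod (w k) \<le> K / 2 ^ lev k" for k
  by (auto simp: w_def norm_divide norm_power K divide_right_mono)
 then show lw: "lvb w" unfolding lvb_def by blast
 \<comment> \<open>Exchanges block \<open>n\<close>, for n congruent to \<open>r\<close> modulo 2,
   with half \<open>b\<close> of block \<open>n + 1\<close>, and fixes everything else.\<close>
 define \<pi> where "\<pi> = (\<lambda>k. if lev k mod 2 = r then mk (lev k + 1) (b * 2 ^ lev k + off k)
   else if lev k \<noteq> 0 \<and> b * 2 ^ (lev k - 1) \<le> off k \<and> off k < (b + 1) * 2 ^ (lev k - 1)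
    then mk (lev k - 1) (off k - b * 2 ^ (lev k - 1)) else k)"
 have up: "b * 2 ^ n + i < 2 ^ (n + 1)" if "i < 2 ^ n" for n i :: nat
  using that b by (cases "b = 0") (auto simp: le_Suc_eq)
 have invol: "\<pi> (\<pi> k) = k" for k
 proof (rule mk_cases[of k])
  fix n i assume i: "i < 2 ^ n" and k: "k = mk n i"
  consider "n mod 2 = r" | "n mod 2 \<noteq> r" "n \<noteq> 0" "b * 2 ^ (n - 1) \<le> i" "i < (b + 1) * 2 ^ (n - 1)"
   | "n mod 2 \<noteq> r" "\<not> (n \<noteq> 0 \<and> b * 2 ^ (n - 1) \<le> i \<and> i < (b + 1) * 2 ^ (n - 1))" by blast
  then show ?thesis
  proof cases
   case 1
   have 2: "(n + 1) mod 2 \<noteq> r" using 1 by presburger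
   have "\<pi> k = mk (n + 1) (b * 2 ^ n + i)" using i 1 by (simp add: k \<pi>_def)
   moreover have "\<pi> (mk (n + 1) (b * 2 ^ n + i)) = mk n i"
    unfolding \<pi>_def lev_mk[OF up[OF i]] off_mk[OF up[OF i]] using 2 i by simp
   ultimately show ?thesis using k by simp
  next
   case 2
   obtain m where m: "n = Suc m" using 2(2) by (cases n) auto
   have r2: "m mod 2 = r" using 2(1) r(1) m by presburger
   have i2: "i - b * 2 ^ m < 2 ^ m" using 2(3,4) m by (simp add: algebra_simps)
   have "\<pi> k = mk m (i - b * 2 ^ m)" using i 2 m by (simp add: k \<pi>_def)
   moreover have "\<pi> (mk m (i - b * 2 ^ m)) = mk n i"
    unfolding \<pi>_def lev_mk[OF i2] off_mk[OF i2] using r2 2(3) m by simp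
   ultimately show ?thesis using k by simp
  next
   case 3
   then have "\<pi> k = k" using i by (auto simp: k \<pi>_def)
   then show ?thesis by simp
  qed
 qed
 then have bij: "bij \<pi>" by (intro o_bij[of \<pi>]) (auto simp: fun_eq_iff)
 have eq: "w (\<pi> k) = dm z k / 2" for k
 proof (rule mk_cases[of k])
  fix n i assume i: "i < 2 ^ n" and k: "k = mk n i"
  have d: "dm z k = z n / 2 ^ n" using i by (simp add: dm_def k)
  consider "n mod 2 = r" | "n mod 2 \<noteq> r" "n \<noteq> 0" "b * 2 ^ (n - 1) \<le> i" "i < (b + 1) * 2 ^ (n - 1)"
   | "n mod 2 \<noteq> r" "\<not> (n \<noteq> 0 \<and> b * 2 ^ (n - 1) \<le> i \<and> i < (b + 1) * 2 ^ (n - 1))" by blast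
  then show ?thesis
  proof cases
   case 1
   have "\<pi> k = mk (n + 1) (b * 2 ^ n + i)" using i 1 by (simp add: k \<pi>_def)
   moreover have "w (mk (n + 1) (b * 2 ^ n + i)) = z n / 2 ^ (n + 1)"
    unfolding w_def lev_mk[OF up[OF i]] off_mk[OF up[OF i]] using i by simp
   ultimately show ?thesis using d by simp
  next
   case 2
   obtain m where m: "n = Suc m" using 2(2) by (cases n) auto
   have i2: "i - b * 2 ^ m < 2 ^ m" using 2(3,4) m by (simp add: algebra_simps)
   have pk: "\<pi> k = mk m (i - b * 2 ^ m)" using i 2 m by (simp add: k \<pi>_def)
   have "z (m - 1) = 0 \<or> m = 0"
   proof (cases m)
    case (Suc l)
    have "l mod 2 \<noteq> r" using 2(1) m Suc by presburger
    then show ?thesis using r(2) Suc by simp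
   qed simp
   then have "w (mk m (i - b * 2 ^ m)) = 0" unfolding w_def lev_mk[OF i2] off_mk[OF i2] by auto
   then show ?thesis using d pk r(2)[OF 2(1)] by simp
  next
   case 3
   then have "\<pi> k = k" using i by (auto simp: k \<pi>_def)
   moreover have "w k = 0" using 3 i unfolding w_def k by auto
   ultimately show ?thesis using d r(2)[OF 3(1)] by simp
  qed
 qed
 have l: "lvb (dm z)" by (rule lvb_dm[OF z])
 have lh: "lvb (\<lambda>k. w (\<pi> k))" unfolding eq using lvb_lin[OF l l, of "1/2" 0] by simp
 have "phi w = phi (\<lambda>k. w (\<pi> k))" by (rule phi_perm[OF lw bij lh, symmetric])
 also have "\<dots> = phi (dm z) / 2" unfolding eq using phi_lin[OF l l, of "1/2" 0] by simp
 finally show "phi w = phi (dm z) / 2" .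
qed

text \<open>The two halves together fill block n + 1 with z_n / 2^(n+1), which is the shifted
  sequence, and each carries half of the trace.\<close>

lemma phi_shift_parity:
 fixes z :: "nat \<Rightarrow> complex"
 assumes z: "Bseq z" and r: "r < 2" "\<And>n. n mod 2 \<noteq> r \<Longrightarrow> z n = 0"
 shows "phi (dm (rshift z)) = phi (dm z)"
proof -
 define w where "w = (\<lambda>(b::nat) k. if lev k \<noteq> 0 \<and> b * 2 ^ (lev k - 1) \<le> off k \<and> off k < (b + 1) * 2 ^ (lev k - 1)
   then z (lev k - 1) / 2 ^ lev k else 0)"
 have w: "phi (w b) = phi (dm z) / 2" "lvb (w b)" if "b \<le> 1" for b
  using phi_shift_half[OF z r that] unfolding w_def by auto
 have "dm (rshift z) = (\<lambda>k. w 0 k + w 1 k)"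
 proof
  fix k show "dm (rshift z) k = w 0 k + w 1 k"
  proof (cases "lev k")
   case 0 then show ?thesis by (simp add: dm_def rshift_def w_def)
  next
   case (Suc m)
   then show ?thesis using off_less[of k] by (auto simp: dm_def rshift_def w_def)
  qed
 qed
 then have "phi (dm (rshift z)) = phi (w 0) + phi (w 1)" using phi_add[OF w(2)[of 0] w(2)[of 1]] by simp
 moreover have "phi (w 0) = phi (dm z) / 2" by (rule w(1)) simp
 moreover have "phi (w 1) = phi (dm z) / 2" by (rule w(1)) simp
 ultimately have "phi (dm (rshift z)) = phi (dm z) / 2 + phi (dm z) / 2" by (simp only:)
 then show ?thesis by simp
qed

lemma Bseq_restrict: "Bseq z \<Longrightarrow> Bseq (\<lambda>n. if P n then z n else (0::complex))"
 by (auto simp: Bseq_def)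

lemma phi_shift:
 fixes z :: "nat \<Rightarrow> complex"
 assumes z: "Bseq z" shows "phi (dm (rshift z)) = phi (dm z)"
proof -
 define y where "y = (\<lambda>r n. if n mod 2 = r then z n else 0)"
 have B: "Bseq (y r)" for r unfolding y_def by (rule Bseq_restrict[OF z])
 have Bs: "Bseq (rshift x)" if "Bseq x" for x :: "nat \<Rightarrow> complex"
  using that by (auto simp: Bseq_def rshift_def)
 have z1: "z = (\<lambda>n. y 0 n + y 1 n)" by (auto simp: y_def fun_eq_iff)
 have d1: "dm z = (\<lambda>k. dm (y 0) k + dm (y 1) k)" by (subst z1) (simp add: dm_def add_divide_distrib fun_eq_iff)
 have d2: "dm (rshift z) = (\<lambda>k. dm (rshift (y 0)) k + dm (rshift (y 1)) k)"
  by (subst z1) (simp add: dm_def rshift_def add_divide_distrib fun_eq_iff)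
 have "phi (dm (rshift (y r))) = phi (dm (y r))" if "r < 2" for r
  by (rule phi_shift_parity[OF B that]) (simp add: y_def)
 then show ?thesis unfolding d1 d2
  by (simp add: phi_add[OF lvb_dm[OF B] lvb_dm[OF B]] phi_add[OF lvb_dm[OF Bs[OF B]] lvb_dm[OF Bs[OF B]]])
qed

text \<open>Increments of a bounded sequence have the form \<open>z\<close> minus
  \<open>rshift z\<close>, and shift invariance removes them. This is why a bounded ambiguity in
  dyadic traces is harmless.\<close>

lemma phi_increment_bounded:
 assumes "Bseq s" shows "phi (dm (\<lambda>n. s (Suc n) - s n)) = 0"
proof -
 \<comment> \<open>Subtracting \<open>s 0\<close> makes the identity hold at index 0 too, where the
   shift inserts a zero.\<close>
 define z where "z = (\<lambda>n. s (Suc n) - s 0)"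
 obtain K where K: "\<And>n. cmod (s n) \<le> K" using assms by (meson BseqE)
 have "cmod (z n) \<le> K + K" for n
  unfolding z_def using norm_triangle_ineq4[of "s (Suc n)" "s 0"] K[of "Suc n"] K[of 0] by linarith
 then have Bz: "Bseq z" by (rule BseqI')
 have "cmod (rshift z n) \<le> K + K" for n
  using norm_triangle_ineq4[of "s n" "s 0"] K[of n] K[of 0] order_trans[OF norm_ge_zero K[of 0]]
  by (cases n) (auto simp: rshift_def z_def)
 then have Bsz: "Bseq (rshift z)" by (rule BseqI')
 have "dm (\<lambda>n. s (Suc n) - s n) = (\<lambda>k. dm z k - dm (rshift z) k)"
 proof
  fix k
  have "s (Suc n) - s n = z n - rshift z n" for n by (cases n) (auto simp: z_def rshift_def)
  then show "dm (\<lambda>n. s (Suc n) - s n) k = dm z k - dm (rshift z) k" by (simp add: dm_def diff_divide_distrib)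
 qed
 then show ?thesis using phi_diff[OF lvb_dm[OF Bz] lvb_dm[OF Bsz]] phi_shift[OF Bz] by simp
qed

lemma sum_level: "(\<Sum>i<2 ^ Suc n - 1. f i) - (\<Sum>i<2 ^ n - 1. f i) = (\<Sum>i<2 ^ n. f (mk n i))" for f :: "nat \<Rightarrow> 'b::ab_group_add"
proof -
 have p: "(1::nat) \<le> 2 ^ n" by simp
 then have "(2::nat) ^ Suc n - 1 = (2 ^ n - 1) + 2 ^ n" by simp
 then have "(\<Sum>i<2 ^ Suc n - 1. f i) = (\<Sum>i<2 ^ n - 1. f i) + (\<Sum>i=2 ^ n - 1..<(2 ^ n - 1) + 2 ^ n. f i)"
  by (simp only: lessThan_atLeast0) (rule sum.atLeastLessThan_concat[symmetric], simp_all)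
 moreover have "(\<Sum>i=2 ^ n - 1..<(2 ^ n - 1) + 2 ^ n. f i) = (\<Sum>i<2 ^ n. f (mk n i))"
  using sum.shift_bounds_nat_ivl[of f 0 "2 ^ n - 1" "2 ^ n"] by (simp add: lessThan_atLeast0 mk_def add.commute)
 ultimately show ?thesis by simp
qed

text \<open>Subtracting the block means leaves a sequence covered by \<open>phi_mean_zero\<close>;
  the sum over block \<open>n\<close> is exactly an increment of the partial sums cut at 2^n -
  1.\<close>

lemma phi_average:
 fixes l :: "nat \<Rightarrow> real"
 assumes "\<And>k. \<bar>l k\<bar> \<le> C / (real k + 1)"
 defines "s \<equiv> \<lambda>n. cor (\<Sum>i<2 ^ n - 1. l i)"
 shows "phi (\<lambda>k. cor (l k)) = phi (dm (\<lambda>n. s (Suc n) - s n))" "Bseq (\<lambda>n. s (Suc n) - s n)"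
proof -
 define a where "a = (\<lambda>n. \<Sum>i<2 ^ n. l (mk n i))"
 have sa: "s (Suc n) - s n = cor (a n)" for n
  unfolding s_def a_def by (simp only: of_real_diff[symmetric] sum_level)
 have ll: "lvb (\<lambda>k. cor (l k))" by (rule lvbI[of _ C]) (simp add: assms)
 then obtain D where D: "\<And>k. \<bar>l k\<bar> \<le> D / 2 ^ lev k" by (auto simp: lvb_def)
 have ab: "\<bar>a n\<bar> \<le> D" for n
 proof -
  have "\<bar>a n\<bar> \<le> (\<Sum>i<(2::nat) ^ n. D / 2 ^ n)"
   unfolding a_def by (rule order_trans[OF sum_abs sum_mono]) (use D in \<open>metis lessThan_iff lev_mk\<close>)
  then show ?thesis by simp
 qed
 then show B: "Bseq (\<lambda>n. s (Suc n) - s n)" unfolding sa by (intro BseqI'[of _ D]) simp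
 define x where "x = (\<lambda>k. l k - a (lev k) / 2 ^ lev k)"
 have 0: "phi (\<lambda>k. cor (x k)) = 0"
 proof (rule phi_mean_zero[of x "D + D"])
  fix k
  have "\<bar>a (lev k) / 2 ^ lev k\<bar> \<le> D / 2 ^ lev k" using ab[of "lev k"] by (simp add: divide_right_mono)
  then show "\<bar>x k\<bar> \<le> (D + D) / 2 ^ lev k" unfolding x_def add_divide_distrib using D[of k] by linarith
 next
  fix n
  have "(\<Sum>i<2 ^ n. x (mk n i)) = (\<Sum>i<2 ^ n. l (mk n i) - a n / 2 ^ n)"
   by (intro sum.cong) (auto simp: x_def)
  also have "\<dots> = 0" by (simp add: sum_subtractf a_def)
  finally show "(\<Sum>i<2 ^ n. x (mk n i)) = 0" .
 qed
 have "(\<lambda>k. cor (l k)) = (\<lambda>k. cor (x k) + dm (\<lambda>n. s (Suc n) - s n) k)"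
  unfolding sa by (simp add: x_def dm_def fun_eq_iff)
 moreover have "lvb (\<lambda>k. cor (x k))"
 proof -
  have "(\<lambda>k. cor (x k)) = (\<lambda>k. 1 * cor (l k) + (-1) * dm (\<lambda>n. s (Suc n) - s n) k)"
   unfolding sa by (simp add: x_def dm_def fun_eq_iff)
  then show ?thesis using lvb_lin[OF ll lvb_dm[OF B], of 1 "-1"] by simp
 qed
 ultimately show "phi (\<lambda>k. cor (l k)) = phi (dm (\<lambda>n. s (Suc n) - s n))"
  using phi_add[OF _ lvb_dm[OF B], of "\<lambda>k. cor (x k)"] 0 by simp
qed

section \<open>Reduction of arbitrary operators to diagonals in the fixed basis\<close>

lemma onb_comp_bij:
 assumes "is_onb c" "bij \<sigma>" shows "is_onb (\<lambda>i. c (\<sigma> i))"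
 unfolding is_onb_def
proof (intro conjI allI impI)
 show "ons (\<lambda>i. c (\<sigma> i))" using is_onb_ons[OF assms(1)] assms(2) by (auto simp: ons_def bij_def inj_def)
 fix x assume x: "\<forall>k. cinner x (c (\<sigma> k)) = 0"
 have "cinner x (c k) = 0" for k
  using x[rule_format, of "inv \<sigma> k"] assms(2) by (simp add: bij_def surj_f_inv_f)
 then show "x = 0" using assms(1) unfolding is_onb_def by blast
qed

text \<open>\<open>u\<close> need not be a basis, so there may be no unitary carrying it to
  \<open>e\<close>. When the odd coefficients vanish the odd vectors can be replaced, and
  \<open>onb_extend_even\<close> makes the system a basis.\<close>

lemma trace_even:
 assumes "ons u" "lvb c" "\<And>i. odd i \<Longrightarrow> c i = 0"
 shows "t (dgo c u u) = phi c"
proof -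
 obtain b where b: "is_onb b" "\<forall>i. b (2 * i) = u (2 * i)" by (rule onb_extend_even[OF e assms(1)])
 have ob: "osys b" using b(1) by (simp add: is_onb_ons ons_osys)
 obtain U V where U: "unit_pair U V" "\<forall>k. U (b k) = e k" by (rule onb_unitary[OF b(1) e])
 have "(c i * cinner x (u i)) *C u i = (c i * cinner x (b i)) *C b i" for i x
  using assms(3)[of i] b(2) by (cases "even i") auto
 then have eq: "dgo c u u = dgo c b b" by (simp add: dgo_def fun_eq_iff)
 have "(\<lambda>x. U (dgo c b b (V x))) = dgo c e e"
  by (rule ext) (simp add: dgo_unitary[OF U(1) ob ob lvb_Bseq[OF assms(2)]] U(2))
 then show ?thesis unfolding eq phi_def using t_unit[OF lvb_wk[OF ob ob assms(2)] U(1)] by simp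
qed

text \<open>The swap of 2j and 2j + 1 moves the odd half to the even places, where it is completed
  to a basis, and is then undone.\<close>

lemma trace_odd:
 assumes "ons u" "lvb c" "\<And>i. even i \<Longrightarrow> c i = 0"
 shows "t (dgo c u u) = phi c"
proof -
 define \<sigma> where "\<sigma> = (\<lambda>i::nat. if even i then i + 1 else i - 1)"
 have ss: "\<sigma> (\<sigma> i) = i" for i by (auto simp: \<sigma>_def)
 then have bij: "bij \<sigma>" by (intro o_bij[of \<sigma>]) (auto simp: fun_eq_iff)
 have "ons (\<lambda>i. u (\<sigma> i))" using assms(1) bij by (auto simp: ons_def bij_def inj_def)
 then obtain b0 where b0: "is_onb b0" "\<forall>i. b0 (2 * i) = u (\<sigma> (2 * i))" by (rule onb_extend_even[OF e])
 define b where "b = (\<lambda>i. b0 (\<sigma> i))"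
 have b: "is_onb b" unfolding b_def by (rule onb_comp_bij[OF b0(1) bij])
 have bu: "b i = u i" if "odd i" for i
 proof -
  have "even (\<sigma> i)" using that by (simp add: \<sigma>_def)
  then obtain j where "\<sigma> i = 2 * j" by blast
  then show ?thesis using b0(2) ss[of i] by (metis b_def)
 qed
 have ob: "osys b" using b by (simp add: is_onb_ons ons_osys)
 obtain U V where U: "unit_pair U V" "\<forall>k. U (b k) = e k" by (rule onb_unitary[OF b e])
 have "(c i * cinner x (u i)) *C u i = (c i * cinner x (b i)) *C b i" for i x
  using assms(3)[of i] bu[of i] by (cases "even i") auto
 then have eq: "dgo c u u = dgo c b b" by (simp add: dgo_def fun_eq_iff)
 have "(\<lambda>x. U (dgo c b b (V x))) = dgo c e e"
  by (rule ext) (simp add: dgo_unitary[OF U(1) ob ob lvb_Bseq[OF assms(2)]] U(2))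
 then show ?thesis unfolding eq phi_def using t_unit[OF lvb_wk[OF ob ob assms(2)] U(1)] by simp
qed

lemma trace_diag:
 assumes "ons u" "lvb c" shows "t (dgo c u u) = phi c"
proof -
 define c0 where "c0 = (\<lambda>i. if even i then c i else 0)"
 define c1 where "c1 = (\<lambda>i. if odd i then c i else 0)"
 have l0: "lvb c0" and l1: "lvb c1" by (auto intro!: lvb_mono[OF assms(2)] simp: c0_def c1_def)
 have c: "c = (\<lambda>i. 1 * c0 i + 1 * c1 i)" by (auto simp: c0_def c1_def fun_eq_iff)
 have ou: "osys u" by (rule ons_osys[OF assms(1)])
 have "dgo c u u = (\<lambda>x. 1 *C dgo c0 u u x + 1 *C dgo c1 u u x)"
  by (rule ext) (subst c, rule dgo_lin[OF ou ou lvb_Bseq[OF l0] lvb_Bseq[OF l1]])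
 then have "t (dgo c u u) = t (dgo c0 u u) + t (dgo c1 u u)"
  using t_lin[OF lvb_wk[OF ou ou l0] lvb_wk[OF ou ou l1], of 1 1] by simp
 also have "t (dgo c0 u u) = phi c0" by (rule trace_even[OF assms(1) l0]) (simp add: c0_def)
 also have "t (dgo c1 u u) = phi c1" by (rule trace_odd[OF assms(1) l1]) (simp add: c1_def)
 finally show ?thesis using phi_lin[OF l0 l1, of 1 1] c by simp
qed

definition tseq :: "(nat \<Rightarrow> complex) \<Rightarrow> complex" where
 "tseq s = phi (dm (\<lambda>n. s (Suc n) - s n))"

lemma tseq_lin:
 assumes "Bseq (\<lambda>n. s (Suc n) - s n)" "Bseq (\<lambda>n. r (Suc n) - r n)"
 shows "tseq (\<lambda>n. a * s n + b * r n) = a * tseq s + b * tseq r"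
proof -
 have "dm (\<lambda>n. (a * s (Suc n) + b * r (Suc n)) - (a * s n + b * r n))
   = (\<lambda>k. a * dm (\<lambda>n. s (Suc n) - s n) k + b * dm (\<lambda>n. r (Suc n) - r n) k)"
  unfolding dm_lin[symmetric] by (simp add: algebra_simps)
 then show ?thesis unfolding tseq_def using phi_lin[OF lvb_dm[OF assms(1)] lvb_dm[OF assms(2)]] by simp
qed

lemma tseq_cong:
 assumes "Bseq (\<lambda>n. s n - r n)" "Bseq (\<lambda>n. r (Suc n) - r n)"
 shows "tseq s = tseq r"
proof -
 let ?d = "\<lambda>n. s n - r n"
 obtain K where K: "\<And>n. cmod (?d n) \<le> K" using assms(1) by (meson BseqE)
 have "Bseq (\<lambda>n. ?d (Suc n) - ?d n)"
  by (rule BseqI'[of _ "K + K"]) (rule order_trans[OF norm_triangle_ineq4], intro add_mono K)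
 from tseq_lin[OF this assms(2), of 1 1] have "tseq (\<lambda>n. ?d n + r n) = tseq ?d + tseq r" by simp
 then show ?thesis using phi_increment_bounded[OF assms(1)] by (simp add: tseq_def)
qed

definition good :: "('a \<Rightarrow> 'a) \<Rightarrow> bool" where
 "good A \<longleftrightarrow> wk A \<and> (\<forall>s. dts e A s \<longrightarrow> t A = tseq s)"

lemma goodI: assumes "wk A" "dts e A s" "t A = tseq s" shows "good A"
 unfolding good_def
proof (intro conjI assms(1) allI impI)
 fix r assume "dts e A r"
 then show "t A = tseq r"
  using tseq_cong[OF dts_unique[OF e assms(2)] dts_increment_Bseq[OF e], of r] assms(3) by simp
qed

lemma good_lin: assumes "good A" "good B" shows "good (\<lambda>x. a *C A x + b *C B x)"
proof -
 have wk: "wk A" "wk B" using assms by (auto simp: good_def)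
 obtain s where s: "dts e A s" using dts_exists[OF wk(1)] by blast
 obtain r where r: "dts e B r" using dts_exists[OF wk(2)] by blast
 have ts: "t A = tseq s" "t B = tseq r" using assms s r by (auto simp: good_def)
 show ?thesis
 proof (rule goodI[OF wk_lin[OF wk] dts_lin[OF e s r]])
  show "t (\<lambda>x. a *C A x + b *C B x) = tseq (\<lambda>n. a * s n + b * r n)"
   using t_lin[OF wk, of a b] tseq_lin[OF dts_increment_Bseq[OF e s] dts_increment_Bseq[OF e r], of a b] ts by simp
 qed
qed

lemma good_pos: assumes "wk A" "posop A" shows "good A"
proof -
 obtain l u C where l: "schmidt l u u" "A = dgo (\<lambda>i. cor (l i)) u u" "\<forall>i. l i \<le> C / (real i + 1)"
  by (rule wk_pos_spectral[OF assms e])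
 have u: "ons u" "osys u" and l0: "\<And>i. 0 \<le> l i" using l(1) by (auto simp: schmidt_def)
 have lb: "\<bar>l i\<bar> \<le> C / (real i + 1)" for i using l(3) l0[of i] by simp
 have lb': "cmod (cor (l i)) \<le> C / (real i + 1)" for i using lb by simp
 have d: "dts e A (\<lambda>n. cor (\<Sum>i<2 ^ n - 1. l i))"
  using dts_dgo[OF e u(2) u(2) lb'] unfolding l(2) by (simp add: ons_cinner[OF u(1)])
 have "t A = phi (\<lambda>i. cor (l i))" unfolding l(2) by (rule trace_diag[OF u(1) lvbI[OF lb']])
 also have "\<dots> = tseq (\<lambda>n. cor (\<Sum>i<2 ^ n - 1. l i))"
  unfolding tseq_def by (rule phi_average(1)[OF lb])
 finally show ?thesis by (rule goodI[OF assms(1) d])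
qed

text \<open>The operator is the sum of s_i <x, h_i> h_i with h_i = g_i + w f_i, hence positive. It
  belongs to the weak class because it is a combination of four diagonal series whose coefficients
  are the s_i.\<close>

lemma good_polar:
 assumes s: "schmidt s f g" and C: "\<forall>i. s i \<le> C / (real i + 1)" and w: "cmod w = 1"
 defines "c \<equiv> \<lambda>i. cor (s i)"
 shows "good (\<lambda>x. 1 *C (1 *C dgo c g g x + 1 *C dgo c f f x) + 1 *C (w *C dgo c g f x + cnj w *C dgo c f g x))"
proof (rule good_pos)
 have f: "osys f" and g: "osys g" and s0: "\<And>i. 0 \<le> s i" using s by (auto simp: schmidt_def ons_osys)
 have cb: "cmod (c i) \<le> C / (real i + 1)" for i unfolding c_def by (rule cmod_schmidt[OF s C])
 have B: "Bseq c" unfolding c_def by (rule schmidt_Bseq[OF s])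
 let ?A = "\<lambda>x. 1 *C (1 *C dgo c g g x + 1 *C dgo c f f x) + 1 *C (w *C dgo c g f x + cnj w *C dgo c f g x)"
 show wk: "wk ?A"
  by (rule wk_lin[OF wk_lin[OF dgo_wk[OF g g cb] dgo_wk[OF f f cb]] wk_lin[OF dgo_wk[OF g f cb] dgo_wk[OF f g cb]]])
 have "Im (cinner (?A x) x) = 0 \<and> 0 \<le> Re (cinner (?A x) x)" for x
 proof -
  have "(\<lambda>i. (c i * cinner x (g i) * cinner (g i) x + c i * cinner x (f i) * cinner (f i) x)
    + (w * (c i * cinner x (g i) * cinner (f i) x) + cnj w * (c i * cinner x (f i) * cinner (g i) x))) sums cinner (?A x) x"
   unfolding cinner_add_left cinner_scaleC_left mult_1
   by (intro sums_add sums_mult dgo_cinner_sums f g B)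
  moreover have "(c i * cinner x (g i) * cinner (g i) x + c i * cinner x (f i) * cinner (f i) x)
    + (w * (c i * cinner x (g i) * cinner (f i) x) + cnj w * (c i * cinner x (f i) * cinner (g i) x))
    = cor (s i * (cmod (cinner x (g i + w *C f i)))^2)" for i
  proof -
   have ww: "w * cnj w = 1" using mult_cnj_self[of w] w by simp
   have "cinner x (g i + w *C f i) * cinner (g i + w *C f i) x
     = cinner x (g i) * cinner (g i) x + (w * cnj w) * (cinner x (f i) * cinner (f i) x)
      + w * (cinner x (g i) * cinner (f i) x) + cnj w * (cinner x (f i) * cinner (g i) x)"
    by (simp add: cinner_add_left cinner_add_right cinner_scaleC_left cinner_scaleC_right algebra_simps)
   then show ?thesis unfolding of_real_mult cinner_mult_cnj[symmetric] ww c_def by (simp add: algebra_simps)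
  qed
  ultimately have S: "(\<lambda>i. cor (s i * (cmod (cinner x (g i + w *C f i)))^2)) sums cinner (?A x) x" by simp
  have "Im (cinner (?A x) x) = 0" using sums_Im[OF S] by (simp add: sums_iff)
  moreover have "0 \<le> Re (cinner (?A x) x)"
   using sums_le[OF _ sums_zero sums_Re[OF S]] s0 by simp
  ultimately show ?thesis by blast
 qed
 then show "posop ?A" unfolding posop_def using wk_clinop[OF wk] by blast
qed

theorem good_all: assumes "wk A" shows "good A"
proof -
 have cl: "clinop A" by (rule wk_clinop[OF assms])
 obtain B where B: "clinop B" "\<forall>x y. cinner (A x) y = cinner x (B y)" by (rule adjoint_exists[OF e cl])
 obtain s f g where s: "schmidt s f g" "A = dgo (\<lambda>i. cor (s i)) f g"
  by (rule schmidt_exists[OF wk_cpt[OF assms] e B])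
 obtain C where C: "\<And>i. s i \<le> C / (real i + 1)" by (rule wk_schmidt_bound[OF _ s(1)]) (use assms s(2) in auto)
 then have C': "\<forall>i. s i \<le> C / (real i + 1)" by blast
 define c where "c = (\<lambda>i. cor (s i))"
 define G where "G = (\<lambda>w x. 1 *C (1 *C dgo c g g x + 1 *C dgo c f f x) + 1 *C (w *C dgo c g f x + cnj w *C dgo c f g x))"
 have G: "good (G w)" if "cmod w = 1" for w
  using good_polar[OF s(1) C' that] unfolding G_def c_def .
 \<comment> \<open>Polarisation: averaging w G(w) over the fourth roots of unity keeps the
   \<open>cnj w\<close> term, which is A, and cancels the rest.\<close>
 have Aeq: "A = (\<lambda>x. 1 *C ((1/4) *C G 1 x + (- 1/4) *C G (-1) x) + 1 *C ((\<i>/4) *C G \<i> x + (- \<i>/4) *C G (-\<i>) x))"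
 proof
  fix x
  define p where "p = dgo c g f x" define q where "q = dgo c f g x" define z where "z = dgo c g g x + dgo c f f x"
  have G': "G w x = z + (w *C p + cnj w *C q)" for w by (simp add: G_def p_def q_def z_def)
  have "1 *C ((1/4) *C G 1 x + (- 1/4) *C G (-1) x) + 1 *C ((\<i>/4) *C G \<i> x + (- \<i>/4) *C G (-\<i>) x)
    = (1/4 - 1/4 + \<i>/4 - \<i>/4) *C z + (1/4 + 1/4 - 1/4 - 1/4) *C p + (1/4 + 1/4 + 1/4 + 1/4) *C q"
   unfolding G' scaleC_add_right scaleC_scaleC scaleC_add_left scaleC_diff_left by simp
  also have "\<dots> = q" by simp
  finally show "A x = 1 *C ((1/4) *C G 1 x + (- 1/4) *C G (-1) x) + 1 *C ((\<i>/4) *C G \<i> x + (- \<i>/4) *C G (-\<i>) x)"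
   by (simp add: s(2) q_def c_def)
 qed
 show ?thesis
  by (subst Aeq, rule good_lin[OF good_lin[OF G G] good_lin[OF G G]]) simp_all
qed

theorem ptrace_dts: assumes "wk A" "dts e A s" shows "t A = phi (dm (\<lambda>n. s (Suc n) - s n))"
proof -
 have "t A = tseq s" using good_all[OF assms(1)] assms(2) unfolding good_def by blast
 then show ?thesis by (simp only: tseq_def)
qed

end

section \<open>Traces and Banach limits\<close>

lemma harmonic_dyadic: "\<bar>(\<Sum>i<2 ^ n - 1. 1 / (real i + 1)) - real n * ln 2\<bar> \<le> 1"
proof -
 have h: "(\<Sum>i<m. 1 / (real i + 1)) = harm m" for m
  unfolding harm_altdef by (intro sum.cong) (auto simp: inverse_eq_divide)
 have l2: "ln (2 ^ n) = real n * ln (2::real)" by (simp add: ln_realpow)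
 have "ln (real (2 ^ n - 1) + 1) \<le> (harm (2 ^ n - 1) :: real)" by (rule ln_le_harm)
 then have 1: "real n * ln 2 \<le> harm (2 ^ n - 1)" by (simp add: of_nat_diff l2)
 obtain m where m: "(2::nat) ^ n = Suc m" by (metis gr0_implies_Suc zero_less_numeral zero_less_power)
 have "harm (Suc m) - ln (real (Suc m)) \<le> harm (Suc 0) - ln (real (Suc 0))"
  by (rule decseqD[OF decseq_harm_diff_ln]) simp
 then have "harm (2 ^ n) \<le> real n * ln 2 + 1" unfolding m[symmetric] by (simp add: harm_def l2)
 moreover have "harm (2 ^ n - 1) \<le> (harm (2 ^ n) :: real)" by (rule harm_mono) simp
 ultimately show ?thesis unfolding h using 1 by simp
qed

text \<open>The normalising operator has dyadic increments log 2; this is the source of the factor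
  log 2 in \<open>Dmap\<close> and in the trace formula.\<close>

lemma dts_harmonic:
 assumes "is_onb e" "ons u"
 shows "dts e (dgo (\<lambda>i. cor (1 / (real i + 1))) u u) (\<lambda>n. cor (real n * ln 2))"
proof -
 have b: "cmod (cor (1 / (real i + 1))) \<le> 1 / (real i + 1)" for i
  unfolding norm_of_real by simp
 have "dts e (dgo (\<lambda>i. cor (1 / (real i + 1))) u u) (\<lambda>n. cor (\<Sum>i<2 ^ n - 1. 1 / (real i + 1)))"
  using dts_dgo[OF assms(1) ons_osys[OF assms(2)] ons_osys[OF assms(2)] b]
  by (simp add: ons_cinner[OF assms(2)])
 moreover have "Bseq (\<lambda>n. cor (real n * ln 2) - cor (\<Sum>i<2 ^ n - 1. 1 / (real i + 1)))"
 proof (rule BseqI'[of _ 1])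
  fix n
  show "cmod (cor (real n * ln 2) - cor (\<Sum>i<2 ^ n - 1. 1 / (real i + 1))) \<le> 1"
   using harmonic_dyadic[of n] by (simp only: of_real_diff[symmetric] norm_of_real abs_minus_commute)
 qed
 ultimately show ?thesis by (rule dts_perturb)
qed

lemma wk_harmonic: "ons u \<Longrightarrow> wk (dgo (\<lambda>i. cor (1 / (real i + 1))) u u)"
 by (rule dgo_wk[OF ons_osys ons_osys, of _ _ _ 1]) (simp_all only: norm_of_real, simp)

lemma banach_limitD:
 assumes "banach_limit B"
 shows "Bseq x \<Longrightarrow> Bseq y \<Longrightarrow> B (\<lambda>n. a * x n + b * y n) = a * B x + b * B y"
  "Bseq x \<Longrightarrow> (\<And>n. 0 \<le> x n) \<Longrightarrow> 0 \<le> B x" "B (\<lambda>_. 1) = 1" "Bseq x \<Longrightarrow> B (rshift x) = B x"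
 using assms unfolding banach_limit_def rshift_def by auto

context trace_onb
begin

text \<open>The functional sends x to the trace of the diagonal D x. Its value at the constant 1 is
  the normalisation: the harmonic operator has dyadic sequence n log 2, whose constant increments
  log 2 are the block sequence of D 1.\<close>

lemma banach_limit_of_trace:
 "banach_limit (\<lambda>x. Re (phi (\<lambda>k. cor (ln 2) * dm (\<lambda>n. cor (x n)) k)))"
 and phi_real: "Bseq x \<Longrightarrow> Im (phi (\<lambda>k. cor (ln 2) * dm (\<lambda>n. cor (x n)) k)) = 0"
proof -
 define P where "P = (\<lambda>x::nat\<Rightarrow>real. phi (\<lambda>k. cor (ln 2) * dm (\<lambda>n. cor (x n)) k))"
 have Bc: "Bseq (\<lambda>n. cor (x n))" if "Bseq x" for x :: "nat \<Rightarrow> real"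
  using that by (simp add: Bseq_def)
 have P: "P x = cor (ln 2) * phi (dm (\<lambda>n. cor (x n)))" if "Bseq x" for x
  using phi_lin[OF lvb_dm[OF Bc[OF that]] lvb_dm[OF Bc[OF that]], of "cor (ln 2)" 0] by (simp add: P_def)
 have lin: "P (\<lambda>n. a * x n + b * y n) = cor a * P x + cor b * P y" if "Bseq x" "Bseq y" for a b x y
 proof -
  have B: "Bseq (\<lambda>n. a * x n + b * y n)"
  proof -
   obtain K L where "\<And>n. norm (x n) \<le> K" "\<And>n. norm (y n) \<le> L" using \<open>Bseq x\<close> \<open>Bseq y\<close> by (meson BseqE)
   then have "norm (a * x n + b * y n) \<le> \<bar>a\<bar> * K + \<bar>b\<bar> * L" for n
    by (intro order_trans[OF norm_triangle_ineq] add_mono) (auto simp: abs_mult mult_left_mono)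
   then show ?thesis by (rule BseqI')
  qed
  have "dm (\<lambda>n. cor (a * x n + b * y n)) =
    (\<lambda>k. cor a * dm (\<lambda>n. cor (x n)) k + cor b * dm (\<lambda>n. cor (y n)) k)"
   unfolding dm_lin[symmetric] by simp
  then show ?thesis unfolding P[OF B] P[OF that(1)] P[OF that(2)]
   using phi_lin[OF lvb_dm[OF Bc[OF that(1)]] lvb_dm[OF Bc[OF that(2)]]] by (simp add: algebra_simps)
 qed
 have pos: "Im (P x) = 0 \<and> 0 \<le> Re (P x)" if "Bseq x" "\<And>n. 0 \<le> x n" for x
 proof -
  let ?c = "\<lambda>k. cor (ln 2) * dm (\<lambda>n. cor (x n)) k"
  have l: "lvb ?c" using lvb_lin[OF lvb_dm[OF Bc[OF that(1)]] lvb_dm[OF Bc[OF that(1)]], of "cor (ln 2)" 0] by simp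
  have c: "?c k = cor (ln 2 * x (lev k) / 2 ^ lev k)" for k by (simp add: dm_def)
  have "posop (dgo ?c e e)"
   by (rule dgo_posop[OF oe(2) lvb_Bseq[OF l]]) (use that in \<open>simp_all only: c Im_complex_of_real Re_complex_of_real, simp\<close>)
  then show ?thesis using t lvb_wk[OF oe(1) oe(1) l] unfolding ptrace_def P_def phi_def by blast
 qed
 have B1: "Bseq (\<lambda>_. c)" for c :: real by (rule BseqI'[of _ "norm c"]) simp
 have one: "P (\<lambda>_. 1) = 1"
 proof -
  have "t (dgo (\<lambda>i. cor (1 / (real i + 1))) e e) = phi (dm (\<lambda>n. cor (real (Suc n) * ln 2) - cor (real n * ln 2)))"
   by (rule ptrace_dts[OF wk_harmonic[OF oe(2)] dts_harmonic[OF e oe(2)]])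
  also have "(\<lambda>n. cor (real (Suc n) * ln 2) - cor (real n * ln 2)) = (\<lambda>n. cor (ln 2))"
   by (simp add: fun_eq_iff algebra_simps)
  also have "dm \<dots> = (\<lambda>k. cor (ln 2) * dm (\<lambda>n. cor 1) k)"
   by (simp add: dm_def fun_eq_iff)
  finally show ?thesis using t oe(2) unfolding P_def ptrace_def by simp
 qed
 have sh: "P (rshift x) = P x" if "Bseq x" for x
 proof -
  have "Bseq (rshift x)" using that by (auto simp: Bseq_def rshift_def)
  moreover have "(\<lambda>n. cor (rshift x n)) = rshift (\<lambda>n. cor (x n))" by (simp add: rshift_def fun_eq_iff)
  ultimately show ?thesis using P[OF that] P[of "rshift x"] phi_shift[OF Bc[OF that]] by simp
 qed
 have "banach_limit (\<lambda>x. Re (P x))" unfolding banach_limit_def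
 proof (intro conjI allI impI)
  fix x y :: "nat \<Rightarrow> real" and a b :: real assume "Bseq x \<and> Bseq y"
  then show "Re (P (\<lambda>n. a * x n + b * y n)) = a * Re (P x) + b * Re (P y)" by (simp add: lin)
 next
  fix x :: "nat \<Rightarrow> real" assume "Bseq x \<and> (\<forall>n. 0 \<le> x n)" then show "0 \<le> Re (P x)" using pos by blast
 next
  show "Re (P (\<lambda>_. 1)) = 1" by (simp add: one)
 next
  fix x :: "nat \<Rightarrow> real" assume "Bseq x"
  from sh[OF this] show "Re (P x) = Re (P (\<lambda>n. if n = 0 then 0 else x (n - 1)))" by (simp add: rshift_def[abs_def])
 qed
 then show "banach_limit (\<lambda>x. Re (phi (\<lambda>k. cor (ln 2) * dm (\<lambda>n. cor (x n)) k)))"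
  by (simp only: P_def)
 show "Im (phi (\<lambda>k. cor (ln 2) * dm (\<lambda>n. cor (x n)) k)) = 0" if x: "Bseq x"
 proof -
  obtain K where K: "\<And>n. norm (x n) \<le> K" using x by (meson BseqE)
  \<comment> \<open>Adding a bound K makes the sequence nonnegative, where positivity already gives
    a real value.\<close>
  have "Bseq (\<lambda>n. x n + K)"
   by (rule BseqI'[of _ "K + \<bar>K\<bar>"]) (rule order_trans[OF norm_triangle_ineq], use K in auto)
  moreover have "0 \<le> x n + K" for n using K[of n] by simp
  ultimately have "Im (P (\<lambda>n. x n + K)) = 0" using pos by blast
  moreover have "P (\<lambda>n. x n + K) = P x + cor K * P (\<lambda>_. 1)" using lin[OF x B1, of 1 K 1] by simp
  ultimately have "Im (P x) = 0" by (simp add: one)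
  then show ?thesis by (simp add: P_def)
 qed
qed

end

definition blim :: "((nat \<Rightarrow> real) \<Rightarrow> real) \<Rightarrow> (nat \<Rightarrow> complex) \<Rightarrow> complex" where
 "blim B x = cor (B (\<lambda>n. Re (x n))) + \<i> * cor (B (\<lambda>n. Im (x n)))"

lemma Bseq_Re: "Bseq x \<Longrightarrow> Bseq (\<lambda>n. Re (x n))"
 using abs_Re_le_cmod order_trans unfolding Bseq_def by (metis real_norm_def)

lemma Bseq_Im: "Bseq x \<Longrightarrow> Bseq (\<lambda>n. Im (x n))"
 using abs_Im_le_cmod order_trans unfolding Bseq_def by (metis real_norm_def)

lemma blim_lin:
 assumes "banach_limit B" "Bseq x" "Bseq y"
 shows "blim B (\<lambda>n. a * x n + b * y n) = a * blim B x + b * blim B y"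
proof -
 note l = banach_limitD(1)[OF assms(1)]
 note R = Bseq_Re[OF assms(2)] Bseq_Re[OF assms(3)] Bseq_Im[OF assms(2)] Bseq_Im[OF assms(3)]
 have Bl: "Bseq (\<lambda>n. p * u n + q * v n)" if uv: "Bseq u" "Bseq v" for p q and u v :: "nat \<Rightarrow> real"
 proof -
  obtain K L where "\<And>n. norm (u n) \<le> K" "\<And>n. norm (v n) \<le> L" using uv by (meson BseqE)
  then have "norm (p * u n + q * v n) \<le> \<bar>p\<bar> * K + \<bar>q\<bar> * L" for n
   by (intro order_trans[OF norm_triangle_ineq] add_mono) (auto simp: abs_mult mult_left_mono)
  then show ?thesis by (rule BseqI')
 qed
 have re: "B (\<lambda>n. Re (a * x n + b * y n)) = (Re a * B (\<lambda>n. Re (x n)) - Im a * B (\<lambda>n. Im (x n))) + (Re b * B (\<lambda>n. Re (y n)) - Im b * B (\<lambda>n. Im (y n)))"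
  using l[OF Bl[OF R(1,3), of "Re a" "- Im a"] Bl[OF R(2,4), of "Re b" "- Im b"], of 1 1]
   l[OF R(1,3), of "Re a" "- Im a"] l[OF R(2,4), of "Re b" "- Im b"] by simp
 have im: "B (\<lambda>n. Im (a * x n + b * y n)) = (Re a * B (\<lambda>n. Im (x n)) + Im a * B (\<lambda>n. Re (x n))) + (Re b * B (\<lambda>n. Im (y n)) + Im b * B (\<lambda>n. Re (y n)))"
  using l[OF Bl[OF R(3,1), of "Re a" "Im a"] Bl[OF R(4,2), of "Re b" "Im b"], of 1 1]
   l[OF R(3,1), of "Re a" "Im a"] l[OF R(4,2), of "Re b" "Im b"] by simp
 show ?thesis unfolding blim_def re im by (simp add: complex_eq_iff algebra_simps)
qed

lemma blim_increment_bounded: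
 assumes B: "banach_limit B" and s: "Bseq s" shows "blim B (\<lambda>n. s (Suc n) - s n) = 0"
proof -
 have real: "B (\<lambda>n. r (Suc n) - r n) = 0" if r: "Bseq r" for r :: "nat \<Rightarrow> real"
 proof -
  define z where "z = (\<lambda>n. r (Suc n) - r 0)"
  obtain K where K: "\<And>n. norm (r n) \<le> K" using r by (meson BseqE)
  have "norm (z n) \<le> K + K" for n
   unfolding z_def using norm_triangle_ineq4[of "r (Suc n)" "r 0"] K[of "Suc n"] K[of 0] by linarith
  then have Bz: "Bseq z" by (rule BseqI')
  then have Bs: "Bseq (rshift z)" by (auto simp: Bseq_def rshift_def)
  have "(\<lambda>n. r (Suc n) - r n) = (\<lambda>n. 1 * z n + (-1) * rshift z n)"
  proof
   fix n show "r (Suc n) - r n = 1 * z n + (-1) * rshift z n" by (cases n) (auto simp: z_def rshift_def)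
  qed
  then show ?thesis using banach_limitD(1)[OF B Bz Bs, of 1 "-1"] banach_limitD(4)[OF B Bz] by simp
 qed
 show ?thesis unfolding blim_def using real[OF Bseq_Re[OF s]] real[OF Bseq_Im[OF s]] by simp
qed

text \<open>The trace is read off from any dyadic trace sequence. Two choices differ by a bounded
  sequence, whose increments every Banach limit annihilates, so linearity and unitary invariance
  pass over from \<open>dts\<close>; positivity holds because partial sums of eigenvalues
  increase.\<close>

theorem trace_of_banach_limit:
 fixes e :: "nat \<Rightarrow> 'a::chilbert"
 assumes B: "banach_limit B" and e: "is_onb e"
 obtains t :: "('a \<Rightarrow> 'a) \<Rightarrow> complex" where "ptrace t"
  "\<forall>A s. wk A \<longrightarrow> dts e A s \<longrightarrow> t A = blim B (\<lambda>n. s (Suc n) - s n) / cor (ln 2)"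
proof -
 define L where "L = (\<lambda>s. blim B (\<lambda>n. s (Suc n) - s n) / cor (ln 2))"
 define t where "t = (\<lambda>A. L (SOME s. dts e A s))"
 have L_lin: "L (\<lambda>n. a * s n + b * r n) = a * L s + b * L r"
  if "Bseq (\<lambda>n. s (Suc n) - s n)" "Bseq (\<lambda>n. r (Suc n) - r n)" for a b s r
 proof -
  have "(\<lambda>n. (a * s (Suc n) + b * r (Suc n)) - (a * s n + b * r n)) = (\<lambda>n. a * (s (Suc n) - s n) + b * (r (Suc n) - r n))"
   by (simp add: algebra_simps)
  then show ?thesis unfolding L_def using blim_lin[OF B that, of a b] by (simp add: add_divide_distrib)
 qed
 have L_cong: "L s = L r" if h: "Bseq (\<lambda>n. s n - r n)" "Bseq (\<lambda>n. r (Suc n) - r n)" for s r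
 proof -
  let ?d = "\<lambda>n. s n - r n"
  obtain K where K: "\<And>n. cmod (?d n) \<le> K" using h(1) by (meson BseqE)
  have "Bseq (\<lambda>n. ?d (Suc n) - ?d n)"
   by (rule BseqI'[of _ "K + K"]) (rule order_trans[OF norm_triangle_ineq4], intro add_mono K)
  from L_lin[OF this h(2), of 1 1] have "L (\<lambda>n. ?d n + r n) = L ?d + L r" by simp
  then show ?thesis using blim_increment_bounded[OF B h(1)] by (simp add: L_def)
 qed
 have tL: "t A = L s" if "dts e A s" for A s
 proof -
  have "dts e A (SOME s. dts e A s)" by (rule someI[of _ s]) (rule that)
  then show ?thesis unfolding t_def by (rule L_cong[OF dts_unique[OF e _ that] dts_increment_Bseq[OF e that]])
 qed
 have "ptrace t" unfolding ptrace_def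
 proof (intro conjI allI impI)
  fix A C :: "'a \<Rightarrow> 'a" and a b assume "wk A \<and> wk C"
  then have wk: "wk A" "wk C" by auto
  obtain s where s: "dts e A s" using dts_exists[OF wk(1), of e] by auto
  obtain r where r: "dts e C r" using dts_exists[OF wk(2), of e] by auto
  show "t (\<lambda>x. a *C A x + b *C C x) = a * t A + b * t C"
   unfolding tL[OF s] tL[OF r] tL[OF dts_lin[OF e s r]]
   by (rule L_lin[OF dts_increment_Bseq[OF e s] dts_increment_Bseq[OF e r]])
 next
  fix A U V :: "'a \<Rightarrow> 'a" assume A: "wk A \<and> unit_pair U V"
  then obtain s where s: "dts e A s" using dts_exists[of A e] by auto
  show "t (\<lambda>x. U (A (V x))) = t A"
   unfolding tL[OF s] by (rule tL[OF dts_unitary[OF e s conjunct2[OF A]]])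
 next
  fix A :: "'a \<Rightarrow> 'a" assume A: "wk A \<and> posop A"
  obtain l u C where l: "schmidt l u u" "A = dgo (\<lambda>i. cor (l i)) u u" "\<forall>i. l i \<le> C / (real i + 1)"
   by (rule wk_pos_spectral[OF conjunct1[OF A] conjunct2[OF A] e])
  have u: "ons u" "osys u" and l0: "\<And>i. 0 \<le> l i" using l(1) by (auto simp: schmidt_def)
  have lb': "cmod (cor (l i)) \<le> C / (real i + 1)" for i by (rule cmod_schmidt[OF l(1,3)])
  have d: "dts e A (\<lambda>n. cor (\<Sum>i<2 ^ n - 1. l i))"
   using dts_dgo[OF e u(2) u(2) lb'] unfolding l(2) by (simp add: ons_cinner[OF u(1)])
  define a where "a = (\<lambda>n. (\<Sum>i<2 ^ Suc n - 1. l i) - (\<Sum>i<2 ^ n - 1. l i))"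
  have a: "(\<lambda>n. cor (\<Sum>i<2 ^ Suc n - 1. l i) - cor (\<Sum>i<2 ^ n - 1. l i)) = (\<lambda>n. cor (a n))"
   by (simp only: a_def of_real_diff)
  have Ba: "Bseq a" using Bseq_Re[OF dts_increment_Bseq[OF e d, unfolded a]] by (simp only: Re_complex_of_real)
  have a0: "0 \<le> a n" for n unfolding a_def by (simp, intro sum_mono2) (auto simp: l0)
  have B0: "B (\<lambda>_. 0) = 0" using banach_limitD(1)[OF B Ba Ba, of 0 0] by simp
  have "t A = blim B (\<lambda>n. cor (a n)) / cor (ln 2)" unfolding tL[OF d] L_def a ..
  also have "blim B (\<lambda>n. cor (a n)) = cor (B a)" by (simp add: blim_def B0)
  finally have "t A = cor (B a / ln 2)" by simp
  moreover have "0 \<le> B a / ln 2" using banach_limitD(2)[OF B Ba a0] by simp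
  ultimately show "Im (t A) = 0" "0 \<le> Re (t A)" by simp_all
 next
  fix u :: "nat \<Rightarrow> 'a" assume u: "ons u"
  have step: "(\<lambda>n. (1 + real n) * ln 2 - real n * ln 2) = (\<lambda>n. ln 2)"
   by (simp add: fun_eq_iff algebra_simps)
  have const: "B (\<lambda>_. c) = c" for c
  proof -
   have B1: "Bseq (\<lambda>_::nat. 1::real)" by (rule BseqI'[of _ 1]) simp
   show ?thesis using banach_limitD(1)[OF B B1 B1, of c 0] banach_limitD(3)[OF B] by simp
  qed
  show "t (dgo (\<lambda>i. cor (1 / (real i + 1))) u u) = 1"
   unfolding tL[OF dts_harmonic[OF e u]] L_def blim_def by (simp add: const step)
 qed
 moreover have "\<forall>A s. wk A \<longrightarrow> dts e A s \<longrightarrow> t A = blim B (\<lambda>n. s (Suc n) - s n) / cor (ln 2)"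
  using tL by (simp add: L_def)
 ultimately show ?thesis by (rule that)
qed

section \<open>The Hilbert space of square-integrable functions\<close>

text \<open>Stated for an arbitrary measure because the frame estimates integrate over an abstract
  parameter space.\<close>

definition sq :: "'a measure \<Rightarrow> ('a \<Rightarrow> complex) \<Rightarrow> bool" where
 "sq M f \<longleftrightarrow> f \<in> borel_measurable M \<and> integrable M (\<lambda>x. (cmod (f x))\<^sup>2)"

lemma sqint_sq: "sqint = sq lborel" by (simp add: sqint_def sq_def fun_eq_iff)

lemma sq_measurable: "sq M f \<Longrightarrow> f \<in> borel_measurable M" by (simp add: sq_def)

lemma two_mult_le_sq: "2 * (a * b) \<le> a\<^sup>2 + b\<^sup>2" for a b :: real
 using sum_squares_ge_zero[of "a - b" 0] by (simp add: power2_eq_square algebra_simps)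

lemma sq_bound:
 assumes "f \<in> borel_measurable M" "sq M g" "\<And>x. x \<in> space M \<Longrightarrow> cmod (f x) \<le> C * cmod (g x)"
 shows "sq M f"
proof -
 note [measurable] = assms(1) sq_measurable[OF assms(2)]
 have "integrable M (\<lambda>x. C\<^sup>2 * (cmod (g x))^2)" using assms(2) by (simp add: sq_def)
 then have "integrable M (\<lambda>x. (cmod (f x))\<^sup>2)"
 proof (rule LINT_dominated)
  show "AE x in M. norm ((cmod (f x))^2) \<le> norm (C\<^sup>2 * (cmod (g x))^2)"
   using power_mono[OF assms(3), of _ 2] by (intro AE_I2) (simp add: power_mult_distrib abs_mult)
 qed measurable
 then show ?thesis using assms(1) by (simp add: sq_def)
qed

lemma sq_lin:
 assumes "sq M f" "sq M g" shows "sq M (\<lambda>x. a * f x + b * g x)"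
proof -
 note [measurable] = sq_measurable[OF assms(1)] sq_measurable[OF assms(2)]
 have "integrable M (\<lambda>x. (2 * (cmod a)^2) * (cmod (f x))^2 + (2 * (cmod b)^2) * (cmod (g x))^2)"
  using assms by (simp add: sq_def)
 then have "integrable M (\<lambda>x. (cmod (a * f x + b * g x))\<^sup>2)"
 proof (rule LINT_dominated)
  have "(cmod (a * f x + b * g x))^2 \<le> (2 * (cmod a)^2) * (cmod (f x))^2 + (2 * (cmod b)^2) * (cmod (g x))^2" for x
  proof -
   have "(cmod (a * f x + b * g x))^2 \<le> (cmod a * cmod (f x) + cmod b * cmod (g x))^2"
    using norm_triangle_ineq[of "a * f x" "b * g x"] by (intro power_mono) (simp_all add: norm_mult)
   also have "\<dots> \<le> (2 * (cmod a)^2) * (cmod (f x))^2 + (2 * (cmod b)^2) * (cmod (g x))^2"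
    using two_mult_le_sq[of "cmod a * cmod (f x)" "cmod b * cmod (g x)"] by (simp add: power2_sum power_mult_distrib)
   finally show ?thesis .
  qed
  then show "AE x in M. norm ((cmod (a * f x + b * g x))^2) \<le> norm ((2 * (cmod a)^2) * (cmod (f x))^2 + (2 * (cmod b)^2) * (cmod (g x))^2)"
   by (intro AE_I2) simp
 qed measurable
 then show ?thesis by (simp add: sq_def)
qed

lemma sq_zero: "sq M (\<lambda>x. 0)" by (simp add: sq_def)
lemma sq_add: "sq M f \<Longrightarrow> sq M g \<Longrightarrow> sq M (\<lambda>x. f x + g x)" using sq_lin[of M f g 1 1] by simp
lemma sq_diff: "sq M f \<Longrightarrow> sq M g \<Longrightarrow> sq M (\<lambda>x. f x - g x)" using sq_lin[of M f g 1 "-1"] by simp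
lemma sq_scale: "sq M f \<Longrightarrow> sq M (\<lambda>x. a * f x)" using sq_lin[of M f f a 0] by simp

lemma sq_prod_integrable:
 assumes "sq M f" "sq M g" shows "integrable M (\<lambda>x. f x * g x)"
proof -
 note [measurable] = sq_measurable[OF assms(1)] sq_measurable[OF assms(2)]
 have "integrable M (\<lambda>x. (cmod (f x))\<^sup>2 + (cmod (g x))^2)" using assms by (simp add: sq_def)
 then show ?thesis
 proof (rule LINT_dominated)
  show "AE x in M. norm (f x * g x) \<le> norm ((cmod (f x))^2 + (cmod (g x))^2)"
  proof (intro AE_I2)
   fix x
   have "cmod (f x) * cmod (g x) \<le> 2 * (cmod (f x) * cmod (g x))" by simp
   also have "\<dots> \<le> (cmod (f x))^2 + (cmod (g x))^2" by (rule two_mult_le_sq)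
   finally show "norm (f x * g x) \<le> norm ((cmod (f x))^2 + (cmod (g x))^2)" by (simp add: norm_mult)
  qed
 qed measurable
qed

lemma sq_cnj: "sq M f \<Longrightarrow> sq M (\<lambda>x. cnj (f x))"
 unfolding sq_def
 using measurable_compose[of f M borel cnj borel] borel_measurable_continuous_onI[OF continuous_on_cnj[OF continuous_on_id]]
 by auto

lemma sq_norm: "sq M f \<Longrightarrow> sq M (\<lambda>x. cor (cmod (f x)))"
 unfolding sq_def by auto

lemma sq_inner_integrable: "sq M f \<Longrightarrow> sq M g \<Longrightarrow> integrable M (\<lambda>x. f x * cnj (g x))"
 by (intro sq_prod_integrable sq_cnj)

lemma sq_nn_integral: "sq M f \<Longrightarrow> (\<integral>\<^sup>+x. ennreal ((cmod (f x))^2) \<partial>M) = ennreal (LINT x|M. (cmod (f x))\<^sup>2)"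
 by (rule nn_integral_eq_integral) (auto simp: sq_def)

lemma sqI_nn: "f \<in> borel_measurable M \<Longrightarrow> (\<integral>\<^sup>+x. ennreal ((cmod (f x))^2) \<partial>M) < \<infinity> \<Longrightarrow> sq M f"
 unfolding sq_def by (auto intro!: integrableI_bounded)

lemma aeq_refl: "aeq f f" by (simp add: aeq_def)
lemma aeq_sym: "aeq f g \<Longrightarrow> aeq g f" unfolding aeq_def by (auto elim: AE_mp)
lemma aeq_trans: "aeq f g \<Longrightarrow> aeq g h \<Longrightarrow> aeq f h" unfolding aeq_def by (auto elim: AE_mp)
\<comment> \<open>A partial quotient: functions that are not square integrable are related to
  nothing, so each class consists of square-integrable representatives.\<close>
quotient_type (overloaded) 'd L2 = "('d::finite) fn" / partial: "\<lambda>f g :: 'd fn. sqint f \<and> sqint g \<and> aeq f g"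
proof (rule part_equivpI)
 show "\<exists>x::'d fn. sqint x \<and> sqint x \<and> aeq x x"
  using sq_zero[of lborel] aeq_refl unfolding sqint_sq by blast
qed (auto simp: symp_def transp_def intro: aeq_sym aeq_trans)

definition cls :: "('d::finite) fn \<Rightarrow> 'd L2" where "cls = abs_L2"
definition rpf :: "('d::finite) L2 \<Rightarrow> 'd fn" where "rpf = rep_L2"

lemma sqint_rpf: "sqint (rpf u)"
 using Quotient3_rep_reflp[OF Quotient3_L2, of u] by (simp add: rpf_def)

lemma cls_rpf [simp]: "cls (rpf u) = u"
 using Quotient3_abs_rep[OF Quotient3_L2, of u] by (simp add: rpf_def cls_def)

lemma cls_eq_iff: "sqint f \<Longrightarrow> sqint g \<Longrightarrow> cls f = cls g \<longleftrightarrow> aeq f g"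
 using Quotient3_rel[OF Quotient3_L2, of f g] aeq_refl by (auto simp: cls_def)

lemma rpf_cls: "sqint f \<Longrightarrow> aeq (rpf (cls f)) f"
 using cls_eq_iff[OF sqint_rpf[of "cls f"], of f] by simp

lemma cls_cong: "sqint f \<Longrightarrow> sqint g \<Longrightarrow> AE x in lborel. f x = g x \<Longrightarrow> cls f = cls g"
 by (simp add: cls_eq_iff aeq_def)

lemma AE_rpf_cls: "sqint f \<Longrightarrow> AE x in lborel. rpf (cls f) x = f x"
 using rpf_cls by (simp add: aeq_def)

lemma L2_cases: obtains f where "sqint f" "u = cls f"
 using sqint_rpf[of u] that[of "rpf u"] by simp

lemma sqint_lin: "sqint f \<Longrightarrow> sqint g \<Longrightarrow> sqint (\<lambda>x. a * f x + b * g x)" by (simp add: sqint_sq sq_lin)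
lemma sqint_add: "sqint f \<Longrightarrow> sqint g \<Longrightarrow> sqint (\<lambda>x. f x + g x)" by (simp add: sqint_sq sq_add)
lemma sqint_diff: "sqint f \<Longrightarrow> sqint g \<Longrightarrow> sqint (\<lambda>x. f x - g x)" by (simp add: sqint_sq sq_diff)
lemma sqint_scale: "sqint f \<Longrightarrow> sqint (\<lambda>x. a * f x)" by (simp add: sqint_sq sq_scale)
lemma sqint_zero: "sqint (\<lambda>_. 0)" by (simp add: sqint_sq sq_zero)
lemma sqint_inner_integrable: "sqint f \<Longrightarrow> sqint g \<Longrightarrow> integrable lborel (\<lambda>x. f x * cnj (g x))"
 by (simp add: sqint_sq sq_inner_integrable)
lemma sqint_measurable: "sqint f \<Longrightarrow> f \<in> borel_measurable borel" by (simp add: sqint_def)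

lemma l2inner_cong:
 assumes "sqint f" "sqint g" "sqint f'" "sqint g'" "aeq f f'" "aeq g g'" shows "l2inner f g = l2inner f' g'"
 unfolding l2inner_def
proof (rule integral_cong_AE)
 show "(\<lambda>x. f x * cnj (g x)) \<in> borel_measurable lborel" "(\<lambda>x. f' x * cnj (g' x)) \<in> borel_measurable lborel"
  using borel_measurable_integrable[OF sqint_inner_integrable[OF assms(1,2)]]
   borel_measurable_integrable[OF sqint_inner_integrable[OF assms(3,4)]] by auto
 show "AE x in lborel. f x * cnj (g x) = f' x * cnj (g' x)"
  using assms(5,6) unfolding aeq_def by eventually_elim simp
qed

lemma l2inner_add_left: "sqint f \<Longrightarrow> sqint g \<Longrightarrow> sqint h \<Longrightarrow> l2inner (\<lambda>x. f x + g x) h = l2inner f h + l2inner g h"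
 unfolding l2inner_def distrib_right by (intro Bochner_Integration.integral_add sqint_inner_integrable)

lemma l2inner_scale_left: "sqint f \<Longrightarrow> sqint h \<Longrightarrow> l2inner (\<lambda>x. a * f x) h = a * l2inner f h"
 unfolding l2inner_def mult.assoc by simp

lemma l2inner_commute: "l2inner f g = cnj (l2inner g f)"
proof -
 have "cnj (l2inner g f) = (LINT x|lborel. cnj (g x * cnj (f x)))"
  unfolding l2inner_def by (rule Bochner_Integration.integral_cnj[symmetric])
 then show ?thesis unfolding l2inner_def by (simp add: mult.commute)
qed

lemma l2inner_self: "l2inner f f = cor ((l2norm f)^2)"
proof -
 have "l2inner f f = (LINT x|lborel. cor ((cmod (f x))^2))"
  unfolding l2inner_def by (simp add: mult_cnj_self)
 then show ?thesis by (simp only: integral_complex_of_real l2norm_def) (simp add: integral_nonneg)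
qed

lemma l2norm_eq_0: assumes "sqint f" "l2norm f = 0" shows "aeq f (\<lambda>_. 0)"
proof -
 have "(LINT x|lborel. (cmod (f x))\<^sup>2) = 0" using assms(2) by (simp add: l2norm_def)
 then have "AE x in lborel. (cmod (f x))\<^sup>2 = 0"
  using assms(1) by (subst (asm) integral_nonneg_eq_0_iff_AE) (auto simp: sqint_def)
 then show ?thesis unfolding aeq_def by (auto elim: AE_mp)
qed

instantiation L2 :: (finite) real_vector
begin

definition zero_L2 :: "'a L2" where "zero_L2 = cls (\<lambda>_. 0)"
definition plus_L2 :: "'a L2 \<Rightarrow> 'a L2 \<Rightarrow> 'a L2" where "plus_L2 u v = cls (\<lambda>x. rpf u x + rpf v x)"
definition minus_L2 :: "'a L2 \<Rightarrow> 'a L2 \<Rightarrow> 'a L2" where "minus_L2 u v = cls (\<lambda>x. rpf u x - rpf v x)"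
definition uminus_L2 :: "'a L2 \<Rightarrow> 'a L2" where "uminus_L2 u = cls (\<lambda>x. (-1) * rpf u x)"
definition scaleR_L2 :: "real \<Rightarrow> 'a L2 \<Rightarrow> 'a L2" where "scaleR_L2 r u = cls (\<lambda>x. cor r * rpf u x)"

lemma L2_add_cls: assumes "sqint f" "sqint g" shows "cls f + cls g = cls (\<lambda>x. f x + g x)"
 unfolding plus_L2_def
proof (rule cls_cong)
 show "AE x in lborel. rpf (cls f) x + rpf (cls g) x = f x + g x"
  using AE_rpf_cls[OF assms(1)] AE_rpf_cls[OF assms(2)] by eventually_elim simp
qed (intro sqint_add sqint_rpf assms)+

lemma L2_diff_cls: assumes "sqint f" "sqint g" shows "cls f - cls g = cls (\<lambda>x. f x - g x)"
 unfolding minus_L2_def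
proof (rule cls_cong)
 show "AE x in lborel. rpf (cls f) x - rpf (cls g) x = f x - g x"
  using AE_rpf_cls[OF assms(1)] AE_rpf_cls[OF assms(2)] by eventually_elim simp
qed (intro sqint_diff sqint_rpf assms)+

lemma L2_uminus_cls: assumes "sqint f" shows "- cls f = cls (\<lambda>x. (-1) * f x)"
 unfolding uminus_L2_def
proof (rule cls_cong)
 show "AE x in lborel. (-1) * rpf (cls f) x = (-1) * f x"
  using AE_rpf_cls[OF assms] by eventually_elim simp
qed (intro sqint_scale sqint_rpf assms)+

lemma L2_scaleR_cls: assumes "sqint f" shows "r *\<^sub>R cls f = cls (\<lambda>x. cor r * f x)"
 unfolding scaleR_L2_def
proof (rule cls_cong)
 show "AE x in lborel. cor r * rpf (cls f) x = cor r * f x"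
  using AE_rpf_cls[OF assms] by eventually_elim simp
qed (intro sqint_scale sqint_rpf assms)+

instance
proof
 fix u v w :: "'a L2" and r s :: real
 obtain f where f: "sqint f" "u = cls f" by (rule L2_cases)
 obtain g where g: "sqint g" "v = cls g" by (rule L2_cases)
 obtain h where h: "sqint h" "w = cls h" by (rule L2_cases)
 note cl = L2_add_cls L2_diff_cls L2_uminus_cls L2_scaleR_cls
  sqint_add sqint_diff sqint_scale sqint_zero sqint_scale[of _ "-1", simplified]
 show "u + v + w = u + (v + w)" unfolding f g h by (simp add: cl f g h add.assoc)
 show "u + v = v + u" unfolding f g by (simp add: cl f g add.commute)
 show "0 + u = u" unfolding f zero_L2_def by (simp add: cl f)
 show "- u + u = 0" unfolding f zero_L2_def by (simp add: cl f)
 show "u - v = u + - v" unfolding f g by (simp add: cl f g)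
 show "r *\<^sub>R (u + v) = r *\<^sub>R u + r *\<^sub>R v" unfolding f g by (simp add: cl f g distrib_left)
 show "(r + s) *\<^sub>R u = r *\<^sub>R u + s *\<^sub>R u" unfolding f by (simp add: cl f distrib_right)
 show "r *\<^sub>R s *\<^sub>R u = (r * s) *\<^sub>R u" unfolding f by (simp add: cl f mult.assoc)
 show "1 *\<^sub>R u = u" unfolding f by (simp add: cl f)
qed

end

instantiation L2 :: (finite) real_inner
begin

definition inner_L2 :: "'a L2 \<Rightarrow> 'a L2 \<Rightarrow> real" where "inner_L2 u v = Re (l2inner (rpf u) (rpf v))"
definition norm_L2 :: "'a L2 \<Rightarrow> real" where "norm_L2 u = l2norm (rpf u)"
definition dist_L2 :: "'a L2 \<Rightarrow> 'a L2 \<Rightarrow> real" where "dist_L2 u v = norm (u - v)"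
definition sgn_L2 :: "'a L2 \<Rightarrow> 'a L2" where "sgn_L2 u = u /\<^sub>R norm u"
definition uniformity_L2 :: "('a L2 \<times> 'a L2) filter" where
 "uniformity_L2 = (INF e\<in>{0<..}. principal {(x, y). dist x y < e})"
definition open_L2 :: "'a L2 set \<Rightarrow> bool" where
 "open_L2 U \<longleftrightarrow> (\<forall>x\<in>U. \<forall>\<^sub>F (x', y) in uniformity. x' = x \<longrightarrow> y \<in> U)"

lemma L2_inner_cls: "sqint f \<Longrightarrow> sqint g \<Longrightarrow> inner (cls f) (cls g) = Re (l2inner f g)"
 unfolding inner_L2_def using l2inner_cong[OF sqint_rpf sqint_rpf _ _ rpf_cls rpf_cls, of f g] by simp

lemma L2_norm_cls: assumes "sqint f" shows "norm (cls f) = l2norm f"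
proof -
 have "cor ((l2norm (rpf (cls f)))^2) = cor ((l2norm f)^2)"
  unfolding l2inner_self[symmetric] by (rule l2inner_cong[OF sqint_rpf sqint_rpf assms assms rpf_cls[OF assms] rpf_cls[OF assms]])
 then have "(l2norm (rpf (cls f)))^2 = (l2norm f)^2" using of_real_eq_iff by blast
 moreover have "l2norm g \<ge> 0" for g :: "'a fn" by (simp add: l2norm_def integral_nonneg)
 ultimately show ?thesis unfolding norm_L2_def by (simp add: power2_eq_iff_nonneg)
qed

instance
proof
 fix u v w :: "'a L2" and r s :: real
 obtain f where f: "sqint f" "u = cls f" by (rule L2_cases)
 obtain g where g: "sqint g" "v = cls g" by (rule L2_cases)
 obtain h where h: "sqint h" "w = cls h" by (rule L2_cases)
 note cl = L2_add_cls L2_diff_cls L2_uminus_cls L2_scaleR_cls L2_inner_cls L2_norm_cls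
  sqint_add sqint_diff sqint_scale sqint_zero sqint_scale[of _ "-1", simplified]
 show "dist u v = norm (u - v)" by (simp add: dist_L2_def)
 show "sgn u = u /\<^sub>R norm u" by (simp add: sgn_L2_def)
 show "(uniformity :: ('a L2 \<times> 'a L2) filter) = (INF e\<in>{0<..}. principal {(x, y). dist x y < e})"
  by (simp add: uniformity_L2_def)
 show "open U = (\<forall>x\<in>U. \<forall>\<^sub>F (x', y) in uniformity. x' = x \<longrightarrow> y \<in> U)" for U :: "'a L2 set"
  by (simp add: open_L2_def)
 show "inner u v = inner v u" unfolding f g by (simp add: cl f g) (subst l2inner_commute, simp)
 show "inner (u + v) w = inner u w + inner v w" unfolding f g h by (simp add: cl f g h l2inner_add_left)
 show "inner (r *\<^sub>R u) v = r * inner u v" unfolding f g by (simp add: cl f g l2inner_scale_left)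
 have sf: "inner u u = (l2norm f)^2" unfolding f by (simp add: cl f l2inner_self)
 have nn: "l2norm f \<ge> 0" by (simp add: l2norm_def integral_nonneg)
 show "0 \<le> inner u u" unfolding sf by simp
 show "(inner u u = 0) = (u = 0)"
 proof
  assume "inner u u = 0"
  then have "aeq f (\<lambda>_. 0)" unfolding sf using l2norm_eq_0[OF f(1)] by simp
  then show "u = 0" unfolding f zero_L2_def using cls_eq_iff[OF f(1) sqint_zero] by simp
 next
  assume "u = 0"
  then show "inner u u = 0" unfolding zero_L2_def by (simp add: cl l2inner_def)
 qed
 show "norm u = sqrt (inner u u)" unfolding sf unfolding f using nn by (simp add: cl f)
qed

end

lemma L2_norm_sq: "sqint f \<Longrightarrow> (norm (cls f))^2 = (LINT x|lborel. (cmod (f x))\<^sup>2)"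
 by (simp add: L2_norm_cls l2norm_def integral_nonneg)

lemma L2_norm_nn: "sqint f \<Longrightarrow> (\<integral>\<^sup>+x. ennreal ((cmod (f x))^2) \<partial>lborel) = ennreal ((norm (cls f))^2)"
 using sq_nn_integral[of lborel f] by (simp add: L2_norm_sq sqint_sq)

lemma L2_sum_cls: "(\<And>i. i \<in> I \<Longrightarrow> sqint (f i)) \<Longrightarrow> (\<Sum>i\<in>I. cls (f i)) = cls (\<lambda>x. \<Sum>i\<in>I. f i x) \<and> sqint (\<lambda>x. \<Sum>i\<in>I. f i x)"
 by (induction I rule: infinite_finite_induct) (auto simp: zero_L2_def sqint_zero L2_add_cls sqint_add)

section \<open>Completeness of L_2 (Riesz-Fischer)\<close>

lemma fast_subsequence:
 fixes X :: "nat \<Rightarrow> 'a::metric_space"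
 assumes "Cauchy X"
 obtains r :: "nat \<Rightarrow> nat" where "strict_mono r" "\<forall>k. dist (X (r (Suc k))) (X (r k)) < (1/2) ^ k"
proof -
 have "\<forall>k. \<exists>M. \<forall>m\<ge>M. \<forall>n\<ge>M. dist (X m) (X n) < (1/2) ^ k" using assms unfolding Cauchy_def by simp
 then obtain N where N: "\<And>k m n. m \<ge> N k \<Longrightarrow> n \<ge> N k \<Longrightarrow> dist (X m) (X n) < (1/2) ^ k" by metis
 define r where "r = (\<lambda>k. (\<Sum>j\<le>k. N j) + k)"
 have r: "strict_mono r" by (rule strict_mono_Suc_iff[THEN iffD2]) (simp add: r_def)
 have ge: "N k \<le> r j" if "k \<le> j" for k j
  using member_le_sum[of k "{..j}" N] that by (simp add: r_def)
 have "dist (X (r (Suc k))) (X (r k)) < (1/2) ^ k" for k by (intro N ge) auto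
 then show ?thesis using r that by blast
qed

text \<open>The sums \<open>G n\<close> of the moduli of the increments have L_2 norm at most 2, by
  the geometric series. Monotone convergence makes their supremum finite almost everywhere, and
  there the series of increments converges absolutely.\<close>

lemma L2_convergent_subseq:
 fixes f :: "nat \<Rightarrow> ('d::finite) fn"
 assumes f: "\<And>k. sqint (f k)" and d: "\<And>k. norm (cls (f (Suc k)) - cls (f k)) < (1/2) ^ k"
 shows "AE x in lborel. convergent (\<lambda>k. f k x)"
proof -
 have [measurable]: "\<And>k. f k \<in> borel_measurable borel" using f by (simp add: sqint_def)
 define a where "a = (\<lambda>k x. cor (cmod (f (Suc k) x - f k x)))"
 have sa: "sqint (a k)" for k unfolding a_def sqint_sq
  by (rule sq_norm) (use sqint_diff[OF f f] in \<open>simp add: sqint_sq\<close>)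
 have na: "norm (cls (a k)) < (1/2) ^ k" for k
 proof -
  have "norm (cls (a k)) = norm (cls (f (Suc k)) - cls (f k))"
   by (simp add: L2_diff_cls f L2_norm_cls sa sqint_diff) (simp add: l2norm_def a_def)
  then show ?thesis using d by simp
 qed
 define G where "G = (\<lambda>n x. \<Sum>k<n. cmod (f (Suc k) x - f k x))"
 have G0: "0 \<le> G n x" for n x by (simp add: G_def sum_nonneg)
 have bound: "(\<integral>\<^sup>+x. ennreal ((G n x)^2) \<partial>lborel) \<le> ennreal 4" for n
 proof -
  have s: "(\<Sum>k<n. cls (a k)) = cls (\<lambda>x. \<Sum>k<n. a k x)" "sqint (\<lambda>x. \<Sum>k<n. a k x)"
   using L2_sum_cls[of "{..<n}" a] sa by auto
  have "norm (\<Sum>k<n. cls (a k)) \<le> (\<Sum>k<n. (1/2) ^ k)"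
   by (rule order_trans[OF norm_sum sum_mono]) (use na in \<open>auto intro: less_imp_le\<close>)
  also have "\<dots> \<le> 2" by (simp add: sum_gp_strict)
  finally have "(norm (\<Sum>k<n. cls (a k)))^2 \<le> 2\<^sup>2" by (intro power_mono) auto
  moreover have "(\<integral>\<^sup>+x. ennreal ((G n x)^2) \<partial>lborel) = ennreal ((norm (\<Sum>k<n. cls (a k)))^2)"
   unfolding s(1) L2_norm_nn[OF s(2), symmetric]
   by (simp add: G_def a_def del: of_real_sum flip: of_real_sum)
  moreover have "ennreal x \<le> ennreal 4" if "x \<le> 2\<^sup>2" for x :: real using that by (intro ennreal_leI) simp
  ultimately show ?thesis by (simp only:)
 qed
 have "(\<integral>\<^sup>+x. (SUP n. ennreal ((G n x)^2)) \<partial>lborel) = (SUP n. \<integral>\<^sup>+x. ennreal ((G n x)^2) \<partial>lborel)"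
 proof (rule nn_integral_monotone_convergence_SUP)
  show "incseq (\<lambda>n x. ennreal ((G n x)^2))"
   unfolding incseq_def le_fun_def using G0
   by (auto intro!: ennreal_leI power_mono sum_mono2 simp: G_def)
  show "(\<lambda>x. ennreal ((G n x)^2)) \<in> borel_measurable lborel" for n unfolding G_def by measurable
 qed
 also have "\<dots> \<le> ennreal 4" by (rule SUP_least) (rule bound)
 also have "\<dots> < \<infinity>" by simp
 finally have "AE x in lborel. (SUP n. ennreal ((G n x)^2)) \<noteq> \<infinity>"
  by (intro nn_integral_PInf_AE) (auto simp: G_def)
 then show ?thesis
 proof eventually_elim
  case (elim x)
  then obtain C where C: "(SUP n. ennreal ((G n x)^2)) = ennreal C" "C \<ge> 0" by (cases "(SUP n. ennreal ((G n x)^2))") auto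
  have "ennreal ((G n x)^2) \<le> ennreal C" for n unfolding C(1)[symmetric] by (rule SUP_upper) simp
  then have "(G n x)^2 \<le> C" for n using C(2) by (simp add: ennreal_le_iff)
  then have "G n x \<le> sqrt C" for n using G0 by (meson real_le_rsqrt)
  then have "summable (\<lambda>k. cmod (f (Suc k) x - f k x))"
   unfolding G_def by (intro summableI_nonneg_bounded[of _ "sqrt C"]) auto
  then have "summable (\<lambda>k. f (Suc k) x - f k x)" by (rule summable_norm_cancel)
  then have "convergent (\<lambda>n. \<Sum>k<n. f (Suc k) x - f k x)" by (simp add: summable_iff_convergent)
  then have "convergent (\<lambda>n. f n x - f 0 x)" by (simp only: sum_lessThan_telescope[of "\<lambda>k. f k x"])
  then have "convergent (\<lambda>n. (f n x - f 0 x) + f 0 x)" by (intro convergent_add convergent_const)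
  then show ?case by simp
 qed
qed

instance L2 :: (finite) complete_space
proof
 fix X :: "nat \<Rightarrow> 'a L2" assume X: "Cauchy X"
 obtain r :: "nat \<Rightarrow> nat" where r: "strict_mono r" "\<forall>k. dist (X (r (Suc k))) (X (r k)) < (1/2) ^ k"
  by (rule fast_subsequence[OF X])
 define f where "f = (\<lambda>k. rpf (X (r k)))"
 have f: "sqint (f k)" "cls (f k) = X (r k)" for k by (auto simp: f_def sqint_rpf)
 have [measurable]: "\<And>k. f k \<in> borel_measurable borel" using f(1) by (simp add: sqint_def)
 have conv: "AE x in lborel. convergent (\<lambda>k. f k x)"
  by (rule L2_convergent_subseq) (use r(2) in \<open>auto simp: f dist_norm\<close>)
 define F where "F = (\<lambda>x. lim (\<lambda>k. f k x))"
 have [measurable]: "F \<in> borel_measurable borel" unfolding F_def by measurable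
 have lim: "AE x in lborel. (\<lambda>k. f k x) \<longlonglongrightarrow> F x"
  using conv by eventually_elim (simp add: F_def convergent_LIMSEQ_iff)
 \<comment> \<open>Fatou's lemma turns the Cauchy bound into a bound for the almost-everywhere limit
   \<open>F\<close>.\<close>
 have est: "(\<integral>\<^sup>+x. ennreal ((cmod (F x - f k x))^2) \<partial>lborel) \<le> ennreal (e\<^sup>2)"
  if e: "e > 0" and N: "\<And>m. m \<ge> N \<Longrightarrow> norm (X (r m) - X (r k)) \<le> e" for e k N
 proof -
  have "(\<integral>\<^sup>+x. ennreal ((cmod (F x - f k x))^2) \<partial>lborel) = (\<integral>\<^sup>+x. liminf (\<lambda>m. ennreal ((cmod (f m x - f k x))^2)) \<partial>lborel)"
  proof (rule nn_integral_cong_AE)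
   show "AE x in lborel. ennreal ((cmod (F x - f k x))^2) = liminf (\<lambda>m. ennreal ((cmod (f m x - f k x))^2))"
    using lim
   proof eventually_elim
    case (elim x)
    have "(\<lambda>m. ennreal ((cmod (f m x - f k x))^2)) \<longlonglongrightarrow> ennreal ((cmod (F x - f k x))^2)"
     by (intro tendsto_ennrealI tendsto_intros elim)
    then show ?case by (intro lim_imp_Liminf[symmetric]) auto
   qed
  qed
  also have "\<dots> \<le> liminf (\<lambda>m. \<integral>\<^sup>+x. ennreal ((cmod (f m x - f k x))^2) \<partial>lborel)"
   by (rule nn_integral_liminf) simp
  also have "\<dots> = liminf (\<lambda>m. ennreal ((norm (X (r m) - X (r k)))^2))"
   using L2_norm_nn[OF sqint_diff[OF f(1) f(1)]] by (simp add: L2_diff_cls[OF f(1) f(1), symmetric] f)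
  also have "\<dots> \<le> liminf (\<lambda>m. ennreal (e\<^sup>2))"
   by (rule Liminf_mono) (auto simp: eventually_sequentially intro!: exI[of _ N] ennreal_leI power_mono N)
  also have "\<dots> = ennreal (e\<^sup>2)" by (simp add: Liminf_const)
  finally show ?thesis .
 qed
 have Cs: "\<exists>N. \<forall>m\<ge>N. \<forall>k\<ge>N. norm (X (r m) - X (r k)) \<le> e" if e: "e > 0" for e
 proof -
  obtain N where N: "\<And>m n. m \<ge> N \<Longrightarrow> n \<ge> N \<Longrightarrow> dist (X m) (X n) < e" using X e unfolding Cauchy_def by blast
  have "norm (X (r m) - X (r k)) \<le> e" if "m \<ge> N" "k \<ge> N" for m k
   using N[of "r m" "r k"] seq_suble[OF r(1), of m] seq_suble[OF r(1), of k] that by (simp add: dist_norm)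
  then show ?thesis by blast
 qed
 obtain N1 where N1: "\<forall>m\<ge>N1. \<forall>k\<ge>N1. norm (X (r m) - X (r k)) \<le> 1" using Cs[of 1] by auto
 have "(\<integral>\<^sup>+x. ennreal ((cmod (F x - f N1 x))^2) \<partial>lborel) \<le> ennreal (1\<^sup>2)"
  by (rule est[of 1 N1]) (use N1 in auto)
 then have s1: "sqint (\<lambda>x. F x - f N1 x)"
  unfolding sqint_sq by (intro sqI_nn) (auto simp: le_less_trans)
 have F: "sqint F" using sqint_add[OF s1 f(1)[of N1]] by simp
 have "(\<lambda>k. X (r k)) \<longlonglongrightarrow> cls F"
 proof (rule metric_LIMSEQ_I)
  fix e :: real assume e: "e > 0"
  then obtain N where N: "\<forall>m\<ge>N. \<forall>k\<ge>N. norm (X (r m) - X (r k)) \<le> e / 2" using Cs[of "e/2"] by auto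
  have "dist (X (r k)) (cls F) < e" if "k \<ge> N" for k
  proof -
   have "(\<integral>\<^sup>+x. ennreal ((cmod (F x - f k x))^2) \<partial>lborel) \<le> ennreal ((e/2)^2)"
    by (rule est[of _ N]) (use N e that in auto)
   then have "ennreal ((norm (cls F - X (r k)))^2) \<le> ennreal ((e/2)^2)"
    using L2_norm_nn[OF sqint_diff[OF F f(1)], of k] by (simp add: L2_diff_cls[OF F f(1), symmetric] f)
   then have "(norm (cls F - X (r k)))^2 \<le> (e/2)^2" by (simp add: ennreal_le_iff)
   then have "norm (cls F - X (r k)) \<le> e/2" by (rule power2_le_imp_le) (use e in simp)
   then show ?thesis using e by (simp add: dist_norm norm_minus_commute)
  qed
  then show "\<exists>N. \<forall>k\<ge>N. dist (X (r k)) (cls F) < e" by blast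
 qed
 then have "X \<longlonglongrightarrow> cls F" using Cauchy_converges_subseq[OF X r(1), of "cls F"] by (simp add: o_def)
 then show "convergent X" by (auto simp: convergent_def)
qed

instantiation L2 :: (finite) chilbert
begin

definition scaleC_L2 :: "complex \<Rightarrow> 'a L2 \<Rightarrow> 'a L2" where "scaleC_L2 a u = cls (\<lambda>x. a * rpf u x)"
definition cinner_L2 :: "'a L2 \<Rightarrow> 'a L2 \<Rightarrow> complex" where "cinner_L2 u v = l2inner (rpf u) (rpf v)"

lemma L2_scaleC_cls: assumes "sqint f" shows "a *C cls f = cls (\<lambda>x. a * f x)"
 unfolding scaleC_L2_def
proof (rule cls_cong)
 show "AE x in lborel. a * rpf (cls f) x = a * f x"
  using AE_rpf_cls[OF assms] by eventually_elim simp
qed (intro sqint_scale sqint_rpf assms)+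

lemma L2_cinner_cls: "sqint f \<Longrightarrow> sqint g \<Longrightarrow> cinner (cls f) (cls g) = l2inner f g"
 unfolding cinner_L2_def using l2inner_cong[OF sqint_rpf sqint_rpf _ _ rpf_cls rpf_cls, of f g] by simp

instance
proof
 fix u v w :: "'a L2" and a b :: complex and r :: real
 obtain f where f: "sqint f" "u = cls f" by (rule L2_cases)
 obtain g where g: "sqint g" "v = cls g" by (rule L2_cases)
 obtain h where h: "sqint h" "w = cls h" by (rule L2_cases)
 note cl = L2_add_cls L2_scaleR_cls L2_scaleC_cls L2_cinner_cls L2_norm_cls sqint_add sqint_scale
 show "a *C (u + v) = a *C u + a *C v" unfolding f g by (simp add: cl f g distrib_left)
 show "(a + b) *C u = a *C u + b *C u" unfolding f by (simp add: cl f distrib_right)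
 show "a *C b *C u = (a * b) *C u" unfolding f by (simp add: cl f mult.assoc)
 show "r *\<^sub>R u = cor r *C u" unfolding f by (simp add: cl f)
 show "cinner (u + v) w = cinner u w + cinner v w" unfolding f g h by (simp add: cl f g h l2inner_add_left)
 show "cinner (a *C u) v = a * cinner u v" unfolding f g by (simp add: cl f g l2inner_scale_left)
 show "cinner u v = cnj (cinner v u)" unfolding f g by (simp add: cl f g) (rule l2inner_commute)
 show "cinner u u = cor ((norm u)^2)" unfolding f by (simp add: cl f l2inner_self)
qed

end

section \<open>Operators on representatives\<close>

text \<open>Descends an operator on functions to classes; \<open>rop\<close> goes back by choosing
  representatives. Outside the square-integrable functions \<open>rop\<close> returns zero, so its
  values are always square integrable.\<close>

definition lop :: "('d::finite) op \<Rightarrow> 'd L2 \<Rightarrow> 'd L2" where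
 "lop A u = (THE v. aeq (A (rpf u)) (rpf v))"

definition rop :: "(('d::finite) L2 \<Rightarrow> 'd L2) \<Rightarrow> 'd op" where
 "rop T f = (if sqint f then rpf (T (cls f)) else (\<lambda>_. 0))"

lemma aeq_rpf_unique: "aeq h (rpf v) \<Longrightarrow> aeq h (rpf w) \<Longrightarrow> v = w"
 using cls_eq_iff[OF sqint_rpf sqint_rpf, of v w] aeq_trans[OF aeq_sym] by auto

lemma lop_eqI: "aeq (A (rpf u)) (rpf v) \<Longrightarrow> lop A u = v"
 unfolding lop_def by (rule the_equality) (auto dest: aeq_rpf_unique)

lemma is_bopD:
 assumes "is_bop A"
 shows "sqint f \<Longrightarrow> sqint (A f)" "sqint f \<Longrightarrow> sqint g \<Longrightarrow> aeq f g \<Longrightarrow> aeq (A f) (A g)"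
  "sqint f \<Longrightarrow> sqint g \<Longrightarrow> aeq (A (\<lambda>x. a * f x + b * g x)) (\<lambda>x. a * A f x + b * A g x)"
  "\<exists>C. \<forall>f. sqint f \<longrightarrow> l2norm (A f) \<le> C * l2norm f"
 using assms unfolding is_bop_def by blast+

lemma lop_cls: assumes "is_bop A" "sqint f" shows "lop A (cls f) = cls (A f)"
proof (rule lop_eqI)
 have "aeq (A (rpf (cls f))) (A f)" by (rule is_bopD(2)[OF assms(1) sqint_rpf assms(2) rpf_cls[OF assms(2)]])
 then show "aeq (A (rpf (cls f))) (rpf (cls (A f)))"
  using aeq_sym[OF rpf_cls[OF is_bopD(1)[OF assms]]] by (rule aeq_trans)
qed

lemma clinop_lop: assumes "is_bop A" shows "clinop (lop A)"
proof -
 obtain C where C: "\<And>f. sqint f \<Longrightarrow> l2norm (A f) \<le> C * l2norm f" using is_bopD(4)[OF assms] by blast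
 note bop = is_bopD[OF assms]
 have lin: "lop A (a *C u + b *C v) = a *C lop A u + b *C lop A v" for a b u v
 proof -
  obtain f where f: "sqint f" "u = cls f" by (rule L2_cases)
  obtain g where g: "sqint g" "v = cls g" by (rule L2_cases)
  have "lop A (a *C u + b *C v) = cls (A (\<lambda>x. a * f x + b * g x))"
   unfolding f g by (simp add: L2_scaleC_cls L2_add_cls sqint_scale f g lop_cls[OF assms] sqint_lin)
  also have "\<dots> = cls (\<lambda>x. a * A f x + b * A g x)"
   by (subst cls_eq_iff) (auto intro!: bop sqint_lin f g)
  also have "\<dots> = a *C lop A u + b *C lop A v"
   unfolding f g by (simp add: lop_cls[OF assms] f g L2_scaleC_cls L2_add_cls sqint_scale bop)
  finally show ?thesis .
 qed
 show ?thesis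
 proof (rule clinopI[of _ C])
  show "lop A (u + v) = lop A u + lop A v" for u v using lin[of 1 u 1 v] by simp
  show "lop A (a *C u) = a *C lop A u" for a u using lin[of a u 0 u] by simp
  show "norm (lop A u) \<le> C * norm u" for u
  proof -
   obtain f where f: "sqint f" "u = cls f" by (rule L2_cases)
   show ?thesis unfolding f by (simp add: lop_cls[OF assms] f L2_norm_cls bop C)
  qed
 qed
qed

lemma rop_sqint: "sqint (rop T f)"
 by (simp add: rop_def sqint_rpf sqint_zero)

lemma cls_rop: "sqint f \<Longrightarrow> cls (rop T f) = T (cls f)"
 by (simp add: rop_def)

lemma is_bop_rop: assumes "clinop T" shows "is_bop (rop T)"
proof -
 obtain K where K: "\<And>x. norm (T x) \<le> K * norm x" using clinop_bound[OF assms] by blast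
 have "aeq (rop T f) (rop T g)" if "sqint f" "sqint g" "aeq f g" for f g
  using that cls_eq_iff[of f g] by (simp add: rop_def aeq_refl)
 moreover have "aeq (rop T (\<lambda>x. a * f x + b * g x)) (\<lambda>x. a * rop T f x + b * rop T g x)" if "sqint f" "sqint g" for f g a b
 proof -
  have "cls (rop T (\<lambda>x. a * f x + b * g x)) = cls (\<lambda>x. a * rop T f x + b * rop T g x)"
   using that by (simp add: cls_rop sqint_lin L2_add_cls[symmetric] L2_scaleC_cls[symmetric] sqint_scale rop_sqint
     clinop_add[OF assms] clinop_scaleC[OF assms])
  then show ?thesis using cls_eq_iff[OF rop_sqint sqint_lin[OF rop_sqint rop_sqint]] by blast
 qed
 moreover have "l2norm (rop T f) \<le> K * l2norm f" if "sqint f" for f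
  using K[of "cls f"] that by (simp add: L2_norm_cls[symmetric] rop_sqint cls_rop)
 ultimately show ?thesis unfolding is_bop_def using rop_sqint by blast
qed

lemma lop_rop: assumes "clinop T" shows "lop (rop T) = T"
proof
 fix u show "lop (rop T) u = T u"
  using lop_cls[OF is_bop_rop[OF assms] sqint_rpf, of u] by (simp add: cls_rop sqint_rpf)
qed

lemma op_eqI: assumes "is_bop A" "is_bop B" "lop A = lop B" shows "op_eq A B"
 unfolding op_eq_def
proof (intro allI impI)
 fix f :: "'a fn" assume f: "sqint f"
 then have "cls (A f) = cls (B f)" using assms by (simp add: lop_cls[symmetric])
 then show "aeq (A f) (B f)" using cls_eq_iff[OF is_bopD(1)[OF assms(1) f] is_bopD(1)[OF assms(2) f]] by simp
qed

lemma lop_cong: assumes "op_eq A B" "is_bop A" shows "lop B = lop A"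
proof
 fix u show "lop B u = lop A u"
 proof (rule lop_eqI)
  have "aeq (B (rpf u)) (A (rpf u))" using assms(1) sqint_rpf aeq_sym unfolding op_eq_def by blast
  moreover have "lop A u = cls (A (rpf u))" using lop_cls[OF assms(2) sqint_rpf, of u] by simp
  ultimately show "aeq (B (rpf u)) (rpf (lop A u))"
   using aeq_trans[OF _ aeq_sym[OF rpf_cls[OF is_bopD(1)[OF assms(2) sqint_rpf]]]] by simp
 qed
qed

lemma is_bop_op_lin: assumes "is_bop A" "is_bop B"
 shows "is_bop (op_lin a A b B)" "lop (op_lin a A b B) = (\<lambda>u. a *C lop A u + b *C lop B u)"
proof -
 let ?T = "\<lambda>u. a *C lop A u + b *C lop B u"
 have T: "clinop ?T" by (rule clinop_lin[OF clinop_lop[OF assms(1)] clinop_lop[OF assms(2)]])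
 note A = is_bopD(1)[OF assms(1)] and B = is_bopD(1)[OF assms(2)]
 have s: "sqint (op_lin a A b B f)" if "sqint f" for f unfolding op_lin_def by (intro sqint_lin A B that)
 have c: "cls (op_lin a A b B f) = ?T (cls f)" if "sqint f" for f
  unfolding op_lin_def using that A B
  by (simp add: lop_cls assms L2_scaleC_cls L2_add_cls sqint_scale)
 obtain K where K: "\<And>u. norm (?T u) \<le> K * norm u" using clinop_bound[OF T] by blast
 show bop: "is_bop (op_lin a A b B)"
  unfolding is_bop_def
 proof (intro conjI allI impI)
  fix f g :: "'a fn" and p q :: complex assume fg: "sqint f \<and> sqint g"
  have "cls (op_lin a A b B (\<lambda>x. p * f x + q * g x)) = p *C cls (op_lin a A b B f) + q *C cls (op_lin a A b B g)"
   using fg by (simp only: c sqint_lin L2_add_cls[symmetric] L2_scaleC_cls[symmetric] sqint_scale clinop_add[OF T] clinop_scaleC[OF T])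
  then have "cls (op_lin a A b B (\<lambda>x. p * f x + q * g x)) = cls (\<lambda>x. p * op_lin a A b B f x + q * op_lin a A b B g x)"
   using fg by (simp only: L2_add_cls[symmetric] L2_scaleC_cls[symmetric] sqint_scale s)
  then show "aeq (op_lin a A b B (\<lambda>x. p * f x + q * g x)) (\<lambda>x. p * op_lin a A b B f x + q * op_lin a A b B g x)"
   using fg cls_eq_iff[OF s[OF sqint_lin] sqint_lin[OF s s]] by blast
 next
  fix f g :: "'a fn" assume fg: "sqint f \<and> sqint g \<and> aeq f g"
  then show "aeq (op_lin a A b B f) (op_lin a A b B g)"
   using cls_eq_iff[OF s s, of f g] c[of f] c[of g] cls_eq_iff[of f g] by simp
 next
  show "\<exists>C. \<forall>f. sqint f \<longrightarrow> l2norm (op_lin a A b B f) \<le> C * l2norm f"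
  proof (intro exI[of _ K] allI impI)
   fix f :: "'a fn" assume f: "sqint f"
   show "l2norm (op_lin a A b B f) \<le> K * l2norm f"
    using K[of "cls f"] f by (simp add: c[symmetric] L2_norm_cls s)
  qed
 qed (rule s)
 show "lop (op_lin a A b B) = ?T"
 proof
  fix u show "lop (op_lin a A b B) u = ?T u"
   using lop_cls[OF bop sqint_rpf, of u] c[OF sqint_rpf, of u] by simp
 qed
qed

lemma opnorm_bound: assumes "is_bop D" "sqint f" shows "l2norm (D f) \<le> opnorm D * l2norm f" "0 \<le> opnorm D"
proof -
 obtain C where C: "\<And>f. sqint f \<Longrightarrow> l2norm (D f) \<le> C * l2norm f" using is_bopD(4)[OF assms(1)] by blast
 let ?S = "{l2norm (D f) | f. sqint f \<and> l2norm f \<le> 1}"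
 have n0: "l2norm g \<ge> 0" for g :: "'a fn" by (simp add: l2norm_def integral_nonneg)
 have bdd: "bdd_above ?S"
 proof (rule bdd_aboveI[of _ "\<bar>C\<bar>"])
  fix y assume "y \<in> ?S"
  then obtain f where f: "sqint f" "l2norm f \<le> 1" "y = l2norm (D f)" by blast
  have "y \<le> \<bar>C\<bar> * l2norm f" using C[OF f(1)] mult_right_mono[OF abs_ge_self[of C] n0[of f]] f(3) by linarith
  also have "\<dots> \<le> \<bar>C\<bar>" using f(2) n0 by (simp add: mult_left_le)
  finally show "y \<le> \<bar>C\<bar>" .
 qed
 have up: "l2norm (D g) \<le> opnorm D" if "sqint g" "l2norm g \<le> 1" for g
  unfolding opnorm_def by (rule cSup_upper[OF _ bdd]) (use that in blast)
 have "l2norm (\<lambda>_::real^'a. 0) = 0" by (simp add: l2norm_def)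
 then show 0: "0 \<le> opnorm D" using up[OF sqint_zero] n0 order_trans by (metis zero_le_one)
 show "l2norm (D f) \<le> opnorm D * l2norm f"
 proof (cases "l2norm f = 0")
  case True then show ?thesis using C[OF assms(2)] by simp
 next
  case False
  then have p: "l2norm f > 0" using n0[of f] by simp
  define g where "g = (\<lambda>x. cor (1 / l2norm f) * f x)"
  have g: "sqint g" unfolding g_def by (rule sqint_scale[OF assms(2)])
  have cg: "cls g = cor (1 / l2norm f) *C cls f" unfolding g_def by (simp only: L2_scaleC_cls[OF assms(2)])
  have ng: "l2norm g \<le> 1"
   unfolding L2_norm_cls[OF g, symmetric] cg using p by (simp add: norm_scaleC L2_norm_cls[OF assms(2)] norm_divide)
  have "l2norm (D g) = norm (lop D (cls g))" by (simp add: lop_cls[OF assms(1) g] L2_norm_cls is_bopD(1)[OF assms(1) g])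
  also have "\<dots> = 1 / l2norm f * l2norm (D f)"
   using p by (simp add: cg clinop_scaleC[OF clinop_lop[OF assms(1)]] norm_scaleC lop_cls[OF assms] L2_norm_cls is_bopD(1)[OF assms] norm_divide)
  finally have "l2norm (D f) = l2norm f * l2norm (D g)" using p by (simp add: field_simps)
  also have "\<dots> \<le> l2norm f * opnorm D" by (intro mult_left_mono up g ng) (use p in simp)
  finally show ?thesis by (simp add: mult.commute)
 qed
qed

lemma opnorm_le: assumes "\<And>f. sqint f \<Longrightarrow> l2norm (D f) \<le> K * l2norm f" "0 \<le> K" shows "opnorm D \<le> K"
 unfolding opnorm_def
proof (rule cSup_least)
 show "{l2norm (D f) |f. sqint f \<and> l2norm f \<le> 1} \<noteq> {}" using sqint_zero
  by (auto intro!: exI[of _ "\<lambda>_. 0"] simp: l2norm_def)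
 fix y assume "y \<in> {l2norm (D f) |f. sqint f \<and> l2norm f \<le> 1}"
 then obtain f where f: "sqint f" "l2norm f \<le> 1" "y = l2norm (D f)" by blast
 have "y \<le> K * l2norm f" using assms(1)[OF f(1)] f(3) by simp
 also have "\<dots> \<le> K" using f(2) assms(2) by (simp add: mult_left_le)
 finally show "y \<le> K" .
qed

lemma rank_le_lop: assumes "is_bop F" shows "rank_le F n \<longleftrightarrow> rank_op (lop F) n"
proof
 assume "rank_le F n"
 then obtain g where g: "\<And>i. i < n \<Longrightarrow> sqint (g i)" "\<And>f. sqint f \<Longrightarrow> \<exists>c. aeq (F f) (\<lambda>x. \<Sum>i<n. c i * g i x)"
  unfolding rank_le_def by blast
 have *: "\<exists>c. lop F u = (\<Sum>i<n. c i *C cls (g i))" for u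
 proof -
  obtain c where c: "aeq (F (rpf u)) (\<lambda>x. \<Sum>i<n. c i * g i x)" using g(2)[OF sqint_rpf] by blast
  have s: "(\<Sum>i<n. cls (\<lambda>x. c i * g i x)) = cls (\<lambda>x. \<Sum>i<n. c i * g i x)" "sqint (\<lambda>x. \<Sum>i<n. c i * g i x)"
   using L2_sum_cls[of "{..<n}" "\<lambda>i x. c i * g i x"] g(1) sqint_scale by auto
  have "lop F u = cls (F (rpf u))" using lop_cls[OF assms sqint_rpf, of u] by simp
  also have "\<dots> = cls (\<lambda>x. \<Sum>i<n. c i * g i x)" using c s(2) cls_eq_iff is_bopD(1)[OF assms sqint_rpf] by blast
  also have "\<dots> = (\<Sum>i<n. c i *C cls (g i))" unfolding s(1)[symmetric] by (intro sum.cong) (auto simp: L2_scaleC_cls g)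
  finally show ?thesis by blast
 qed
 show "rank_op (lop F) n" unfolding rank_op_def by (intro exI[of _ "\<lambda>i. cls (g i)"] allI *)
next
 assume "rank_op (lop F) n"
 then obtain g where g: "\<And>u. \<exists>c. lop F u = (\<Sum>i<n. c i *C g i)" unfolding rank_op_def by blast
 show "rank_le F n" unfolding rank_le_def
 proof (intro exI[of _ "\<lambda>i. rpf (g i)"] conjI allI impI)
  show "sqint (rpf (g i))" for i by (rule sqint_rpf)
  fix f :: "'a fn" assume f: "sqint f"
  obtain c where c: "lop F (cls f) = (\<Sum>i<n. c i *C g i)" using g by blast
  have s: "(\<Sum>i<n. cls (\<lambda>x. c i * rpf (g i) x)) = cls (\<lambda>x. \<Sum>i<n. c i * rpf (g i) x)" "sqint (\<lambda>x. \<Sum>i<n. c i * rpf (g i) x)"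
   using L2_sum_cls[of "{..<n}" "\<lambda>i x. c i * rpf (g i) x"] sqint_scale[OF sqint_rpf] by auto
  have "cls (F f) = (\<Sum>i<n. c i *C cls (rpf (g i)))" using c lop_cls[OF assms f] by simp
  also have "\<dots> = (\<Sum>i<n. cls (\<lambda>x. c i * rpf (g i) x))" by (intro sum.cong refl L2_scaleC_cls sqint_rpf)
  also have "\<dots> = cls (\<lambda>x. \<Sum>i<n. c i * rpf (g i) x)" by (rule s(1))
  finally show "\<exists>c. aeq (F f) (\<lambda>x. \<Sum>i<n. c i * rpf (g i) x)" using cls_eq_iff[OF is_bopD(1)[OF assms f] s(2)] by blast
 qed
qed

lemma opnorm_diff:
 assumes "is_bop A" "is_bop F"
 shows "norm (lop A u - lop F u) \<le> opnorm (op_lin 1 A (-1) F) * norm u"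
  "(\<And>u. norm (lop A u - lop F u) \<le> K * norm u) \<Longrightarrow> 0 \<le> K \<Longrightarrow> opnorm (op_lin 1 A (-1) F) \<le> K"
proof -
 let ?D = "op_lin 1 A (-1) F"
 note D = is_bop_op_lin[OF assms, of 1 "-1"]
 have eq: "l2norm (?D f) = norm (lop A (cls f) - lop F (cls f))" if "sqint f" for f
 proof -
  have "l2norm (?D f) = norm (cls (?D f))" using L2_norm_cls[OF is_bopD(1)[OF D(1) that]] by simp
  also have "cls (?D f) = lop ?D (cls f)" using lop_cls[OF D(1) that] by simp
  finally show ?thesis unfolding D(2) by simp
 qed
 show "norm (lop A u - lop F u) \<le> opnorm ?D * norm u"
  using opnorm_bound(1)[OF D(1) sqint_rpf[of u]] eq[OF sqint_rpf, of u] L2_norm_cls[OF sqint_rpf, of u] by simp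
 show "opnorm ?D \<le> K" if K: "\<And>u. norm (lop A u - lop F u) \<le> K * norm u" "0 \<le> K"
  by (rule opnorm_le[OF _ K(2)]) (use K(1) in \<open>simp add: eq L2_norm_cls[symmetric]\<close>)
qed

lemma rank_op_zero: "rank_op (\<lambda>x. 0) n"
 unfolding rank_op_def by (intro exI[of _ "\<lambda>_. 0"] allI exI[of _ "\<lambda>_. 0"]) simp

lemma sing_val_set: fixes A :: "('d::finite) op" assumes "is_bop A"
 shows "{opnorm (op_lin 1 A (-1) F) | F. is_bop F \<and> rank_le F n} \<noteq> {}"
  "bdd_below {opnorm (op_lin 1 A (-1) F) | F. is_bop F \<and> rank_le F n}"
proof -
 let ?Z = "rop (\<lambda>x::'d L2. 0)"
 have b: "is_bop ?Z" by (rule is_bop_rop[OF clinop_zero])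
 moreover have "rank_le ?Z n" unfolding rank_le_lop[OF b] lop_rop[OF clinop_zero] by (rule rank_op_zero)
 ultimately show "{opnorm (op_lin 1 A (-1) F) | F. is_bop F \<and> rank_le F n} \<noteq> {}" by blast
 show "bdd_below {opnorm (op_lin 1 A (-1) F) | F. is_bop F \<and> rank_le F n}"
  by (rule bdd_belowI[of _ 0]) (use opnorm_bound(2)[OF is_bop_op_lin(1)[OF assms] sqint_zero] in blast)
qed

text \<open>Truncating the expansion attains the infimum, and \<open>schmidt_lower\<close> shows
  that nothing of rank \<open>n\<close> does better.\<close>

lemma sing_val_schmidt:
 assumes "is_bop A" "schmidt l f g" "lop A = dgo (\<lambda>i. cor (l i)) f g"
 shows "sing_val n A = l n"
proof (rule antisym)
 let ?S = "{opnorm (op_lin 1 A (-1) F) | F. is_bop F \<and> rank_le F n}"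
 have f: "osys f" "osys g" and l0: "\<And>i. 0 \<le> l i" and dec: "decseq l" using assms(2) by (auto simp: schmidt_def ons_osys)
 define T where "T = (\<lambda>x. \<Sum>i<n. (cor (l i) * cinner x (f i)) *C g i)"
 have T: "clinop T" "rank_op T n" unfolding T_def by (rule clinop_partial, rule rank_op_sum)
 have bT: "is_bop (rop T)" "lop (rop T) = T" using is_bop_rop[OF T(1)] lop_rop[OF T(1)] by auto
 have "opnorm (op_lin 1 A (-1) (rop T)) \<le> l n"
 proof (rule opnorm_diff(2)[OF assms(1) bT(1) _ l0])
  fix u
  have "norm (dgo (\<lambda>i. cor (l i)) f g u - T u) \<le> l n * norm u"
   unfolding T_def
   by (rule dgo_tail_norm[OF f _ l0 schmidt_Bseq[OF assms(2)]]) (use dec l0 in \<open>auto simp: decseq_def\<close>)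
  then show "norm (lop A u - lop (rop T) u) \<le> l n * norm u" by (simp only: bT(2) assms(3))
 qed
 moreover have "opnorm (op_lin 1 A (-1) (rop T)) \<in> ?S" using bT T(2) rank_le_lop[OF bT(1)] by auto
 ultimately show "sing_val n A \<le> l n" unfolding sing_val_def
  using cInf_lower[OF _ sing_val_set(2)[OF assms(1)]] order_trans by blast
 show "l n \<le> sing_val n A" unfolding sing_val_def
 proof (rule cInf_greatest[OF sing_val_set(1)[OF assms(1)]])
  fix y assume "y \<in> ?S"
  then obtain F where F: "is_bop F" "rank_le F n" "y = opnorm (op_lin 1 A (-1) F)" by blast
  show "l n \<le> y"
   by (rule schmidt_lower[OF assms(2) clinop_lop[OF F(1)]])
    (use F rank_le_lop[OF F(1)] opnorm_diff(1)[OF assms(1) F(1)] assms(3) in auto)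
 qed
qed

text \<open>The infimum in \<open>sing_val\<close> need not be attained by an approximant at hand,
  so one direction replaces C by C + 1 to gain strict room. In the other, compactness comes from
  \<open>wk_cpt\<close>.\<close>

lemma weak1_wk: fixes A :: "('d::finite) op" shows "weak1 A \<longleftrightarrow> is_bop A \<and> wk (lop A)"
proof
 assume w: "weak1 A"
 then have A: "is_bop A" by (simp add: weak1_def compact_op_def)
 obtain C where C: "\<And>n. (real n + 1) * sing_val n A \<le> C" using w unfolding weak1_def bdd_above_def by blast
 have "\<exists>F. clinop F \<and> rank_op F n \<and> (\<forall>u :: 'd L2. norm (lop A u - F u) \<le> (C + 1) / (real n + 1) * norm u)" for n
 proof -
  have "sing_val n A < (C + 1) / (real n + 1)" using C[of n] by (simp add: field_simps)
  then obtain y where "y \<in> {opnorm (op_lin 1 A (-1) F) | F. is_bop F \<and> rank_le F n}" "y < (C + 1) / (real n + 1)"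
   unfolding sing_val_def using cInf_lessD[OF sing_val_set(1)[OF A]] by blast
  then obtain F where F: "is_bop F" "rank_le F n" "opnorm (op_lin 1 A (-1) F) < (C + 1) / (real n + 1)" by blast
  have "norm (lop A u - lop F u) \<le> (C + 1) / (real n + 1) * norm u" for u :: "'d L2"
   using opnorm_diff(1)[OF A F(1), of u] mult_right_mono[OF less_imp_le[OF F(3)] norm_ge_zero[of u]] by linarith
  then show ?thesis using clinop_lop[OF F(1)] F(2) rank_le_lop[OF F(1)] by blast
 qed
 then show "is_bop A \<and> wk (lop A)" unfolding wk_def using A clinop_lop[OF A] by blast
next
 assume a: "is_bop A \<and> wk (lop A)"
 then have A: "is_bop A" and wk: "wk (lop A)" by auto
 obtain C where C: "\<And>n. \<exists>F. clinop F \<and> rank_op F n \<and> (\<forall>u :: 'd L2. norm (lop A u - F u) \<le> C / (real n + 1) * norm u)"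
  using wk unfolding wk_def by blast
 have "(real n + 1) * sing_val n A \<le> \<bar>C\<bar>" for n
 proof -
  obtain F where F: "clinop F" "rank_op F n" "\<And>u :: 'd L2. norm (lop A u - F u) \<le> C / (real n + 1) * norm u" using C by blast
  have bF: "is_bop (rop F)" "lop (rop F) = F" using is_bop_rop[OF F(1)] lop_rop[OF F(1)] by auto
  have "opnorm (op_lin 1 A (-1) (rop F)) \<le> \<bar>C\<bar> / (real n + 1)"
  proof (rule opnorm_diff(2)[OF A bF(1)])
   fix u :: "'d L2"
   have "C / (real n + 1) * norm u \<le> \<bar>C\<bar> / (real n + 1) * norm u" by (intro mult_right_mono divide_right_mono) auto
   then show "norm (lop A u - lop (rop F) u) \<le> \<bar>C\<bar> / (real n + 1) * norm u" using F(3)[of u] bF(2) by simp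
  qed simp
  moreover have "opnorm (op_lin 1 A (-1) (rop F)) \<in> {opnorm (op_lin 1 A (-1) F) | F. is_bop F \<and> rank_le F n}"
   using bF F(2) rank_le_lop[OF bF(1)] by auto
  ultimately have "sing_val n A \<le> \<bar>C\<bar> / (real n + 1)" unfolding sing_val_def
   using cInf_lower[OF _ sing_val_set(2)[OF A]] order_trans by blast
  then show ?thesis by (simp add: field_simps)
 qed
 then have "bdd_above (range (\<lambda>n. (real n + 1) * sing_val n A))" by (intro bdd_aboveI[of _ "\<bar>C\<bar>"]) auto
 moreover have "compact_op A" unfolding compact_op_def
 proof (intro conjI A allI impI)
  fix fs :: "nat \<Rightarrow> 'd fn" assume fs: "(\<forall>k. sqint (fs k)) \<and> bdd_above (range (\<lambda>k. l2norm (fs k)))"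
  then obtain K where "\<And>k. l2norm (fs k) \<le> K" by (auto simp: bdd_above_def)
  then have "bounded (range (\<lambda>k. cls (fs k)))" using fs by (auto simp: bounded_iff L2_norm_cls)
  then obtain r :: "nat \<Rightarrow> nat" where r: "strict_mono r" "convergent (\<lambda>k. lop A (cls (fs (r k))))"
   using wk_cpt[OF wk] unfolding cpt_def by blast
  have eq: "l2norm (\<lambda>x. A (fs m) x - A (fs n) x) = dist (lop A (cls (fs m))) (lop A (cls (fs n)))" for m n
   using fs by (simp add: lop_cls[OF A] dist_norm L2_diff_cls is_bopD(1)[OF A] L2_norm_cls sqint_diff)
  have "Cauchy (\<lambda>k. lop A (cls (fs (r k))))" using r(2) by (simp add: Cauchy_convergent_iff)
  then show "\<exists>r::nat\<Rightarrow>nat. strict_mono r \<and> (\<forall>\<epsilon>>0. \<exists>N. \<forall>m\<ge>N. \<forall>n\<ge>N. l2norm (\<lambda>x. A (fs (r m)) x - A (fs (r n)) x) < \<epsilon>)"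
   unfolding eq Cauchy_def using r(1) by (intro exI[of _ r] conjI) simp_all
 qed
 ultimately show "weak1 A" unfolding weak1_def by blast
qed

lemma posop_lop: "is_bop A \<Longrightarrow> pos_op A \<longleftrightarrow> posop (lop A)"
proof -
 assume A: "is_bop A"
 have eq: "l2inner (A f) f = cinner (lop A (cls f)) (cls f)" if "sqint f" for f
  using that by (simp add: lop_cls[OF A] L2_cinner_cls is_bopD(1)[OF A])
 have "(\<forall>f. sqint f \<longrightarrow> l2inner (A f) f \<in> \<real> \<and> 0 \<le> Re (l2inner (A f) f)) \<longleftrightarrow> (\<forall>u. Im (cinner (lop A u) u) = 0 \<and> 0 \<le> Re (cinner (lop A u) u))"
  by (metis eq complex_is_Real_iff cls_rpf sqint_rpf)
 then show ?thesis unfolding pos_op_def posop_def using A clinop_lop[OF A] by blast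
qed

lemma unitary_pair_lop: assumes "unitary_pair U V" shows "unit_pair (lop U) (lop V)"
proof -
 have U: "is_bop U" and V: "is_bop V" using assms by (auto simp: unitary_pair_def)
 note sU = is_bopD(1)[OF U] and sV = is_bopD(1)[OF V]
 have "norm (lop U u) = norm u \<and> lop V (lop U u) = u \<and> lop U (lop V u) = u" for u
 proof -
  obtain f where f: "sqint f" "u = cls f" by (rule L2_cases)
  have "l2norm (U f) = l2norm f" "aeq (V (U f)) f" "aeq (U (V f)) f" using assms f(1) by (auto simp: unitary_pair_def)
  then show ?thesis unfolding f(2) using f(1)
   by (simp add: lop_cls[OF U] lop_cls[OF V] sU sV L2_norm_cls cls_eq_iff)
 qed
 then show ?thesis unfolding unit_pair_def using clinop_lop[OF U] clinop_lop[OF V] by blast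
qed

lemma unitary_pair_rop: assumes "unit_pair U V" shows "unitary_pair (rop U) (rop V)"
proof -
 have U: "clinop U" "clinop V" "\<And>x. norm (U x) = norm x \<and> V (U x) = x \<and> U (V x) = x" using assms by (auto simp: unit_pair_def)
 have "l2norm (rop U f) = l2norm f \<and> aeq (rop V (rop U f)) f \<and> aeq (rop U (rop V f)) f" if "sqint f" for f
  using that U(3)[of "cls f"] by (simp add: cls_eq_iff[symmetric] rop_sqint cls_rop L2_norm_cls[symmetric])
 then show ?thesis unfolding unitary_pair_def using is_bop_rop U by blast
qed

lemma lop_comp: fixes A B :: "('d::finite) op" assumes "is_bop A" "is_bop B" shows "lop (A \<circ> B) = (\<lambda>u. lop A (lop B u))" "is_bop (A \<circ> B)"
proof -
 note A = is_bopD[OF assms(1)] and B = is_bopD[OF assms(2)]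
 obtain C where C: "\<And>f. sqint f \<Longrightarrow> l2norm (A f) \<le> C * l2norm f" using A(4) by blast
 obtain D where D: "\<And>f. sqint f \<Longrightarrow> l2norm (B f) \<le> D * l2norm f" using B(4) by blast
 show bop: "is_bop (A \<circ> B)" unfolding is_bop_def
 proof (intro conjI allI impI)
  fix f g :: "'d fn" and a b assume fg: "sqint f \<and> sqint g"
  have "aeq (A (B (\<lambda>x. a * f x + b * g x))) (A (\<lambda>x. a * B f x + b * B g x))"
   using fg by (intro A(2) B sqint_lin) auto
  also have "aeq (A (\<lambda>x. a * B f x + b * B g x)) (\<lambda>x. a * A (B f) x + b * A (B g) x)" using fg by (intro A(3) B(1)) auto
  finally (aeq_trans) show "aeq ((A \<circ> B) (\<lambda>x. a * f x + b * g x)) (\<lambda>x. a * (A \<circ> B) f x + b * (A \<circ> B) g x)" by simp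
 next
  show "\<exists>C. \<forall>f. sqint f \<longrightarrow> l2norm ((A \<circ> B) f) \<le> C * l2norm f"
  proof (intro exI[of _ "\<bar>C\<bar> * \<bar>D\<bar>"] allI impI)
   fix f :: "'d fn" assume f: "sqint f"
   have n0: "l2norm g \<ge> 0" for g :: "'d fn" by (simp add: l2norm_def integral_nonneg)
   have "l2norm (A (B f)) \<le> \<bar>C\<bar> * l2norm (B f)" using C[OF B(1)[OF f]] mult_right_mono[OF abs_ge_self[of C] n0] order_trans by blast
   also have "l2norm (B f) \<le> \<bar>D\<bar> * l2norm f" using D[OF f] mult_right_mono[OF abs_ge_self[of D] n0] order_trans by blast
   finally show "l2norm ((A \<circ> B) f) \<le> \<bar>C\<bar> * \<bar>D\<bar> * l2norm f" by (simp add: mult_left_mono mult.assoc)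
  qed
 qed (use A B in auto)
 show "lop (A \<circ> B) = (\<lambda>u. lop A (lop B u))"
 proof
  fix u :: "'d L2"
  obtain f where f: "sqint f" "u = cls f" by (rule L2_cases)
  show "lop (A \<circ> B) u = lop A (lop B u)"
   unfolding f using lop_cls[OF bop f(1)] by (simp add: lop_cls[OF assms(1)] lop_cls[OF assms(2)] f B(1))
 qed
qed

theorem ptrace_of_trace:
 fixes \<tau> :: "('d::finite) op \<Rightarrow> complex"
 assumes "pos_norm_trace \<tau>" shows "ptrace (\<lambda>T. \<tau> (rop T))" "weak1 A \<Longrightarrow> \<tau> A = \<tau> (rop (lop A))"
proof -
 note tr = assms[unfolded pos_norm_trace_def is_trace_def]
 have "\<forall>A B. weak1 A \<and> op_eq A B \<longrightarrow> \<tau> A = \<tau> B" using tr by (elim conjE)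
 then have eqD: "\<tau> A = \<tau> B" if "weak1 A" "op_eq A B" for A B using that by blast
 have "\<forall>A B a b. weak1 A \<and> weak1 B \<longrightarrow> \<tau> (op_lin a A b B) = a * \<tau> A + b * \<tau> B" using tr by (elim conjE)
 then have linD: "\<tau> (op_lin a A b B) = a * \<tau> A + b * \<tau> B" if "weak1 A" "weak1 B" for A B a b using that by simp
 have "\<forall>A U V. weak1 A \<and> unitary_pair U V \<longrightarrow> \<tau> (U \<circ> A \<circ> V) = \<tau> A" using tr by (elim conjE)
 then have unitD: "\<tau> (U \<circ> A \<circ> V) = \<tau> A" if "weak1 A" "unitary_pair U V" for A U V using that by simp
 have "\<forall>A. weak1 A \<and> pos_op A \<longrightarrow> \<tau> A \<in> \<real> \<and> 0 \<le> Re (\<tau> A)" using tr by (elim conjE)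
 then have posD: "\<tau> A \<in> \<real> \<and> 0 \<le> Re (\<tau> A)" if "weak1 A" "pos_op A" for A using that by simp
 have "\<forall>A. weak1 A \<and> pos_op A \<and> (\<forall>n. sing_val n A = 1 / (real n + 1)) \<longrightarrow> \<tau> A = 1" using tr by (elim conjE)
 then have oneD: "\<tau> A = 1" if "weak1 A" "pos_op A" "\<And>n. sing_val n A = 1 / (real n + 1)" for A using that by simp
 show "\<tau> A = \<tau> (rop (lop A))" if w: "weak1 A"
 proof (rule eqD[OF w op_eqI])
  show "is_bop A" using w by (simp add: weak1_wk)
  then show "is_bop (rop (lop A))" "lop A = lop (rop (lop A))"
   by (simp_all add: is_bop_rop clinop_lop lop_rop)
 qed
 have w: "weak1 (rop T)" if "wk T" for T :: "'d L2 \<Rightarrow> 'd L2"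
  using that is_bop_rop[OF wk_clinop[OF that]] lop_rop[OF wk_clinop[OF that]] by (simp add: weak1_wk)
 have b: "is_bop (rop T)" "lop (rop T) = T" if "wk T" for T :: "'d L2 \<Rightarrow> 'd L2"
  using that is_bop_rop[OF wk_clinop[OF that]] lop_rop[OF wk_clinop[OF that]] by auto
 show "ptrace (\<lambda>T. \<tau> (rop T))" unfolding ptrace_def
 proof (intro conjI allI impI)
  fix S T :: "'d L2 \<Rightarrow> 'd L2" and p q assume st: "wk S \<and> wk T"
  let ?L = "\<lambda>x. p *C S x + q *C T x"
  have wL: "wk ?L" using st wk_lin by blast
  note bS = b[OF conjunct1[OF st]] and bT = b[OF conjunct2[OF st]]
  note L = is_bop_op_lin[OF bS(1) bT(1), of p q, unfolded bS(2) bT(2)]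
  have "\<tau> (rop ?L) = \<tau> (op_lin p (rop S) q (rop T))"
   by (rule eqD[OF w[OF wL] op_eqI[OF b(1)[OF wL] L(1)]]) (simp only: L(2) b(2)[OF wL])
  also have "\<dots> = p * \<tau> (rop S) + q * \<tau> (rop T)" using w st by (intro linD) auto
  finally show "\<tau> (rop ?L) = p * \<tau> (rop S) + q * \<tau> (rop T)" .
 next
  fix T U V :: "'d L2 \<Rightarrow> 'd L2" assume tu: "wk T \<and> unit_pair U V"
  let ?L = "\<lambda>x. U (T (V x))"
  have wL: "wk ?L" using tu wk_unitary by blast
  have cl: "clinop U" "clinop V" using tu by (auto simp: unit_pair_def)
  note bT = b[OF conjunct1[OF tu]]
  note UT = lop_comp[OF is_bop_rop[OF cl(1)] bT(1), unfolded lop_rop[OF cl(1)] bT(2)]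
  note UTV = lop_comp[OF UT(2) is_bop_rop[OF cl(2)], unfolded UT(1) lop_rop[OF cl(2)]]
  have "\<tau> (rop ?L) = \<tau> (rop U \<circ> rop T \<circ> rop V)"
   by (rule eqD[OF w[OF wL] op_eqI[OF b(1)[OF wL] UTV(2)]]) (simp only: UTV(1) b(2)[OF wL])
  also have "\<dots> = \<tau> (rop T)"
   using w unitary_pair_rop tu by (intro unitD) auto
  finally show "\<tau> (rop ?L) = \<tau> (rop T)" .
 next
  fix T :: "'d L2 \<Rightarrow> 'd L2" assume T: "wk T \<and> posop T"
  have "pos_op (rop T)" using posop_lop[OF b(1)[OF conjunct1[OF T]]] b(2)[OF conjunct1[OF T]] T by simp
  then have "\<tau> (rop T) \<in> \<real> \<and> 0 \<le> Re (\<tau> (rop T))" using w T by (intro posD) auto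
  then show "Im (\<tau> (rop T)) = 0" "0 \<le> Re (\<tau> (rop T))" by (auto simp: complex_is_Real_iff)
 next
  fix u :: "nat \<Rightarrow> 'd L2" assume u: "ons u"
  let ?T = "dgo (\<lambda>i. cor (1 / (real i + 1))) u u"
  have wT: "wk ?T" by (rule wk_harmonic[OF u])
  have sch: "schmidt (\<lambda>i. 1 / (real i + 1)) u u"
  proof -
   have "(\<lambda>i. 1 / (real i + 1)) \<longlonglongrightarrow> 0" by real_asymp
   moreover have "decseq (\<lambda>i. 1 / (real i + 1))" by (auto simp: decseq_def field_simps)
   ultimately show ?thesis unfolding schmidt_def using u ons_osys[OF u] ons_norm[OF u] by auto
  qed
  have "posop ?T"
   by (rule dgo_posop[OF u schmidt_Bseq[OF sch]]) (simp_all only: Im_complex_of_real Re_complex_of_real, simp)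
  then have "pos_op (rop ?T)" using posop_lop[OF b(1)[OF wT]] b(2)[OF wT] by simp
  then show "\<tau> (rop ?T) = 1"
   by (rule oneD[OF w[OF wT]]) (rule sing_val_schmidt[OF b(1)[OF wT] sch b(2)[OF wT]])
 qed
qed

text \<open>For normalisation, a positive operator with singular values 1/(n+1) is, by the spectral
  theorem and \<open>sing_val_schmidt\<close>, the harmonic diagonal along some orthonormal
  sequence.\<close>

theorem trace_of_ptrace:
 fixes t :: "(('d::finite) L2 \<Rightarrow> 'd L2) \<Rightarrow> complex" and e :: "nat \<Rightarrow> 'd L2"
 assumes "ptrace t" "is_onb e" shows "pos_norm_trace (\<lambda>A. t (lop A))"
proof -
 note p = assms(1)[unfolded ptrace_def]
 show ?thesis unfolding pos_norm_trace_def is_trace_def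
 proof (intro conjI allI impI)
  fix A B :: "'d op" assume "weak1 A \<and> op_eq A B"
  then show "t (lop A) = t (lop B)" using lop_cong[of A B] by (simp add: weak1_wk)
 next
  fix A B :: "'d op" and a b assume "weak1 A \<and> weak1 B"
  then show "t (lop (op_lin a A b B)) = a * t (lop A) + b * t (lop B)"
   using is_bop_op_lin(2)[of A B a b] p by (simp add: weak1_wk)
 next
  fix A U V :: "'d op" assume a: "weak1 A \<and> unitary_pair U V"
  then have U: "is_bop U" "is_bop V" "is_bop A" by (auto simp: unitary_pair_def weak1_wk)
  have "lop (U \<circ> A \<circ> V) = (\<lambda>u. lop U (lop A (lop V u)))"
   using lop_comp(1)[OF lop_comp(2)[OF U(1,3)] U(2)] lop_comp(1)[OF U(1,3)] by simp
  moreover have "t (\<lambda>u. lop U (lop A (lop V u))) = t (lop A)"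
   using p unitary_pair_lop[of U V] a by (auto simp: weak1_wk)
  ultimately show "t (lop (U \<circ> A \<circ> V)) = t (lop A)" by simp
 next
  fix A :: "'d op" assume a: "weak1 A \<and> pos_op A"
  then have "wk (lop A) \<and> posop (lop A)" using posop_lop[of A] by (auto simp: weak1_wk)
  then show "t (lop A) \<in> \<real>" "0 \<le> Re (t (lop A))" using p by (auto simp: complex_is_Real_iff)
 next
  fix A :: "'d op" assume a: "weak1 A \<and> pos_op A \<and> (\<forall>n. sing_val n A = 1 / (real n + 1))"
  then have A: "is_bop A" "wk (lop A)" "posop (lop A)" using posop_lop[of A] by (auto simp: weak1_wk)
  obtain l u C where l: "schmidt l u u" "lop A = dgo (\<lambda>i. cor (l i)) u u" "\<forall>i. l i \<le> C / (real i + 1)"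
   by (rule wk_pos_spectral[OF A(2,3) assms(2)])
  have "l = (\<lambda>n. 1 / (real n + 1))" using sing_val_schmidt[OF A(1) l(1,2)] a by (simp add: fun_eq_iff)
  moreover have "ons u" using l(1) by (simp add: schmidt_def)
  ultimately show "t (lop A) = 1" using p l(2) by simp
 qed
qed

lemma onb_cls: assumes "onb e" shows "is_onb (\<lambda>k. cls (e k))" "sqint (e k)"
proof -
 have s: "sqint (e k)" for k using assms by (simp add: onb_def)
 show "sqint (e k)" by (rule s)
 show "is_onb (\<lambda>k. cls (e k))" unfolding is_onb_def
 proof (intro conjI allI impI)
  show "ons (\<lambda>k. cls (e k))" using assms by (simp add: ons_def L2_cinner_cls s onb_def)
  fix x assume x: "\<forall>k. cinner x (cls (e k)) = 0"
  obtain f where f: "sqint f" "x = cls f" by (rule L2_cases)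
  have "aeq f (\<lambda>_. 0)" using assms x f s unfolding onb_def by (simp add: L2_cinner_cls)
  then show "x = 0" unfolding f(2) zero_L2_def using cls_eq_iff[OF f(1) sqint_zero] by simp
 qed
qed

lemma onb_rpf: assumes "is_onb E" shows "onb (\<lambda>k. rpf (E k))"
proof -
 have "cinner (cls f) (E k) = l2inner f (rpf (E k))" if "sqint f" for f k
  using L2_cinner_cls[OF that sqint_rpf, of "E k"] by simp
 moreover have "cinner (E j) (E k) = l2inner (rpf (E j)) (rpf (E k))" for j k
  using L2_cinner_cls[OF sqint_rpf sqint_rpf, of "E j" "E k"] by simp
 ultimately show ?thesis using assms unfolding onb_def is_onb_def ons_def
  by (metis cls_eq_iff sqint_rpf sqint_zero zero_L2_def)
qed

text \<open>\<open>diag\<close> is a choice; boundedness of \<open>x\<close> gives it something to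
  choose, and its values on a basis determine a bounded operator.\<close>

lemma lop_diag:
 assumes "onb e" "Bseq x" shows "is_bop (diag e x)" "lop (diag e x) = dgo x (\<lambda>k. cls (e k)) (\<lambda>k. cls (e k))"
proof -
 let ?E = "\<lambda>k. cls (e k)"
 note E = onb_cls[OF assms(1)]
 have oE: "ons ?E" "osys ?E" using E(1) by (auto simp: is_onb_ons ons_osys)
 have cl: "clinop (dgo x ?E ?E)" by (rule dgo_clinop[OF oE(2) oE(2) assms(2)])
 have "\<exists>T. is_bop T \<and> (\<forall>k. aeq (T (e k)) (\<lambda>y. x k * e k y))"
 proof (intro exI[of _ "rop (dgo x ?E ?E)"] conjI is_bop_rop cl allI)
  fix k
  have "cls (rop (dgo x ?E ?E) (e k)) = cls (\<lambda>y. x k * e k y)"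
   by (simp add: cls_rop E(2) dgo_ons[OF oE assms(2)] L2_scaleC_cls)
  then show "aeq (rop (dgo x ?E ?E) (e k)) (\<lambda>y. x k * e k y)" using cls_eq_iff[OF rop_sqint sqint_scale[OF E(2)]] by blast
 qed
 then have d: "is_bop (diag e x) \<and> (\<forall>k. aeq (diag e x (e k)) (\<lambda>y. x k * e k y))"
  unfolding diag_def by (rule someI_ex)
 then show b: "is_bop (diag e x)" by blast
 show "lop (diag e x) = dgo x ?E ?E"
 proof
  fix u show "lop (diag e x) u = dgo x ?E ?E u"
  proof (rule clinop_eq_onb[OF E(1) clinop_lop[OF b] cl])
   fix k
   have "lop (diag e x) (cls (e k)) = cls (diag e x (e k))" by (rule lop_cls[OF b E(2)])
   also have "\<dots> = cls (\<lambda>y. x k * e k y)"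
    using d cls_eq_iff[OF is_bopD(1)[OF b E(2)] sqint_scale[OF E(2)]] by blast
   also have "\<dots> = dgo x ?E ?E (cls (e k))" by (simp add: dgo_ons[OF oE assms(2)] L2_scaleC_cls E(2))
   finally show "lop (diag e x) (cls (e k)) = dgo x ?E ?E (cls (e k))" .
  qed
 qed
qed

section \<open>Affine substitutions and a total family\<close>

lemma nn_affine:
 fixes f :: "'a::euclidean_space \<Rightarrow> ennreal"
 assumes [measurable]: "f \<in> borel_measurable borel" and c: "c \<noteq> 0"
 shows "(\<integral>\<^sup>+x. f x \<partial>lborel) = ennreal (\<bar>c\<bar> ^ DIM('a)) * (\<integral>\<^sup>+x. f (t + c *\<^sub>R x) \<partial>lborel)"
 by (subst lborel_affine[OF c, of t]) (simp add: nn_integral_density nn_integral_distr nn_integral_cmult)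

lemma lint_affine:
 fixes f :: "'a::euclidean_space \<Rightarrow> complex"
 assumes [measurable]: "f \<in> borel_measurable borel" and c: "c \<noteq> 0"
 shows "(LINT x|lborel. f x) = cor (\<bar>c\<bar> ^ DIM('a)) * (LINT x|lborel. f (t + c *\<^sub>R x))"
 by (subst lborel_affine[OF c, of t]) (simp add: integral_density integral_distr scaleR_conv_of_real)

lemma integrable_affine:
 fixes f :: "'a::euclidean_space \<Rightarrow> 'b::{banach, second_countable_topology}"
 assumes f: "integrable lborel f" and c: "c \<noteq> 0"
 shows "integrable lborel (\<lambda>x. f (t + c *\<^sub>R x))"
proof -
 have [measurable]: "f \<in> borel_measurable borel" using borel_measurable_integrable[OF f] by simp
 have "ennreal (\<bar>c\<bar> ^ DIM('a)) * (\<integral>\<^sup>+x. norm (f (t + c *\<^sub>R x)) \<partial>lborel) < \<infinity>"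
  using nn_affine[OF _ c, of "\<lambda>x. ennreal (norm (f x))" t] f by (simp add: integrable_iff_bounded)
 moreover have "ennreal (\<bar>c\<bar> ^ DIM('a)) \<noteq> 0" using c by (simp add: ennreal_eq_0_iff not_le)
 ultimately show ?thesis unfolding integrable_iff_bounded by (auto simp: ennreal_mult_less_top)
qed

lemma sqint_affine: assumes "sqint f" "c \<noteq> 0" shows "sqint (\<lambda>x. f (t + c *\<^sub>R x))"
proof -
 have [measurable]: "f \<in> borel_measurable borel" by (rule sqint_measurable[OF assms(1)])
 have "(\<lambda>x. f (t + c *\<^sub>R x)) \<in> borel_measurable borel" by measurable
 then show ?thesis using assms integrable_affine[of "\<lambda>x. (cmod (f x))\<^sup>2" c t] by (simp add: sqint_def)
qed

lemma sqint_indicator: "A \<in> sets borel \<Longrightarrow> emeasure lborel A < \<infinity> \<Longrightarrow> sqint (indicator A)"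
 unfolding sqint_def by (subst Bochner_Integration.integrable_cong[OF refl, of _ _ "indicator A :: _ \<Rightarrow> real"]) (auto simp: indicator_def)

lemma lint_indicator: "A \<in> sets borel \<Longrightarrow> emeasure lborel A < \<infinity> \<Longrightarrow> (LINT x|lborel. indicator A x) = cor (measure lborel A)"
proof -
 assume "A \<in> sets borel" "emeasure lborel A < \<infinity>"
 then have "(LINT x|lborel. cor (indicator A x)) = cor (measure lborel A)" by (subst integral_complex_of_real) simp
 moreover have "(LINT x|lborel. cor (indicator A x)) = (LINT x|lborel. indicator A x)"
  by (intro LINT_cong) (auto simp: indicator_def)
 ultimately show ?thesis by simp
qed

text \<open>Each property has its use: stability under intersection and exhaustion for uniqueness of
  measures, countability for common null sets, openness for continuity of translations. Finite
  intersections of basic open sets, cut by balls, have them all.\<close>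

lemma total_open_sets:
 obtains U :: "nat \<Rightarrow> ('a::euclidean_space) set" where "\<forall>n. open (U n) \<and> bounded (U n)" "Int_stable (range U)"
  "sets borel = sigma_sets UNIV (range U)" "\<exists>A::nat \<Rightarrow> 'a set. range A \<subseteq> range U \<and> (\<Union>i. A i) = UNIV"
proof -
 obtain B :: "'a set set" where B: "countable B" "topological_basis B" using ex_countable_basis by blast
 define C where "C = (\<lambda>(F, n). \<Inter>F \<inter> ball 0 (real n)) ` ({F. finite F \<and> F \<subseteq> B} \<times> (UNIV :: nat set))"
 have cC: "countable C" unfolding C_def using countable_Collect_finite_subset[OF B(1)] by (auto simp: conj_commute)
 have mem: "\<Inter>F \<inter> ball 0 (real n) \<in> C" if "finite F" "F \<subseteq> B" for F n
  unfolding C_def using that by (intro image_eqI[of _ _ "(F, n)"]) auto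
 have ne: "C \<noteq> {}" using mem[of "{}" 0] by auto
 define U where "U = from_nat_into C"
 have rU: "range U = C" unfolding U_def by (rule range_from_nat_into[OF ne cC])
 have opn: "open X \<and> bounded X" if "X \<in> C" for X
  using that topological_basis_open[OF B(2)] unfolding C_def by (auto intro!: open_Inter open_Int)
 have st: "Int_stable C"
 proof (rule Int_stableI)
  fix X Y assume "X \<in> C" "Y \<in> C"
  then obtain F n G m where X: "finite F" "F \<subseteq> B" "X = \<Inter>F \<inter> ball 0 (real n)" and Y: "finite G" "G \<subseteq> B" "Y = \<Inter>G \<inter> ball 0 (real m)"
   unfolding C_def by auto
  have "X \<inter> Y = \<Inter>(F \<union> G) \<inter> ball 0 (real (min n m))" unfolding X(3) Y(3) by (auto simp: of_nat_min)
  then show "X \<inter> Y \<in> C" using mem[of "F \<union> G" "min n m"] X Y by auto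
 qed
 have "sigma_sets UNIV C = sets borel"
 proof (rule antisym)
  show "sigma_sets UNIV C \<subseteq> sets borel"
  proof -
   have "C \<subseteq> sets borel" using opn by auto
   from sets.sigma_sets_subset[OF this] show ?thesis by simp
  qed
  have "sets borel = sigma_sets UNIV B"
   using borel_eq_countable_basis[OF B] by (metis sets_measure_of subset_Pow_Union top_greatest Pow_UNIV)
  also have "\<dots> \<subseteq> sigma_sets UNIV C"
  proof (rule sigma_sets_mono, rule subsetI)
   fix b assume b: "b \<in> B"
   have "b = (\<Union>n. \<Inter>{b} \<inter> ball 0 (real n))" using reals_Archimedean2 by fastforce
   also have "\<dots> \<in> sigma_sets UNIV C" by (intro sigma_sets.Union sigma_sets.Basic mem) (use b in auto)
   finally show "b \<in> sigma_sets UNIV C" .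
  qed
  finally show "sets borel \<subseteq> sigma_sets UNIV C" .
 qed
 moreover have "range (\<lambda>n. ball 0 (real n)) \<subseteq> C" using mem[of "{}"] by auto
 moreover have "(\<Union>n. ball (0::'a) (real n)) = UNIV" using reals_Archimedean2 by fastforce
 ultimately show ?thesis using that[of U] opn st rU by blast
qed

lemma emeasure_open_bounded: "bounded (U :: 'a::euclidean_space set) \<Longrightarrow> emeasure lborel U < \<infinity>"
 by (rule emeasure_bounded_finite)

text \<open>Real and imaginary parts are treated separately. Since \<open>ennreal\<close> sends
  negative numbers to 0, the densities of \<open>g\<close> and \<open>- g\<close> are its positive
  and negative parts; they agree on the generator, hence as measures, hence almost
  everywhere.\<close>

lemma total_indicators:
 fixes f :: "('d::finite) fn"
 assumes f: "sqint f" and U: "\<forall>n. open (U n) \<and> bounded (U n)" "Int_stable (range U)"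
  "sets borel = sigma_sets UNIV (range U)" "\<exists>A::nat \<Rightarrow> (real^'d) set. range A \<subseteq> range U \<and> (\<Union>i. A i) = UNIV"
  and z: "\<And>n. l2inner f (indicator (U n)) = 0"
 shows "aeq f (\<lambda>_. 0)"
proof -
 have [measurable]: "f \<in> borel_measurable borel" by (rule sqint_measurable[OF f])
 have Um[measurable]: "U n \<in> sets borel" for n using U(1) by auto
 have sU: "sqint (indicator (U n))" for n by (rule sqint_indicator) (use U(1) emeasure_open_bounded in auto)
 have int: "integrable lborel (\<lambda>x. f x * indicator (U n) x)" for n
  using sqint_inner_integrable[OF f sU[of n]] by (rule back_subst[of "integrable lborel"]) (auto simp: indicator_def)
 have fz: "(LINT x|lborel. f x * indicator (U n) x) = 0" for n
  using z[of n] unfolding l2inner_def by (rule back_subst[of "\<lambda>v. v = 0"]) (auto intro!: LINT_cong simp: indicator_def)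
 have key: "AE x in lborel. g x = 0"
  if g[measurable]: "g \<in> borel_measurable borel" and gi: "\<And>n. integrable lborel (\<lambda>x. g x * indicator (U n) x)"
   and g0: "\<And>n. (LINT x|lborel. g x * indicator (U n) x) = 0" for g :: "real^'d \<Rightarrow> real"
 proof -
  have em: "emeasure (density lborel (\<lambda>x. ennreal (h x))) (U n) = (\<integral>\<^sup>+x. ennreal (h x * indicator (U n) x) \<partial>lborel)"
   if [measurable]: "h \<in> borel_measurable borel" for h n
   by (subst emeasure_density) (auto intro!: nn_integral_cong simp: indicator_def)
  have fin: "(\<integral>\<^sup>+x. ennreal (g x * indicator (U n) x) \<partial>lborel) \<noteq> \<infinity>" "(\<integral>\<^sup>+x. ennreal (- g x * indicator (U n) x) \<partial>lborel) \<noteq> \<infinity>" for n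
   using gi[of n] unfolding real_integrable_def by auto
  have e2r: "enn2real (\<integral>\<^sup>+x. ennreal (g x * indicator (U n) x) \<partial>lborel) = enn2real (\<integral>\<^sup>+x. ennreal (- g x * indicator (U n) x) \<partial>lborel)" for n
   using g0[of n] unfolding real_lebesgue_integral_def[OF gi] by simp
  have eq: "(\<integral>\<^sup>+x. ennreal (g x * indicator (U n) x) \<partial>lborel) = (\<integral>\<^sup>+x. ennreal (- g x * indicator (U n) x) \<partial>lborel)" for n
  proof -
   have "a = b" if "enn2real a = enn2real b" "a \<noteq> \<infinity>" "b \<noteq> \<infinity>" for a b
    using that by (cases a; cases b) auto
   from this[OF e2r fin] show ?thesis .
  qed
  from U(4) obtain A :: "nat \<Rightarrow> (real^'d) set" where A: "range A \<subseteq> range U \<and> (\<Union>i. A i) = UNIV" by (rule exE)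
  have "density lborel (\<lambda>x. ennreal (g x)) = density lborel (\<lambda>x. ennreal (- g x))"
  proof (rule measure_eqI_generator_eq[OF U(2), where \<Omega> = UNIV and A = A])
   show "emeasure (density lborel (\<lambda>x. ennreal (g x))) X = emeasure (density lborel (\<lambda>x. ennreal (- g x))) X" if X: "X \<in> range U" for X
    using X em[of g] em[of "\<lambda>x. - g x"] eq by auto
   show "emeasure (density lborel (\<lambda>x. ennreal (g x))) (A i) \<noteq> \<infinity>" for i
   proof -
    obtain n where "A i = U n" using A by blast
    then show ?thesis using em[of g n] fin(1)[of n] by simp
   qed
  qed (use U(3) A in auto)
  then have "AE x in lborel. ennreal (g x) = ennreal (- g x)"
   by (intro sigma_finite_measure.density_unique[OF sigma_finite_lborel]) auto
  then show ?thesis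
  proof eventually_elim
   case (elim x)
   then show ?case by (cases "g x > 0"; cases "g x < 0") (auto simp: ennreal_neg)
  qed
 qed
 have "AE x in lborel. Re (f x) = 0"
 proof (rule key)
  show "integrable lborel (\<lambda>x. Re (f x) * indicator (U n) x)" for n
   using integrable_Re[OF int[of n]] by (rule back_subst[of "integrable lborel"]) (auto simp: indicator_def)
  show "(LINT x|lborel. Re (f x) * indicator (U n) x) = 0" for n
  proof -
   have "(LINT x|lborel. Re (f x) * indicator (U n) x) = (LINT x|lborel. Re (f x * indicator (U n) x))"
    by (intro LINT_cong) (auto simp: indicator_def)
   also have "\<dots> = Re (LINT x|lborel. f x * indicator (U n) x)" by (rule integral_Re[OF int])
   finally show ?thesis by (simp only: fz) simp
  qed
 qed simp
 moreover have "AE x in lborel. Im (f x) = 0"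
 proof (rule key)
  show "integrable lborel (\<lambda>x. Im (f x) * indicator (U n) x)" for n
   using integrable_Im[OF int[of n]] by (rule back_subst[of "integrable lborel"]) (auto simp: indicator_def)
  show "(LINT x|lborel. Im (f x) * indicator (U n) x) = 0" for n
  proof -
   have "(LINT x|lborel. Im (f x) * indicator (U n) x) = (LINT x|lborel. Im (f x * indicator (U n) x))"
    by (intro LINT_cong) (auto simp: indicator_def)
   also have "\<dots> = Im (LINT x|lborel. f x * indicator (U n) x)" by (rule integral_Im[OF int])
   finally show ?thesis by (simp only: fz) simp
  qed
 qed simp
 ultimately show ?thesis unfolding aeq_def by eventually_elim (simp add: complex_eq_iff)
qed

text \<open>Indicators of disjoint unit cubes along the main diagonal.\<close>

lemma L2_ons_exists: "\<exists>c :: nat \<Rightarrow> ('d::finite) L2. ons c"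
proof -
 define B where "B = (\<lambda>k::nat. box (real k *\<^sub>R (One :: real^'d)) ((real k + 1) *\<^sub>R One))"
 have m[measurable]: "B k \<in> sets borel" for k unfolding B_def by simp
 have em: "emeasure lborel (B k) = 1" for k
  unfolding B_def by (subst emeasure_lborel_box) (auto simp: inner_diff_left inner_sum_left_Basis algebra_simps)
 have s: "sqint (indicator (B k))" for k by (rule sqint_indicator) (simp_all add: em)
 have disj: "B j \<inter> B k = {}" if jk: "j < k" for j k
 proof -
  obtain b :: "real^'d" where b: "b \<in> Basis" using nonempty_Basis by blast
  have "\<not> (x \<in> B j \<and> x \<in> B k)" for x
  proof
   assume "x \<in> B j \<and> x \<in> B k"
   then have "x \<bullet> b < real j + 1" "real k < x \<bullet> b" using b by (auto simp: B_def mem_box inner_sum_left_Basis)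
   then show False using jk by linarith
  qed
  then show ?thesis by blast
 qed
 have "cinner (cls (indicator (B j))) (cls (indicator (B k))) = (if j = k then 1 else 0)" for j k
 proof -
  have "cinner (cls (indicator (B j))) (cls (indicator (B k))) = (LINT x|lborel. indicator (B j \<inter> B k) x)"
   unfolding L2_cinner_cls[OF s s] l2inner_def by (intro LINT_cong) (auto simp: indicator_def)
  also have "\<dots> = cor (measure lborel (B j \<inter> B k))"
  proof (rule lint_indicator)
   have "emeasure lborel (B j \<inter> B k) \<le> emeasure lborel (B k)" by (rule emeasure_mono) auto
   then show "emeasure lborel (B j \<inter> B k) < \<infinity>" using em[of k] by (auto intro: le_less_trans)
  qed simp
  also have "measure lborel (B j \<inter> B k) = (if j = k then 1 else 0)"
   using disj[of j k] disj[of k j] em[of k] by (cases j k rule: linorder_cases) (auto simp: measure_def Int_commute)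
  finally show ?thesis by simp
 qed
 then show ?thesis unfolding ons_def by (intro exI[of _ "\<lambda>k. cls (indicator (B k))"]) auto
qed

text \<open>The last clause is a density principle: a property that defines a closed subspace need
  only be checked on the indicators of the \<open>U n\<close>.\<close>

lemma L2_onb:
 obtains E :: "nat \<Rightarrow> ('d::finite) L2" and U :: "nat \<Rightarrow> (real^'d) set" where "is_onb E" "\<forall>n. open (U n) \<and> bounded (U n)"
  "\<forall>S. csub S \<longrightarrow> closed S \<longrightarrow> (\<forall>n. cls (indicator (U n)) \<in> S) \<longrightarrow> S = UNIV"
proof -
 obtain U :: "nat \<Rightarrow> (real^'d) set" where U: "\<forall>n. open (U n) \<and> bounded (U n)" "Int_stable (range U)"
  "sets borel = sigma_sets UNIV (range U)" "\<exists>A::nat \<Rightarrow> (real^'d) set. range A \<subseteq> range U \<and> (\<Union>i. A i) = UNIV"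
  by (rule total_open_sets)
 define b where "b = (\<lambda>n. cls (indicator (U n)) :: 'd L2)"
 have sU: "sqint (indicator (U n))" for n by (rule sqint_indicator) (use U(1) emeasure_open_bounded in auto)
 have tot: "x = 0" if "\<And>k. cinner x (b k) = 0" for x :: "'d L2"
 proof -
  obtain f where f: "sqint f" "x = cls f" by (rule L2_cases)
  have "l2inner f (indicator (U n)) = 0" for n using that[of n] by (simp add: b_def f L2_cinner_cls sU)
  then have "aeq f (\<lambda>_. 0)" by (rule total_indicators[OF f(1) U])
  then show ?thesis unfolding f(2) zero_L2_def using cls_eq_iff[OF f(1) sqint_zero] by simp
 qed
 obtain c :: "nat \<Rightarrow> 'd L2" where c: "ons c" using L2_ons_exists by blast
 obtain E where E: "is_onb E" "\<forall>S i. csub S \<longrightarrow> range b \<subseteq> S \<longrightarrow> E i \<in> S" by (rule onb_of_total[OF tot c])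
 have "S = UNIV" if "csub S" "closed S" "\<forall>n. cls (indicator (U n)) \<in> S" for S
  using closed_csub_total[OF E that(1,2)] that(3) by (auto simp: b_def)
 then show ?thesis using that[OF E(1) U(1)] by blast
qed

section \<open>Continuity of translations\<close>

text \<open>The change of variables formula applied to |f - g|^2 shows that the substitution
  preserves almost-everywhere equality.\<close>

lemma cls_shift_cong:
 assumes "sqint f" "sqint g" "aeq f g" "c \<noteq> 0" shows "cls (\<lambda>x. f (t + c *\<^sub>R x)) = cls (\<lambda>x. g (t + c *\<^sub>R x))"
proof (rule cls_cong[OF sqint_affine[OF assms(1,4)] sqint_affine[OF assms(2,4)]])
 note [measurable] = sqint_measurable[OF assms(1)] sqint_measurable[OF assms(2)]
 have z0: "(\<integral>\<^sup>+x. ennreal ((cmod (f x - g x))^2) \<partial>lborel) = 0"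
  using assms(3) unfolding aeq_def by (subst nn_integral_0_iff_AE) (auto elim: AE_mp)
 have "(\<integral>\<^sup>+x. ennreal ((cmod (f (t + c *\<^sub>R x) - g (t + c *\<^sub>R x)))^2) \<partial>lborel) = 0"
 proof -
  have 1: "(\<integral>\<^sup>+x. ennreal ((cmod (f x - g x))^2) \<partial>lborel)
    = ennreal (\<bar>c\<bar> ^ DIM(real^'a)) * (\<integral>\<^sup>+x. ennreal ((cmod (f (t + c *\<^sub>R x) - g (t + c *\<^sub>R x)))^2) \<partial>lborel)"
   by (rule nn_affine[OF _ assms(4)]) measurable
  have 2: "ennreal (\<bar>c\<bar> ^ DIM(real^'a)) \<noteq> 0" using assms(4) by (simp add: ennreal_eq_0_iff not_le)
  have "x = 0" if "y = 0" "y = z * x" "z \<noteq> 0" for x y z :: ennreal using that by simp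
  from this[OF z0 1 2] show ?thesis .
 qed
 then show "AE x in lborel. f (t + c *\<^sub>R x) = g (t + c *\<^sub>R x)"
  by (subst (asm) nn_integral_0_iff_AE) (auto elim: AE_mp simp: ennreal_eq_0_iff)
qed

definition trn :: "real^('d::finite) \<Rightarrow> 'd L2 \<Rightarrow> 'd L2" where "trn z u = cls (\<lambda>x. rpf u (z + 1 *\<^sub>R x))"

lemma trn_cls: "sqint f \<Longrightarrow> trn z (cls f) = cls (\<lambda>x. f (z + x))"
 unfolding trn_def using cls_shift_cong[OF sqint_rpf _ rpf_cls, of f 1 z] by simp

lemma sqint_trn: "sqint f \<Longrightarrow> sqint (\<lambda>x. f (z + x))" using sqint_affine[of f 1 z] by simp

lemma trn_lin: "trn z (a *C u + b *C v) = a *C trn z u + b *C trn z v"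
proof -
 obtain f where f: "sqint f" "u = cls f" by (rule L2_cases)
 obtain g where g: "sqint g" "v = cls g" by (rule L2_cases)
 show ?thesis unfolding f g by (simp add: L2_scaleC_cls L2_add_cls sqint_scale sqint_lin f g trn_cls sqint_trn)
qed

lemma norm_trn: "norm (trn z u) = norm u"
proof -
 obtain f where f: "sqint f" "u = cls f" by (rule L2_cases)
 note [measurable] = sqint_measurable[OF f(1)]
 have "ennreal ((norm (trn z u))^2) = ennreal ((norm u)^2)"
  unfolding f(2) trn_cls[OF f(1)] L2_norm_nn[OF sqint_trn[OF f(1)], symmetric] L2_norm_nn[OF f(1), symmetric]
  using nn_affine[of "\<lambda>x. ennreal ((cmod (f x))^2)" 1 z] by simp
 then have "(norm (trn z u))^2 = (norm u)^2" by (simp add: ennreal_inj)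
 then show ?thesis by (simp add: power2_eq_iff_nonneg)
qed

lemma trn_diff: "trn z (u - v) = trn z u - trn z v" using trn_lin[of z 1 u "-1" v] by simp

lemma trn_zero: "trn z 0 = 0" using trn_lin[of z 0 0 0 0] by simp

text \<open>The vectors with this property form a closed subspace, as translations are isometries.
  For the indicator of an open set the translates converge pointwise on the set, so the inner
  product with the original tends to the squared norm; equal norms then force norm
  convergence.\<close>

theorem trn_continuous:
 fixes u :: "('d::finite) L2" assumes Z: "Z \<longlonglongrightarrow> 0" shows "(\<lambda>k. trn (Z k) u) \<longlonglongrightarrow> u"
proof -
 obtain E :: "nat \<Rightarrow> 'd L2" and U :: "nat \<Rightarrow> (real^'d) set" where U: "\<forall>n. open (U n) \<and> bounded (U n)"
  and dense: "\<forall>S. csub S \<longrightarrow> closed S \<longrightarrow> (\<forall>n. cls (indicator (U n)) \<in> S) \<longrightarrow> S = (UNIV :: 'd L2 set)"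
  by (rule L2_onb)
 define S where "S = {u :: 'd L2. (\<lambda>k. trn (Z k) u) \<longlonglongrightarrow> u}"
 have lin: "a *C u + b *C v \<in> S" if "u \<in> S" "v \<in> S" for a b u v
  using that unfolding S_def trn_lin mem_Collect_eq by (intro tendsto_add tendsto_scaleC)
 have "(0::'d L2) \<in> S" by (simp add: S_def trn_zero)
 then have cs: "csub S" unfolding csub_def using lin[of _ _ 1 1] lin[of _ 0 _ 0] by auto
 have cl: "closed S"
  unfolding closed_sequential_limits
 proof (intro allI impI)
  fix f l assume fl: "(\<forall>n. f n \<in> S) \<and> f \<longlonglongrightarrow> l"
  then have f: "\<forall>n. f n \<in> S" and l: "f \<longlonglongrightarrow> l" by auto
  show "l \<in> S" unfolding S_def mem_Collect_eq
  proof (rule metric_LIMSEQ_I)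
   fix e :: real assume e: "e > 0"
   then obtain n where n: "dist (f n) l < e / 3" using metric_LIMSEQ_D[OF l, of "e/3"] by auto
   obtain N where N: "\<And>k. k \<ge> N \<Longrightarrow> dist (trn (Z k) (f n)) (f n) < e / 3"
    using metric_LIMSEQ_D[of "\<lambda>k. trn (Z k) (f n)" "f n" "e/3"] f e by (auto simp: S_def)
   have "dist (trn (Z k) l) l < e" if "k \<ge> N" for k
   proof -
    have "dist (trn (Z k) l) (trn (Z k) (f n)) = dist l (f n)"
     unfolding dist_norm trn_diff[symmetric] by (rule norm_trn)
    then show ?thesis using N[OF that] n dist_triangle[of "trn (Z k) l" l "trn (Z k) (f n)"]
      dist_triangle[of "trn (Z k) (f n)" l "f n"] by (simp add: dist_commute)
   qed
   then show "\<exists>N. \<forall>k\<ge>N. dist (trn (Z k) l) l < e" by blast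
  qed
 qed
 have mem: "cls (indicator (U n)) \<in> S" for n
 proof -
  let ?I = "indicator (U n) :: real^'d \<Rightarrow> complex"
  have o: "open (U n)" and Um[measurable]: "U n \<in> sets borel" using U by auto
  have fin: "emeasure lborel (U n) < \<infinity>" using U emeasure_open_bounded by auto
  have s: "sqint ?I" by (rule sqint_indicator[OF Um fin])
  let ?m = "measure lborel (U n)"
  have c: "cinner (trn (Z k) (cls ?I)) (cls ?I) = (LINT x|lborel. ?I (Z k + x) * ?I x)" for k
   unfolding trn_cls[OF s] L2_cinner_cls[OF sqint_trn[OF s] s] l2inner_def
   by (intro LINT_cong) (auto simp: indicator_def)
  have "(\<lambda>k. LINT x|lborel. ?I (Z k + x) * ?I x) \<longlonglongrightarrow> (LINT x|lborel. ?I x)"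
  proof (rule integral_dominated_convergence[where w = "indicator (U n)"])
   show "integrable lborel (indicator (U n) :: real^'d \<Rightarrow> real)" using fin by simp
   show "AE x in lborel. (\<lambda>k. ?I (Z k + x) * ?I x) \<longlonglongrightarrow> ?I x"
   proof (rule AE_I2)
    fix x
    show "(\<lambda>k. ?I (Z k + x) * ?I x) \<longlonglongrightarrow> ?I x"
    proof (cases "x \<in> U n")
     case True
     have "(\<lambda>k. Z k + x) \<longlonglongrightarrow> x" using tendsto_add[OF Z tendsto_const[of x]] by simp
     then have "\<forall>\<^sub>F k in sequentially. Z k + x \<in> U n" by (rule topological_tendstoD[OF _ o True])
     then have "\<forall>\<^sub>F k in sequentially. ?I (Z k + x) * ?I x = ?I x" by eventually_elim (simp add: True)
     then show ?thesis by (rule tendsto_eventually)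
    qed simp
   qed
   show "AE x in lborel. norm (?I (Z k + x) * ?I x) \<le> indicator (U n) x" for k
    by (rule AE_I2) (auto simp: indicator_def)
  qed measurable
  also have "(LINT x|lborel. ?I x) = cor ?m" by (rule lint_indicator[OF Um fin])
  finally have lim: "(\<lambda>k. cinner (trn (Z k) (cls ?I)) (cls ?I)) \<longlonglongrightarrow> cor ?m" unfolding c .
  have n2: "(norm (cls ?I))^2 = ?m"
  proof -
   have "(norm (cls ?I))^2 = (LINT x|lborel. indicator (U n) x)"
    unfolding L2_norm_sq[OF s] by (intro LINT_cong) (auto simp: indicator_def)
   then show ?thesis by simp
  qed
  have "(\<lambda>k. ?m - 2 * Re (cinner (trn (Z k) (cls ?I)) (cls ?I)) + ?m) \<longlonglongrightarrow> ?m - 2 * Re (cor ?m) + ?m"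
   by (intro tendsto_intros lim)
  then have "(\<lambda>k. (norm (trn (Z k) (cls ?I) - cls ?I))\<^sup>2) \<longlonglongrightarrow> 0"
   unfolding norm_diff_sq norm_trn n2 by simp
  from tendsto_real_sqrt[OF this] have "(\<lambda>k. norm (trn (Z k) (cls ?I) - cls ?I)) \<longlonglongrightarrow> 0" by simp
  then have "(\<lambda>k. trn (Z k) (cls ?I) - cls ?I) \<longlonglongrightarrow> 0" by (rule tendsto_norm_zero_cancel)
  from tendsto_add[OF this tendsto_const[of "cls ?I"]] show ?thesis by (simp add: S_def)
 qed
 have "S = UNIV" using dense cs cl mem by blast
 then show ?thesis unfolding S_def by blast
qed

section \<open>The Fourier integral\<close>

text \<open>Unnormalised, with the sign as a parameter: -1 gives \<open>fourier\<close>, 1 the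
  inverse transform up to (2 pi)^d, and complex conjugation exchanges the two.\<close>

definition fou :: "real \<Rightarrow> ('d::finite) fn \<Rightarrow> 'd fn" where
 "fou \<sigma> f s = (LINT x|lborel. iexp (\<sigma> * inner x s) * f x)"

lemma fourier_fou: "fourier = fou (-1)"
 by (simp add: fun_eq_iff fourier_def fou_def)

lemma norm_iexp: "cmod (iexp x) = 1" by (simp add: norm_exp_i_times)

lemma cnj_iexp: "cnj (iexp x) = iexp (- x)" by (simp add: exp_cnj)

lemma fou_kernel_integrable: "integrable lborel f \<Longrightarrow> integrable lborel (\<lambda>x. iexp (\<sigma> * inner x s) * f x)"
proof (rule LINT_dominated[of _ f])
 assume f: "integrable lborel f"
 then have [measurable]: "f \<in> borel_measurable borel" using borel_measurable_integrable by auto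
 show "(\<lambda>x. iexp (\<sigma> * inner x s) * f x) \<in> borel_measurable lborel" by measurable
 show "AE x in lborel. cmod (iexp (\<sigma> * inner x s) * f x) \<le> cmod (f x)" by (simp only: norm_mult norm_iexp) simp
qed

lemma fou_measurable [measurable]: "f \<in> borel_measurable borel \<Longrightarrow> fou \<sigma> f \<in> borel_measurable borel"
proof -
 assume [measurable]: "f \<in> borel_measurable borel"
 have "(\<lambda>s. LINT x|lborel. iexp (\<sigma> * inner x s) * f x) \<in> borel_measurable borel" by measurable
 then show ?thesis unfolding fou_def[abs_def] .
qed

lemma fou_bound: "cmod (fou \<sigma> f s) \<le> (LINT x|lborel. cmod (f x))"
proof -
 have "cmod (fou \<sigma> f s) \<le> (LINT x|lborel. cmod (iexp (\<sigma> * inner x s) * f x))" unfolding fou_def by (rule integral_norm_bound)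
 then show ?thesis by (simp only: norm_mult norm_iexp mult_1)
qed

lemma fou_lin:
 assumes "integrable lborel f" "integrable lborel g"
 shows "fou \<sigma> (\<lambda>x. a * f x + b * g x) s = a * fou \<sigma> f s + b * fou \<sigma> g s"
proof -
 have "fou \<sigma> (\<lambda>x. a * f x + b * g x) s = (LINT x|lborel. a * (iexp (\<sigma> * inner x s) * f x) + b * (iexp (\<sigma> * inner x s) * g x))"
  unfolding fou_def by (intro LINT_cong) (auto simp: algebra_simps)
 also have "\<dots> = a * fou \<sigma> f s + b * fou \<sigma> g s"
  unfolding fou_def using fou_kernel_integrable[OF assms(1), of \<sigma> s] fou_kernel_integrable[OF assms(2), of \<sigma> s] by simp
 finally show ?thesis .
qed

lemma fou_cnj: "fou \<sigma> (\<lambda>x. cnj (f x)) s = cnj (fou (- \<sigma>) f s)"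
proof -
 have "cnj (fou (- \<sigma>) f s) = (LINT x|lborel. cnj (iexp (- \<sigma> * inner x s) * f x))"
  unfolding fou_def by (rule Bochner_Integration.integral_cnj[symmetric])
 also have "\<dots> = fou \<sigma> (\<lambda>x. cnj (f x)) s"
  unfolding fou_def by (intro LINT_cong) (simp_all only: complex_cnj_mult cnj_iexp, simp_all)
 finally show ?thesis by simp
qed

lemma lborel_prod_integrable:
 fixes h :: "'a::euclidean_space \<Rightarrow> complex" and q :: "'b::euclidean_space \<Rightarrow> complex"
 assumes h: "integrable lborel h" and q: "integrable lborel q" and k[measurable]: "k \<in> borel_measurable (lborel \<Otimes>\<^sub>M lborel)"
  and b: "\<And>z. cmod (k z) \<le> cmod (h (fst z)) * cmod (q (snd z))"
 shows "integrable (lborel \<Otimes>\<^sub>M lborel) (k :: 'a \<times> 'b \<Rightarrow> complex)"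
proof -
 have [measurable]: "h \<in> borel_measurable borel" "q \<in> borel_measurable borel"
  using borel_measurable_integrable[OF h] borel_measurable_integrable[OF q] by auto
 have "integrable (lborel \<Otimes>\<^sub>M lborel) (\<lambda>z. h (fst z) * q (snd z))"
 proof (rule lborel_pair.Fubini_integrable)
  show "integrable lborel (\<lambda>x. LINT y|lborel. cmod (h (fst (x, y)) * q (snd (x, y))))"
   using h by (simp add: norm_mult)
  show "AE x in lborel. integrable lborel (\<lambda>y. h (fst (x, y)) * q (snd (x, y)))" using q by simp
 qed measurable
 then show ?thesis
  by (rule LINT_dominated) (use b in \<open>auto simp: norm_mult\<close>)
qed

lemma fou_multiplication:
 fixes h q :: "('d::finite) fn"
 assumes h: "integrable lborel h" and q: "integrable lborel q"
 shows "(LINT s|lborel. fou \<sigma> h s * q s) = (LINT x|lborel. h x * fou \<sigma> q x)"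
proof -
 have [measurable]: "h \<in> borel_measurable borel" "q \<in> borel_measurable borel"
  using borel_measurable_integrable[OF h] borel_measurable_integrable[OF q] by auto
 have i: "integrable (lborel \<Otimes>\<^sub>M lborel) (case_prod (\<lambda>x s. iexp (\<sigma> * inner x s) * h x * q s))"
  by (rule lborel_prod_integrable[OF h q]) (auto simp: norm_mult simp del: of_real_mult)
 have "(LINT s|lborel. fou \<sigma> h s * q s) = (LINT s|lborel. (LINT x|lborel. iexp (\<sigma> * inner x s) * h x * q s))"
  unfolding fou_def by simp
 also have "\<dots> = (LINT x|lborel. (LINT s|lborel. iexp (\<sigma> * inner x s) * h x * q s))" by (rule lborel_pair.Fubini_integral[OF i])
 also have "\<dots> = (LINT x|lborel. h x * fou \<sigma> q x)"
  unfolding fou_def Bochner_Integration.integral_mult_right_zero[symmetric]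
  by (intro LINT_cong refl) (simp add: inner_commute mult_ac)
 finally show ?thesis .
qed

section \<open>The Gaussian\<close>

text \<open>A rescaling of the characteristic function of the standard normal distribution.\<close>

lemma gaussian_1d:
 "integrable lborel (\<lambda>x. iexp (t * x) * cor (exp (- (x\<^sup>2) / 2)))"
 "(LINT x|lborel. iexp (t * x) * cor (exp (- (x\<^sup>2) / 2))) = cor (sqrt (2 * pi) * exp (- (t\<^sup>2) / 2))"
proof -
 have e: "iexp (t * x) * cor (exp (- (x\<^sup>2) / 2)) = cor (sqrt (2 * pi)) * (std_normal_density x *\<^sub>R iexp (t * x))" for x
  by (simp add: std_normal_density_def scaleR_conv_of_real)
 have "integrable lborel std_normal_density" by simp
 then have i: "integrable lborel (\<lambda>x. std_normal_density x *\<^sub>R iexp (t * x))"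
  by (rule LINT_dominated) (auto simp: norm_iexp simp del: of_real_mult)
 show "integrable lborel (\<lambda>x. iexp (t * x) * cor (exp (- (x\<^sup>2) / 2)))"
  unfolding e by (rule integrable_mult_right) (rule i)
 have "char std_normal_distribution t = (LINT x|lborel. std_normal_density x *\<^sub>R iexp (t * x))"
  unfolding char_def by (subst integral_density) auto
 then show "(LINT x|lborel. iexp (t * x) * cor (exp (- (x\<^sup>2) / 2))) = cor (sqrt (2 * pi) * exp (- (t\<^sup>2) / 2))"
  unfolding e integral_mult_right_zero by (simp add: char_std_normal_distribution)
qed

lemma lint_prod_Basis:
 fixes g :: "'a::euclidean_space \<Rightarrow> real \<Rightarrow> complex"
 assumes g: "\<And>b. b \<in> Basis \<Longrightarrow> integrable lborel (g b)"
 shows "integrable lborel (\<lambda>x::'a. \<Prod>b\<in>Basis. g b (x \<bullet> b))"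
  "(LINT x|(lborel::'a measure). (\<Prod>b\<in>Basis. g b (x \<bullet> b))) = (\<Prod>b\<in>Basis. (LINT t|lborel. g b t))"
proof -
 interpret product_sigma_finite "\<lambda>_::'a. lborel :: real measure" by standard
 have [measurable]: "b \<in> Basis \<Longrightarrow> g b \<in> borel_measurable borel" for b using borel_measurable_integrable[OF g] by auto
 let ?h = "\<lambda>f::'a \<Rightarrow> real. \<Sum>b\<in>Basis. f b *\<^sub>R b"
 have eq: "(\<Prod>b\<in>Basis. g b (?h f \<bullet> b)) = (\<Prod>b\<in>Basis. g b (f b))" for f
  by (intro prod.cong) (auto simp: inner_sum_left_Basis)
 show "integrable lborel (\<lambda>x::'a. \<Prod>b\<in>Basis. g b (x \<bullet> b))"
  unfolding lborel_eq[where 'a = 'a]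
  by (subst integrable_distr_eq) (auto simp: eq intro!: product_integrable_prod g)
 show "(LINT x|(lborel::'a measure). (\<Prod>b\<in>Basis. g b (x \<bullet> b))) = (\<Prod>b\<in>Basis. (LINT t|lborel. g b t))"
  unfolding lborel_eq[where 'a = 'a]
  by (subst integral_distr) (auto simp: eq intro!: product_integral_prod g)
qed

definition gau :: "real^('d::finite) \<Rightarrow> complex" where "gau s = cor (exp (- (norm s)\<^sup>2 / 2))"

lemma norm_sq_Basis: "(norm (x :: 'a::euclidean_space))^2 = (\<Sum>b\<in>Basis. (x \<bullet> b)\<^sup>2)"
 unfolding power2_norm_eq_inner by (subst euclidean_inner) (simp add: power2_eq_square)

lemma gau_prod: "iexp (\<sigma> * inner x s) * gau x = (\<Prod>b\<in>Basis. iexp (\<sigma> * (s \<bullet> b) * (x \<bullet> b)) * cor (exp (- ((x \<bullet> b)^2) / 2)))"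
proof -
 have 1: "\<sigma> * inner x s = (\<Sum>b\<in>Basis. \<sigma> * (s \<bullet> b) * (x \<bullet> b))" by (subst euclidean_inner) (simp add: sum_distrib_left mult_ac)
 have 2: "- (norm x)\<^sup>2 / 2 = (\<Sum>b\<in>Basis. - ((x \<bullet> b)^2) / 2)"
  unfolding norm_sq_Basis by (simp add: sum_negf sum_divide_distrib)
 show ?thesis unfolding gau_def 1 2 prod.distrib by (simp add: exp_sum sum_distrib_left)
qed

lemma gau_integrable: "integrable lborel (gau :: real^('d::finite) \<Rightarrow> complex)" and gau_fou: "fou \<sigma> gau s = cor (sqrt (2 * pi) ^ CARD('d)) * gau (\<sigma> *\<^sub>R (s :: real^('d::finite)))"
proof -
 have i: "integrable lborel (\<lambda>x. iexp (\<sigma> * inner x s) * gau x)" for s :: "real^'d" and \<sigma>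
  unfolding gau_prod
  by (rule lint_prod_Basis(1)[where g = "\<lambda>b t. iexp (\<sigma> * (s \<bullet> b) * t) * cor (exp (- (t\<^sup>2) / 2))"]) (rule gaussian_1d(1))
 show "integrable lborel (gau :: real^'d \<Rightarrow> complex)" using i[of 0 0] by simp
 have "fou \<sigma> gau s = (\<Prod>b\<in>Basis. (LINT t|lborel. iexp (\<sigma> * (s \<bullet> b) * t) * cor (exp (- (t\<^sup>2) / 2))))"
  unfolding fou_def gau_prod
  by (rule lint_prod_Basis(2)[where g = "\<lambda>b t. iexp (\<sigma> * (s \<bullet> b) * t) * cor (exp (- (t\<^sup>2) / 2))"]) (rule gaussian_1d(1))
 also have "\<dots> = (\<Prod>b\<in>(Basis :: (real^'d) set). cor (sqrt (2 * pi) * exp (- ((\<sigma> * (s \<bullet> b))^2) / 2)))"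
  by (simp only: gaussian_1d(2))
 also have "\<dots> = cor (sqrt (2 * pi) ^ CARD('d)) * gau (\<sigma> *\<^sub>R s)"
 proof -
  have "(\<Prod>b\<in>(Basis :: (real^'d) set). exp (- ((\<sigma> * (s \<bullet> b))^2) / 2)) = exp (- (norm (\<sigma> *\<^sub>R s))\<^sup>2 / 2)"
   unfolding norm_sq_Basis by (simp add: exp_sum[symmetric] sum_negf sum_divide_distrib)
  then show ?thesis unfolding gau_def by (simp add: prod.distrib of_real_prod[symmetric] del: of_real_prod)
 qed
 finally show "fou \<sigma> gau s = cor (sqrt (2 * pi) ^ CARD('d)) * gau (\<sigma> *\<^sub>R s)" .
qed

section \<open>The Plancherel theorem\<close>

lemma sqrt_power_sq: "(sqrt (2 * pi) ^ n)^2 = (2 * pi) ^ n"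
 by (subst power2_eq_square, subst power_mult_distrib[symmetric]) simp

lemma gau_scaled_integrable: "a \<noteq> 0 \<Longrightarrow> integrable lborel (\<lambda>s. gau (a *\<^sub>R s))"
 using integrable_affine[OF gau_integrable, of a 0] by simp

lemma gau_measurable [measurable]: "gau \<in> borel_measurable borel"
 using borel_measurable_integrable[OF gau_integrable] by simp

lemma gau_scaled_fou:
 fixes z :: "real^('d::finite)" assumes a: "a > 0"
 shows "cor (a ^ CARD('d)) * fou 1 (\<lambda>s. gau (a *\<^sub>R s)) (a *\<^sub>R z) = cor (sqrt (2 * pi) ^ CARD('d)) * gau z"
proof -
 have "fou 1 gau z = (LINT s|lborel. iexp (1 * inner s z) * gau s)" by (simp add: fou_def)
 also have "\<dots> = cor (\<bar>a\<bar> ^ DIM(real^'d)) * (LINT s|lborel. iexp (1 * inner (0 + a *\<^sub>R s) z) * gau (0 + a *\<^sub>R s))"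
  by (rule lint_affine) (use a in auto)
 also have "\<dots> = cor (a ^ CARD('d)) * fou 1 (\<lambda>s. gau (a *\<^sub>R s)) (a *\<^sub>R z)"
  using a by (simp add: fou_def mult_ac)
 finally show ?thesis using gau_fou[of 1 z] by simp
qed

lemma bounded_mult_integrable:
 fixes g :: "'a::euclidean_space \<Rightarrow> complex"
 assumes [measurable]: "b \<in> borel_measurable borel" and g: "integrable lborel g" and B: "\<And>x. cmod (b x) \<le> K"
 shows "integrable lborel (\<lambda>x. b x * g x)"
proof (rule LINT_dominated[of _ "\<lambda>x. cor K * g x"])
 note [measurable] = borel_measurable_integrable[OF g]
 show "(\<lambda>x. b x * g x) \<in> borel_measurable lborel" by measurable
 show "AE x in lborel. cmod (b x * g x) \<le> cmod (cor K * g x)"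
  using B order_trans[OF norm_ge_zero B] by (intro AE_I2) (auto simp: norm_mult intro!: mult_right_mono)
qed (use g in simp)

lemma trn_correlation_bound: "cmod (cinner u (trn z u)) \<le> (norm u)^2"
 using cinner_CS[of u "trn z u"] by (simp add: norm_trn power2_eq_square)

lemma trn_correlation:
 "sqint f \<Longrightarrow> cinner (cls f) (trn z (cls f)) = (LINT x|lborel. f x * cnj (f (z + x)))"
 by (simp add: trn_cls L2_cinner_cls sqint_trn l2inner_def)

lemma cnj_measurable [measurable]: "f \<in> borel_measurable M \<Longrightarrow> (\<lambda>x. cnj (f x)) \<in> borel_measurable M"
 using measurable_compose[of f M borel cnj borel] borel_measurable_continuous_onI[OF continuous_on_cnj[OF continuous_on_id]] by auto

lemma correlation_integrable:
 fixes f :: "('d::finite) fn"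
 assumes f: "sqint f"
 shows "integrable (lborel \<Otimes>\<^sub>M lborel) (\<lambda>(z, x). gau z * (f x * cnj (f (a *\<^sub>R z + x))))"
proof (rule lborel_pair.Fubini_integrable)
 note [measurable] = sqint_measurable[OF f]
 let ?N = "(norm (cls f))^2"
 have i: "integrable lborel (\<lambda>x. f x * cnj (f (z + x)))" for z by (rule sqint_inner_integrable[OF f sqint_trn[OF f]])
 show "(\<lambda>(z, x). gau z * (f x * cnj (f (a *\<^sub>R z + x)))) \<in> borel_measurable (lborel \<Otimes>\<^sub>M lborel)" by measurable
 show "AE z in lborel. integrable lborel (\<lambda>x. case (z, x) of (z, x) \<Rightarrow> gau z * (f x * cnj (f (a *\<^sub>R z + x))))"
  unfolding prod.case by (intro AE_I2 integrable_mult_right i)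
 show "integrable lborel (\<lambda>z. LINT x|lborel. norm (case (z, x) of (z, x) \<Rightarrow> gau z * (f x * cnj (f (a *\<^sub>R z + x)))))"
 proof (rule LINT_dominated[of _ "\<lambda>z. ?N * cmod (gau z)"])
  show "(\<lambda>z. LINT x|lborel. norm (case (z, x) of (z, x) \<Rightarrow> gau z * (f x * cnj (f (a *\<^sub>R z + x))))) \<in> borel_measurable lborel"
   by measurable
  show "AE z in lborel. norm (LINT x|lborel. norm (case (z, x) of (z, x) \<Rightarrow> gau z * (f x * cnj (f (a *\<^sub>R z + x))))) \<le> norm (?N * cmod (gau z))"
  proof (rule AE_I2)
   fix z
   let ?g = "\<lambda>x. f (a *\<^sub>R z + x)"
   have sg: "sqint ?g" by (rule sqint_trn[OF f])
   have Ng: "(LINT x|lborel. (cmod (?g x))\<^sup>2) = ?N"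
    unfolding L2_norm_sq[OF sg, symmetric] trn_cls[OF f, symmetric] norm_trn by (rule refl)
   have "(LINT x|lborel. cmod (f x) * cmod (?g x)) \<le> (LINT x|lborel. ((cmod (f x))^2 + (cmod (?g x))^2) / 2)"
   proof (rule integral_mono)
    show "integrable lborel (\<lambda>x. cmod (f x) * cmod (?g x))" using integrable_norm[OF i[of "a *\<^sub>R z"]] by (simp add: norm_mult)
    show "integrable lborel (\<lambda>x. ((cmod (f x))^2 + (cmod (?g x))^2) / 2)" using f sg by (simp add: sqint_def)
    show "cmod (f x) * cmod (?g x) \<le> ((cmod (f x))^2 + (cmod (?g x))^2) / 2" for x
     using two_mult_le_sq[of "cmod (f x)" "cmod (?g x)"] by simp
   qed
   also have "\<dots> = ?N" using f sg Ng L2_norm_sq[OF f] by (simp add: sqint_def)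
   finally have b: "(LINT x|lborel. cmod (f x) * cmod (?g x)) \<le> ?N" .
   have "(LINT x|lborel. norm (gau z * (f x * cnj (?g x)))) = cmod (gau z) * (LINT x|lborel. cmod (f x) * cmod (?g x))"
    by (simp add: norm_mult)
   then show "norm (LINT x|lborel. norm (case (z, x) of (z, x) \<Rightarrow> gau z * (f x * cnj (f (a *\<^sub>R z + x))))) \<le> norm (?N * cmod (gau z))"
    using mult_left_mono[OF b, of "cmod (gau z)"] by (simp add: integral_nonneg abs_mult mult.commute)
  qed
 qed (intro integrable_mult_right integrable_norm gau_integrable)
qed

text \<open>Gaussian regularisation. The weight makes Fubini legitimate, and its own transform
  concentrates at the origin, so the integral becomes a Gaussian average of the autocorrelation of
  \<open>f\<close> at scale \<open>a\<close>; letting \<open>a\<close> tend to 0 gives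
  Plancherel.\<close>

lemma plancherel_gauss:
 fixes f :: "('d::finite) fn"
 assumes f: "l1l2 f" and a: "a > 0"
 shows "(LINT s|lborel. fou (-1) f s * (cnj (fou (-1) f s) * gau (a *\<^sub>R s)))
  = cor (sqrt (2 * pi) ^ CARD('d)) * (LINT z|lborel. gau z * cinner (cls f) (trn (a *\<^sub>R z) (cls f)))"
proof -
 have fi: "integrable lborel f" and fs: "sqint f" using f by (auto simp: l1l2_def)
 note [measurable] = sqint_measurable[OF fs]
 let ?c = "cor (sqrt (2 * pi) ^ CARD('d))"
 let ?W = "fou 1 (\<lambda>s :: real^'d. gau (a *\<^sub>R s))"
 have gi: "integrable lborel (\<lambda>s :: real^'d. gau (a *\<^sub>R s))" using a by (intro gau_scaled_integrable) simp
 have qi: "integrable lborel (\<lambda>s. cnj (fou (-1) f s) * gau (a *\<^sub>R s))"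
  by (rule bounded_mult_integrable[OF _ gi, where K = "LINT x|lborel. cmod (f x)"]) (simp_all add: fou_bound)
 have ei: "integrable lborel (\<lambda>s :: real^'d. iexp (- 1 * inner s x) * gau (a *\<^sub>R s))" for x
 proof -
  have m: "(\<lambda>s :: real^'d. iexp (- 1 * inner s x)) \<in> borel_measurable borel" by measurable
  show ?thesis by (rule bounded_mult_integrable[OF m gi, where K = 1]) (simp only: norm_iexp order_refl)
 qed
 have ci: "integrable lborel (\<lambda>x. cnj (f x))" using fi by simp
 have 2: "fou (-1) (\<lambda>s. cnj (fou (-1) f s) * gau (a *\<^sub>R s)) x = ?c * (LINT z|lborel. gau z * cnj (f (a *\<^sub>R z + x)))" for x
 proof -
  have "fou (-1) (\<lambda>s. cnj (fou (-1) f s) * gau (a *\<^sub>R s)) x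
    = (LINT s|lborel. fou 1 (\<lambda>x. cnj (f x)) s * (iexp (- 1 * inner s x) * gau (a *\<^sub>R s)))"
   unfolding fou_def[of "-1" _ x] fou_cnj by (intro LINT_cong refl) (simp only: mult_ac)
  also have "\<dots> = (LINT y|lborel. cnj (f y) * fou 1 (\<lambda>s. iexp (- 1 * inner s x) * gau (a *\<^sub>R s)) y)"
   by (rule fou_multiplication[OF ci ei])
  also have "\<dots> = (LINT y|lborel. cnj (f y) * ?W (y - x))"
  proof (intro LINT_cong refl arg_cong2[of _ _ _ _ "(*)"])
   fix y
   show "fou 1 (\<lambda>s. iexp (- 1 * inner s x) * gau (a *\<^sub>R s)) y = ?W (y - x)"
    unfolding fou_def by (intro LINT_cong refl) (simp add: inner_diff_right exp_add[symmetric] algebra_simps flip: mult.assoc)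
  qed
  also have "\<dots> = cor (\<bar>a\<bar> ^ DIM(real^'d)) * (LINT z|lborel. cnj (f (x + a *\<^sub>R z)) * ?W (x + a *\<^sub>R z - x))"
   by (rule lint_affine) (use a in auto)
  also have "\<dots> = (LINT z|lborel. cnj (f (x + a *\<^sub>R z)) * (cor (a ^ CARD('d)) * ?W (a *\<^sub>R z)))"
   unfolding Bochner_Integration.integral_mult_right_zero[symmetric]
   using a by (intro LINT_cong refl) simp
  also have "\<dots> = ?c * (LINT z|lborel. gau z * cnj (f (a *\<^sub>R z + x)))"
   unfolding gau_scaled_fou[OF a] Bochner_Integration.integral_mult_right_zero[symmetric]
   by (intro LINT_cong refl) (simp add: add.commute)
  finally show ?thesis .
 qed
 have "(LINT s|lborel. fou (-1) f s * (cnj (fou (-1) f s) * gau (a *\<^sub>R s)))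
   = (LINT x|lborel. f x * (?c * (LINT z|lborel. gau z * cnj (f (a *\<^sub>R z + x)))))"
  unfolding fou_multiplication[OF fi qi] 2 by (rule refl)
 also have "\<dots> = ?c * (LINT x|lborel. (LINT z|lborel. gau z * (f x * cnj (f (a *\<^sub>R z + x)))))"
  unfolding Bochner_Integration.integral_mult_right_zero[symmetric]
  by (intro LINT_cong refl) (simp add: mult_ac)
 also have "(LINT x|lborel. (LINT z|lborel. gau z * (f x * cnj (f (a *\<^sub>R z + x)))))
   = (LINT z|lborel. (LINT x|lborel. gau z * (f x * cnj (f (a *\<^sub>R z + x)))))"
  by (rule lborel_pair.Fubini_integral[OF correlation_integrable[OF fs]])
 also have "\<dots> = (LINT z|lborel. gau z * cinner (cls f) (trn (a *\<^sub>R z) (cls f)))"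
  unfolding trn_correlation[OF fs] by simp
 finally show ?thesis .
qed

text \<open>Along a = 1/(k+1) the weighted integrals increase to the full one, while the correlation
  side converges by dominated convergence and continuity of translations. Two factors sqrt(2 pi)^d,
  one of them the total mass of the Gaussian, make up (2 pi)^d.\<close>

lemma plancherel_l1l2_minus:
 fixes f :: "('d::finite) fn"
 assumes f: "l1l2 f"
 shows "sqint (fou (-1) f)" "(norm (cls (fou (-1) f)))^2 = (2 * pi) ^ CARD('d) * (norm (cls f))^2"
proof -
 have fi: "integrable lborel f" and fs: "sqint f" using f by (auto simp: l1l2_def)
 note [measurable] = sqint_measurable[OF fs]
 let ?F = "fou (-1) f" and ?L = "(2 * pi) ^ CARD('d) * (norm (cls f))^2"
 define a where "a k = 1 / (real k + 1)" for k
 have a: "a k > 0" for k by (simp add: a_def)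
 have a0: "a \<longlonglongrightarrow> 0" unfolding a_def by real_asymp
 define w where "w k s = exp (- (norm (a k *\<^sub>R (s :: real^'d)))\<^sup>2 / 2)" for k s
 have wm[measurable]: "w k \<in> borel_measurable borel" for k unfolding w_def by measurable
 define J where "J k = (LINT s|lborel. (cmod (?F s))\<^sup>2 * w k s)" for k
 have J: "cor (J k) = cor (sqrt (2 * pi) ^ CARD('d)) * (LINT z|lborel. gau z * cinner (cls f) (trn (a k *\<^sub>R z) (cls f)))" for k
 proof -
  have "cor (J k) = (LINT s|lborel. cor ((cmod (?F s))^2 * w k s))"
   unfolding J_def by (rule integral_complex_of_real[symmetric])
  also have "\<dots> = (LINT s|lborel. ?F s * (cnj (?F s) * gau (a k *\<^sub>R s)))"
   by (intro LINT_cong refl) (simp add: gau_def w_def mult_cnj_self flip: mult.assoc)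
  finally show ?thesis unfolding plancherel_gauss[OF f a] .
 qed
 have ib: "integrable lborel (\<lambda>s :: real^'d. cmod (gau s) * (norm (cls f))^2)" by (intro integrable_mult_left integrable_norm gau_integrable)
 have cm[measurable]: "(\<lambda>z. gau z * cinner (cls f) (trn (a k *\<^sub>R z) (cls f))) \<in> borel_measurable borel" for k
  unfolding trn_correlation[OF fs] by measurable
 have g0: "(LINT z|lborel. gau (z :: real^'d)) = cor (sqrt (2 * pi) ^ CARD('d))"
  using gau_fou[of 0 "0 :: real^'d"] by (simp add: fou_def gau_def)
 have "(\<lambda>k. LINT z|lborel. gau z * cinner (cls f) (trn (a k *\<^sub>R z) (cls f))) \<longlonglongrightarrow> (LINT z|lborel. gau (z :: real^'d) * cinner (cls f) (cls f))"
 proof (rule integral_dominated_convergence[OF _ _ ib])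
  show "AE z in lborel. (\<lambda>k. gau z * cinner (cls f) (trn (a k *\<^sub>R z) (cls f))) \<longlonglongrightarrow> gau z * cinner (cls f) (cls f)"
  proof (rule AE_I2)
   fix z :: "real^'d"
   have "(\<lambda>k. a k *\<^sub>R z) \<longlonglongrightarrow> 0" using tendsto_scaleR[OF a0 tendsto_const[of z]] by simp
   from tendsto_cinner_right[OF trn_continuous[OF this, of "cls f"], of "cls f"]
   show "(\<lambda>k. gau z * cinner (cls f) (trn (a k *\<^sub>R z) (cls f))) \<longlonglongrightarrow> gau z * cinner (cls f) (cls f)" by (rule tendsto_mult_left)
  qed
  show "AE z in lborel. norm (gau z * cinner (cls f) (trn (a k *\<^sub>R z) (cls f))) \<le> cmod (gau z) * (norm (cls f))^2" for k
   by (intro AE_I2) (simp add: norm_mult mult_left_mono trn_correlation_bound)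
 qed measurable
 also have "(LINT z|lborel. gau (z :: real^'d) * cinner (cls f) (cls f)) = cor (sqrt (2 * pi) ^ CARD('d)) * cor ((norm (cls f))^2)"
  by (simp only: cinner_norm Bochner_Integration.integral_mult_left_zero g0)
 finally have "(\<lambda>k. cor (J k)) \<longlonglongrightarrow> cor (sqrt (2 * pi) ^ CARD('d)) * (cor (sqrt (2 * pi) ^ CARD('d)) * cor ((norm (cls f))^2))"
  unfolding J by (rule tendsto_mult_left)
 then have "(\<lambda>k. cor (J k)) \<longlonglongrightarrow> cor (sqrt (2 * pi) ^ CARD('d) * (sqrt (2 * pi) ^ CARD('d) * (norm (cls f))^2))" by simp
 then have "J \<longlonglongrightarrow> sqrt (2 * pi) ^ CARD('d) * (sqrt (2 * pi) ^ CARD('d) * (norm (cls f))^2)" by (simp only: tendsto_of_real_iff)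
 moreover have "sqrt (2 * pi) ^ CARD('d) * (sqrt (2 * pi) ^ CARD('d) * (norm (cls f))^2) = ?L"
  by (simp only: mult.assoc[symmetric] power2_eq_square[of "sqrt (2 * pi) ^ CARD('d)", symmetric] sqrt_power_sq)
 ultimately have Jl: "J \<longlonglongrightarrow> ?L" by simp
 have wi: "integrable lborel (\<lambda>s. (cmod (?F s))\<^sup>2 * w k s)" for k
 proof -
  have "integrable lborel (\<lambda>s. cor ((cmod (?F s))^2) * gau (a k *\<^sub>R s))"
  proof (rule bounded_mult_integrable[OF _ gau_scaled_integrable])
   show "cmod (cor ((cmod (?F s))^2)) \<le> (LINT x|lborel. cmod (f x))^2" for s
    using power_mono[OF fou_bound[of "-1" f s] norm_ge_zero, of 2] by (simp add: norm_power)
  qed (use a[of k] in simp_all)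
  from integrable_Re[OF this] show ?thesis by (simp add: gau_def w_def)
 qed
 have nn: "(\<integral>\<^sup>+s. ennreal ((cmod (?F s))^2 * w k s) \<partial>lborel) = ennreal (J k)" for k
  unfolding J_def by (rule nn_integral_eq_integral[OF wi]) (simp add: w_def)
 have "(\<lambda>k. \<integral>\<^sup>+s. ennreal ((cmod (?F s))^2 * w k s) \<partial>lborel) \<longlonglongrightarrow> (\<integral>\<^sup>+s. ennreal ((cmod (?F s))^2) \<partial>lborel)"
 proof (rule nn_integral_LIMSEQ)
  show "incseq (\<lambda>k s. ennreal ((cmod (?F s))^2 * w k s))"
  proof (intro incseq_SucI le_funI ennreal_leI mult_left_mono)
   fix k and s :: "real^'d"
   have "(a (Suc k) * norm s)^2 \<le> (a k * norm s)^2"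
    using a[of "Suc k"] by (intro power_mono mult_right_mono) (auto simp: a_def frac_le)
   then show "w k s \<le> w (Suc k) s" using a[of k] a[of "Suc k"] by (simp add: w_def)
  qed simp
  show "(\<lambda>k. ennreal ((cmod (?F s))^2 * w k s)) \<longlonglongrightarrow> ennreal ((cmod (?F s))^2)" for s
  proof (rule tendsto_ennrealI)
   have "(\<lambda>k. (cmod (?F s))\<^sup>2 * exp (- (norm (a k *\<^sub>R s))\<^sup>2 / 2)) \<longlonglongrightarrow> (cmod (?F s))\<^sup>2 * exp (- (norm (0 *\<^sub>R s))\<^sup>2 / 2)"
    by (intro tendsto_intros a0) simp
   then show "(\<lambda>k. (cmod (?F s))\<^sup>2 * w k s) \<longlonglongrightarrow> (cmod (?F s))\<^sup>2" by (simp add: w_def)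
  qed
 qed measurable
 then have "(\<lambda>k. ennreal (J k)) \<longlonglongrightarrow> (\<integral>\<^sup>+s. ennreal ((cmod (?F s))^2) \<partial>lborel)" unfolding nn .
 from LIMSEQ_unique[OF this tendsto_ennrealI[OF Jl]]
 have eq: "(\<integral>\<^sup>+s. ennreal ((cmod (?F s))^2) \<partial>lborel) = ennreal ?L" .
 show sF: "sqint ?F" unfolding sqint_sq by (rule sqI_nn) (simp_all add: eq)
 show "(norm (cls ?F))^2 = ?L" using eq unfolding L2_norm_nn[OF sF] by (simp add: ennreal_inj)
qed

lemma l1l2_cnj: "l1l2 f \<Longrightarrow> l1l2 (\<lambda>x. cnj (f x))"
 using sq_cnj[of lborel f] by (simp add: l1l2_def sqint_sq)

lemma l1l2_lin: "l1l2 f \<Longrightarrow> l1l2 g \<Longrightarrow> l1l2 (\<lambda>x. a * f x + b * g x)"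
 by (simp add: l1l2_def sqint_lin)

definition pm :: "real \<Rightarrow> bool" where "pm \<sigma> \<longleftrightarrow> \<sigma> = 1 \<or> \<sigma> = -1"

lemma pm_minus: "pm \<sigma> \<Longrightarrow> pm (- \<sigma>)" by (auto simp: pm_def)

lemma plancherel_l1l2:
 fixes f :: "('d::finite) fn"
 assumes f: "l1l2 f" and \<sigma>: "pm \<sigma>"
 shows "sqint (fou \<sigma> f)" "(norm (cls (fou \<sigma> f)))^2 = (2 * pi) ^ CARD('d) * (norm (cls f))^2"
proof -
 have "sqint (fou \<sigma> f) \<and> (norm (cls (fou \<sigma> f)))\<^sup>2 = (2 * pi) ^ CARD('d) * (norm (cls f))^2"
 proof (cases "\<sigma> = -1")
  case True
  then show ?thesis using plancherel_l1l2_minus[OF f] by simp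
 next
  case False
  then have s: "\<sigma> = 1" using \<sigma> by (simp add: pm_def)
  have eq: "fou 1 f = (\<lambda>s. cnj (fou (-1) (\<lambda>x. cnj (f x)) s))" using fou_cnj[of "-1" f] by (simp add: fun_eq_iff)
  note p = plancherel_l1l2_minus[OF l1l2_cnj[OF f]]
  have sq: "sqint (fou 1 f)" unfolding eq sqint_sq using p(1) by (intro sq_cnj) (simp add: sqint_sq)
  have "(norm (cls (\<lambda>x. cnj (f x))))^2 = (norm (cls f))^2"
   using f l1l2_cnj[OF f] by (simp add: L2_norm_sq l1l2_def)
  moreover have "(norm (cls (fou 1 f)))^2 = (norm (cls (fou (-1) (\<lambda>x. cnj (f x)))))^2"
   unfolding L2_norm_sq[OF sq] L2_norm_sq[OF p(1)] by (simp add: eq)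
  ultimately show ?thesis using sq p(2) s by simp
 qed
 then show "sqint (fou \<sigma> f)" "(norm (cls (fou \<sigma> f)))^2 = (2 * pi) ^ CARD('d) * (norm (cls f))^2" by auto
qed

section \<open>The Fourier transform on $L_2$\<close>

definition FT0 :: "real \<Rightarrow> ('d::finite) fn \<Rightarrow> 'd L2" where
 "FT0 \<sigma> f = cor (1 / sqrt (2 * pi) ^ CARD('d)) *C cls (fou \<sigma> f)"

definition cut :: "nat \<Rightarrow> ('d::finite) fn \<Rightarrow> 'd fn" where "cut n f = (\<lambda>x. indicator (ball 0 (real n)) x * f x)"

text \<open>Limit over truncations to balls, normalised by (2 pi)^(-d/2) through \<open>FT0\<close>.
  By \<open>FT_limit\<close> every approximation from L_1 \<inter> L_2 gives the same value.\<close>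

definition FT :: "real \<Rightarrow> ('d::finite) L2 \<Rightarrow> 'd L2" where "FT \<sigma> u = lim (\<lambda>n. FT0 \<sigma> (cut n (rpf u)))"

lemma indicator_mult_l1l2:
 assumes f: "sqint f" and [measurable]: "S \<in> sets borel" and S: "emeasure lborel S < \<infinity>"
 shows "l1l2 (\<lambda>x. indicator S x * f x)"
proof -
 note [measurable] = sqint_measurable[OF f]
 have "sqint (\<lambda>x. indicator S x * f x)" unfolding sqint_sq
  by (rule sq_bound[where g = f and C = 1]) (use f in \<open>auto simp: sqint_sq indicator_def\<close>)
 moreover have "integrable lborel (\<lambda>x. indicator S x * f x)"
  using sq_prod_integrable[of lborel "indicator S" f] sqint_indicator[of S] f S by (simp add: sqint_sq)
 ultimately show ?thesis by (simp add: l1l2_def)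
qed

lemma cut_l1l2: "sqint f \<Longrightarrow> l1l2 (cut n f)"
 unfolding cut_def by (intro indicator_mult_l1l2 emeasure_bounded_finite[OF bounded_ball]) auto

lemma cut_tendsto:
 fixes f :: "('d::finite) fn"
 assumes f: "sqint f" shows "(\<lambda>n. cls (cut n f)) \<longlonglongrightarrow> cls f"
proof -
 note [measurable] = sqint_measurable[OF f]
 have s: "sqint (cut n f)" for n using cut_l1l2[OF f] by (simp add: l1l2_def)
 have m: "(\<lambda>x. (cmod (cut n f x - f x))\<^sup>2) \<in> borel_measurable lborel" for n
  using sqint_measurable[OF sqint_diff[OF s[of n] f]] by simp
 have "(\<lambda>n. LINT x|lborel. (cmod (cut n f x - f x))\<^sup>2) \<longlonglongrightarrow> (LINT x|(lborel :: (real^'d) measure). 0)"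
 proof (rule integral_dominated_convergence)
  show "integrable lborel (\<lambda>x. (cmod (f x))\<^sup>2)" using f by (simp add: sqint_def)
  show "AE x in lborel. (\<lambda>n. (cmod (cut n f x - f x))\<^sup>2) \<longlonglongrightarrow> 0"
  proof (rule AE_I2)
   fix x :: "real^'d"
   obtain N :: nat where N: "norm x < real N" using reals_Archimedean2 by blast
   have "\<forall>\<^sub>F n in sequentially. (cmod (cut n f x - f x))\<^sup>2 = 0"
    unfolding eventually_sequentially using N by (intro exI[of _ N]) (auto simp: cut_def)
   then show "(\<lambda>n. (cmod (cut n f x - f x))\<^sup>2) \<longlonglongrightarrow> 0" by (rule tendsto_eventually)
  qed
  show "AE x in lborel. norm ((cmod (cut n f x - f x))^2) \<le> (cmod (f x))^2" for n
   by (rule AE_I2) (auto simp: cut_def indicator_def)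
 qed (rule borel_measurable_const m)+
 then have "(\<lambda>n. (norm (cls (cut n f) - cls f))\<^sup>2) \<longlonglongrightarrow> 0"
  by (simp add: L2_diff_cls s f L2_norm_sq sqint_diff)
 from tendsto_real_sqrt[OF this] have "(\<lambda>n. norm (cls (cut n f) - cls f)) \<longlonglongrightarrow> 0" by simp
 then have "(\<lambda>n. cls (cut n f) - cls f) \<longlonglongrightarrow> 0" by (rule tendsto_norm_zero_cancel)
 from tendsto_add[OF this tendsto_const[of "cls f"]] show ?thesis by simp
qed

lemma FT0_lin:
 assumes "l1l2 f" "l1l2 g" "pm \<sigma>"
 shows "FT0 \<sigma> (\<lambda>x. a * f x + b * g x) = a *C FT0 \<sigma> f + b *C FT0 \<sigma> g"
proof -
 have "fou \<sigma> (\<lambda>x. a * f x + b * g x) = (\<lambda>s. a * fou \<sigma> f s + b * fou \<sigma> g s)"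
  using assms by (simp add: fun_eq_iff fou_lin l1l2_def)
 then have "cls (fou \<sigma> (\<lambda>x. a * f x + b * g x)) = a *C cls (fou \<sigma> f) + b *C cls (fou \<sigma> g)"
  by (simp add: L2_scaleC_cls L2_add_cls sqint_scale plancherel_l1l2(1)[OF assms(1,3)] plancherel_l1l2(1)[OF assms(2,3)])
 then show ?thesis by (simp add: FT0_def scaleC_add_right scaleC_scaleC mult_ac)
qed

lemma FT0_norm: assumes "l1l2 (f :: ('d::finite) fn)" "pm \<sigma>" shows "norm (FT0 \<sigma> f) = norm (cls f)"
proof -
 have "(norm (FT0 \<sigma> f))^2 = (norm (cls f))^2"
  unfolding FT0_def norm_scaleC power_mult_distrib plancherel_l1l2(2)[OF assms]
  by (simp add: norm_divide norm_power power_divide sqrt_power_sq)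
 then show ?thesis by (simp add: power2_eq_iff_nonneg)
qed

lemma FT0_diff_norm:
 assumes "l1l2 f" "l1l2 g" "pm \<sigma>" shows "norm (FT0 \<sigma> f - FT0 \<sigma> g) = norm (cls f - cls g)"
proof -
 have d: "l1l2 (\<lambda>x. 1 * f x + (-1) * g x)" using assms by (intro l1l2_lin)
 have "FT0 \<sigma> f - FT0 \<sigma> g = FT0 \<sigma> (\<lambda>x. 1 * f x + (-1) * g x)" unfolding FT0_lin[OF assms] by simp
 moreover have "cls f - cls g = cls (\<lambda>x. 1 * f x + (-1) * g x)" using assms by (simp add: L2_diff_cls l1l2_def)
 ultimately show ?thesis using FT0_norm[OF d assms(3)] by simp
qed

lemma FT_limit:
 assumes f: "\<And>n. l1l2 (f n)" and lim: "(\<lambda>n. cls (f n)) \<longlonglongrightarrow> u" and \<sigma>: "pm \<sigma>"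
 shows "(\<lambda>n. FT0 \<sigma> (f n)) \<longlonglongrightarrow> FT \<sigma> u"
proof -
 let ?c = "\<lambda>n. cut n (rpf u)"
 have c: "l1l2 (?c n)" for n by (rule cut_l1l2[OF sqint_rpf])
 have cl: "(\<lambda>n. cls (?c n)) \<longlonglongrightarrow> u" using cut_tendsto[OF sqint_rpf, of u] by simp
 have "Cauchy (\<lambda>n. cls (?c n))" using cl by (intro convergent_Cauchy) (auto simp: convergent_def)
 then have "Cauchy (\<lambda>n. FT0 \<sigma> (?c n))"
  unfolding Cauchy_def dist_norm FT0_diff_norm[OF c c \<sigma>] .
 then have 1: "(\<lambda>n. FT0 \<sigma> (?c n)) \<longlonglongrightarrow> FT \<sigma> u"
  unfolding FT_def by (simp add: Cauchy_convergent_iff convergent_LIMSEQ_iff)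
 have "(\<lambda>n. norm (cls (f n) - cls (?c n))) \<longlonglongrightarrow> 0" using tendsto_norm[OF tendsto_diff[OF lim cl]] by simp
 then have "(\<lambda>n. norm (FT0 \<sigma> (f n) - FT0 \<sigma> (?c n))) \<longlonglongrightarrow> 0" unfolding FT0_diff_norm[OF f c \<sigma>] .
 then have "(\<lambda>n. FT0 \<sigma> (f n) - FT0 \<sigma> (?c n)) \<longlonglongrightarrow> 0" by (rule tendsto_norm_zero_cancel)
 from tendsto_add[OF this 1] show ?thesis by simp
qed

lemma FT_cls: "l1l2 f \<Longrightarrow> pm \<sigma> \<Longrightarrow> FT \<sigma> (cls f) = FT0 \<sigma> f"
 using FT_limit[of "\<lambda>_. f" "cls f" \<sigma>] by (simp add: tendsto_const_iff LIMSEQ_const_iff)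

lemma FT_approx: "pm \<sigma> \<Longrightarrow> (\<lambda>n. FT0 \<sigma> (cut n (rpf u))) \<longlonglongrightarrow> FT \<sigma> u"
 by (rule FT_limit[OF cut_l1l2[OF sqint_rpf]]) (use cut_tendsto[OF sqint_rpf, of u] in simp_all)

lemma FT_lin: assumes \<sigma>: "pm \<sigma>" shows "FT \<sigma> (a *C u + b *C v) = a *C FT \<sigma> u + b *C FT \<sigma> v"
proof -
 let ?f = "\<lambda>n. cut n (rpf u)" and ?g = "\<lambda>n. cut n (rpf v)"
 note l = cut_l1l2[OF sqint_rpf]
 have t: "(\<lambda>n. cls (?f n)) \<longlonglongrightarrow> u" "(\<lambda>n. cls (?g n)) \<longlonglongrightarrow> v" using cut_tendsto[OF sqint_rpf, of u] cut_tendsto[OF sqint_rpf, of v] by simp_all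
 have e: "cls (\<lambda>x. a * ?f n x + b * ?g n x) = a *C cls (?f n) + b *C cls (?g n)" for n
  using l[of n u] l[of n v] by (simp add: l1l2_def L2_scaleC_cls L2_add_cls sqint_scale)
 have "(\<lambda>n. FT0 \<sigma> (\<lambda>x. a * ?f n x + b * ?g n x)) \<longlonglongrightarrow> FT \<sigma> (a *C u + b *C v)"
  by (rule FT_limit[OF l1l2_lin[OF l l] _ \<sigma>]) (unfold e, intro tendsto_add tendsto_scaleC t)
 moreover have "(\<lambda>n. FT0 \<sigma> (\<lambda>x. a * ?f n x + b * ?g n x)) \<longlonglongrightarrow> a *C FT \<sigma> u + b *C FT \<sigma> v"
  unfolding FT0_lin[OF l l \<sigma>] by (intro tendsto_add tendsto_scaleC FT_approx \<sigma>)
 ultimately show ?thesis by (rule LIMSEQ_unique)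
qed

lemma FT_norm: assumes \<sigma>: "pm \<sigma>" shows "norm (FT \<sigma> u) = norm u"
proof (rule LIMSEQ_unique)
 show "(\<lambda>n. norm (FT0 \<sigma> (cut n (rpf u)))) \<longlonglongrightarrow> norm (FT \<sigma> u)" by (intro tendsto_norm FT_approx \<sigma>)
 show "(\<lambda>n. norm (FT0 \<sigma> (cut n (rpf u)))) \<longlonglongrightarrow> norm u"
  unfolding FT0_norm[OF cut_l1l2[OF sqint_rpf] \<sigma>] using cut_tendsto[OF sqint_rpf, of u] by (intro tendsto_norm) simp
qed

text \<open>The multiplication formula gives it on L_1 \<inter> L_2; the two arguments then pass to
  the limit one after the other.\<close>

lemma FT_adjoint: assumes \<sigma>: "pm \<sigma>" shows "cinner (FT \<sigma> u) v = cinner u (FT (- \<sigma>) v)"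
proof -
 let ?f = "\<lambda>n. cut n (rpf u)" and ?g = "\<lambda>n. cut n (rpf v)"
 note l = cut_l1l2[OF sqint_rpf]
 have t: "(\<lambda>n. cls (?f n)) \<longlonglongrightarrow> u" "(\<lambda>n. cls (?g n)) \<longlonglongrightarrow> v" using cut_tendsto[OF sqint_rpf, of u] cut_tendsto[OF sqint_rpf, of v] by simp_all
 have key: "cinner (FT0 \<sigma> f) (cls g) = cinner (cls f) (FT0 (- \<sigma>) g)" if f: "l1l2 f" and g: "l1l2 g" for f g :: "'a fn"
 proof -
  have "l2inner (fou \<sigma> f) g = (LINT s|lborel. fou \<sigma> f s * cnj (g s))" by (simp add: l2inner_def)
  also have "\<dots> = (LINT x|lborel. f x * fou \<sigma> (\<lambda>s. cnj (g s)) x)"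
   by (rule fou_multiplication) (use f g in \<open>auto simp: l1l2_def\<close>)
  also have "\<dots> = l2inner f (fou (- \<sigma>) g)" unfolding fou_cnj l2inner_def ..
  finally show ?thesis using f g plancherel_l1l2(1)[OF f \<sigma>] plancherel_l1l2(1)[OF g pm_minus[OF \<sigma>]]
   by (simp add: FT0_def cinner_scaleC_left cinner_scaleC_right L2_cinner_cls l1l2_def)
 qed
 have 1: "(\<lambda>m. cinner (FT0 \<sigma> (?f n)) (cls (?g m))) \<longlonglongrightarrow> cinner (FT0 \<sigma> (?f n)) v" for n by (rule tendsto_cinner_right[OF t(2)])
 have 2: "(\<lambda>m. cinner (FT0 \<sigma> (?f n)) (cls (?g m))) \<longlonglongrightarrow> cinner (cls (?f n)) (FT (- \<sigma>) v)" for n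
  unfolding key[OF l l] by (rule tendsto_cinner_right[OF FT_approx[OF pm_minus[OF \<sigma>]]])
 have e: "cinner (FT0 \<sigma> (?f n)) v = cinner (cls (?f n)) (FT (- \<sigma>) v)" for n by (rule LIMSEQ_unique[OF 1 2])
 show ?thesis
  by (rule LIMSEQ_unique[OF tendsto_cinner_left[OF FT_approx[OF \<sigma>]]]) (unfold e, rule tendsto_cinner_left[OF t(1)])
qed

text \<open>Inversion follows from isometry and the adjoint relation: with F' the transform of
  opposite sign, |F' F u - u|^2 expands to |u|^2 - 2 |F u|^2 + |u|^2 = 0.\<close>

theorem FT_unit: assumes \<sigma>: "pm \<sigma>" shows "unit_pair (FT \<sigma>) (FT (- \<sigma>) :: ('d::finite) L2 \<Rightarrow> 'd L2)"
proof -
 have cl: "clinop (FT r :: 'd L2 \<Rightarrow> 'd L2)" if r: "pm r" for r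
 proof (rule clinopI[of _ 1])
  fix x y :: "'d L2" and a
  show "FT r (x + y) = FT r x + FT r y" using FT_lin[OF r, of 1 x 1 y] by simp
  show "FT r (a *C x) = a *C FT r x" using FT_lin[OF r, of a x 0 0] by simp
  show "norm (FT r x) \<le> 1 * norm x" using FT_norm[OF r, of x] by simp
 qed
 have inv: "FT (- r) (FT r u) = u" if r: "pm r" for r and u :: "'d L2"
 proof -
  have d: "FT r (x - y) = FT r x - FT r y" for x y :: "'d L2" using FT_lin[OF r, of 1 x "-1" y] by simp
  have "(norm (FT (- r) (FT r u) - u))^2 = (norm (FT (- r) (FT r u)))^2 - 2 * Re (cinner (FT (- r) (FT r u)) u) + (norm u)^2"
   by (rule norm_diff_sq)
  also have "cinner (FT (- r) (FT r u)) u = cinner (FT r u) (FT r u)" using FT_adjoint[OF pm_minus[OF r], of "FT r u" u] by simp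
  finally show ?thesis by (simp add: FT_norm r pm_minus cinner_norm)
 qed
 show ?thesis unfolding unit_pair_def
  using cl[OF \<sigma>] cl[OF pm_minus[OF \<sigma>]] FT_norm[OF \<sigma>] inv[OF \<sigma>] inv[OF pm_minus[OF \<sigma>]] by auto
qed

section \<open>Weak trace class operators from a continuous frame\<close>

text \<open>What the localised exponentials satisfy: \<open>\<kappa>\<close> will be (2 pi)^(-d),
  \<open>V\<close> the volume of the support ball, \<open>c\<close> the volume of the unit ball,
  \<open>D\<close> the constant of the modulation tail, and \<open>Q q\<close> the set |s|^d \<le>
  q. \<open>B\<close> is the adjoint of \<open>A\<close>.\<close>

locale frame_op =
 fixes A B :: "'a::chilbert \<Rightarrow> 'a" and e :: "nat \<Rightarrow> 'a" and M :: "'s measure" and \<epsilon> :: "'s \<Rightarrow> 'a"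
  and \<kappa> V c D :: real and Q :: "real \<Rightarrow> 's set"
 assumes cpt: "cpt A" and B: "clinop B" and adj: "\<forall>x y. cinner (A x) y = cinner x (B y)" and e: "is_onb e"
  and pos: "0 < \<kappa>" "0 \<le> c" "0 \<le> D" "0 \<le> V" and space: "space M = UNIV"
  and V: "\<And>s. (norm (\<epsilon> s))\<^sup>2 \<le> V"
  and sq: "\<And>u. sq M (\<lambda>s. cinner u (\<epsilon> s))"
  and bessel: "\<And>u. \<kappa> * (LINT s|M. (cmod (cinner u (\<epsilon> s)))\<^sup>2) \<le> (norm u)^2"
  and frame: "\<And>u v. cinner (A u) v = cor \<kappa> * (LINT s|M. cinner u (\<epsilon> s) * cinner (A (\<epsilon> s)) v)"
  and Q: "\<And>q. 0 < q \<Longrightarrow> Q q \<in> sets M" "\<And>q. 0 < q \<Longrightarrow> emeasure M (Q q) \<le> ennreal (c * q)"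
  and tail: "\<And>q. 0 < q \<Longrightarrow> integrable M (\<lambda>s. indicator (- Q q) s * (norm (A (\<epsilon> s)))^2)"
   "\<And>q. 0 < q \<Longrightarrow> (LINT s|M. indicator (- Q q) s * (norm (A (\<epsilon> s)))^2) \<le> D / q"
begin

lemma clA: "clinop A" using cpt by (simp add: cpt_def)

lemma QC: "0 < q \<Longrightarrow> - Q q \<in> sets M"
 using sets.compl_sets[OF Q(1), of q] by (simp add: space Compl_eq_Diff_UNIV)

lemma sqA: "sq M (\<lambda>s. cinner (A (\<epsilon> s)) v)"
proof -
 have "(\<lambda>s. cinner (A (\<epsilon> s)) v) = (\<lambda>s. cnj (cinner (B v) (\<epsilon> s)))"
  using adj by (simp add: fun_eq_iff cinner_commute[of "B v"])
 then show ?thesis using sq_cnj[OF sq[of "B v"]] by simp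
qed

lemma int_sq: "integrable M (\<lambda>s. (cmod (cinner u (\<epsilon> s)))\<^sup>2)" using sq[of u] by (simp add: sq_def)

lemma int_X: "integrable M (\<lambda>s. cinner u (\<epsilon> s) * cinner (A (\<epsilon> s)) v)"
 by (rule sq_prod_integrable[OF sq sqA])

lemma measure_Q: "0 < q \<Longrightarrow> emeasure M (Q q) < \<infinity>" "0 < q \<Longrightarrow> measure M (Q q) \<le> c * q"
proof -
 assume q: "0 < q"
 show f: "emeasure M (Q q) < \<infinity>" using Q(2)[OF q] by (rule le_less_trans) simp
 then have "ennreal (measure M (Q q)) \<le> ennreal (c * q)" using Q(2)[OF q] by (simp add: emeasure_eq_ennreal_measure less_top)
 then show "measure M (Q q) \<le> c * q" using pos q by (simp add: ennreal_le_iff)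
qed

lemma split_frame:
 assumes "0 < q"
 shows "cinner (A u) v = cor \<kappa> * (LINT s|M. indicator (Q q) s *\<^sub>R (cinner u (\<epsilon> s) * cinner (A (\<epsilon> s)) v))
  + cor \<kappa> * (LINT s|M. indicator (- Q q) s *\<^sub>R (cinner u (\<epsilon> s) * cinner (A (\<epsilon> s)) v))"
proof -
 let ?X = "\<lambda>s. cinner u (\<epsilon> s) * cinner (A (\<epsilon> s)) v"
 have "(LINT s|M. ?X s) = (LINT s|M. indicator (Q q) s *\<^sub>R ?X s + indicator (- Q q) s *\<^sub>R ?X s)"
  by (intro LINT_cong refl) (auto simp: indicator_def)
 also have "\<dots> = (LINT s|M. indicator (Q q) s *\<^sub>R ?X s) + (LINT s|M. indicator (- Q q) s *\<^sub>R ?X s)"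
  by (rule Bochner_Integration.integral_add) (intro integrable_mult_indicator Q(1) QC assms int_X)+
 finally show ?thesis unfolding frame[of u v] by (simp add: distrib_left)
qed

text \<open>The weighted inequality 2ab \<le> a^2/q + q b^2 separates the factors. The first sum is
  integrated and bounded by \<open>bessel\<close> once for each of the \<open>m\<close> vectors; the
  second is bounded pointwise by the squared norm of A at \<epsilon> s because \<open>k\<close> is
  an orthogonal system, and the tail hypothesis then cancels the weight q.\<close>

lemma tail_sum:
 assumes q: "0 < q" and h: "\<And>i. norm (h i) \<le> 1" and k: "osys k"
 shows "cmod (\<Sum>i<m. cor \<kappa> * (LINT s|M. indicator (- Q q) s *\<^sub>R (cinner (h i) (\<epsilon> s) * cinner (A (\<epsilon> s)) (k i))))
  \<le> (real m / q + \<kappa> * D) / 2"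
proof -
 let ?X = "\<lambda>i s. cinner (h i) (\<epsilon> s) * cinner (A (\<epsilon> s)) (k i)"
 let ?w = "\<lambda>s. indicator (- Q q) s * (norm (A (\<epsilon> s)))^2"
 let ?b = "\<lambda>s. (1 / q * (\<Sum>i<m. (cmod (cinner (h i) (\<epsilon> s)))\<^sup>2) + q * ?w s) / 2"
 have ib: "integrable M ?b" by (intro integrable_divide Bochner_Integration.integrable_add integrable_mult_right Bochner_Integration.integrable_sum int_sq tail q)
 have iX: "integrable M (\<lambda>s. indicator (- Q q) s *\<^sub>R ?X i s)" for i by (intro integrable_mult_indicator QC q int_X)
 have pt: "cmod (\<Sum>i<m. indicator (- Q q) s *\<^sub>R ?X i s) \<le> ?b s" for s
 proof (cases "s \<in> Q q")
  case True
  then show ?thesis using q by (simp add: sum_nonneg)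
 next
  case False
  have "cmod (\<Sum>i<m. indicator (- Q q) s *\<^sub>R ?X i s) \<le> (\<Sum>i<m. cmod (?X i s))"
   using False by (intro order_trans[OF norm_sum] sum_mono) simp
  also have "\<dots> \<le> (\<Sum>i<m. (1 / q * (cmod (cinner (h i) (\<epsilon> s)))^2 + q * (cmod (cinner (A (\<epsilon> s)) (k i)))^2) / 2)"
  proof (rule sum_mono)
   fix i
   let ?a = "cmod (cinner (h i) (\<epsilon> s))" and ?z = "cmod (cinner (A (\<epsilon> s)) (k i))"
   have "0 \<le> (?a - q * ?z)^2 / q" using q by simp
   then have "2 * (?a * ?z) \<le> 1 / q * ?a\<^sup>2 + q * ?z\<^sup>2" using q by (simp add: power2_eq_square field_simps)
   then show "cmod (?X i s) \<le> (1 / q * ?a\<^sup>2 + q * ?z\<^sup>2) / 2" by (simp add: norm_mult)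
  qed
  also have "\<dots> = (1 / q * (\<Sum>i<m. (cmod (cinner (h i) (\<epsilon> s)))\<^sup>2) + q * (\<Sum>i<m. (cmod (cinner (A (\<epsilon> s)) (k i)))\<^sup>2)) / 2"
   by (simp add: sum.distrib sum_distrib_left sum_divide_distrib add_divide_distrib)
  also have "\<dots> \<le> ?b s"
   using osys_bessel[OF k, of "{..<m}" "A (\<epsilon> s)"] q False by (simp add: mult_left_mono)
  finally show ?thesis .
 qed
 have "(\<Sum>i<m. cor \<kappa> * (LINT s|M. indicator (- Q q) s *\<^sub>R ?X i s))
   = cor \<kappa> * (LINT s|M. (\<Sum>i<m. indicator (- Q q) s *\<^sub>R ?X i s))"
  unfolding sum_distrib_left[symmetric] Bochner_Integration.integral_sum[OF iX] by (rule refl)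
 then have "cmod (\<Sum>i<m. cor \<kappa> * (LINT s|M. indicator (- Q q) s *\<^sub>R ?X i s))
   = \<kappa> * cmod (LINT s|M. (\<Sum>i<m. indicator (- Q q) s *\<^sub>R ?X i s))" using pos by (simp add: norm_mult)
 also have "\<dots> \<le> \<kappa> * (LINT s|M. ?b s)"
 proof (rule mult_left_mono)
  have "cmod (LINT s|M. (\<Sum>i<m. indicator (- Q q) s *\<^sub>R ?X i s)) \<le> (LINT s|M. cmod (\<Sum>i<m. indicator (- Q q) s *\<^sub>R ?X i s))"
   by (rule integral_norm_bound)
  also have "\<dots> \<le> (LINT s|M. ?b s)"
   by (rule integral_mono[OF _ ib pt]) (intro integrable_norm Bochner_Integration.integrable_sum iX)
  finally show "cmod (LINT s|M. (\<Sum>i<m. indicator (- Q q) s *\<^sub>R ?X i s)) \<le> (LINT s|M. ?b s)" .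
 qed (use pos in simp)
 also have "(LINT s|M. ?b s) = (1 / q * (\<Sum>i<m. (LINT s|M. (cmod (cinner (h i) (\<epsilon> s)))\<^sup>2)) + q * (LINT s|M. ?w s)) / 2"
  using int_sq tail(1)[OF q] by simp
 also have "\<kappa> * \<dots> = (1 / q * (\<Sum>i<m. \<kappa> * (LINT s|M. (cmod (cinner (h i) (\<epsilon> s)))\<^sup>2)) + \<kappa> * (q * (LINT s|M. ?w s))) / 2"
  by (simp add: sum_distrib_left algebra_simps)
 also have "\<dots> \<le> (1 / q * (\<Sum>i<m. 1) + \<kappa> * (q * (D / q))) / 2"
 proof (intro divide_right_mono add_mono mult_left_mono sum_mono tail(2) q)
  fix i show "\<kappa> * (LINT s|M. (cmod (cinner (h i) (\<epsilon> s)))\<^sup>2) \<le> 1"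
   by (rule order_trans[OF bessel]) (simp add: h power_le_one)
 qed (use q pos in auto)
 finally show ?thesis using q by simp
qed

text \<open>Take m = i + 1 and q proportional to m, so small that at most half of the total mass of
  f_0, ..., f_i falls on \<open>Q q\<close>. Then l_i m/2 is at most the sum of l_j (1 - a_j) over j
  < m, which is the part off \<open>Q q\<close> of the sum of <A f_j, g_j>; \<open>tail_sum\<close>
  bounds it independently of m.\<close>

lemma schmidt_bound:
 assumes s: "schmidt l f g" "A = dgo (\<lambda>i. cor (l i)) f g"
  "\<forall>i. B (g i) = cor (l i) *C f i" "\<forall>i. A (f i) = cor (l i) *C g i"
 obtains C where "\<forall>i. l i \<le> C / (real i + 1)"
proof -
 have f: "ons f" "osys f" "osys g" and l: "decseq l" "\<And>i. 0 \<le> l i" and g1: "\<And>i. l i \<noteq> 0 \<Longrightarrow> norm (g i) = 1"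
  using s(1) by (auto simp: schmidt_def ons_osys)
 \<comment> \<open>Twice the constant in the bound for the mass on \<open>Q q\<close>, so that q = m
   / \<delta> captures at most m / 2; the summand 1 keeps it positive.\<close>
 define \<delta> where "\<delta> = 2 * \<kappa> * V * c + 1"
 define K where "K = (\<delta> + \<kappa> * D) / 2"
 have d: "\<delta> > 0" using pos by (simp add: \<delta>_def add_nonneg_pos)
 have "l i \<le> 2 * K / (real i + 1)" for i
 proof -
  define m where "m = Suc i"
  define q where "q = real m / \<delta>"
  have q: "q > 0" using d by (simp add: q_def m_def)
  let ?F = "\<lambda>j s. (cmod (cinner (f j) (\<epsilon> s)))\<^sup>2"
  let ?X = "\<lambda>j s. cinner (f j) (\<epsilon> s) * cinner (A (\<epsilon> s)) (g j)"
  \<comment> \<open>The share of the unit mass of f_j carried by \<open>Q q\<close>; it is at most 1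
    by \<open>bessel\<close>.\<close>
  define a where "a j = \<kappa> * (LINT s|M. indicator (Q q) s *\<^sub>R ?F j s)" for j
  have X: "?X j s = cor (l j * ?F j s)" for j s
  proof -
   have "cinner (A (\<epsilon> s)) (g j) = cor (l j) * cnj (cinner (f j) (\<epsilon> s))"
    using adj s(3) by (simp add: cinner_scaleC_right cinner_commute[of "f j"])
   then show ?thesis using mult_cnj_self[of "cinner (f j) (\<epsilon> s)"] by (simp add: mult_ac)
  qed
  have iF: "integrable M (\<lambda>s. indicator (Q q) s *\<^sub>R ?F j s)" for j by (intro integrable_mult_indicator Q(1) q int_sq)
  have a1: "a j \<le> 1" for j
  proof -
   have "a j \<le> \<kappa> * (LINT s|M. ?F j s)" unfolding a_def
    by (intro mult_left_mono integral_mono iF int_sq) (use pos in \<open>auto simp: indicator_def\<close>)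
   also have "\<dots> \<le> 1" using bessel[of "f j"] ons_norm[OF f(1), of j] by simp
   finally show ?thesis .
  qed
  have iQ: "integrable M (\<lambda>s. indicator (Q q) s *\<^sub>R V)"
   using measure_Q(1)[OF q] Q(1)[OF q] by simp
  have "(\<Sum>j<m. a j) = \<kappa> * (LINT s|M. (\<Sum>j<m. indicator (Q q) s *\<^sub>R ?F j s))"
   unfolding a_def sum_distrib_left[symmetric] Bochner_Integration.integral_sum[OF iF] by (rule refl)
  also have "\<dots> \<le> \<kappa> * (LINT s|M. indicator (Q q) s *\<^sub>R V)"
  proof (intro mult_left_mono integral_mono iQ Bochner_Integration.integrable_sum iF)
   fix s
   \<comment> \<open>Bessel for the single vector \<epsilon> s: the m densities together never
     exceed V.\<close>
   have "(\<Sum>j<m. ?F j s) = (\<Sum>j<m. (cmod (cinner (\<epsilon> s) (f j)))\<^sup>2)"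
    by (intro sum.cong refl) (subst cinner_commute, simp)
   also have "\<dots> \<le> V" using osys_bessel[OF f(2), of "{..<m}" "\<epsilon> s"] V[of s] by simp
   finally show "(\<Sum>j<m. indicator (Q q) s *\<^sub>R ?F j s) \<le> indicator (Q q) s *\<^sub>R V"
    by (auto simp: indicator_def)
  qed (use pos in simp)
  also have "(LINT s|M. indicator (Q q) s *\<^sub>R V) = measure M (Q q) * V" using Q(1)[OF q] by (simp add: space)
  also have "\<kappa> * (measure M (Q q) * V) \<le> \<kappa> * (c * q * V)"
   using measure_Q(2)[OF q] pos by (intro mult_left_mono mult_right_mono) auto
  also have "\<dots> = \<kappa> * V * c * real m / \<delta>" by (simp add: q_def)
  also have "\<dots> \<le> real m / 2"
  proof -
   have "2 * (\<kappa> * V * c) * real m \<le> \<delta> * real m" by (intro mult_right_mono) (auto simp: \<delta>_def)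
   then show ?thesis using d by (simp add: field_simps)
  qed
  finally have sa: "(\<Sum>j<m. a j) \<le> real m / 2" .
  have eq: "cor \<kappa> * (LINT s|M. indicator (- Q q) s *\<^sub>R ?X j s) = cor (l j * (1 - a j))" for j
  proof -
   have "cinner (A (f j)) (g j) = cor (l j)"
    using s(4) g1[of j] by (cases "l j = 0") (auto simp: cinner_scaleC_left cinner_norm)
   moreover have "(LINT s|M. indicator (Q q) s *\<^sub>R ?X j s) = cor (l j * (LINT s|M. indicator (Q q) s *\<^sub>R ?F j s))"
   proof -
    have "(LINT s|M. indicator (Q q) s *\<^sub>R ?X j s) = (LINT s|M. cor (l j * (indicator (Q q) s *\<^sub>R ?F j s)))"
     by (intro LINT_cong refl) (simp add: X indicator_def)
    also have "\<dots> = cor (LINT s|M. l j * (indicator (Q q) s *\<^sub>R ?F j s))" by (rule integral_complex_of_real)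
    finally show ?thesis by simp
   qed
   ultimately show ?thesis using split_frame[OF q, of "f j" "g j"] by (simp add: a_def algebra_simps)
  qed
  have "l i * (real m - (\<Sum>j<m. a j)) = (\<Sum>j<m. l i * (1 - a j))"
   by (simp add: sum_distrib_left[symmetric] sum_subtractf)
  also have "\<dots> \<le> (\<Sum>j<m. l j * (1 - a j))"
   using l(1) a1 by (intro sum_mono mult_right_mono) (auto simp: m_def decseq_def)
  also have "\<dots> = Re (\<Sum>j<m. cor (l j * (1 - a j)))" by simp
  also have "\<dots> \<le> cmod (\<Sum>j<m. cor (l j * (1 - a j)))" by (rule complex_Re_le_cmod)
  also have "\<dots> \<le> (real m / q + \<kappa> * D) / 2"
   unfolding eq[symmetric] by (rule tail_sum[OF q _ f(3)]) (use ons_norm[OF f(1)] in simp)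
  also have "real m / q = \<delta>" using d by (simp add: q_def m_def)
  finally have "l i * (real m - (\<Sum>j<m. a j)) \<le> K" by (simp add: K_def)
  moreover have "l i * (real m / 2) \<le> l i * (real m - (\<Sum>j<m. a j))" using sa l(2)[of i] by (intro mult_left_mono) auto
  ultimately have "l i * (real m / 2) \<le> K" by linarith
  then show ?thesis by (simp add: m_def field_simps)
 qed
 then have "\<forall>i. l i \<le> 2 * K / (real i + 1)" by blast
 then show ?thesis by (rule that)
qed

text \<open>Expanding in the basis writes the function as a pointwise limit of sums of products
  already known to be measurable.\<close>

lemma AE_meas: "(\<lambda>s. cinner (A (\<epsilon> s)) (\<epsilon> s)) \<in> borel_measurable M"
proof (rule borel_measurable_LIMSEQ_metric)
 show "(\<lambda>s. \<Sum>k<n. cinner (A (\<epsilon> s)) (e k) * cinner (e k) (\<epsilon> s)) \<in> borel_measurable M" for n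
  using sq_measurable[OF sq] sq_measurable[OF sqA] by (intro borel_measurable_sum borel_measurable_times)
 show "(\<lambda>n. \<Sum>k<n. cinner (A (\<epsilon> s)) (e k) * cinner (e k) (\<epsilon> s)) \<longlonglongrightarrow> cinner (A (\<epsilon> s)) (\<epsilon> s)" for s
  using onb_cinner_sums[OF e, of "A (\<epsilon> s)" "\<epsilon> s"] by (simp add: sums_def)
qed

lemma AE_int: "0 < q \<Longrightarrow> integrable M (\<lambda>s. indicator (Q q) s *\<^sub>R cinner (A (\<epsilon> s)) (\<epsilon> s))"
proof -
 assume q: "0 < q"
 obtain K where K0: "K > 0" and K: "\<And>x. norm (A x) \<le> K * norm x" using clinop_bound[OF clA] by metis
 then have K1: "K \<ge> 0" by simp
 have b: "cmod (cinner (A (\<epsilon> s)) (\<epsilon> s)) \<le> K * V" for s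
 proof -
  have "cmod (cinner (A (\<epsilon> s)) (\<epsilon> s)) \<le> norm (A (\<epsilon> s)) * norm (\<epsilon> s)" by (rule cinner_CS)
  also have "\<dots> \<le> K * norm (\<epsilon> s) * norm (\<epsilon> s)" by (intro mult_right_mono K) simp
  also have "\<dots> \<le> K * V" using mult_left_mono[OF V K1] by (simp add: power2_eq_square mult.assoc)
  finally show ?thesis .
 qed
 show ?thesis
 proof (rule LINT_dominated[of _ "\<lambda>s. indicator (Q q) s *\<^sub>R (K * V)"])
  show "integrable M (\<lambda>s. indicator (Q q) s *\<^sub>R (K * V))" using measure_Q(1)[OF q] Q(1)[OF q] by simp
  show "(\<lambda>s. indicator (Q q) s *\<^sub>R cinner (A (\<epsilon> s)) (\<epsilon> s)) \<in> borel_measurable M"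
   using AE_meas Q(1)[OF q] by (intro borel_measurable_scaleR borel_measurable_indicator) auto
  show "AE s in M. norm (indicator (Q q) s *\<^sub>R cinner (A (\<epsilon> s)) (\<epsilon> s)) \<le> norm (indicator (Q q) s *\<^sub>R (K * V))"
   using b K1 pos(4) by (intro AE_I2) (auto simp: indicator_def)
 qed
qed

text \<open>The trace of the Schmidt truncation of rank m = 2^n - 1 is the sum of <A g_i, g_i>,
  which the frame splits at q = 2^n. The part off \<open>Q q\<close> is bounded by
  \<open>tail_sum\<close>; on \<open>Q q\<close> replacing A by its truncation costs at most l_m V
  pointwise, hence O(l_m q) in the integral, which is bounded.\<close>

theorem frame_dts:
 "wk A" "dts e A (\<lambda>n. cor \<kappa> * (LINT s|M. indicator (Q (2 ^ n)) s *\<^sub>R cinner (A (\<epsilon> s)) (\<epsilon> s)))"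
proof -
 obtain l f g where s: "schmidt l f g" "A = dgo (\<lambda>i. cor (l i)) f g"
  "\<forall>i. B (g i) = cor (l i) *C f i" "\<forall>i. A (f i) = cor (l i) *C g i"
  by (rule schmidt_exists[OF cpt e B adj])
 obtain C where C: "\<forall>i. l i \<le> C / (real i + 1)" by (rule schmidt_bound[OF s])
 have f: "ons f" "osys f" "osys g" and l: "decseq l" "\<And>i. 0 \<le> l i" using s(1) by (auto simp: schmidt_def ons_osys)
 have lC: "cmod (cor (l i)) \<le> C / (real i + 1)" for i using C l(2)[of i] by simp
 show "wk A" unfolding s(2) by (rule dgo_wk[OF f(2,3) lC])
 have base: "dts e A (\<lambda>n. \<Sum>i<2 ^ n - 1. cor (l i) * cinner (g i) (f i))"
  unfolding s(2) by (rule dts_dgo[OF e f(2,3) lC])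
 show "dts e A (\<lambda>n. cor \<kappa> * (LINT s|M. indicator (Q (2 ^ n)) s *\<^sub>R cinner (A (\<epsilon> s)) (\<epsilon> s)))" (is "dts e A ?P")
 proof (rule dts_perturb[OF base], rule BseqI')
  fix n
  \<comment> \<open>Here m + 1 = q, so the first discarded singular value satisfies l_m \<le> C /
    q.\<close>
  define m where "m = (2::nat) ^ n - 1"
  define q where "q = (2::real) ^ n"
  have q: "q > 0" and mq: "real m + 1 = q" by (simp_all add: q_def m_def of_nat_diff)
  let ?X = "\<lambda>i s. cinner (g i) (\<epsilon> s) * cinner (A (\<epsilon> s)) (g i)"
  let ?Y = "\<lambda>s. cinner (A (\<epsilon> s)) (\<epsilon> s)"
  have iX: "integrable M (\<lambda>s. indicator (Q q) s *\<^sub>R ?X i s)" for i by (intro integrable_mult_indicator Q(1) q int_X)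
  have "(\<Sum>i<m. cor (l i) * cinner (g i) (f i)) = (\<Sum>i<m. cinner (A (g i)) (g i))"
  proof (rule sum.cong[OF refl])
   fix i
   have "cinner (A (g i)) (g i) = cinner (g i) (B (g i))" by (rule adj[rule_format])
   then show "cor (l i) * cinner (g i) (f i) = cinner (A (g i)) (g i)"
    by (simp only: s(3)[rule_format] cinner_scaleC_right complex_cnj_complex_of_real)
  qed
  also have "\<dots> = (\<Sum>i<m. cor \<kappa> * (LINT s|M. indicator (Q q) s *\<^sub>R ?X i s))
    + (\<Sum>i<m. cor \<kappa> * (LINT s|M. indicator (- Q q) s *\<^sub>R ?X i s))" (is "_ = ?H + ?T")
   by (subst sum.distrib[symmetric]) (rule sum.cong[OF refl split_frame[OF q]])
  finally have dec: "(\<Sum>i<m. cor (l i) * cinner (g i) (f i)) = ?H + ?T" .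
  have T: "cmod ?T \<le> (1 + \<kappa> * D) / 2"
  proof -
   have "cmod ?T \<le> (real m / q + \<kappa> * D) / 2"
    using f(3) by (intro tail_sum q f(3)) (simp add: osys_def)
   also have "real m / q \<le> 1" using mq q by simp
   then have "(real m / q + \<kappa> * D) / 2 \<le> (1 + \<kappa> * D) / 2" by (intro divide_right_mono add_right_mono) simp_all
   finally show ?thesis .
  qed
  \<comment> \<open>The sum is <A_m \<epsilon> s, \<epsilon> s> for the Schmidt truncation A_m, and
    A - A_m has norm at most l_m.\<close>
  have pt: "cmod (?Y s - (\<Sum>i<m. ?X i s)) \<le> l m * V" for s
  proof -
   have "(\<Sum>i<m. ?X i s) = cinner (\<Sum>i<m. (cor (l i) * cinner (\<epsilon> s) (f i)) *C g i) (\<epsilon> s)"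
    unfolding cinner_sum_left
   proof (rule sum.cong[OF refl])
    fix i
    have "cinner (A (\<epsilon> s)) (g i) = cinner (\<epsilon> s) (B (g i))" by (rule adj[rule_format])
    then have "cinner (A (\<epsilon> s)) (g i) = cor (l i) * cinner (\<epsilon> s) (f i)"
     by (simp only: s(3)[rule_format] cinner_scaleC_right complex_cnj_complex_of_real)
    then show "?X i s = cinner ((cor (l i) * cinner (\<epsilon> s) (f i)) *C g i) (\<epsilon> s)"
     by (simp only: cinner_scaleC_left mult.commute)
   qed
   then have "?Y s - (\<Sum>i<m. ?X i s) = cinner (A (\<epsilon> s) - (\<Sum>i<m. (cor (l i) * cinner (\<epsilon> s) (f i)) *C g i)) (\<epsilon> s)"
    by (simp add: cinner_diff_left)
   also have "cmod \<dots> \<le> norm (A (\<epsilon> s) - (\<Sum>i<m. (cor (l i) * cinner (\<epsilon> s) (f i)) *C g i)) * norm (\<epsilon> s)" by (rule cinner_CS)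
   also have "\<dots> \<le> l m * norm (\<epsilon> s) * norm (\<epsilon> s)"
    unfolding s(2) using l by (intro mult_right_mono dgo_tail_norm f inverse_bound_Bseq[OF lC]) (auto simp: decseq_def)
   also have "\<dots> \<le> l m * V" using mult_left_mono[OF V l(2)] by (simp add: power2_eq_square mult.assoc)
   finally show ?thesis .
  qed
  have iD: "integrable M (\<lambda>s. indicator (Q q) s *\<^sub>R (?Y s - (\<Sum>i<m. ?X i s)))"
  proof -
   have "integrable M (\<lambda>s. indicator (Q q) s *\<^sub>R ?Y s - (\<Sum>i<m. indicator (Q q) s *\<^sub>R ?X i s))"
    by (intro Bochner_Integration.integrable_diff AE_int q Bochner_Integration.integrable_sum iX)
   then show ?thesis by (simp add: scaleR_diff_right scaleR_sum_right)
  qed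
  have "?P n - ?H = cor \<kappa> * (LINT s|M. indicator (Q q) s *\<^sub>R (?Y s - (\<Sum>i<m. ?X i s)))"
   unfolding q_def[symmetric] sum_distrib_left[symmetric] right_diff_distrib[symmetric] scaleR_diff_right scaleR_sum_right
    Bochner_Integration.integral_diff[OF AE_int[OF q] Bochner_Integration.integrable_sum[OF iX]]
    Bochner_Integration.integral_sum[OF iX] by (rule refl)
  then have "cmod (?P n - ?H) = \<kappa> * cmod (LINT s|M. indicator (Q q) s *\<^sub>R (?Y s - (\<Sum>i<m. ?X i s)))" using pos by (simp add: norm_mult)
  also have "\<dots> \<le> \<kappa> * (LINT s|M. indicator (Q q) s *\<^sub>R (l m * V))"
  proof (rule mult_left_mono[OF order_trans[OF integral_norm_bound]])
   show "(LINT s|M. cmod (indicator (Q q) s *\<^sub>R (?Y s - (\<Sum>i<m. ?X i s)))) \<le> (LINT s|M. indicator (Q q) s *\<^sub>R (l m * V))"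
   proof (rule integral_mono)
    show "integrable M (\<lambda>s. indicator (Q q) s *\<^sub>R (l m * V))" using measure_Q(1)[OF q] Q(1)[OF q] by simp
    show "cmod (indicator (Q q) s *\<^sub>R (?Y s - (\<Sum>i<m. ?X i s))) \<le> indicator (Q q) s *\<^sub>R (l m * V)" for s
     using pt[of s] by (auto simp: indicator_def)
   qed (rule integrable_norm[OF iD])
  qed (use pos in simp)
  also have "\<dots> = \<kappa> * (measure M (Q q) * (l m * V))" using Q(1)[OF q] by (simp add: space)
  also have "\<dots> \<le> \<kappa> * (c * q * (C / q * V))"
   using measure_Q(2)[OF q] C[rule_format, of m] l(2)[of m] pos q unfolding mq by (intro mult_left_mono mult_mono mult_right_mono) auto
  also have "\<dots> = \<kappa> * c * C * V" using q by simp
  finally have H: "cmod (?P n - ?H) \<le> \<kappa> * c * C * V" .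
  have eq: "?P n - (\<Sum>i<2 ^ n - 1. cor (l i) * cinner (g i) (f i)) = (?P n - ?H) - ?T"
   unfolding m_def[symmetric] dec by simp
  show "norm (?P n - (\<Sum>i<2 ^ n - 1. cor (l i) * cinner (g i) (f i))) \<le> \<kappa> * c * C * V + (1 + \<kappa> * D) / 2"
   unfolding eq by (rule order_trans[OF norm_triangle_ineq4 add_mono[OF H T]])
 qed
qed

end

section \<open>Multiplication operators and Fourier multipliers\<close>

lemma sqint_mul:
 assumes "sqint f" "g \<in> borel_measurable borel" "\<And>s. \<bar>g s\<bar> \<le> K"
 shows "sqint (\<lambda>s. cor (g s) * f s)"
proof -
 note [measurable] = sqint_measurable[OF assms(1)] assms(2)
 show ?thesis unfolding sqint_sq
  by (rule sq_bound[where g = f and C = K]) (use assms in \<open>auto simp: sqint_sq norm_mult intro!: mult_right_mono\<close>)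
qed

definition mulop :: "(real^('d::finite) \<Rightarrow> real) \<Rightarrow> 'd L2 \<Rightarrow> 'd L2" where
 "mulop g u = cls (\<lambda>s. cor (g s) * rpf u s)"

definition bmf :: "(real^('d::finite) \<Rightarrow> real) \<Rightarrow> bool" where
 "bmf g \<longleftrightarrow> g \<in> borel_measurable borel \<and> (\<exists>K. \<forall>s. \<bar>g s\<bar> \<le> K)"

lemma bmf_sqint: "bmf g \<Longrightarrow> sqint f \<Longrightarrow> sqint (\<lambda>s. cor (g s) * f s)"
 unfolding bmf_def using sqint_mul by blast

lemma mulop_cls: assumes "bmf g" "sqint f" shows "mulop g (cls f) = cls (\<lambda>s. cor (g s) * f s)"
 unfolding mulop_def
proof (rule cls_cong)
 show "AE s in lborel. cor (g s) * rpf (cls f) s = cor (g s) * f s"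
  using AE_rpf_cls[OF assms(2)] by eventually_elim simp
qed (intro bmf_sqint sqint_rpf assms)+

lemma clinop_mulop: assumes g: "bmf g" shows "clinop (mulop g)"
proof -
 obtain K where K: "\<And>s. \<bar>g s\<bar> \<le> K" using g by (auto simp: bmf_def)
 have K0: "0 \<le> K" using K[of undefined] by (rule order_trans[OF abs_ge_zero])
 show ?thesis
 proof (rule clinopI[of _ K])
  fix u v :: "'a L2" and a
  obtain f where f: "sqint f" "u = cls f" by (rule L2_cases)
  obtain h where h: "sqint h" "v = cls h" by (rule L2_cases)
  note s = bmf_sqint[OF g f(1)] bmf_sqint[OF g h(1)]
  show "mulop g (u + v) = mulop g u + mulop g v" unfolding f(2) h(2)
   by (simp add: L2_add_cls f h s mulop_cls[OF g] sqint_add distrib_left)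
  show "mulop g (a *C u) = a *C mulop g u" 
  proof -
   have e: "(\<lambda>s. cor (g s) * (a * f s)) = (\<lambda>s. a * (cor (g s) * f s))" by (simp add: fun_eq_iff)
   show ?thesis
    unfolding f(2) L2_scaleC_cls[OF f(1)] mulop_cls[OF g sqint_scale[OF f(1)]] mulop_cls[OF g f(1)] L2_scaleC_cls[OF s(1)] e ..
  qed
  have "(norm (mulop g u))^2 \<le> (K * norm u)^2"
   unfolding f(2) mulop_cls[OF g f(1)] L2_norm_sq[OF s(1)] power_mult_distrib L2_norm_sq[OF f(1)] Bochner_Integration.integral_mult_right_zero[symmetric]
  proof (rule integral_mono)
   show "integrable lborel (\<lambda>x. (cmod (cor (g x) * f x))\<^sup>2)" using s(1) by (simp add: sqint_def)
   show "integrable lborel (\<lambda>x. K\<^sup>2 * (cmod (f x))^2)" using f(1) by (simp add: sqint_def)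
   show "(cmod (cor (g x) * f x))^2 \<le> K\<^sup>2 * (cmod (f x))^2" for x
    using power_mono[OF K[of x], of 2] by (simp add: norm_mult power_mult_distrib mult_right_mono)
  qed
  then show "norm (mulop g u) \<le> K * norm u" by (rule power2_le_imp_le) (simp add: K0)
 qed
qed

lemma bmf_mult: assumes "bmf g" "bmf h" shows "bmf (\<lambda>s. g s * h s)"
proof -
 obtain K L where K: "\<And>s. \<bar>g s\<bar> \<le> K" "\<And>s. \<bar>h s\<bar> \<le> L" using assms by (auto simp: bmf_def)
 have "\<bar>g s * h s\<bar> \<le> K * L" for s using mult_mono[OF K(1)[of s] K(2)[of s]] order_trans[OF abs_ge_zero K(1)[of s]] by (simp add: abs_mult)
 then show ?thesis using assms unfolding bmf_def by (intro conjI borel_measurable_times) auto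
qed

lemma mulop_mulop: assumes "bmf g" "bmf h" shows "mulop g (mulop h u) = mulop (\<lambda>s. g s * h s) u"
proof -
 obtain f where f: "sqint f" "u = cls f" by (rule L2_cases)
 show ?thesis unfolding f(2) by (simp add: mulop_cls assms bmf_mult bmf_sqint f mult.assoc)
qed

lemma mulop_adjoint: assumes g: "bmf g" shows "cinner (mulop g u) v = cinner u (mulop g v)"
proof -
 obtain f where f: "sqint f" "u = cls f" by (rule L2_cases)
 obtain h where h: "sqint h" "v = cls h" by (rule L2_cases)
 show ?thesis unfolding f(2) h(2) mulop_cls[OF g f(1)] mulop_cls[OF g h(1)]
   L2_cinner_cls[OF bmf_sqint[OF g f(1)] h(1)] L2_cinner_cls[OF f(1) bmf_sqint[OF g h(1)]] l2inner_def
  by (simp add: mult_ac)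
qed

definition fmul :: "(real^('d::finite) \<Rightarrow> real) \<Rightarrow> 'd L2 \<Rightarrow> 'd L2" where
 "fmul g u = FT 1 (mulop g (FT (-1) u))"

lemma pm1: "pm 1" "pm (-1)" by (auto simp: pm_def)

lemma FT_unit1: "unit_pair (FT 1 :: ('d::finite) L2 \<Rightarrow> 'd L2) (FT (-1))" by (rule FT_unit[OF pm1(1)])

lemma FT_inv: "FT 1 (FT (-1) u) = u" "FT (-1) (FT 1 u) = u"
 using FT_unit1[unfolded unit_pair_def, THEN conjunct2, THEN conjunct2, THEN spec, of u] by auto

lemma clinop_FT: "clinop (FT 1)" "clinop (FT (-1))"
 by (rule FT_unit1[unfolded unit_pair_def, THEN conjunct1])
  (rule FT_unit1[unfolded unit_pair_def, THEN conjunct2, THEN conjunct1])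

lemma clinop_fmul: "bmf g \<Longrightarrow> clinop (fmul g)"
 unfolding fmul_def[abs_def] by (rule clinop_comp[OF clinop_FT(1) clinop_comp[OF clinop_mulop clinop_FT(2)]])

lemma fmul_adjoint: "bmf g \<Longrightarrow> cinner (fmul g u) v = cinner u (fmul g v)"
 by (simp add: fmul_def FT_adjoint[OF pm1(1)] FT_adjoint[OF pm1(2)] mulop_adjoint)

lemma fou_parseval:
 fixes f g :: "('d::finite) fn"
 assumes f: "l1l2 f" and g: "l1l2 g"
 shows "cinner (cls (fou (-1) f)) (cls (fou (-1) g)) = cor ((2 * pi) ^ CARD('d)) * cinner (cls f) (cls g)"
proof -
 let ?c = "1 / sqrt (2 * pi) ^ CARD('d)"
 have "cinner (cls f) (cls g) = cinner (FT (-1) (cls f)) (FT (-1) (cls g))"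
  by (rule unit_cinner[symmetric, OF FT_unit[OF pm1(2)]])
 also have "\<dots> = cor (?c * ?c) * cinner (cls (fou (-1) f)) (cls (fou (-1) g))"
  unfolding FT_cls[OF f pm1(2)] FT_cls[OF g pm1(2)] FT0_def cinner_scaleC_left cinner_scaleC_right by simp
 also have "?c * ?c = 1 / (2 * pi) ^ CARD('d)"
  unfolding sqrt_power_sq[symmetric] by (simp add: power2_eq_square)
 finally show ?thesis by simp
qed

lemma fmul_fourier_mult:
 fixes g :: "real^('d::finite) \<Rightarrow> real"
 assumes g: "bmf g" shows "fourier_mult g (rop (fmul g))"
 unfolding fourier_mult_def
proof (intro conjI allI impI is_bop_rop clinop_fmul g)
 fix f h :: "'d fn" assume fh: "l1l2 f \<and> l1l2 h"
 then have f: "l1l2 f" "sqint f" and h: "l1l2 h" "sqint h" by (auto simp: l1l2_def)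
 note sF = plancherel_l1l2(1)[OF f(1) pm1(2)] and sH = plancherel_l1l2(1)[OF h(1) pm1(2)]
 let ?c = "1 / sqrt (2 * pi) ^ CARD('d)"
 have "l2inner (rop (fmul g) f) h = cinner (fmul g (cls f)) (cls h)"
  using L2_cinner_cls[OF rop_sqint h(2), of "fmul g" f] by (simp add: cls_rop f)
 also have "\<dots> = cinner (mulop g (FT (-1) (cls f))) (FT (-1) (cls h))" unfolding fmul_def by (rule FT_adjoint[OF pm1(1)])
 also have "mulop g (FT (-1) (cls f)) = cor ?c *C cls (\<lambda>s. cor (g s) * fou (-1) f s)"
  unfolding FT_cls[OF f(1) pm1(2)] FT0_def by (simp only: clinop_scaleC[OF clinop_mulop[OF g]] mulop_cls[OF g sF])
 also have "FT (-1) (cls h) = cor ?c *C cls (fou (-1) h)" unfolding FT_cls[OF h(1) pm1(2)] FT0_def ..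
 also have "cinner (cor ?c *C cls (\<lambda>s. cor (g s) * fou (-1) f s)) (cor ?c *C cls (fou (-1) h))
   = cor (?c * ?c) * (LINT s|lborel. cor (g s) * fou (-1) f s * cnj (fou (-1) h s))"
  unfolding cinner_scaleC_left cinner_scaleC_right L2_cinner_cls[OF bmf_sqint[OF g sF] sH] l2inner_def by simp
 also have "?c * ?c = 1 / (2 * pi) ^ CARD('d)"
  unfolding sqrt_power_sq[symmetric] by (simp add: power2_eq_square)
 finally show "l2inner (rop (fmul g) f) h = cor (1 / (2 * pi) ^ CARD('d)) *
   (LINT \<xi>|lborel. cor (g \<xi>) * fourier f \<xi> * cnj (fourier h \<xi>))" by (simp add: fourier_fou)
qed

section \<open>The Bessel potential of order d and its resolvent\<close>

definition bes :: "real^('d::finite) \<Rightarrow> real" where "bes \<xi> = (1 + (norm \<xi>)^2) powr (- real CARD('d) / 2)"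

text \<open>Symbol of the inverse of 1 + t (1 - Laplacian)^(-d/2).\<close>

definition res :: "real \<Rightarrow> real^('d::finite) \<Rightarrow> real" where "res t \<xi> = 1 / (1 + t * bes \<xi>)"

lemma bes_bounds: "0 \<le> bes \<xi>" "bes \<xi> \<le> 1"
proof -
 have "(1 + (norm \<xi>)^2) powr (- real CARD('a) / 2) \<le> (1 + (norm \<xi>)^2) powr 0" by (rule powr_mono) auto
 then show "bes \<xi> \<le> 1" by (simp add: bes_def add_pos_nonneg pos_add_strict split: if_splits)
qed (simp add: bes_def)

lemma bes_measurable [measurable]: "bes \<in> borel_measurable borel" unfolding bes_def[abs_def] by measurable

lemma bes_bmf: "bmf bes"
 unfolding bmf_def by (intro conjI bes_measurable exI[of _ 1]) (simp add: abs_of_nonneg bes_bounds)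

lemma res_bmf: assumes t: "0 < t" shows "bmf (res t)"
proof -
 have "res t \<in> borel_measurable borel" unfolding res_def[abs_def] by measurable
 moreover have "\<bar>res t \<xi>\<bar> \<le> 1" for \<xi> using mult_nonneg_nonneg[OF less_imp_le[OF t] bes_bounds(1)[of \<xi>]] by (simp add: res_def)
 ultimately show ?thesis unfolding bmf_def by blast
qed

lemma mulop_one: "mulop (\<lambda>s. 1) u = u" by (simp add: mulop_def)

text \<open>Both one-sided identities are recorded since \<open>laplacian_modulated\<close> asks for
  a two-sided inverse.\<close>

lemma fmul_resolvent:
 assumes t: "0 < t"
 shows "fmul (res t) (u + cor t *C fmul bes u) = u" "fmul (res t) u + cor t *C fmul bes (fmul (res t) u) = u"
proof -
 have bs: "bmf (\<lambda>s. 1 + t * bes s)"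
  unfolding bmf_def
 proof (intro conjI exI[of _ "1 + t"] allI)
  show "\<bar>1 + t * bes s\<bar> \<le> 1 + t" for s
   using mult_left_mono[OF bes_bounds(2)[of s], of t] mult_nonneg_nonneg[OF less_imp_le[OF t] bes_bounds(1)[of s]] t by simp
 qed measurable
 note fm = clinop_FT
 have e: "mulop (\<lambda>s. 1 + t * bes s) v = v + cor t *C mulop bes v" for v
 proof -
  obtain f where f: "sqint f" "v = cls f" by (rule L2_cases)
  note sb = bmf_sqint[OF bes_bmf f(1)]
  have e: "(\<lambda>s. cor (1 + t * bes s) * f s) = (\<lambda>s. f s + cor t * (cor (bes s) * f s))"
   by (simp add: fun_eq_iff algebra_simps)
  show ?thesis unfolding f(2) mulop_cls[OF bs f(1)] mulop_cls[OF bes_bmf f(1)] e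
    L2_scaleC_cls[OF sb] L2_add_cls[OF f(1) sqint_scale[OF sb]] ..
 qed
 have one: "res t s * (1 + t * bes s) = 1" for s using mult_nonneg_nonneg[OF less_imp_le[OF t] bes_bounds(1)[of s]] by (simp add: res_def)
 have "FT (-1) (u + cor t *C fmul bes u) = mulop (\<lambda>s. 1 + t * bes s) (FT (-1) u)"
  unfolding e fmul_def by (simp add: clinop_add[OF fm(2)] clinop_scaleC[OF fm(2)] FT_inv)
 then show "fmul (res t) (u + cor t *C fmul bes u) = u"
  unfolding fmul_def by (simp add: mulop_mulop[OF res_bmf[OF t] bs] one mulop_one FT_inv)
 have "fmul (res t) u + cor t *C fmul bes (fmul (res t) u) = FT 1 (mulop (\<lambda>s. 1 + t * bes s) (mulop (res t) (FT (-1) u)))"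
  unfolding e fmul_def FT_inv by (simp add: clinop_add[OF fm(1)] clinop_scaleC[OF fm(1)])
 then show "fmul (res t) u + cor t *C fmul bes (fmul (res t) u) = u"
  by (simp add: mulop_mulop[OF bs res_bmf[OF t]] one mulop_one FT_inv mult.commute[of "1 + _"])
qed

text \<open>The hypothesis speaks of every multiplier and inverse with the stated properties;
  \<open>fmul bes\<close> and \<open>fmul (res t)\<close> give such a pair. The constant is squared
  because the sum is the square of a Hilbert-Schmidt norm.\<close>

lemma laplacian_modulated_hs:
 fixes A :: "('d::finite) op" and E :: "nat \<Rightarrow> 'd L2"
 assumes A: "laplacian_modulated A" and E: "is_onb E"
 obtains C where "0 \<le> C" "\<forall>t>0. summable (\<lambda>k. (norm (lop A (fmul (res t) (E k))))\<^sup>2) \<and> (\<Sum>k. (norm (lop A (fmul (res t) (E k))))\<^sup>2) \<le> C / t"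
proof -
 have bA: "is_bop A" using A by (simp add: laplacian_modulated_def)
 from A obtain C where C: "\<forall>t>0. \<forall>M T. fourier_mult (\<lambda>\<xi>. (1 + (norm \<xi>)^2) powr (- real CARD('d) / 2)) M \<and> is_bop T \<and>
    (\<forall>f. sqint f \<longrightarrow> aeq (T (\<lambda>x. f x + cor t * M f x)) f \<and> aeq (\<lambda>x. T f x + cor t * M (T f) x) f)
    \<longrightarrow> hs_le (A \<circ> T) (C / sqrt t)" unfolding laplacian_modulated_def by (elim conjE exE) blast
 have "summable (\<lambda>k. (norm (lop A (fmul (res t) (E k))))\<^sup>2) \<and> (\<Sum>k. (norm (lop A (fmul (res t) (E k))))\<^sup>2) \<le> C\<^sup>2 / t" if t: "0 < t" for t
 proof -
  let ?M = "rop (fmul bes) :: 'd op" and ?T = "rop (fmul (res t)) :: 'd op"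
  have cT: "clinop (fmul (res t) :: 'd L2 \<Rightarrow> 'd L2)" by (rule clinop_fmul[OF res_bmf[OF t]])
  have M: "fourier_mult (\<lambda>\<xi>. (1 + (norm \<xi>)^2) powr (- real CARD('d) / 2)) ?M"
   using fmul_fourier_mult[OF bes_bmf] unfolding bes_def[abs_def] .
  have inv: "aeq (?T (\<lambda>x. f x + cor t * ?M f x)) f \<and> aeq (\<lambda>x. ?T f x + cor t * ?M (?T f) x) f" if f: "sqint f" for f
  proof -
   have s: "sqint (\<lambda>x. f x + cor t * ?M f x)" "sqint (\<lambda>x. ?T f x + cor t * ?M (?T f) x)"
    by (intro sqint_add sqint_scale rop_sqint f)+
   have "cls (?T (\<lambda>x. f x + cor t * ?M f x)) = cls f"
    using fmul_resolvent(1)[OF t, of "cls f"]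
    by (simp add: cls_rop s f L2_add_cls[symmetric] L2_scaleC_cls[symmetric] sqint_scale rop_sqint)
   moreover have "cls (\<lambda>x. ?T f x + cor t * ?M (?T f) x) = cls f"
    using fmul_resolvent(2)[OF t, of "cls f"]
    by (simp add: cls_rop s f L2_add_cls[symmetric] L2_scaleC_cls[symmetric] sqint_scale rop_sqint)
   ultimately show ?thesis using cls_eq_iff[OF rop_sqint f] cls_eq_iff[OF s(2) f] by simp
  qed
  have "\<forall>f. sqint f \<longrightarrow> aeq (?T (\<lambda>x. f x + cor t * ?M f x)) f \<and> aeq (\<lambda>x. ?T f x + cor t * ?M (?T f) x) f"
   using inv by simp
  then have "hs_le (A \<circ> ?T) (C / sqrt t)"
   by (intro C[THEN spec, THEN mp, OF t, THEN spec, THEN spec, THEN mp, OF conjI[OF M conjI[OF is_bop_rop[OF cT]]]])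
  then have h: "summable (\<lambda>k. (l2norm ((A \<circ> ?T) (rpf (E k))))\<^sup>2)" "sqrt (\<Sum>k. (l2norm ((A \<circ> ?T) (rpf (E k))))\<^sup>2) \<le> C / sqrt t"
   using onb_rpf[OF E] unfolding hs_le_def by blast+
  have e: "l2norm ((A \<circ> ?T) (rpf (E k))) = norm (lop A (fmul (res t) (E k)))" for k
  proof -
   have "norm (lop A (fmul (res t) (E k))) = norm (lop A (cls (?T (rpf (E k)))))" by (simp add: cls_rop sqint_rpf)
   also have "\<dots> = l2norm (A (?T (rpf (E k))))"
    by (simp add: lop_cls[OF bA rop_sqint] L2_norm_cls is_bopD(1)[OF bA rop_sqint])
   finally show ?thesis by simp
  qed
  let ?S = "\<Sum>k. (norm (lop A (fmul (res t) (E k))))\<^sup>2"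
  have s: "summable (\<lambda>k. (norm (lop A (fmul (res t) (E k))))\<^sup>2)" "sqrt ?S \<le> C / sqrt t" using h unfolding e .
  have S0: "0 \<le> ?S" by (rule suminf_nonneg[OF s(1)]) simp
  have "(sqrt ?S)^2 \<le> (C / sqrt t)^2" by (rule power_mono[OF s(2)]) (simp add: S0)
  then show ?thesis using s(1) S0 t by (simp add: power_divide)
 qed
 then show ?thesis by (intro that[of "C\<^sup>2"]) auto
qed

section \<open>Hilbert--Schmidt operators\<close>

text \<open>Tonelli for the double series of |<X e_k, e_j>|^2. Sums in the extended nonnegative
  reals avoid any question of convergence.\<close>

lemma hs_transpose:
 assumes e: "is_onb e" and adj: "\<And>x y. cinner (X x) y = cinner x (Y y)"
 shows "(\<Sum>k. ennreal ((norm (X (e k)))^2)) = (\<Sum>k. ennreal ((norm (Y (e k)))^2))"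
proof -
 have n: "ennreal ((norm x)^2) = (\<Sum>j. ennreal ((cmod (cinner x (e j)))^2))" for x
  using onb_norm_sums[OF e, of x] by (subst suminf_ennreal_eq[of _ "(norm x)^2"]) auto
 have "(\<Sum>k. ennreal ((norm (X (e k)))^2)) = (\<Sum>k. \<integral>\<^sup>+j. ennreal ((cmod (cinner (X (e k)) (e j)))^2) \<partial>count_space UNIV)"
  unfolding n by (simp add: nn_integral_count_space_nat)
 also have "\<dots> = (\<integral>\<^sup>+j. (\<Sum>k. ennreal ((cmod (cinner (X (e k)) (e j)))^2)) \<partial>count_space UNIV)"
  by (rule nn_integral_suminf[symmetric]) simp
 also have "\<dots> = (\<Sum>j. \<Sum>k. ennreal ((cmod (cinner (X (e k)) (e j)))^2))" by (rule nn_integral_count_space_nat)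
 also have "\<dots> = (\<Sum>j. ennreal ((norm (Y (e j)))^2))"
 proof -
  have "cmod (cinner (X (e k)) (e j)) = cmod (cinner (Y (e j)) (e k))" for j k
   unfolding adj by (subst cinner_commute) simp
  then show ?thesis unfolding n by simp
 qed
 finally show ?thesis .
qed

text \<open>Finite sections along the basis converge in norm; Cauchy-Schwarz bounds the error by the
  tail of the Hilbert-Schmidt sum.\<close>

lemma hs_cpt:
 assumes e: "is_onb e" and X: "clinop X" and s: "summable (\<lambda>k. (norm (X (e k)))\<^sup>2)"
 shows "cpt X"
proof (rule cpt_approx[OF X])
 fix \<epsilon> :: real assume \<epsilon>: "\<epsilon> > 0"
 have o: "osys e" using e by (simp add: is_onb_def ons_osys)
 obtain n where n: "\<And>m N. m \<ge> n \<Longrightarrow> norm (\<Sum>k=m..<N. (norm (X (e k)))\<^sup>2) < \<epsilon>\<^sup>2"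
  using s[unfolded summable_Cauchy] \<epsilon> by (meson zero_less_power)
 let ?F = "\<lambda>x. \<Sum>k<n. cinner x (e k) *C X (e k)"
 have "norm (X x - ?F x) \<le> \<epsilon> * norm x" for x
 proof -
  have sm: "(\<lambda>k. cinner x (e k) *C X (e k)) sums X x"
   using clinop_sums[OF X onb_expand[OF e, of x]] by (simp only: clinop_scaleC[OF X])
  have "(\<lambda>N. (\<Sum>k<N. cinner x (e k) *C X (e k)) - ?F x) \<longlonglongrightarrow> X x - ?F x"
   using sm unfolding sums_def by (intro tendsto_diff tendsto_const)
  then have lim: "(\<lambda>N. norm ((\<Sum>k<N. cinner x (e k) *C X (e k)) - ?F x)) \<longlonglongrightarrow> norm (X x - ?F x)" by (rule tendsto_norm)
  have "norm ((\<Sum>k<N. cinner x (e k) *C X (e k)) - ?F x) \<le> \<epsilon> * norm x" if N: "N \<ge> n" for N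
  proof -
   have "(\<Sum>k<N. cinner x (e k) *C X (e k)) - ?F x = (\<Sum>k=n..<N. cinner x (e k) *C X (e k))"
    using sum.atLeastLessThan_concat[of 0 n N "\<lambda>k. cinner x (e k) *C X (e k)"] N by (simp add: lessThan_atLeast0 algebra_simps)
   then have "norm ((\<Sum>k<N. cinner x (e k) *C X (e k)) - ?F x) \<le> (\<Sum>k=n..<N. cmod (cinner x (e k)) * norm (X (e k)))"
    using norm_sum[of "\<lambda>k. cinner x (e k) *C X (e k)" "{n..<N}"] by (simp add: norm_scaleC)
   also have "\<dots> \<le> \<epsilon> * norm x"
   proof (rule power2_le_imp_le)
    have "(\<Sum>k=n..<N. cmod (cinner x (e k)) * norm (X (e k)))^2 \<le> (\<Sum>k=n..<N. (cmod (cinner x (e k)))\<^sup>2) * (\<Sum>k=n..<N. (norm (X (e k)))\<^sup>2)"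
     by (rule Cauchy_Schwarz_ineq_sum)
    also have "\<dots> \<le> (norm x)^2 * \<epsilon>\<^sup>2"
     using osys_bessel[OF o, of "{n..<N}" x] n[of n N] by (intro mult_mono) (auto simp: sum_nonneg)
    finally show "(\<Sum>k=n..<N. cmod (cinner x (e k)) * norm (X (e k)))^2 \<le> (\<epsilon> * norm x)^2" by (simp add: power_mult_distrib mult.commute)
   qed (use \<epsilon> in simp)
   finally show ?thesis .
  qed
  then show ?thesis by (intro LIMSEQ_le_const2[OF lim]) auto
 qed
 then show "\<exists>F n. clinop F \<and> rank_op F n \<and> (\<forall>x. norm (X x - F x) \<le> \<epsilon> * norm x)"
  by (intro exI[of _ ?F] exI[of _ n] conjI clinop_finsum clinop_rank1 rank_op_sum allI)
qed

lemma cpt_precomp: assumes "cpt X" "clinop W" shows "cpt (\<lambda>u. X (W u))"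
 unfolding cpt_def
proof (intro conjI allI impI)
 show "clinop (\<lambda>u. X (W u))" by (rule clinop_comp[OF _ assms(2)]) (use assms(1) in \<open>simp add: cpt_def\<close>)
 fix Z :: "nat \<Rightarrow> 'a" assume Z: "bounded (range Z)"
 have "bounded (W ` range Z)" by (rule bounded_linear_image[OF Z clinop_bounded_linear[OF assms(2)]])
 then have "bounded (range (\<lambda>k. W (Z k)))" by (simp add: image_image)
 then show "\<exists>r::nat\<Rightarrow>nat. strict_mono r \<and> convergent (\<lambda>k. X (W (Z (r k))))" using assms(1) unfolding cpt_def by blast
qed

section \<open>Localised exponentials\<close>

text \<open>The cut-off to a ball makes the exponential square integrable and is invisible to an
  operator supported in that ball.\<close>

definition eps :: "real \<Rightarrow> real^('d::finite) \<Rightarrow> 'd L2" where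
 "eps r s = cls (\<lambda>y. indicator (cball 0 r) y * iexp (inner y s))"

definition chi :: "real \<Rightarrow> ('d::finite) L2 \<Rightarrow> 'd L2" where "chi r = mulop (indicator (cball 0 r))"

lemma chi_bmf: "bmf (indicator (cball 0 r))"
 unfolding bmf_def by (intro conjI exI[of _ 1] borel_measurable_indicator) (auto simp: indicator_def)

lemma cball_finite: "emeasure lborel (cball 0 r :: 'a::euclidean_space set) < \<infinity>"
 by (rule emeasure_bounded_finite) simp

lemma of_real_indicator: "cor (indicator S y) = indicator S y" by (simp add: indicator_def)

lemma chi_cls: "sqint f \<Longrightarrow> chi r (cls f) = cls (\<lambda>y. indicator (cball 0 r) y * f y)"
 unfolding chi_def by (simp only: mulop_cls[OF chi_bmf] of_real_indicator)

lemma chi_rpf_l1l2: "l1l2 (\<lambda>y. indicator (cball 0 r) y * rpf u y)"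
 by (rule indicator_mult_l1l2[OF sqint_rpf _ cball_finite]) simp

lemma chi_rpf: "chi r u = cls (\<lambda>y. indicator (cball 0 r) y * rpf u y)"
 using chi_cls[OF sqint_rpf, of r u] by simp

lemma chi_adjoint: "cinner (chi r u) v = cinner u (chi r v)"
 unfolding chi_def by (rule mulop_adjoint[OF chi_bmf])

lemma chi_idem: "chi r (chi r u) = chi r u"
proof -
 have "(\<lambda>s. indicator (cball 0 r) s * indicator (cball 0 r) s) = (indicator (cball 0 r) :: real^'a \<Rightarrow> real)"
  by (auto simp: fun_eq_iff indicator_def)
 then show ?thesis unfolding chi_def mulop_mulop[OF chi_bmf chi_bmf] by simp
qed

lemma chi_norm: "norm (chi r u) \<le> norm u"
proof -
 have "(norm (chi r u))^2 = Re (cinner (chi r u) u)"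
  using chi_adjoint[of r "chi r u" u] cinner_norm[of "chi r u"] by (simp add: chi_idem chi_adjoint[of r u "chi r u"] cinner_commute[of u])
 also have "\<dots> \<le> norm (chi r u) * norm u" by (rule order_trans[OF complex_Re_le_cmod cinner_CS])
 finally show ?thesis by (cases "norm (chi r u) = 0") (auto simp: power2_eq_square)
qed

lemma iexp_inner_measurable [measurable]: "(\<lambda>y :: 'a::euclidean_space. iexp (inner y s)) \<in> borel_measurable borel"
 by (intro borel_measurable_continuous_onI continuous_intros)

lemma cball_sets [measurable]: "cball x r \<in> sets borel" by simp

lemma eps_sqint: "sqint (\<lambda>y :: real^'d::finite. indicator (cball 0 r) y * iexp (inner y s))"
 unfolding sqint_sq
proof (rule sq_bound[where g = "indicator (cball 0 r)" and C = 1])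
 show "sq lborel (indicator (cball 0 r) :: real^'d \<Rightarrow> complex)" using sqint_indicator[OF _ cball_finite[of r]] by (simp add: sqint_sq)
 have "(\<lambda>y. indicator (cball 0 r) y * iexp (inner y s)) \<in> borel_measurable borel"
  by (intro borel_measurable_times borel_measurable_indicator iexp_inner_measurable) simp
 then show "(\<lambda>y. indicator (cball 0 r) y * iexp (inner y s)) \<in> borel_measurable lborel" by simp
 show "cmod (indicator (cball 0 r) y * iexp (inner y s)) \<le> 1 * cmod (indicator (cball 0 r) y)" for y
  by (simp only: norm_mult norm_iexp)
qed

lemma eps_norm: "(norm (eps r (s :: real^'d::finite)))^2 = measure lborel (cball (0 :: real^'d) r)"
proof -
 have "(norm (eps r s))^2 = (LINT y|lborel. indicator (cball (0 :: real^'d) r) y)"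
  unfolding eps_def L2_norm_sq[OF eps_sqint] by (intro LINT_cong refl) (simp only: norm_mult norm_iexp, simp add: indicator_def)
 then show ?thesis by simp
qed

lemma cinner_eps: "cinner u (eps r s) = fou (-1) (\<lambda>y. indicator (cball 0 r) y * rpf u y) s"
proof -
 have "cinner u (eps r s) = l2inner (rpf u) (\<lambda>y. indicator (cball 0 r) y * iexp (inner y s))"
  unfolding eps_def using L2_cinner_cls[OF sqint_rpf eps_sqint, of u r s] by simp
 also have "\<dots> = fou (-1) (\<lambda>y. indicator (cball 0 r) y * rpf u y) s"
  unfolding l2inner_def fou_def
  by (intro LINT_cong refl) (simp only: complex_cnj_mult cnj_iexp, simp add: indicator_def)
 finally show ?thesis .
qed

lemma cinner_eps_fun: "(\<lambda>s. cinner u (eps r s)) = fou (-1) (\<lambda>y. indicator (cball 0 r) y * rpf u y)"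
 by (simp add: fun_eq_iff cinner_eps)

lemma sqint_cinner_eps: "sqint (\<lambda>s. cinner u (eps r s))"
 unfolding cinner_eps_fun by (rule plancherel_l1l2(1)[OF chi_rpf_l1l2 pm1(2)])

text \<open><u, eps_s> is the Fourier transform at s of u restricted to the ball, so the
  exponentials form a continuous Parseval frame for the functions on that ball, up to the factor (2
  pi)^d.\<close>

lemma eps_parseval:
 "(LINT s|lborel. cinner u (eps r s) * cnj (cinner v (eps r s))) = cor ((2 * pi) ^ CARD('d)) * cinner (chi r u) (chi r (v :: 'd::finite L2))"
 using fou_parseval[OF chi_rpf_l1l2 chi_rpf_l1l2, of r u r v] L2_cinner_cls[OF sqint_cinner_eps sqint_cinner_eps, of u r v r]
 unfolding chi_rpf[symmetric] cinner_eps_fun[symmetric] by (simp add: l2inner_def)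

lemma eps_parseval_norm:
 "(LINT s|lborel. (cmod (cinner u (eps r s)))\<^sup>2) = (2 * pi) ^ CARD('d) * (norm (chi r (u :: 'd::finite L2)))^2"
 using plancherel_l1l2(2)[OF chi_rpf_l1l2 pm1(2), of r u] L2_norm_sq[OF sqint_cinner_eps, of u r]
 unfolding chi_rpf[symmetric] cinner_eps_fun[symmetric] by simp

lemma FT_chi: "FT (-1) (chi r w) = cor (1 / sqrt (2 * pi) ^ CARD('d)) *C cls (\<lambda>s. cinner (w :: 'd::finite L2) (eps r s))"
 unfolding chi_rpf FT_cls[OF chi_rpf_l1l2 pm1(2)] FT0_def cinner_eps_fun ..

text \<open>The ball |s| \<le> q^(1/d), written without roots; its volume is linear in q, which lets
  q be compared with a rank.\<close>

definition Qset :: "real \<Rightarrow> (real^('d::finite)) set" where "Qset q = {s. norm s ^ CARD('d) \<le> q}"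

lemma Qset_sets [measurable]: "Qset q \<in> sets borel"
proof -
 have "Measurable.pred borel (\<lambda>s :: real^'d. norm s ^ CARD('d) \<le> q)" by measurable
 then show ?thesis by (simp add: Qset_def pred_def)
qed

lemma Qset_emeasure: assumes q: "0 < q" shows "emeasure lborel (Qset q :: (real^('d::finite)) set) \<le> ennreal (unit_ball_vol (real CARD('d)) * q)"
proof -
 let ?\<rho> = "q powr (1 / real CARD('d))"
 have p: "?\<rho> ^ CARD('d) = q" using q by (simp add: powr_realpow[symmetric] powr_powr)
 have "Qset q \<subseteq> (cball 0 ?\<rho> :: (real^'d) set)"
 proof
  fix s :: "real^'d" assume "s \<in> Qset q"
  then have "norm s ^ CARD('d) \<le> ?\<rho> ^ CARD('d)" by (simp add: Qset_def p)
  then have "norm s \<le> ?\<rho>" by (simp add: power_mono_iff)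
  then show "s \<in> cball 0 ?\<rho>" by simp
 qed
 then have "emeasure lborel (Qset q :: (real^'d) set) \<le> emeasure lborel (cball 0 ?\<rho> :: (real^'d) set)" by (rule emeasure_mono) simp
 also have "\<dots> = ennreal (unit_ball_vol (real CARD('d)) * q)" by (subst emeasure_cball) (auto simp: p)
 finally show ?thesis .
qed

text \<open>Off \<open>Qset q\<close> one has (1 + |s|^2)^(d/2) \<ge> |s|^d > q, and
  \<open>bes\<close> is the reciprocal of the left side.\<close>

lemma bes_le: assumes q: "0 < q" and s: "s \<notin> Qset q" shows "q * bes (s :: real^('d::finite)) \<le> 1"
proof -
 have n: "q < norm s ^ CARD('d)" using s by (simp add: Qset_def)
 have s0: "0 < norm s" 
 proof (rule ccontr)
  assume "\<not> 0 < norm s"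
  then have "norm s = 0" by simp
  then have "norm s ^ CARD('d) = 0" using zero_power[OF zero_less_card_finite] by metis
  then show False using n q by linarith
 qed
 have "norm s ^ CARD('d) = (norm s)\<^sup>2 powr (real CARD('d) / 2)"
 proof -
  have "(norm s)^2 = norm s powr 2" using s0 by (simp add: powr_numeral)
  then have "(norm s)\<^sup>2 powr (real CARD('d) / 2) = norm s powr (2 * (real CARD('d) / 2))" by (simp only: powr_powr)
  also have "\<dots> = norm s ^ CARD('d)" using powr_realpow[OF s0, of "CARD('d)"] by simp
  finally show ?thesis by simp
 qed
 also have "\<dots> \<le> (1 + (norm s)^2) powr (real CARD('d) / 2)" by (rule powr_mono2) auto
 finally have "q \<le> (1 + (norm s)^2) powr (real CARD('d) / 2)" using n by simp
 moreover have "(1 + (norm s)^2) powr (real CARD('d) / 2) * bes s = 1"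
  unfolding bes_def powr_add[symmetric] by (simp add: add_pos_nonneg pos_add_strict less_imp_neq[symmetric])
 ultimately show ?thesis using mult_right_mono[OF _ bes_bounds(1), of q _ s] by metis
qed

locale local_hs =
 fixes L B :: "('d::finite) L2 \<Rightarrow> 'd L2" and E :: "nat \<Rightarrow> 'd L2" and r C :: real
 assumes L: "clinop L" and B: "clinop B" and adj: "\<forall>x y. cinner (L x) y = cinner x (B y)" and E: "is_onb E"
  and Lchi: "\<And>u. L (chi r u) = L u" and C0: "0 \<le> C"
  and hs: "\<forall>t>0. summable (\<lambda>k. (norm (L (fmul (res t) (E k))))\<^sup>2) \<and> (\<Sum>k. (norm (L (fmul (res t) (E k))))\<^sup>2) \<le> C / t"
begin

lemma Bchi: "chi r (B v) = B v"
proof (rule cinner_eqI)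
 fix z
 have "cinner (B v) z = cnj (cinner (L z) v)" using adj by (simp add: cinner_commute[of "B v"])
 also have "\<dots> = cnj (cinner (chi r z) (B v))" using adj Lchi[of z] by metis
 also have "\<dots> = cinner (chi r (B v)) z" by (simp add: chi_adjoint cinner_commute[of _ z])
 finally show "cinner (chi r (B v)) z = cinner (B v) z" by simp
qed

text \<open>\<open>L\<close> factors as the bounded operator 1 + \<open>fmul bes\<close> followed by
  the Hilbert-Schmidt operator that applies \<open>fmul (res 1)\<close> and then
  \<open>L\<close>.\<close>

lemma compact: "cpt L"
proof -
 have "clinop (\<lambda>u. L (fmul (res 1) u))" by (rule clinop_comp[OF L clinop_fmul[OF res_bmf]]) simp
 then have X: "cpt (\<lambda>u. L (fmul (res 1) u))" by (rule hs_cpt[OF E]) (use hs in auto)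
 have "clinop (\<lambda>u. 1 *C u + cor 1 *C fmul bes u)"
  by (intro clinop_lin clinop_fmul bes_bmf clinopI[of "\<lambda>u. u" 1]) auto
 from cpt_precomp[OF X this] show ?thesis by (simp add: fmul_resolvent(1)[of 1, simplified])
qed

lemma norm_L_sums: "(\<lambda>k. (cmod (cinner (B (E k)) (eps r s)))\<^sup>2) sums (norm (L (eps r s)))\<^sup>2"
proof -
 have "cmod (cinner (B (E k)) (eps r s)) = cmod (cinner (L (eps r s)) (E k))" for k
  using adj by (subst cinner_commute) simp
 then show ?thesis using onb_norm_sums[OF E, of "L (eps r s)"] by simp
qed

lemma norm_L_measurable: "(\<lambda>s. (norm (L (eps r s)))\<^sup>2) \<in> borel_measurable borel"
proof (rule borel_measurable_LIMSEQ_real)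
 show "(\<lambda>s. \<Sum>k<n. (cmod (cinner (B (E k)) (eps r s)))\<^sup>2) \<in> borel_measurable borel" for n
  using sqint_measurable[OF sqint_cinner_eps] by measurable
 show "(\<lambda>n. \<Sum>k<n. (cmod (cinner (B (E k)) (eps r s)))\<^sup>2) \<longlonglongrightarrow> (norm (L (eps r s)))\<^sup>2" for s
  using norm_L_sums[of s] by (simp add: sums_def)
qed

text \<open>Expand |L eps_s|^2 over the basis as the sum of |<B E_k, eps_s>|^2. Each B E_k lives in
  the ball, so <B E_k, eps_s> is its Fourier transform, and Plancherel turns the weight into the
  multiplier \<open>fmul (res t)\<close> applied to B E_k. The resulting sum is the squared
  Hilbert-Schmidt norm of the adjoint of the operator in \<open>hs\<close>.\<close>

lemma resolvent_bound:
 assumes t: "0 < t"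
 shows "(\<integral>\<^sup>+s. ennreal ((res t s)^2 * (norm (L (eps r s)))^2) \<partial>lborel) \<le> ennreal ((2 * pi) ^ CARD('d) * C / t)"
proof -
 note rb = res_bmf[OF t]
 let ?g = "\<lambda>k s. cor (res t s) * cinner (B (E k)) (eps r s)"
 have sg: "sqint (?g k)" for k by (rule bmf_sqint[OF rb sqint_cinner_eps])
 have gm: "(\<lambda>s. ennreal ((cmod (?g k s))^2)) \<in> borel_measurable borel" for k using sqint_measurable[OF sg[of k]] by measurable
 have "(\<integral>\<^sup>+s. ennreal ((res t s)^2 * (norm (L (eps r s)))^2) \<partial>lborel) = (\<integral>\<^sup>+s. (\<Sum>k. ennreal ((cmod (?g k s))^2)) \<partial>lborel)"
 proof (rule nn_integral_cong)
  fix s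
  have "(\<lambda>k. (cmod (?g k s))\<^sup>2) sums ((res t s)^2 * (norm (L (eps r s)))^2)"
   using sums_mult[OF norm_L_sums[of s], of "(res t s)^2"] by (simp add: norm_mult power_mult_distrib)
  then show "ennreal ((res t s)^2 * (norm (L (eps r s)))^2) = (\<Sum>k. ennreal ((cmod (?g k s))^2))"
   by (intro suminf_ennreal_eq[symmetric]) auto
 qed
 also have "\<dots> = (\<Sum>k. \<integral>\<^sup>+s. ennreal ((cmod (?g k s))^2) \<partial>lborel)" by (rule nn_integral_suminf) (use gm in simp)
 also have "\<dots> = (\<Sum>k. ennreal ((2 * pi) ^ CARD('d)) * ennreal ((norm (fmul (res t) (B (E k))))^2))"
 proof (rule arg_cong[of _ _ suminf], rule ext)
  fix k
  have "norm (fmul (res t) (B (E k))) = norm (mulop (res t) (FT (-1) (chi r (B (E k)))))"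
   unfolding fmul_def Bchi by (simp add: FT_norm[OF pm1(1)])
  also have "mulop (res t) (FT (-1) (chi r (B (E k)))) = cor (1 / sqrt (2 * pi) ^ CARD('d)) *C cls (?g k)"
   unfolding FT_chi by (simp only: clinop_scaleC[OF clinop_mulop[OF rb]] mulop_cls[OF rb sqint_cinner_eps])
  finally have "(norm (fmul (res t) (B (E k))))^2 = (1 / sqrt (2 * pi) ^ CARD('d))^2 * (norm (cls (?g k)))^2"
   by (simp add: norm_scaleC power_mult_distrib power_divide norm_divide norm_power)
  also have "(1 / sqrt (2 * pi) ^ CARD('d))^2 = (1 / (2 * pi) ^ CARD('d))" by (simp only: power_divide sqrt_power_sq power_one)
  finally have "(2 * pi) ^ CARD('d) * (norm (fmul (res t) (B (E k))))^2 = (norm (cls (?g k)))^2" by simp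
  then show "(\<integral>\<^sup>+s. ennreal ((cmod (?g k s))^2) \<partial>lborel) = ennreal ((2 * pi) ^ CARD('d)) * ennreal ((norm (fmul (res t) (B (E k))))^2)"
   unfolding L2_norm_nn[OF sg] by (simp add: ennreal_mult[symmetric])
 qed
 also have "\<dots> = ennreal ((2 * pi) ^ CARD('d)) * (\<Sum>k. ennreal ((norm (fmul (res t) (B (E k))))^2))" by (rule ennreal_suminf_cmult)
 also have "(\<Sum>k. ennreal ((norm (fmul (res t) (B (E k))))^2)) = (\<Sum>k. ennreal ((norm (L (fmul (res t) (E k))))^2))"
  by (rule hs_transpose[symmetric, OF E, of "\<lambda>u. L (fmul (res t) u)" "\<lambda>u. fmul (res t) (B u)"]) (use adj fmul_adjoint[OF rb] in simp)
 also have "\<dots> = ennreal (\<Sum>k. (norm (L (fmul (res t) (E k))))\<^sup>2)" using hs t by (intro suminf_ennreal2) auto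
 also have "\<dots> \<le> ennreal (C / t)" using hs t by (intro ennreal_leI) auto
 finally show ?thesis using C0 t by (simp add: ennreal_mult[symmetric] mult_left_mono)
qed

text \<open>Take t = q in \<open>resolvent_bound\<close>: off \<open>Qset q\<close> the weight
  \<open>res q\<close> is at least 1/2, whence the factor 4 after squaring.\<close>

lemma tail_bound:
 assumes q: "0 < q"
 shows "integrable lborel (\<lambda>s. indicator (- Qset q) s * (norm (L (eps r s)))^2)"
  "(LINT s|lborel. indicator (- Qset q) s * (norm (L (eps r s)))^2) \<le> 4 * (2 * pi) ^ CARD('d) * C / q"
proof -
 let ?f = "\<lambda>s. indicator (- Qset q) s * (norm (L (eps r s)))^2"
 note [measurable] = norm_L_measurable
 have [measurable]: "(res q :: real^'d \<Rightarrow> real) \<in> borel_measurable borel" by (rule conjunct1[OF res_bmf[OF q, unfolded bmf_def]])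
 have le: "?f s \<le> 4 * ((res q s)^2 * (norm (L (eps r s)))^2)" for s
 proof (cases "s \<in> Qset q")
  case False
  have "1 / 2 \<le> res q s" using bes_le[OF q False] bes_bounds(1)[of s] q by (simp add: res_def field_simps add_pos_nonneg)
  then have "(1 / 2)^2 \<le> (res q s)^2" by (intro power_mono) auto
  then have "1 \<le> 4 * (res q s)^2" by (simp add: power2_eq_square)
  from mult_right_mono[OF this, of "(norm (L (eps r s)))^2"] show ?thesis using False by simp
 qed simp
 have "(\<integral>\<^sup>+s. ennreal (?f s) \<partial>lborel) \<le> (\<integral>\<^sup>+s. ennreal 4 * ennreal ((res q s)^2 * (norm (L (eps r s)))^2) \<partial>lborel)"
  using le by (intro nn_integral_mono) (simp add: ennreal_mult[symmetric] ennreal_leI del: ennreal_numeral)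
 also have "\<dots> = ennreal 4 * (\<integral>\<^sup>+s. ennreal ((res q s)^2 * (norm (L (eps r s)))^2) \<partial>lborel)" by (rule nn_integral_cmult) measurable
 also have "\<dots> \<le> ennreal 4 * ennreal ((2 * pi) ^ CARD('d) * C / q)" by (intro mult_left_mono resolvent_bound q) simp
 also have "\<dots> = ennreal (4 * (2 * pi) ^ CARD('d) * C / q)" using C0 q by (simp add: ennreal_mult[symmetric] mult.assoc del: ennreal_numeral)
 finally have nn: "(\<integral>\<^sup>+s. ennreal (?f s) \<partial>lborel) \<le> ennreal (4 * (2 * pi) ^ CARD('d) * C / q)" .
 have "(\<integral>\<^sup>+s. ennreal (norm (?f s)) \<partial>lborel) = (\<integral>\<^sup>+s. ennreal (?f s) \<partial>lborel)" by (intro nn_integral_cong) (simp add: abs_mult)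
 then have "(\<integral>\<^sup>+s. ennreal (norm (?f s)) \<partial>lborel) < \<infinity>" using nn by (auto intro: le_less_trans)
 then show i: "integrable lborel ?f" by (intro integrableI_bounded) measurable
 show "(LINT s|lborel. ?f s) \<le> 4 * (2 * pi) ^ CARD('d) * C / q"
  using nn unfolding nn_integral_eq_integral[OF i AE_I2[OF mult_nonneg_nonneg[OF indicator_pos_le zero_le_power2]]]
  using C0 q by (simp add: ennreal_le_iff)
qed

sublocale frame_op L B E lborel "eps r" "1 / (2 * pi) ^ CARD('d)" "measure lborel (cball (0 :: real^'d) r)" "unit_ball_vol (real CARD('d))" "4 * (2 * pi) ^ CARD('d) * C" Qset
proof
 show "cpt L" by (rule compact)
 show "(1 / (2 * pi) ^ CARD('d)) * (LINT s|lborel. (cmod (cinner u (eps r s)))\<^sup>2) \<le> (norm u)^2" for u :: "'d L2"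
  unfolding eps_parseval_norm using chi_norm[of r u] by (simp add: power_mono)
 show "cinner (L u) v = cor (1 / (2 * pi) ^ CARD('d)) * (LINT s|lborel. cinner u (eps r s) * cinner (L (eps r s)) v)" for u v :: "'d L2"
 proof -
  have "cinner (L u) v = cinner (chi r u) (chi r (B v))" using adj Lchi[of u] Bchi[of v] by metis
  also have "\<dots> = cor (1 / (2 * pi) ^ CARD('d)) * (LINT s|lborel. cinner u (eps r s) * cnj (cinner (B v) (eps r s)))"
   unfolding eps_parseval by simp
  also have "(\<lambda>s. cnj (cinner (B v) (eps r s))) = (\<lambda>s. cinner (L (eps r s)) v)"
   using adj by (simp add: fun_eq_iff cinner_commute[of "B v"])
  then have "(LINT s|lborel. cinner u (eps r s) * cnj (cinner (B v) (eps r s))) = (LINT s|lborel. cinner u (eps r s) * cinner (L (eps r s)) v)"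
   by (simp add: fun_eq_iff)
  finally show ?thesis .
 qed
 show "emeasure lborel (Qset q :: (real^'d) set) \<le> ennreal (unit_ball_vol (real CARD('d)) * q)" if "0 < q" for q by (rule Qset_emeasure[OF that])
 show "integrable lborel (\<lambda>s. indicator (- Qset q) s * (norm (L (eps r s)))^2)" if "0 < q" for q by (rule tail_bound(1)[OF that])
 show "(LINT s|lborel. indicator (- Qset q) s * (norm (L (eps r s)))^2) \<le> 4 * (2 * pi) ^ CARD('d) * C / q" if "0 < q" for q by (rule tail_bound(2)[OF that])
 show "sq lborel (\<lambda>s. cinner u (eps r s))" for u :: "'d L2" using sqint_cinner_eps[of u r] by (simp add: sqint_sq)
qed (use B adj E C0 in \<open>simp_all add: eps_norm\<close>)

end

section \<open>The symbol of a compactly supported operator\<close>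

lemma AE_swap_eq:
 fixes f g :: "(real^'d::finite) \<times> (real^'d) \<Rightarrow> complex"
 assumes f: "f \<in> borel_measurable borel" and g: "g \<in> borel_measurable borel"
 shows "(AE x in lborel. AE y in lborel. f (x, y) = g (x, y)) \<longleftrightarrow> (AE y in lborel. AE x in lborel. f (x, y) = g (x, y))"
proof (rule lborel_pair.AE_commute)
 have "{z \<in> space borel. f z - g z = 0} = (\<lambda>z. f z - g z) -` {0} \<inter> space borel" by auto
 also have "\<dots> \<in> sets borel" by (rule measurable_sets[OF borel_measurable_diff[OF f g]]) simp
 finally have "{z. f z = g z} \<in> sets borel" by simp
 then show "{z \<in> space (lborel \<Otimes>\<^sub>M lborel). f (fst z, snd z) = g (fst z, snd z)} \<in> sets (lborel \<Otimes>\<^sub>M lborel)"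
  unfolding lborel_prod by simp
qed

lemma fiber_measurable:
 fixes f :: "'a::euclidean_space \<times> 'b::euclidean_space \<Rightarrow> complex"
 assumes f: "f \<in> borel_measurable borel"
 shows "(\<lambda>y. f (x, y)) \<in> borel_measurable borel" "(\<lambda>x. f (x, y)) \<in> borel_measurable borel"
proof -
 have "(\<lambda>y. (x, y)) \<in> borel_measurable borel" "(\<lambda>x. (x, y)) \<in> borel_measurable borel"
  by (intro borel_measurable_continuous_onI continuous_intros)+
 from this[THEN measurable_compose, OF f] show "(\<lambda>y. f (x, y)) \<in> borel_measurable borel" "(\<lambda>x. f (x, y)) \<in> borel_measurable borel" by auto
qed

lemma fst_snd_borel:
 "(fst :: 'a::second_countable_topology \<times> 'b::second_countable_topology \<Rightarrow> 'a) \<in> borel_measurable borel"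
 "(snd :: 'a \<times> 'b \<Rightarrow> 'b) \<in> borel_measurable borel"
 by (intro borel_measurable_continuous_onI continuous_intros)+

lemma fiber_integral_measurable:
 fixes f :: "'a::euclidean_space \<times> 'b::euclidean_space \<Rightarrow> complex"
 assumes f: "f \<in> borel_measurable borel"
 shows "(\<lambda>x. LINT y|lborel. f (x, y)) \<in> borel_measurable borel" "(\<lambda>y. LINT x|lborel. f (x, y)) \<in> borel_measurable borel"
proof -
 have *: "(\<lambda>x. LINT y|lborel. g (x, y)) \<in> borel_measurable borel"
  if g: "g \<in> borel_measurable borel" for g :: "'c::euclidean_space \<times> 'e::euclidean_space \<Rightarrow> complex"
 proof (rule lborel.borel_measurable_lebesgue_integral)
  have "sets (borel \<Otimes>\<^sub>M lborel) = sets (borel :: ('c \<times> 'e) measure)"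
   unfolding borel_prod[symmetric] by (rule sets_pair_measure_cong) auto
  then show "case_prod (\<lambda>x y. g (x, y)) \<in> borel_measurable (borel \<Otimes>\<^sub>M lborel)"
   by (subst measurable_cong_sets[OF _ refl]) (use g in simp_all)
 qed
 show "(\<lambda>x. LINT y|lborel. f (x, y)) \<in> borel_measurable borel" by (rule *[OF f])
 have "(\<lambda>z :: 'b \<times> 'a. (snd z, fst z)) \<in> borel_measurable borel" by (intro borel_measurable_continuous_onI continuous_intros)
 from *[OF measurable_compose[OF this f]] show "(\<lambda>y. LINT x|lborel. f (x, y)) \<in> borel_measurable borel" by simp
qed

lemma fiber_sqint:
 fixes f :: "(real^'d::finite) \<times> (real^'d) \<Rightarrow> complex"
 assumes f: "f \<in> borel_measurable borel" and i: "integrable lborel (\<lambda>z. (cmod (f z))\<^sup>2)"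
 shows "AE x in lborel. sqint (\<lambda>y. f (x, y))"
proof -
 have "integrable (lborel \<Otimes>\<^sub>M lborel) (\<lambda>z. (cmod (f z))\<^sup>2)" using i by (simp add: lborel_prod)
 from lborel_pair.AE_integrable_fst'[OF this] show ?thesis
  by eventually_elim (simp add: sqint_def fiber_measurable(1)[OF f])
qed

lemma sqint_indicator_mult: "sqint f \<Longrightarrow> sqint (\<lambda>y. indicator (cball 0 r) y * f y)"
 using indicator_mult_l1l2[OF _ _ cball_finite, of f r] by (simp add: l1l2_def)

locale symbol_op = local_hs "lop A" B E r C for A :: "('d::finite) op" and B E r C +
 fixes p K :: "(real^'d) \<times> (real^'d) \<Rightarrow> complex"
 assumes bA: "is_bop A" and chiL: "\<And>u. chi r (lop A u) = lop A u"
  and p: "p \<in> borel_measurable borel" "integrable lborel (\<lambda>z. (cmod (p z))\<^sup>2)"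
  and K: "K \<in> borel_measurable borel" "integrable lborel (\<lambda>z. (cmod (K z))\<^sup>2)"
  and AK: "\<And>f. sqint f \<Longrightarrow> AE x in lborel. A f x = (LINT y|lborel. K (x, y) * f y)"
  and sym: "AE x in lborel. \<forall>h. l1l2 h \<longrightarrow> (LINT z|lborel. K (x, x - z) * cnj (h z)) =
      (1 / (2 * pi) ^ CARD('d)) * (LINT s|lborel. p (x, s) * cnj (fourier h s))"
begin

lemma A_zero: assumes f: "sqint f" and z: "lop A (cls f) = 0" shows "AE x in lborel. A f x = 0"
proof -
 have "cls (A f) = cls (\<lambda>_. 0)" using z unfolding lop_cls[OF bA f] zero_L2_def .
 then show ?thesis using cls_eq_iff[OF is_bopD(1)[OF bA f] sqint_zero] by (simp add: aeq_def)
qed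

text \<open>\<open>A\<close> annihilates functions living off the ball, in particular the outer
  parts of the indicators of the \<open>U n\<close>. As these are countably many, one null set of x
  serves them all, and they determine K(x, .) almost everywhere.\<close>

lemma K_support: "AE x in lborel. AE y in lborel. K (x, y) = indicator (cball 0 r) y * K (x, y)"
proof -
 obtain U :: "nat \<Rightarrow> (real^'d) set" where U: "\<forall>n. open (U n) \<and> bounded (U n)" "Int_stable (range U)"
  "sets borel = sigma_sets UNIV (range U)" "\<exists>A::nat \<Rightarrow> (real^'d) set. range A \<subseteq> range U \<and> (\<Union>i. A i) = UNIV"
  by (rule total_open_sets)
 let ?f = "\<lambda>n y. indicator (U n) y - indicator (cball 0 r) y * indicator (U n) y :: complex"
 have sU: "sqint (indicator (U n))" for n by (rule sqint_indicator) (use U(1) emeasure_open_bounded in auto)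
 note sc = sqint_indicator_mult[OF sU]
 have sf: "sqint (?f n)" for n by (rule sqint_diff[OF sU sc])
 have "lop A (cls (?f n)) = 0" for n
 proof -
  have "cls (?f n) = cls (indicator (U n)) - chi r (cls (indicator (U n)))" by (simp only: L2_diff_cls[OF sU sc] chi_cls[OF sU])
  then show ?thesis by (simp add: clinop_diff[OF L] Lchi)
 qed
 then have "AE x in lborel. A (?f n) x = 0" for n by (rule A_zero[OF sf])
 then have "AE x in lborel. \<forall>n. A (?f n) x = 0" by (simp add: AE_all_countable)
 moreover have "AE x in lborel. \<forall>n. A (?f n) x = (LINT y|lborel. K (x, y) * ?f n y)"
  using AK[OF sf] by (simp add: AE_all_countable)
 ultimately show ?thesis using fiber_sqint[OF K]
 proof eventually_elim
  case (elim x)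
  let ?g = "\<lambda>y. K (x, y) - indicator (cball 0 r) y * K (x, y)"
  have sg: "sqint ?g" by (rule sqint_diff[OF elim(3) sqint_indicator_mult[OF elim(3)]])
  have "l2inner ?g (indicator (U n)) = 0" for n
  proof -
   have "l2inner ?g (indicator (U n)) = (LINT y|lborel. K (x, y) * ?f n y)"
    unfolding l2inner_def by (intro LINT_cong refl) (simp add: indicator_def)
   then show ?thesis using elim(1,2) by simp
  qed
  from total_indicators[OF sg U this] show ?case unfolding aeq_def by eventually_elim simp
 qed
qed

text \<open>A jointly measurable version of (A eps_s)(x). Representatives chosen separately for each
  s carry no measurability in s, which the exchange of almost-everywhere quantifiers
  requires.\<close>

definition G :: "(real^'d) \<times> (real^'d) \<Rightarrow> complex" where
 "G z = (LINT y|lborel. K (fst z, y) * (indicator (cball 0 r) y * iexp (inner y (snd z))))"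

lemma G_measurable: "G \<in> borel_measurable borel"
proof -
 let ?f = "\<lambda>w :: ((real^'d) \<times> (real^'d)) \<times> (real^'d). K (fst (fst w), snd w) * (indicator (cball 0 r) (snd w) * iexp (inner (snd w) (snd (fst w))))"
 have "(\<lambda>w :: ((real^'d) \<times> (real^'d)) \<times> (real^'d). (fst (fst w), snd w)) \<in> borel_measurable borel"
  by (intro borel_measurable_continuous_onI continuous_intros)
 from measurable_compose[OF this K(1)] have 1: "(\<lambda>w :: ((real^'d) \<times> (real^'d)) \<times> (real^'d). K (fst (fst w), snd w)) \<in> borel_measurable borel" .
 have 2: "(\<lambda>w :: ((real^'d) \<times> (real^'d)) \<times> (real^'d). indicator (cball 0 r) (snd w) :: complex) \<in> borel_measurable borel"
  by (rule measurable_compose[OF fst_snd_borel(2) borel_measurable_indicator]) simp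
 have 3: "(\<lambda>w :: ((real^'d) \<times> (real^'d)) \<times> (real^'d). iexp (inner (snd w) (snd (fst w)))) \<in> borel_measurable borel"
  by (intro borel_measurable_continuous_onI continuous_intros)
 have "?f \<in> borel_measurable borel" by (intro borel_measurable_times 1 2 3)
 from fiber_integral_measurable(1)[OF this] show ?thesis by (simp add: G_def[abs_def])
qed

text \<open>Pull back by the unitary transform: truncations of \<open>FT 1 w\<close> approximate it
  and are orthogonal to it, so it is orthogonal to itself.\<close>

lemma orth_zero:
 assumes "\<And>h. l1l2 h \<Longrightarrow> cinner w (FT (-1) (cls h)) = 0" shows "w = (0 :: 'd L2)"
proof -
 let ?v = "FT 1 w" and ?c = "\<lambda>n. cls (cut n (rpf (FT 1 w)))"
 have "cinner ?v (?c n) = 0" for n using assms[OF cut_l1l2[OF sqint_rpf]] FT_adjoint[OF pm1(1), of w "?c n"] by simp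
 moreover have "(\<lambda>n. cinner ?v (?c n)) \<longlonglongrightarrow> cinner ?v ?v"
  using tendsto_cinner_right[OF cut_tendsto[OF sqint_rpf, of ?v], of ?v] by simp
 ultimately have "cinner ?v ?v = 0" using LIMSEQ_unique[OF tendsto_const[of 0]] by simp
 then have "norm ?v = 0" by (simp add: cinner_norm)
 then show ?thesis using FT_norm[OF pm1(1), of w] by simp
qed

text \<open>For almost every x the defining relation says that p(x, .) and the transform of z
  \<mapsto> K(x, x - z) have equal inner products with the transforms of all test functions.
  \<open>K_support\<close> makes that section integrable, so its transform is an actual integral and
  can be rewritten by y = x - z.\<close>

lemma symbol_eq: "AE x in lborel. AE s in lborel. p (x, s) = iexp (- inner x s) * G (x, s)"
 using sym K_support fiber_sqint[OF K] fiber_sqint[OF p]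
proof eventually_elim
 case (elim x)
 let ?Kx = "\<lambda>y. K (x, y)" and ?px = "\<lambda>s. p (x, s)"
 let ?Kc = "\<lambda>y. indicator (cball 0 r) y * K (x, y)"
 let ?k = "\<lambda>z. ?Kx (x + (-1) *\<^sub>R z)" and ?kc = "\<lambda>z. ?Kc (x + (-1) *\<^sub>R z)"
 note sK = elim(3) and sp = elim(4)
 note sKc = sqint_indicator_mult[OF sK, of r]
 have sk: "sqint ?k" by (rule sqint_affine[OF sK]) simp
 have skc: "sqint ?kc" by (rule sqint_affine[OF sKc]) simp
 have kk: "cls ?k = cls ?kc" by (rule cls_shift_cong[OF sK sKc]) (use elim(2) in \<open>auto simp: aeq_def\<close>)
 have lKc: "integrable lborel ?Kc" using indicator_mult_l1l2[OF sK _ cball_finite, of r] by (simp add: l1l2_def)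
 have lk: "l1l2 ?kc" unfolding l1l2_def using skc integrable_affine[OF lKc, of "-1" x] by simp
 note sF = plancherel_l1l2(1)[OF lk pm1(2)]
 have "cls ?px - cls (fou (-1) ?kc) = 0"
 proof (rule orth_zero)
  fix h :: "'d fn" assume h: "l1l2 h"
  then have sh: "sqint h" by (simp add: l1l2_def)
  note sH = plancherel_l1l2(1)[OF h pm1(2)]
  have "cor (1 / (2 * pi) ^ CARD('d)) * cinner (cls ?px) (cls (fou (-1) h)) = cinner (cls ?k) (cls h)"
   unfolding L2_cinner_cls[OF sp sH] L2_cinner_cls[OF sk sh] l2inner_def using elim(1)[rule_format, OF h] by (simp add: fourier_fou)
  also have "\<dots> = cor (1 / (2 * pi) ^ CARD('d)) * cinner (cls (fou (-1) ?kc)) (cls (fou (-1) h))"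
   unfolding kk fou_parseval[OF lk h] by simp
  finally have "cinner (cls ?px) (cls (fou (-1) h)) = cinner (cls (fou (-1) ?kc)) (cls (fou (-1) h))" by simp
  then show "cinner (cls ?px - cls (fou (-1) ?kc)) (FT (-1) (cls h)) = 0"
   by (simp add: FT_cls[OF h pm1(2)] FT0_def cinner_scaleC_right cinner_diff_left)
 qed
 then have "AE s in lborel. p (x, s) = fou (-1) ?kc s" using cls_eq_iff[OF sp sF] by (simp add: aeq_def)
 then show ?case
 proof eventually_elim
  case (elim s)
  have "fou (-1) ?kc s = (LINT z|lborel. iexp (- inner z s) * ?kc z)" by (simp add: fou_def)
  also have "\<dots> = cor (\<bar>-1\<bar> ^ DIM(real^'d)) * (LINT y|lborel. iexp (- inner (x + (-1) *\<^sub>R y) s) * ?Kc (x + (-1) *\<^sub>R (x + (-1) *\<^sub>R y)))"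
  proof (rule lint_affine)
   show "(\<lambda>z. iexp (- inner z s) * ?kc z) \<in> borel_measurable borel"
    by (intro borel_measurable_times sqint_measurable[OF skc]) (intro borel_measurable_continuous_onI continuous_intros)
  qed simp
  also have "\<dots> = (LINT y|lborel. iexp (- inner x s) * (K (x, y) * (indicator (cball 0 r) y * iexp (inner y s))))"
  proof -
   have "iexp (- inner (x + (-1) *\<^sub>R y) s) = iexp (- inner x s) * iexp (inner y s)" for y
    by (simp add: inner_diff_left exp_add[symmetric] algebra_simps)
   then show ?thesis by (simp add: mult_ac)
  qed
  also have "\<dots> = iexp (- inner x s) * G (x, s)" by (simp add: G_def)
  finally show ?case using elim by simp
 qed
qed

lemma G_eps: "AE x in lborel. G (x, s) = rpf (lop A (eps r s)) x"
proof -
 let ?e = "\<lambda>y. indicator (cball 0 r) y * iexp (inner y s)"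
 have s: "sqint ?e" by (rule eps_sqint)
 have "lop A (eps r s) = cls (A ?e)" unfolding eps_def by (rule lop_cls[OF bA s])
 then have "AE x in lborel. rpf (lop A (eps r s)) x = A ?e x" using AE_rpf_cls[OF is_bopD(1)[OF bA s]] by simp
 with AK[OF s] show ?thesis by eventually_elim (simp add: G_def)
qed

lemma eps_support: "AE x in lborel. rpf (lop A (eps r s)) x = indicator (cball 0 r) x * rpf (lop A (eps r s)) x"
proof -
 let ?u = "lop A (eps r s)"
 have "cls (rpf ?u) = cls (\<lambda>x. indicator (cball 0 r) x * rpf ?u x)" using chi_rpf[of r ?u] by (simp add: chiL)
 then show ?thesis by (simp only: cls_eq_iff[OF sqint_rpf sqint_indicator_mult[OF sqint_rpf]] aeq_def)
qed

text \<open>In x the symbol is supported in the ball, so over a bounded \<open>S\<close> it is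
  square integrable on a set of finite measure, hence integrable, and Fubini applies. The inner
  integral over x of exp(-i<x,s>) (A eps_s)(x) is <A eps_s, eps_s>.\<close>

lemma symbol_integral:
 assumes S: "S \<in> sets borel" "bounded S"
 shows "(LINT x|lborel. (LINT s|lborel. indicator S s *\<^sub>R p (x, s))) = (LINT s|lborel. indicator S s *\<^sub>R cinner (lop A (eps r s)) (eps r s))"
proof -
 have ind: "(\<lambda>z :: (real^'d) \<times> (real^'d). indicator (cball 0 r) (fst z) :: complex) \<in> borel_measurable borel"
  by (rule measurable_compose[OF fst_snd_borel(1) borel_measurable_indicator]) simp
 have indS: "(\<lambda>z :: (real^'d) \<times> (real^'d). indicator S (snd z) *\<^sub>R p z) \<in> borel_measurable borel"
  by (rule borel_measurable_scaleR[OF measurable_compose[OF fst_snd_borel(2) borel_measurable_indicator[OF S(1)]] p(1)])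
 let ?q = "\<lambda>z :: (real^'d) \<times> (real^'d). indicator (cball (0 :: real^'d) r \<times> S) z * p z"
 have e1: "(\<lambda>z :: (real^'d) \<times> (real^'d). iexp (- inner (fst z) (snd z)) * G z) \<in> borel_measurable borel"
  by (intro borel_measurable_times G_measurable) (intro borel_measurable_continuous_onI continuous_intros)
 have e2: "(\<lambda>z :: (real^'d) \<times> (real^'d). indicator (cball 0 r) (fst z) * p z) \<in> borel_measurable borel" by (intro borel_measurable_times ind p)
 have "AE s in lborel. AE x in lborel. p (x, s) = iexp (- inner x s) * G (x, s)"
  using symbol_eq AE_swap_eq[OF p(1) e1] by simp
 then have fib: "AE s in lborel. AE x in lborel. p (x, s) = iexp (- inner x s) * rpf (lop A (eps r s)) x \<and> p (x, s) = indicator (cball 0 r) x * p (x, s)"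
 proof eventually_elim
  case (elim s)
  from elim G_eps[of s] eps_support[of s] show ?case
  proof eventually_elim
   case (elim x)
   then show ?case by (cases "x \<in> cball 0 r") auto
  qed
 qed
 have "AE s in lborel. AE x in lborel. p (x, s) = indicator (cball 0 r) x * p (x, s)"
  using fib by eventually_elim (auto elim: AE_mp)
 then have sup: "AE x in lborel. AE s in lborel. p (x, s) = indicator (cball 0 r) x * p (x, s)"
  using AE_swap_eq[OF p(1) e2] by simp
 have bS: "bounded (cball (0 :: real^'d) r \<times> S)" using S(2) by (intro bounded_Times) auto
 have mS: "cball (0 :: real^'d) r \<times> S \<in> sets borel" 
 proof -
  have "cball (0 :: real^'d) r \<times> S \<in> sets (borel \<Otimes>\<^sub>M borel)" by (rule pair_measureI) (use S(1) in auto)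
  then show ?thesis unfolding borel_prod .
 qed
 have iq: "integrable lborel ?q"
 proof (rule sq_prod_integrable)
  show "sq lborel p" using p by (simp add: sq_def)
  have "integrable lborel (indicator (cball (0 :: real^'d) r \<times> S) :: _ \<Rightarrow> real)" using mS emeasure_bounded_finite[OF bS] by simp
  moreover have "(cmod (indicator (cball (0 :: real^'d) r \<times> S) z))^2 = (indicator (cball (0 :: real^'d) r \<times> S) z :: real)" for z by (simp add: indicator_def)
  ultimately show "sq lborel (indicator (cball (0 :: real^'d) r \<times> S))" using mS by (simp add: sq_def)
 qed
 have iq': "integrable (lborel \<Otimes>\<^sub>M lborel) (case_prod (\<lambda>x s. ?q (x, s)))"
  unfolding lborel_prod by (rule back_subst[of "integrable lborel", OF iq]) (auto simp: fun_eq_iff)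
 have qm: "?q \<in> borel_measurable borel" using borel_measurable_integrable[OF iq] by simp
 have "(LINT x|lborel. (LINT s|lborel. indicator S s *\<^sub>R p (x, s))) = (LINT x|lborel. (LINT s|lborel. ?q (x, s)))"
 proof (rule integral_cong_AE)
  show "(\<lambda>x. LINT s|lborel. indicator S s *\<^sub>R p (x, s)) \<in> borel_measurable lborel" using fiber_integral_measurable(1)[OF indS] by simp
  show "(\<lambda>x. LINT s|lborel. ?q (x, s)) \<in> borel_measurable lborel" using fiber_integral_measurable(1)[OF qm] by simp
  show "AE x in lborel. (LINT s|lborel. indicator S s *\<^sub>R p (x, s)) = (LINT s|lborel. ?q (x, s))"
   using sup
  proof eventually_elim
   case (elim x)
   show ?case
   proof (rule integral_cong_AE)
    show "(\<lambda>s. indicator S s *\<^sub>R p (x, s)) \<in> borel_measurable lborel" using fiber_measurable(1)[OF indS, of x] by simp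
    show "(\<lambda>s. ?q (x, s)) \<in> borel_measurable lborel" using fiber_measurable(1)[OF qm, of x] by simp
    show "AE s in lborel. indicator S s *\<^sub>R p (x, s) = ?q (x, s)"
     using elim by eventually_elim (auto simp: indicator_def)
   qed
  qed
 qed
 also have "\<dots> = (LINT s|lborel. (LINT x|lborel. ?q (x, s)))" by (rule lborel_pair.Fubini_integral[OF iq', symmetric])
 also have "\<dots> = (LINT s|lborel. indicator S s *\<^sub>R cinner (lop A (eps r s)) (eps r s))"
 proof (rule integral_cong_AE)
  show "(\<lambda>s. LINT x|lborel. ?q (x, s)) \<in> borel_measurable lborel" using fiber_integral_measurable(2)[OF qm] by simp
  show "(\<lambda>s. indicator S s *\<^sub>R cinner (lop A (eps r s)) (eps r s)) \<in> borel_measurable lborel"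
   by (intro borel_measurable_scaleR borel_measurable_indicator AE_meas) (simp add: S)
  show "AE s in lborel. (LINT x|lborel. ?q (x, s)) = indicator S s *\<^sub>R cinner (lop A (eps r s)) (eps r s)"
   using fib
  proof eventually_elim
   case (elim s)
   let ?u = "lop A (eps r s)"
   let ?e = "\<lambda>y. indicator (cball 0 r) y * iexp (inner y s)"
   have "(LINT x|lborel. ?q (x, s)) = (LINT x|lborel. indicator S s * (rpf ?u x * cnj (?e x)))"
   proof (rule integral_cong_AE)
    show "(\<lambda>x. ?q (x, s)) \<in> borel_measurable lborel" using fiber_measurable(2)[OF qm, of s] by simp
    show "(\<lambda>x. indicator S s * (rpf ?u x * cnj (?e x))) \<in> borel_measurable lborel"
     using borel_measurable_times[OF borel_measurable_const borel_measurable_integrable[OF sqint_inner_integrable[OF sqint_rpf eps_sqint]]] by simp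
    show "AE x in lborel. ?q (x, s) = indicator S s * (rpf ?u x * cnj (?e x))"
     using elim
    proof eventually_elim
     case (elim x)
     have "cnj (?e x) = indicator (cball 0 r) x * iexp (- inner x s)"
      by (simp only: complex_cnj_mult cnj_iexp) (simp add: indicator_def)
     moreover have "?q (x, s) = indicator S s * (indicator (cball 0 r) x * (iexp (- inner x s) * rpf ?u x))"
      by (subst elim[THEN conjunct1]) (auto simp: indicator_def)
     ultimately show ?case by (simp only: mult_ac)
    qed
   qed
   also have "\<dots> = indicator S s * cinner ?u (eps r s)"
    unfolding eps_def using L2_cinner_cls[OF sqint_rpf eps_sqint, of ?u r s] by (simp add: l2inner_def eps_def)
   finally show ?case by (simp add: indicator_def)
  qed
 qed
 finally show ?thesis .
qed

text \<open>Raising the radii to the power d turns the annulus into the difference of two sets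
  \<open>Qset\<close>.\<close>

lemma annulus_Q:
 "annulus_seq p n = (LINT s|lborel. indicator (Qset (2 ^ Suc n)) s *\<^sub>R cinner (lop A (eps r s)) (eps r s))
  - (LINT s|lborel. indicator (Qset (2 ^ n)) s *\<^sub>R cinner (lop A (eps r s)) (eps r s))"
proof -
 let ?S = "{s :: real^'d. 2 powr (real n / real CARD('d)) < norm s \<and> norm s \<le> 2 powr ((real n + 1) / real CARD('d))}"
 have pw: "(2 powr (real m / real CARD('d))) ^ CARD('d) = 2 ^ m" for m by (simp add: powr_realpow[symmetric] powr_powr)
 have le: "norm s \<le> 2 powr (real m / real CARD('d)) \<longleftrightarrow> s \<in> Qset (2 ^ m)" for m and s :: "real^'d"
  unfolding Qset_def mem_Collect_eq pw[symmetric] by (simp add: power_mono_iff)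
 have S: "?S = Qset (2 ^ Suc n) - Qset (2 ^ n)"
  using le[of _ n] le[of _ "Suc n"] by (auto simp: not_le[symmetric] add.commute)
 have sub: "s \<in> Qset (2 ^ n) \<Longrightarrow> s \<in> Qset (2 ^ Suc n)" for s :: "real^'d"
  by (auto simp: Qset_def intro: order_trans)
 have bS: "bounded ?S" by (rule bounded_subset[OF bounded_cball[of 0 "2 powr ((real n + 1) / real CARD('d))"]]) auto
 have "annulus_seq p n = (LINT x|lborel. (LINT s|lborel. indicator ?S s *\<^sub>R p (x, s)))"
  by (simp add: annulus_seq_def set_lebesgue_integral_def)
 also have "\<dots> = (LINT s|lborel. indicator ?S s *\<^sub>R cinner (lop A (eps r s)) (eps r s))"
  by (rule symbol_integral[OF _ bS]) (simp add: S)
 also have "\<dots> = (LINT s|lborel. indicator (Qset (2 ^ Suc n)) s *\<^sub>R cinner (lop A (eps r s)) (eps r s)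
   - indicator (Qset (2 ^ n)) s *\<^sub>R cinner (lop A (eps r s)) (eps r s))"
  unfolding S by (intro LINT_cong refl) (use sub in \<open>auto simp: indicator_def\<close>)
 finally show ?thesis by (simp add: Bochner_Integration.integral_diff[OF AE_int AE_int])
qed

end

text \<open>Any ball containing the supports of both cut-offs works, since multiplying
  \<open>\<phi>\<close> or \<open>\<psi>\<close> by its indicator changes nothing.\<close>

lemma compactly_supported_chi:
 fixes A :: "('d::finite) op"
 assumes A: "compactly_supported A" and bA: "is_bop A"
 obtains r where "\<forall>u. lop A (chi r u) = lop A u \<and> chi r (lop A u) = lop A u"
proof -
 obtain \<phi> \<psi> where c: "cc_smooth \<phi>" "cc_smooth \<psi>" "op_eq (\<lambda>f x. \<phi> x * A (\<lambda>y. \<psi> y * f y) x) A"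
  using A unfolding compactly_supported_def by blast
 have "bounded ({x. \<phi> x \<noteq> 0} \<union> {x. \<psi> x \<noteq> 0})" using c(1,2) by (simp add: cc_smooth_def)
 then obtain r where "\<forall>x\<in>{x. \<phi> x \<noteq> 0} \<union> {x. \<psi> x \<noteq> 0}. norm x \<le> r" unfolding bounded_iff by (rule exE)
 then have r: "{x. \<phi> x \<noteq> 0} \<union> {x. \<psi> x \<noteq> 0} \<subseteq> cball 0 r" by auto
 have e: "aeq (\<lambda>x. \<phi> x * A (\<lambda>y. \<psi> y * f y) x) (A f)" if "sqint f" for f using c(3) that by (simp add: op_eq_def)
 have "lop A (chi r u) = lop A u \<and> chi r (lop A u) = lop A u" for u
 proof
  obtain f where f: "sqint f" "u = cls f" by (rule L2_cases)
  let ?f = "\<lambda>y. indicator (cball 0 r) y * f y"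
  have sf: "sqint ?f" by (rule sqint_indicator_mult[OF f(1)])
  note sA = is_bopD(1)[OF bA f(1)]
  have \<psi>: "(\<lambda>y. \<psi> y * ?f y) = (\<lambda>y. \<psi> y * f y)" using r by (auto simp: fun_eq_iff indicator_def)
  have "aeq (A ?f) (A f)" using aeq_trans[OF aeq_sym[OF e[OF sf]]] e[OF f(1)] unfolding \<psi> by blast
  then have "cls (A ?f) = cls (A f)" using cls_eq_iff[OF is_bopD(1)[OF bA sf] sA] by simp
  then show "lop A (chi r u) = lop A u" unfolding f(2) chi_cls[OF f(1)] lop_cls[OF bA sf] lop_cls[OF bA f(1)] .
  have "AE x in lborel. indicator (cball 0 r) x * A f x = A f x"
   using e[OF f(1)] unfolding aeq_def
  proof eventually_elim
   case (elim x)
   show ?case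
   proof (cases "x \<in> cball 0 r")
    case False
    then have "\<phi> x = 0" using r by auto
    then show ?thesis using elim by simp
   qed simp
  qed
  then show "chi r (lop A u) = lop A u"
   unfolding f(2) lop_cls[OF bA f(1)] chi_cls[OF sA] by (rule cls_cong[OF sqint_indicator_mult[OF sA] sA])
 qed
 then show ?thesis using that[of r] by blast
qed

theorem symbol_dts:
 fixes A :: "('d::finite) op"
 assumes A: "laplacian_modulated A" "compactly_supported A" "is_symbol A p" and E: "is_onb E"
 obtains s where "wk (lop A)" "dts E (lop A) s"
  "\<forall>n. s (Suc n) - s n = cor (1 / (2 * pi) ^ CARD('d)) * annulus_seq p n"
proof -
 have bA: "is_bop A" using A(1) by (simp add: laplacian_modulated_def)
 obtain r where r: "\<forall>u. lop A (chi r u) = lop A u \<and> chi r (lop A u) = lop A u" by (rule compactly_supported_chi[OF A(2) bA])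
 obtain B where B: "clinop B" "\<forall>x y. cinner (lop A x) y = cinner x (B y)" by (rule adjoint_exists[OF E clinop_lop[OF bA]])
 obtain C where C: "0 \<le> C" "\<forall>t>0. summable (\<lambda>k. (norm (lop A (fmul (res t) (E k))))\<^sup>2) \<and> (\<Sum>k. (norm (lop A (fmul (res t) (E k))))\<^sup>2) \<le> C / t"
  by (rule laplacian_modulated_hs[OF A(1) E])
 from A(3) have p: "p \<in> borel_measurable borel" "integrable lborel (\<lambda>z. (cmod (p z))\<^sup>2)" by (auto simp: is_symbol_def)
 from A(3) obtain K where K: "K \<in> borel_measurable lborel" "integrable lborel (\<lambda>z. (cmod (K z))\<^sup>2)"
  "\<forall>f. sqint f \<longrightarrow> (AE x in lborel. A f x = (LINT y|lborel. K (x, y) * f y))"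
  "AE x in lborel. \<forall>h. l1l2 h \<longrightarrow> (LINT z|lborel. K (x, x - z) * cnj (h z)) =
      (1 / (2 * pi) ^ CARD('d)) * (LINT s|lborel. p (x, s) * cnj (fourier h s))"
  unfolding is_symbol_def by (elim conjE exE) (rule that)
 interpret symbol_op A B E r C p K
  by unfold_locales (use clinop_lop[OF bA] B E r C bA p K in simp_all)
 let ?s = "\<lambda>n. cor (1 / (2 * pi) ^ CARD('d)) * (LINT s|lborel. indicator (Qset (2 ^ n)) s *\<^sub>R cinner (lop A (eps r s)) (eps r s))"
 show ?thesis
 proof (rule that[of ?s])
  show "\<forall>n. ?s (Suc n) - ?s n = cor (1 / (2 * pi) ^ CARD('d)) * annulus_seq p n"
   unfolding annulus_Q by (simp only: right_diff_distrib) simp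
 qed (rule frame_dts)+
qed

section \<open>Existence of a Banach limit\<close>

text \<open>The value 0 on unbounded sequences makes every coordinate \<open>cesaro n x\<close>
  bounded in \<open>n\<close>, as the compactness argument in a product of intervals
  demands.\<close>

definition cesaro :: "nat \<Rightarrow> (nat \<Rightarrow> real) \<Rightarrow> real" where
 "cesaro n x = (if Bseq x then (\<Sum>k\<le>n. x k) / (real n + 1) else 0)"

lemma cesaro_bound: assumes "\<And>k. \<bar>x k\<bar> \<le> K" shows "\<bar>cesaro n x\<bar> \<le> K"
proof -
 have K: "0 \<le> K" using assms[of 0] by linarith
 have "\<bar>\<Sum>k\<le>n. x k\<bar> \<le> (\<Sum>k\<le>n. K)" by (intro order_trans[OF sum_abs] sum_mono assms)
 then have "\<bar>\<Sum>k\<le>n. x k\<bar> \<le> K * (real n + 1)" by (simp add: algebra_simps)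
 then show ?thesis using K by (simp add: cesaro_def abs_divide divide_le_eq)
qed

lemma Bseq_lin: fixes x y :: "nat \<Rightarrow> real" assumes "Bseq x" "Bseq y" shows "Bseq (\<lambda>n. a * x n + b * y n)"
proof -
 obtain K L where K: "\<And>n. \<bar>x n\<bar> \<le> K" "\<And>n. \<bar>y n\<bar> \<le> L" using assms by (metis BseqE real_norm_def)
 have "norm (a * x n + b * y n) \<le> \<bar>a\<bar> * K + \<bar>b\<bar> * L" for n
 proof -
  have "\<bar>a * x n + b * y n\<bar> \<le> \<bar>a\<bar> * \<bar>x n\<bar> + \<bar>b\<bar> * \<bar>y n\<bar>" by (metis abs_mult abs_triangle_ineq)
  also have "\<dots> \<le> \<bar>a\<bar> * K + \<bar>b\<bar> * L" by (intro add_mono mult_left_mono K) auto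
  finally show ?thesis by simp
 qed
 then show ?thesis by (rule BseqI')
qed

text \<open>A cluster point of the Cesaro means in the product of the intervals [- M x, M x],
  compact by Tychonoff. Linearity, positivity and normalisation hold for each mean on bounded
  sequences; shift invariance appears in the limit, because the means of a sequence and its shift
  differ by x_n / (n + 1).\<close>

lemma banach_limit_exists: "\<exists>B. banach_limit B"
proof -
 define M where "M x = (SOME K. \<forall>n. \<bar>cesaro n x\<bar> \<le> K)" for x
 have M: "\<bar>cesaro n x\<bar> \<le> M x" for n x
 proof -
  have "\<exists>K. \<forall>n. \<bar>cesaro n x\<bar> \<le> K"
  proof (cases "Bseq x")
   case True
   then obtain K where "\<And>n. \<bar>x n\<bar> \<le> K" by (metis BseqE real_norm_def)
   then show ?thesis using cesaro_bound by blast
  qed (auto simp: cesaro_def)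
  from someI_ex[OF this] show ?thesis unfolding M_def by blast
 qed
 define U where "U = (PiE UNIV (\<lambda>x. {- M x..M x}) :: ((nat \<Rightarrow> real) \<Rightarrow> real) set)"
 have "compactin (product_topology (\<lambda>_. euclidean) UNIV) U" unfolding U_def compactin_PiE by simp
 then have "compact U" by (simp add: euclidean_product_topology)
 define F where "F = filtermap cesaro sequentially"
 have F0: "F \<noteq> bot" unfolding F_def by (simp add: filtermap_bot_iff)
 have "eventually (\<lambda>b. b \<in> U) F" unfolding F_def eventually_filtermap U_def using M by (simp add: abs_le_iff PiE_UNIV_domain minus_le_iff)
 with \<open>compact U\<close> F0 obtain B where B: "inf (nhds B) F \<noteq> bot" unfolding compact_filter by blast
 \<comment> \<open>The filter refining both the means and the neighbourhoods of \<open>B\<close>: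
   coordinates converge along it to the values of \<open>B\<close>, and whatever holds eventually
   for the means holds along it.\<close>
 define G where "G = inf (nhds B) F"
 have G0: "G \<noteq> bot" using B by (simp add: G_def)
 have ev: "((\<lambda>b. b x) \<longlongrightarrow> B x) G" for x
 proof -
  have "((\<lambda>b. b x) \<longlongrightarrow> B x) (nhds B)"
  proof (rule topological_tendstoI)
   fix S assume S: "open S" "B x \<in> S"
   have "open ((\<lambda>b :: (nat \<Rightarrow> real) \<Rightarrow> real. b x) -` S)" by (rule open_vimage[OF S(1) continuous_on_product_coordinates])
   then show "\<forall>\<^sub>F b in nhds B. b x \<in> S" unfolding eventually_nhds using S(2) by (intro exI[of _ "(\<lambda>b. b x) -` S"]) auto
  qed
  then show ?thesis unfolding G_def by (rule tendsto_mono[rotated]) simp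
 qed
 have evF: "eventually P G" if "eventually P F" for P using that unfolding G_def by (rule filter_leD[rotated]) simp
 have evc: "eventually P F" if "\<And>n. P (cesaro n)" for P unfolding F_def eventually_filtermap using that by simp
 have lin: "B (\<lambda>n. a * x n + b * y n) = a * B x + b * B y" if xy: "Bseq x" "Bseq y" for a b x y
 proof (rule tendsto_unique[OF G0 ev])
  have "((\<lambda>c. a * c x + b * c y) \<longlongrightarrow> a * B x + b * B y) G" by (intro tendsto_intros ev)
  moreover have "eventually (\<lambda>c. a * c x + b * c y = c (\<lambda>n. a * x n + b * y n)) G"
   by (intro evF evc) (simp add: cesaro_def xy Bseq_lin sum.distrib sum_distrib_left add_divide_distrib)
  ultimately show "((\<lambda>c. c (\<lambda>n. a * x n + b * y n)) \<longlongrightarrow> a * B x + b * B y) G" by (rule Lim_transform_eventually)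
 qed
 have posB: "0 \<le> B x" if x: "Bseq x" "\<And>n. 0 \<le> x n" for x
  by (rule tendsto_lowerbound[OF ev _ G0]) (intro evF evc, simp add: cesaro_def x sum_nonneg)
 have one: "B (\<lambda>_. 1) = 1"
  by (rule tendsto_unique[OF G0 ev], rule tendsto_eventually, intro evF evc) (simp add: cesaro_def add.commute)
 have sh: "B x = B (\<lambda>n. if n = 0 then 0 else x (n - 1))" if x: "Bseq x" for x
 proof -
  let ?y = "\<lambda>n. if n = 0 then 0 else x (n - 1)"
  obtain K where K: "\<And>n. \<bar>x n\<bar> \<le> K" using x by (metis BseqE real_norm_def)
  have y: "Bseq ?y" by (rule BseqI'[of _ K]) (use K[of 0] K in \<open>auto intro: order_trans[OF abs_ge_zero]\<close>)
  have d: "cesaro n x - cesaro n ?y = x n / (real n + 1)" for n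
  proof -
   have "(\<Sum>k\<le>n. ?y k) = (\<Sum>k<n. x k)" by (induction n) auto
   then have "(\<Sum>k\<le>n. x k) - (\<Sum>k\<le>n. ?y k) = x n" by (simp add: lessThan_Suc_atMost[symmetric])
   then show ?thesis using x y by (simp add: cesaro_def diff_divide_distrib[symmetric])
  qed
  have "(\<lambda>n. x n / (real n + 1)) \<longlonglongrightarrow> 0"
  proof (rule Lim_null_comparison)
   show "\<forall>\<^sub>F n in sequentially. norm (x n / (real n + 1)) \<le> K / (real n + 1)" using K by (simp add: divide_right_mono)
   show "(\<lambda>n. K / (real n + 1)) \<longlonglongrightarrow> 0" by real_asymp
  qed
  then have "((\<lambda>c. c x - c ?y) \<longlongrightarrow> 0) F" unfolding F_def filterlim_filtermap d .
  then have "((\<lambda>c. c x - c ?y) \<longlongrightarrow> 0) G" unfolding G_def by (rule tendsto_mono[rotated]) simp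
  moreover have "((\<lambda>c. c x - c ?y) \<longlongrightarrow> B x - B ?y) G" by (intro tendsto_diff ev)
  ultimately have "B x - B ?y = 0" by (rule tendsto_unique[OF G0, rotated])
  then show ?thesis by simp
 qed
 show ?thesis unfolding banach_limit_def using lin posB one sh by (intro exI[of _ B]) auto
qed

section \<open>Traces of the operator\<close>

lemma Dmap_dm: "Dmap x = dm (\<lambda>n. cor (ln 2) * x n)"
proof
 fix k
 have "(THE n::nat. 2^n \<le> k + 1 \<and> k + 1 < 2^(n+1)) = lev k"
 proof (rule the_equality)
  show "n = lev k" if "2 ^ n \<le> k + 1 \<and> k + 1 < 2 ^ (n + 1)" for n using lev_eqI[of n k] that by simp
 qed (use lev_bounds[of k] in simp)
 then show "Dmap x k = dm (\<lambda>n. cor (ln 2) * x n) k" by (simp add: Dmap_def dm_def Let_def)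
qed

lemma Bseq_mult_left: "Bseq x \<Longrightarrow> Bseq (\<lambda>n. (a::complex) * x n)"
 by (rule Bseq_mult[OF convergent_imp_Bseq[OF convergent_const]])

context
 fixes A :: "('d::finite) op" and p :: "(real^'d) \<times> (real^'d) \<Rightarrow> complex"
 assumes A: "laplacian_modulated A" "compactly_supported A" "is_symbol A p"
begin

lemma bopA: "is_bop A" using A(1) by (simp add: laplacian_modulated_def)

text \<open>Boundedness comes from the operator side: up to a constant the annulus integrals are the
  increments of a dyadic trace sequence.\<close>

lemma Bseq_annulus: "Bseq (annulus_seq p)"
proof -
 obtain E :: "nat \<Rightarrow> 'd L2" and U :: "nat \<Rightarrow> (real^'d) set" where E: "is_onb E" by (rule L2_onb)
 obtain s where s: "dts E (lop A) s" "\<forall>n. s (Suc n) - s n = cor (1 / (2 * pi) ^ CARD('d)) * annulus_seq p n" by (rule symbol_dts[OF A E])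
 have "Bseq (\<lambda>n. cor (1 / (2 * pi) ^ CARD('d)) * annulus_seq p n)" using dts_increment_Bseq[OF E s(1)] by (simp only: s(2)[rule_format])
 from Bseq_mult_left[OF this, of "cor ((2 * pi) ^ CARD('d))"] show ?thesis by simp
qed

lemma weak1A: "weak1 A"
proof -
 obtain E :: "nat \<Rightarrow> 'd L2" and U :: "nat \<Rightarrow> (real^'d) set" where E: "is_onb E" by (rule L2_onb)
 obtain s where s: "wk (lop A)" by (rule symbol_dts[OF A E])
 then show ?thesis using bopA by (simp add: weak1_wk)
qed

lemma trace_phi:
 fixes \<tau> :: "'d op \<Rightarrow> complex"
 assumes \<tau>: "pos_norm_trace \<tau>" and E: "is_onb E"
 shows "\<tau> A = cor (1 / (2 * pi) ^ CARD('d)) * trace_onb.phi (\<lambda>T. \<tau> (rop T)) E (dm (annulus_seq p))"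
proof -
 interpret trace_onb "\<lambda>T. \<tau> (rop T)" E by standard (rule ptrace_of_trace(1)[OF \<tau>], rule E)
 obtain s where s: "wk (lop A)" "dts E (lop A) s" "\<forall>n. s (Suc n) - s n = cor (1 / (2 * pi) ^ CARD('d)) * annulus_seq p n" by (rule symbol_dts[OF A E])
 have "\<tau> A = phi (dm (\<lambda>n. s (Suc n) - s n))" unfolding ptrace_of_trace(2)[OF \<tau> weak1A] by (rule ptrace_dts[OF s(1,2)])
 also have "\<dots> = phi (\<lambda>k. cor (1 / (2 * pi) ^ CARD('d)) * dm (annulus_seq p) k + 0 * dm (annulus_seq p) k)"
  unfolding s(3)[rule_format] using dm_lin[of "cor (1 / (2 * pi) ^ CARD('d))" "annulus_seq p" 0 "annulus_seq p"] by simp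
 also have "\<dots> = cor (1 / (2 * pi) ^ CARD('d)) * phi (dm (annulus_seq p))" by (subst phi_lin) (simp_all add: lvb_dm Bseq_annulus)
 finally show ?thesis .
qed

lemma trace_formula:
 fixes \<tau> :: "'d op \<Rightarrow> complex"
 assumes \<tau>: "pos_norm_trace \<tau>" and ob: "onb e"
 shows "\<tau> A = cor (1 / ((2 * pi) ^ CARD('d) * ln 2)) * \<tau> (diag e (Dmap (annulus_seq p)))"
proof -
 let ?E = "\<lambda>k. cls (e k)"
 note E = onb_cls(1)[OF ob]
 interpret trace_onb "\<lambda>T. \<tau> (rop T)" ?E by standard (rule ptrace_of_trace(1)[OF \<tau>], rule E)
 let ?D = "Dmap (annulus_seq p)"
 have lD: "lvb ?D" unfolding Dmap_dm by (intro lvb_dm Bseq_mult_left Bseq_annulus)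
 note d = lop_diag[OF ob lvb_Bseq[OF lD]]
 have "weak1 (diag e ?D)" unfolding weak1_wk d(2) using d(1) lvb_wk[OF oe(1) oe(1) lD] by simp
 then have 1: "\<tau> (diag e ?D) = phi ?D" by (simp add: ptrace_of_trace(2)[OF \<tau>] d(2) phi_def)
 have 2: "?D = (\<lambda>k. cor (ln 2) * dm (annulus_seq p) k + 0 * dm (annulus_seq p) k)"
  unfolding Dmap_dm using dm_lin[of "cor (ln 2)" "annulus_seq p" 0 "annulus_seq p"] by simp
 have "phi (\<lambda>k. cor (ln 2) * dm (annulus_seq p) k + 0 * dm (annulus_seq p) k) = cor (ln 2) * phi (dm (annulus_seq p))"
  by (subst phi_lin) (simp_all add: lvb_dm Bseq_annulus)
 then have "\<tau> (diag e ?D) = cor (ln 2) * phi (dm (annulus_seq p))" unfolding 1 unfolding 2 .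
 then show ?thesis unfolding trace_phi[OF \<tau> E] by simp
qed

lemma trace_blim:
 fixes \<tau> :: "'d op \<Rightarrow> complex"
 assumes \<tau>: "pos_norm_trace \<tau>"
 obtains B where "banach_limit B" "\<tau> A = cor (1 / (2 * pi) ^ CARD('d)) * (blim B (annulus_seq p) / cor (ln 2))"
proof -
 obtain E :: "nat \<Rightarrow> 'd L2" and U :: "nat \<Rightarrow> (real^'d) set" where E: "is_onb E" by (rule L2_onb)
 interpret trace_onb "\<lambda>T. \<tau> (rop T)" E by standard (rule ptrace_of_trace(1)[OF \<tau>], rule E)
 let ?a = "annulus_seq p"
 let ?P = "\<lambda>x :: nat \<Rightarrow> real. phi (\<lambda>k. cor (ln 2) * dm (\<lambda>n. cor (x n)) k)"
 let ?B = "\<lambda>x. Re (?P x)"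
 note R = Bseq_Re[OF Bseq_annulus] and I = Bseq_Im[OF Bseq_annulus]
 have Bc: "Bseq (\<lambda>n. cor (x n))" if "Bseq x" for x :: "nat \<Rightarrow> real" using that by (simp add: Bseq_def)
 have lv: "lvb (\<lambda>k. cor (ln 2) * dm (\<lambda>n. cor (x n)) k)" if x: "Bseq x" for x :: "nat \<Rightarrow> real"
  using lvb_dm[OF Bseq_mult_left[OF Bc[OF x], of "cor (ln 2)"]] dm_lin[of "cor (ln 2)" "\<lambda>n. cor (x n)" 0 "\<lambda>_. 0"] by simp
 have re: "?P x = cor (?B x)" if "Bseq x" for x using phi_real[OF that] by (simp add: complex_eq_iff)
 have "cor (ln 2) * phi (dm ?a) = phi (\<lambda>k. cor (ln 2) * dm ?a k + 0 * dm ?a k)"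
  by (subst phi_lin) (simp_all add: lvb_dm Bseq_annulus)
 also have "(\<lambda>k. cor (ln 2) * dm ?a k + 0 * dm ?a k)
   = (\<lambda>k. 1 * (cor (ln 2) * dm (\<lambda>n. cor (Re (?a n))) k) + \<i> * (cor (ln 2) * dm (\<lambda>n. cor (Im (?a n))) k))"
 proof
  fix k
  have "?a (lev k) = cor (Re (?a (lev k))) + \<i> * cor (Im (?a (lev k)))" by (rule complex_eq)
  then have "dm ?a k = dm (\<lambda>n. cor (Re (?a n))) k + \<i> * dm (\<lambda>n. cor (Im (?a n))) k"
   unfolding dm_def by (simp add: add_divide_distrib[symmetric])
  then show "cor (ln 2) * dm ?a k + 0 * dm ?a k = 1 * (cor (ln 2) * dm (\<lambda>n. cor (Re (?a n))) k)
    + \<i> * (cor (ln 2) * dm (\<lambda>n. cor (Im (?a n))) k)" by (simp add: algebra_simps)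
 qed
 also have "phi \<dots> = 1 * ?P (\<lambda>n. Re (?a n)) + \<i> * ?P (\<lambda>n. Im (?a n))" by (rule phi_lin[OF lv[OF R] lv[OF I]])
 also have "\<dots> = blim ?B ?a" unfolding blim_def by (simp only: re[OF R, symmetric] re[OF I, symmetric] mult_1)
 finally have "phi (dm ?a) = blim ?B ?a / cor (ln 2)" by (simp add: field_simps)
 then have "\<tau> A = cor (1 / (2 * pi) ^ CARD('d)) * (blim ?B ?a / cor (ln 2))" unfolding trace_phi[OF \<tau> E] by simp
 then show ?thesis by (rule that[OF banach_limit_of_trace])
qed

text \<open>Together with \<open>trace_blim\<close> this makes the values of positive normalised
  traces at \<open>A\<close> exactly the Banach limits of the annulus sequence, up to the
  constant.\<close>

lemma blim_trace:
 assumes B: "banach_limit B"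
 obtains \<tau> :: "'d op \<Rightarrow> complex" where "pos_norm_trace \<tau>" "\<tau> A = cor (1 / (2 * pi) ^ CARD('d)) * (blim B (annulus_seq p) / cor (ln 2))"
proof -
 obtain E :: "nat \<Rightarrow> 'd L2" and U :: "nat \<Rightarrow> (real^'d) set" where E: "is_onb E" by (rule L2_onb)
 obtain s where s: "wk (lop A)" "dts E (lop A) s" "\<forall>n. s (Suc n) - s n = cor (1 / (2 * pi) ^ CARD('d)) * annulus_seq p n" by (rule symbol_dts[OF A E])
 obtain t :: "('d L2 \<Rightarrow> 'd L2) \<Rightarrow> complex" where t: "ptrace t"
  "\<forall>A s. wk A \<longrightarrow> dts E A s \<longrightarrow> t A = blim B (\<lambda>n. s (Suc n) - s n) / cor (ln 2)" by (rule trace_of_banach_limit[OF B E])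
 have "t (lop A) = blim B (\<lambda>n. cor (1 / (2 * pi) ^ CARD('d)) * annulus_seq p n + 0 * annulus_seq p n) / cor (ln 2)"
  using t(2)[rule_format, OF s(1,2)] s(3) by simp
 also have "\<dots> = cor (1 / (2 * pi) ^ CARD('d)) * (blim B (annulus_seq p) / cor (ln 2))" by (simp only: blim_lin[OF B Bseq_annulus Bseq_annulus]) simp
 finally show ?thesis by (rule that[OF trace_of_ptrace[OF t(1) E]])
qed

end

theorem theorem8p10:
  fixes A :: "(real^'d \<Rightarrow> complex) \<Rightarrow> (real^'d \<Rightarrow> complex)"
    and p :: "(real^'d) \<times> (real^'d) \<Rightarrow> complex"
  assumes "laplacian_modulated A" and "compactly_supported A" and "is_symbol A p"
  shows "weak1 A \<and>
    (\<forall>\<tau> e. pos_norm_trace \<tau> \<and> onb e \<longrightarrow>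
       \<tau> A = complex_of_real (1 / ((2 * pi) ^ CARD('d) * ln 2)) *
               \<tau> (diag e (Dmap (annulus_seq p)))) \<and>
    ((\<forall>\<tau>. pos_norm_trace \<tau> \<longrightarrow>
        \<tau> A = complex_of_real (1 / (real CARD('d) * (2 * pi) ^ CARD('d))) * lim (res_seq p)
        \<and> convergent (res_seq p))
     \<longleftrightarrow>
     (\<exists>\<alpha>. res_seq p \<longlonglongrightarrow> \<alpha> \<and>
        almost_conv (annulus_seq p) (complex_of_real (ln 2 / real CARD('d)) * \<alpha>)))"
 proof (intro conjI allI impI)
 show "weak1 A" by (rule weak1A[OF assms])
 show "\<tau> A = cor (1 / ((2 * pi) ^ CARD('d) * ln 2)) * \<tau> (diag e (Dmap (annulus_seq p)))"
  if "pos_norm_trace \<tau> \<and> onb e" for \<tau> e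
  by (rule trace_formula[OF assms that[THEN conjunct1] that[THEN conjunct2]])
 let ?v = "cor (1 / (2 * pi) ^ CARD('d))" and ?a = "annulus_seq p"
  and ?c = "cor (1 / (real CARD('d) * (2 * pi) ^ CARD('d)))"
  and ?l = "cor (ln 2 / real CARD('d))"
 \<comment> \<open>The annulus side carries 1 / ((2 pi)^d log 2), the residue side 1 / (d (2 pi)^d);
   their quotient is log 2 / d.\<close>
 have scal: "?v * (b / cor (ln 2)) = ?c * \<alpha> \<longleftrightarrow> b = ?l * \<alpha>" for b \<alpha> :: complex
 proof -
  have e: "?c * \<alpha> = ?v * (?l * \<alpha> / cor (ln 2))" by (simp add: field_simps)
  have "?v * (b / cor (ln 2)) = ?c * \<alpha> \<longleftrightarrow> ?v * (b / cor (ln 2)) = ?v * (?l * \<alpha> / cor (ln 2))" by (simp only: e)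
  also have "\<dots> \<longleftrightarrow> b = ?l * \<alpha>" by (simp only: mult_cancel_left divide_cancel_right) simp
  finally show ?thesis .
 qed
 show "(\<forall>\<tau>. pos_norm_trace \<tau> \<longrightarrow> \<tau> A = ?c * lim (res_seq p) \<and> convergent (res_seq p))
   \<longleftrightarrow> (\<exists>\<alpha>. res_seq p \<longlonglongrightarrow> \<alpha> \<and> almost_conv ?a (?l * \<alpha>))" (is "?L = ?R")
 proof
  assume L: ?L
  \<comment> \<open>Convergence of \<open>res_seq\<close> is asserted under the quantifier over
    traces, so one trace must be exhibited before it can be used.\<close>
  obtain B0 where B0: "banach_limit B0" using banach_limit_exists by blast
  obtain \<tau>0 where "pos_norm_trace \<tau>0" "\<tau>0 A = ?v * (blim B0 ?a / cor (ln 2))" by (rule blim_trace[OF assms B0])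
  then have "res_seq p \<longlonglongrightarrow> lim (res_seq p)" using L by (simp add: convergent_LIMSEQ_iff)
  moreover have "almost_conv ?a (?l * lim (res_seq p))"
   unfolding almost_conv_def
  proof (intro conjI allI impI)
   show "Bseq ?a" by (rule Bseq_annulus[OF assms])
   fix B assume B: "banach_limit B"
   obtain \<tau> where \<tau>: "pos_norm_trace \<tau>" "\<tau> A = ?v * (blim B ?a / cor (ln 2))" by (rule blim_trace[OF assms B])
   have "?v * (blim B ?a / cor (ln 2)) = ?c * lim (res_seq p)" using L \<tau> by metis
   then have "blim B ?a = ?l * lim (res_seq p)" by (simp only: scal)
   then show "cor (B (\<lambda>n. Re (?a n))) + \<i> * cor (B (\<lambda>n. Im (?a n))) = ?l * lim (res_seq p)"
    by (simp only: blim_def)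
  qed
  ultimately show ?R by blast
 next
  assume ?R
  then obtain \<alpha> where \<alpha>: "res_seq p \<longlonglongrightarrow> \<alpha>" "almost_conv ?a (?l * \<alpha>)" by blast
  have lim: "lim (res_seq p) = \<alpha>" "convergent (res_seq p)" using \<alpha>(1) by (auto simp: limI convergent_def)
  have "\<tau> A = ?c * \<alpha>" if \<tau>: "pos_norm_trace \<tau>" for \<tau>
  proof -
   obtain B where B: "banach_limit B" "\<tau> A = ?v * (blim B ?a / cor (ln 2))" by (rule trace_blim[OF assms \<tau>])
   have "blim B ?a = ?l * \<alpha>" using \<alpha>(2) B(1) by (simp add: almost_conv_def blim_def)
   then show ?thesis unfolding B(2) by (simp only: scal)
  qed
  then show ?L using lim by simp
 qed
qed

end
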